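(* Let $0\le l<k<n$ be integers, let $p\ge k-l+1$ be a real number, and let $f$ be a positive smooth function on $\mathbb{S}^n$ satisfying $$\nabla^2\Big(f^{\frac{1}{p+k-l-1}}\Big)+f^{\frac{1}{p+k-l-1}}\sigma\ge 0\quad\text{on }\mathbb{S}^n .$$ (1) If $p=k-l+1$ and $(u,\tau)$ is the pair (unique up to dilation) consisting of a positive smooth $(n-l)$-admissible function $u$ and a constant $\tau>0$ with $\frac{H_{n-l}(A)}{H_{n-k}(A)}=\tau u^{k-l}f^{-1}$ on $\mathbb{S}^n$, where $A=\nabla^2u+u\sigma$, then $u$ is strictly spherically convex. (2) If $p>k-l+1$ and $u$ is the unique positive smooth $(n-l)$-admissible solution of $\frac{H_{n-l}(A)}{H_{n-k}(A)}=f^{-1}u^{p-1}$ on $\mathbb{S}^n$, where $A=\nabla^2u+u\sigma$, then $u$ is strictly spherically convex.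
   Context: $\mathbb{S}^n$ is the unit sphere in $\mathbb{R}^{n+1}$ with its round metric $\sigma$; $\nabla^2u$ is the Hessian of $u$ with respect to $\sigma$, and for $u\in C^2(\mathbb{S}^n)$ we set $A=\nabla^2u+u\sigma$. For a symmetric matrix (or a symmetric 2-tensor, with eigenvalues $\lambda=(\lambda_1,\dots,\lambda_n)$ taken with respect to $\sigma$), $\sigma_k(A)=\sigma_k(\lambda)=\sum_{1\le i_1<\dots<i_k\le n}\lambda_{i_1}\cdots\lambda_{i_k}$ with $\sigma_0=1$, and $H_k=\binom{n}{k}^{-1}\sigma_k$. The Gårding cone is $\Gamma_m=\{\lambda\in\mathbb{R}^n:\sigma_i(\lambda)>0,\ 1\le i\le m\}$. A function $u\in C^2(\mathbb{S}^n)$ is called $m$-admissible if the eigenvalues of $A$ lie in $\Gamma_m$ at every point of $\mathbb{S}^n$, and strictly spherically convex if $A>0$ (positive definite) everywhere on $\mathbb{S}^n$. The existence and stated uniqueness of the solutions in (1) and (2) hold for every positive smooth $f$. *)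

theory Defs
  imports "HOL-Analysis.Analysis"
begin

section \<open>Functions of class $C^r$ on the unit sphere\<close>

text \<open>For open \<open>S\<close>. Since all spaces are finite-dimensional, the derivative is of class
  $C^k$ as a map into linear maps iff all directional derivatives are of class $C^k$.\<close>

fun Ck_on :: "nat \<Rightarrow> ('a::euclidean_space \<Rightarrow> real) \<Rightarrow> 'a set \<Rightarrow> bool" where
  "Ck_on 0 f S \<longleftrightarrow> continuous_on S f"
| "Ck_on (Suc k) f S \<longleftrightarrow>
     (\<exists>f'. (\<forall>x\<in>S. (f has_derivative f' x) (at x)) \<and> (\<forall>v. Ck_on k (\<lambda>x. f' x v) S))"

text \<open>Functions on the sphere are represented by functions on the ambient space, whose values
  off the sphere are irrelevant. The case \<open>r = \<infinity>\<close> is smoothness.\<close>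

definition C_on_sphere :: "enat \<Rightarrow> ('a::euclidean_space \<Rightarrow> real) \<Rightarrow> bool" where
  "C_on_sphere r u \<longleftrightarrow>
     (\<exists>U g. open U \<and> sphere 0 1 \<subseteq> U \<and> (\<forall>j. enat j \<le> r \<longrightarrow> Ck_on j g U) \<and>
            (\<forall>x\<in>sphere 0 1. g x = u x))"

section \<open>Calculus for the round metric\<close>

definition tangent_sphere :: "'a::euclidean_space \<Rightarrow> 'a set" where
  "tangent_sphere x = {v. v \<bullet> x = 0}"

definition tangent_proj :: "'a::euclidean_space \<Rightarrow> 'a \<Rightarrow> 'a" where
  "tangent_proj x v = v - (v \<bullet> x) *\<^sub>R x"

text \<open>For \<open>x\<close> in the sphere and \<open>v\<close> tangent at \<open>x\<close>, this is the derivative at \<open>x\<close> in direction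
  \<open>v\<close> of a function on the sphere, computed with its extension that is constant along rays
  (any other extension gives the same value). For \<open>v\<close> normal to the sphere it is \<open>0\<close>.\<close>

definition sphere_deriv ::
    "('a::euclidean_space \<Rightarrow> 'b::real_normed_vector) \<Rightarrow> 'a \<Rightarrow> 'a \<Rightarrow> 'b" where
  "sphere_deriv F x v = frechet_derivative (\<lambda>y. F (y /\<^sub>R norm y)) (at x) v"

text \<open>The vector representing \<open>sphere_deriv u x\<close> with respect to the inner product; it is tangent,
  as \<open>sphere_deriv u x x = 0\<close>.\<close>

definition sphere_grad :: "('a::euclidean_space \<Rightarrow> real) \<Rightarrow> 'a \<Rightarrow> 'a" where
  "sphere_grad u x = (\<Sum>b\<in>Basis. sphere_deriv u x b *\<^sub>R b)"

text \<open>The Levi-Civita connection of the round metric, i.e. the metric induced from the ambient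
  space: the tangential part of the ambient derivative of a tangent field \<open>X\<close>.\<close>

definition sphere_nabla :: "('a::euclidean_space \<Rightarrow> 'a) \<Rightarrow> 'a \<Rightarrow> 'a \<Rightarrow> 'a" where
  "sphere_nabla X x v = tangent_proj x (sphere_deriv X x v)"

definition sphere_hessian :: "('a::euclidean_space \<Rightarrow> real) \<Rightarrow> 'a \<Rightarrow> 'a \<Rightarrow> 'a \<Rightarrow> real" where
  "sphere_hessian u x v w = sphere_nabla (sphere_grad u) x v \<bullet> w"

definition A_tensor :: "('a::euclidean_space \<Rightarrow> real) \<Rightarrow> 'a \<Rightarrow> 'a \<Rightarrow> 'a \<Rightarrow> real" where
  "A_tensor u x v w = sphere_hessian u x v w + u x * (v \<bullet> w)"

section \<open>Elementary symmetric functions of the eigenvalues\<close>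

definition sigma_sym :: "nat \<Rightarrow> nat \<Rightarrow> (nat \<Rightarrow> real) \<Rightarrow> real" where
  "sigma_sym n k lam = (\<Sum>S\<in>{S. S \<subseteq> {1..n} \<and> card S = k}. \<Prod>i\<in>S. lam i)"

definition H_sym :: "nat \<Rightarrow> nat \<Rightarrow> (nat \<Rightarrow> real) \<Rightarrow> real" where
  "H_sym n k lam = sigma_sym n k lam / real (n choose k)"

definition Garding_cone :: "nat \<Rightarrow> nat \<Rightarrow> (nat \<Rightarrow> real) set" where
  "Garding_cone n m = {lam. \<forall>i\<in>{1..m}. sigma_sym n i lam > 0}"

text \<open>\<open>is_eigenvalues n x B lam\<close>: with respect to the round metric, \<open>lam 1, \<dots>, lam n\<close> are the eigenvalues
  (with multiplicity) of the bilinear form \<open>B\<close> on the \<open>n\<close>-dimensional tangent space at \<open>x\<close>;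
  \<open>e 1, \<dots>, e n\<close> is an orthonormal basis of eigenvectors.\<close>

definition is_eigenvalues ::
    "nat \<Rightarrow> 'a::euclidean_space \<Rightarrow> ('a \<Rightarrow> 'a \<Rightarrow> real) \<Rightarrow> (nat \<Rightarrow> real) \<Rightarrow> bool" where
  "is_eigenvalues n x B lam \<longleftrightarrow>
     (\<exists>e. (\<forall>i\<in>{1..n}. e i \<in> tangent_sphere x) \<and>
          (\<forall>i\<in>{1..n}. \<forall>j\<in>{1..n}. e i \<bullet> e j = (if i = j then 1 else 0)) \<and>
          (\<forall>i\<in>{1..n}. \<forall>w\<in>tangent_sphere x. B (e i) w = lam i * (e i \<bullet> w)))"

text \<open>For symmetric \<open>B\<close> such a tuple exists by the spectral theorem and is unique up to order on
  \<open>{1..n}\<close>; only symmetric functions of it are used.\<close>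

definition eigenvalues :: "nat \<Rightarrow> 'a::euclidean_space \<Rightarrow> ('a \<Rightarrow> 'a \<Rightarrow> real) \<Rightarrow> nat \<Rightarrow> real" where
  "eigenvalues n x B = (SOME lam. is_eigenvalues n x B lam)"

definition H_A :: "nat \<Rightarrow> nat \<Rightarrow> ('a::euclidean_space \<Rightarrow> real) \<Rightarrow> 'a \<Rightarrow> real" where
  "H_A n k u x = H_sym n k (eigenvalues n x (A_tensor u x))"

definition admissible :: "nat \<Rightarrow> nat \<Rightarrow> ('a::euclidean_space \<Rightarrow> real) \<Rightarrow> bool" where
  "admissible n m u \<longleftrightarrow> C_on_sphere 2 u \<and>
     (\<forall>x\<in>sphere 0 1. eigenvalues n x (A_tensor u x) \<in> Garding_cone n m)"

definition strictly_spherically_convex :: "('a::euclidean_space \<Rightarrow> real) \<Rightarrow> bool" where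
  "strictly_spherically_convex u \<longleftrightarrow> C_on_sphere 2 u \<and>
     (\<forall>x\<in>sphere 0 1. \<forall>v\<in>tangent_sphere x. v \<noteq> 0 \<longrightarrow> A_tensor u x v v > 0)"

end

theory Submission
  imports Defs
begin

text \<open>
  Let \<open>v\<close> be the extension of \<open>u\<close> that is positively homogeneous of degree one. At a unit vector \<open>x\<close>
  the tensor \<open>A\<close> of \<open>u\<close> is the restriction to the tangent space of the Euclidean Hessian \<open>D2 v x\<close>,
  which has \<open>x\<close> in its kernel (\<open>A_tensor_hext\<close>). Put \<open>a = n - l\<close>, \<open>b = n - k\<close>,
  \<open>F = (\<sigma>\<^sub>a / \<sigma>\<^sub>b) powr (1 / (a - b))\<close> and \<open>\<alpha> = (p - 1) / (k - l)\<close>, and let \<open>g\<close> be the homogeneous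
  extension of \<open>f powr (1 / (p + k - l - 1))\<close>. Both equations become
  \<open>1 / F (D2 v) = c * g powr (1 + \<alpha>) * v powr (- \<alpha>)\<close> off the origin. The hypothesis on \<open>f\<close> says that
  \<open>g\<close> is convex, the hypothesis on \<open>p\<close> that \<open>\<alpha> \<ge> 1\<close>, and the claim is that \<open>D2 v x\<close> is positive
  definite transversally to \<open>x\<close>.

  The reason is that the equation behaves well under sums \<open>z = \<Sum> x\<^sub>i\<close>, by two inequalities of opposite
  direction. First, \<open>F\<close> and its dual, obtained by inverting the eigenvalues, are increasing and concave.
  Hence \<open>\<Sum> 1 / F A\<^sub>i \<le> 1 / F C\<close> whenever the \<open>A\<^sub>i\<close> are positive semidefinite and
  \<open>C (\<Sum> h\<^sub>i) \<le> \<Sum> A\<^sub>i h\<^sub>i\<close> as quadratic forms (\<open>parallel_sum_ineq\<close>). Second, the right-hand side is a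
  convex homogeneous function of \<open>(g, v)\<close>, so that its sum over the \<open>x\<^sub>i\<close> is at least
  \<open>c * g z powr (1 + \<alpha>) * (\<Sum> v x\<^sub>i) powr (- \<alpha>)\<close> (\<open>rhs_superadd\<close>).

  Convexity of \<open>v\<close> (\<open>v_subadd\<close>): the convex envelope of \<open>v\<close> at \<open>z\<close> is the least value of \<open>\<Sum> v x\<^sub>i\<close> over all
  decompositions of \<open>z\<close>. If \<open>v\<close> is not convex, then the ratio of \<open>v\<close> to its envelope has a maximum
  above \<open>1\<close>. There the second variation supplies exactly the hypothesis of \<open>parallel_sum_ineq\<close> with the
  Hessians at the \<open>x\<^sub>i\<close> and a multiple of the Hessian at \<open>z\<close> (\<open>contact\<close>). The two inequalities
  then nearly contradict each other; they are compatible only because \<open>\<alpha> = 1\<close> is allowed, where multiples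
  of solutions are solutions.
  Therefore a small multiple of \<open>exp (K * s x) * norm x\<close> is added to \<open>v\<close>. For large \<open>K\<close> its Hessian is
  strongly positive in the direction of the gradient of \<open>s\<close>, which makes \<open>F\<close> grow by a definite factor
  (\<open>form_gain\<close>). Every function on the sphere has critical points; those of \<open>s\<close> are placed near a
  minimum point \<open>p\<close> of \<open>v\<close> on the sphere (\<open>barrier_exists\<close>), where the maximum cannot lie since
  \<open>v p * norm x \<le> v x\<close> for all \<open>x\<close>.

  Strict convexity (\<open>v_strict\<close>): the same scheme is applied to the minimum of
  \<open>v x + v y - v (x + y) - \<epsilon> * exp (K * s (x + y)) * (norm x + norm y - norm (x + y))\<close>. If this
  expression is never negative, then the second order expansion at \<open>x = y\<close> bounds \<open>D2 v\<close> from below. The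
  second variation at a negative minimum involves derivatives of the triangle defect of the norm, whose
  unfavourable terms (\<open>norm_defect_estimates\<close>) are absorbed by adding \<open>\<kappa> / norm x\<close> times the identity to
  the Hessians. What this costs on the right-hand side is of the order of \<open>\<kappa>\<close> times the triangle defect
  (\<open>Phi_defect\<close>), and the barrier wins for large \<open>K\<close>. Near \<open>p\<close> the inequality holds for a different
  reason: \<open>v - v p * norm\<close> has a minimum at \<open>p\<close>, which makes \<open>v\<close> strictly convex there (\<open>gap_near_min\<close>).
\<close>

section \<open>Elementary symmetric functions and the Garding cone\<close>

text \<open>The index set is arbitrary because the arguments below proceed by deleting indices.\<close>

definition esym :: "'i set \<Rightarrow> nat \<Rightarrow> ('i \<Rightarrow> real) \<Rightarrow> real" where
  "esym I k l = (\<Sum>S\<in>{S. S \<subseteq> I \<and> card S = k}. \<Prod>i\<in>S. l i)"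

definition gcone :: "'i set \<Rightarrow> nat \<Rightarrow> ('i \<Rightarrow> real) set" where
  "gcone I k = {l. \<forall>j\<in>{1..k}. esym I j l > 0}"

lemma esym_0 [simp]: "finite I \<Longrightarrow> esym I 0 l = 1"
proof -
  assume "finite I"
  then have "{S. S \<subseteq> I \<and> card S = 0} = {{}}"
    by (auto dest: finite_subset)
  then show ?thesis by (simp add: esym_def)
qed

lemma esym_cong: "(\<And>i. i \<in> I \<Longrightarrow> l i = m i) \<Longrightarrow> esym I k l = esym I k m"
  unfolding esym_def by (intro sum.cong refl prod.cong) auto

lemma esym_card_gt: "finite I \<Longrightarrow> card I < k \<Longrightarrow> esym I k l = 0"
proof -
  assume "finite I" "card I < k"
  then have "card S \<noteq> k" if "S \<subseteq> I" for S
    using card_mono[of I S] that by linarith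
  then have "{S. S \<subseteq> I \<and> card S = k} = {}" by blast
  then show ?thesis by (simp only: esym_def sum.empty)
qed

lemma esym_insert:
  assumes "finite I" "i \<notin> I"
  shows "esym (insert i I) (Suc k) l = l i * esym I k l + esym I (Suc k) l"
proof -
  let ?A = "{S. S \<subseteq> I \<and> card S = k}" and ?B = "{S. S \<subseteq> I \<and> card S = Suc k}"
  have fin: "finite ?A" "finite ?B" using assms by auto
  have fS: "finite S" if "S \<subseteq> I" for S using that assms finite_subset by auto
  have eq: "{S. S \<subseteq> insert i I \<and> card S = Suc k} = insert i ` ?A \<union> ?B"
  proof (intro set_eqI iffI)
    fix S assume S: "S \<in> {S. S \<subseteq> insert i I \<and> card S = Suc k}"
    show "S \<in> insert i ` ?A \<union> ?B"
    proof (cases "i \<in> S")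
      case True
      then have "S = insert i (S - {i})" "S - {i} \<subseteq> I" "card (S - {i}) = k"
        using S by auto
      then show ?thesis by blast
    next
      case False then show ?thesis using S by auto
    qed
  next
    fix S assume "S \<in> insert i ` ?A \<union> ?B"
    then show "S \<in> {S. S \<subseteq> insert i I \<and> card S = Suc k}"
    proof
      assume "S \<in> insert i ` ?A"
      then obtain T where T: "S = insert i T" "T \<subseteq> I" "card T = k" by auto
      then have "i \<notin> T" "finite T" using assms fS by auto
      then show ?thesis using T by auto
    qed auto
  qed
  have disj: "insert i ` ?A \<inter> ?B = {}" using assms by auto
  have inj: "inj_on (insert i) ?A"
    using assms(2) by (intro inj_onI) (metis (mono_tags, lifting) insert_ident mem_Collect_eq subset_eq)
  have "esym (insert i I) (Suc k) l = (\<Sum>S\<in>insert i ` ?A. prod l S) + (\<Sum>S\<in>?B. prod l S)"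
    unfolding esym_def eq by (rule sum.union_disjoint) (use fin disj in auto)
  also have "(\<Sum>S\<in>insert i ` ?A. prod l S) = (\<Sum>S\<in>?A. prod l (insert i S))"
    using inj by (simp add: sum.reindex)
  also have "\<dots> = (\<Sum>S\<in>?A. l i * prod l S)"
    using assms fS by (intro sum.cong refl prod.insert) auto
  finally show ?thesis by (simp add: esym_def sum_distrib_left)
qed

lemma esym_remove:
  assumes "finite I" "i \<in> I"
  shows "esym I (Suc k) l = l i * esym (I - {i}) k l + esym (I - {i}) (Suc k) l"
  using esym_insert[of "I - {i}" i k l] assms by (simp add: insert_absorb)

text \<open>Each product over \<open>k + 1\<close> indices arises once for each of its factors.\<close>

lemma esym_double_sum:
  assumes "finite I"
  shows "(\<Sum>i\<in>I. l i * esym (I - {i}) k l) = real (Suc k) * esym I (Suc k) l"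
  using assms
proof (induction I arbitrary: k rule: finite_induct)
  case empty
  then show ?case using esym_card_gt[of "{}" "Suc k" l] by simp
next
  case (insert x I)
  have step: "(\<Sum>i\<in>I. l i * esym (insert x I - {i}) (Suc j) l)
      = l x * (\<Sum>i\<in>I. l i * esym (I - {i}) j l) + (\<Sum>i\<in>I. l i * esym (I - {i}) (Suc j) l)" for j
  proof -
    have "esym (insert x I - {i}) (Suc j) l
        = l x * esym (I - {i}) j l + esym (I - {i}) (Suc j) l" if "i \<in> I" for i
    proof -
      have "insert x I - {i} = insert x (I - {i})" using insert that by auto
      then show ?thesis using esym_insert[of "I - {i}" x j l] insert by auto
    qed
    then show ?thesis
      by (simp add: sum_distrib_left sum.distrib[symmetric] algebra_simps cong: sum.cong)
  qed
  have rm: "insert x I - {x} = I" using insert by auto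
  have "(\<Sum>i\<in>insert x I. l i * esym (insert x I - {i}) k l)
      = l x * esym I k l + (\<Sum>i\<in>I. l i * esym (insert x I - {i}) k l)"
    using insert rm by simp
  also have "\<dots> = real (Suc k) * esym (insert x I) (Suc k) l"
  proof (cases k)
    case 0
    have "(\<Sum>i\<in>I. l i * esym (insert x I - {i}) 0 l) = (\<Sum>i\<in>I. l i * esym (I - {i}) 0 l)"
      using insert by simp
    then show ?thesis using 0 insert.IH[of 0] insert by (simp add: esym_insert)
  next
    case (Suc j)
    show ?thesis unfolding Suc step insert.IH esym_insert[OF insert(1,2)]
      by (simp add: algebra_simps)
  qed
  finally show ?case .
qed

lemma esym_pos:
  assumes "finite I" "\<And>i. i \<in> I \<Longrightarrow> 0 < l i" "k \<le> card I"
  shows "0 < esym I k l"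
proof -
  obtain T where "T \<subseteq> I" "card T = k" using obtain_subset_with_card_n[OF assms(3)] by auto
  then have "{S. S \<subseteq> I \<and> card S = k} \<noteq> {}" by auto
  then show ?thesis unfolding esym_def using assms
    by (intro sum_pos prod_pos) auto
qed

lemma esym_scale: "finite I \<Longrightarrow> esym I k (\<lambda>i. c * l i) = c ^ k * esym I k l"
  by (simp add: esym_def prod.distrib sum_distrib_left)

lemma esym_bij:
  assumes "bij_betw h J I"
  shows "esym J k (\<lambda>j. l (h j)) = esym I k l"
proof -
  have inj: "inj_on h J" and im: "h ` J = I" using assms by (auto simp: bij_betw_def)
  have "bij_betw (image h) {S. S \<subseteq> J \<and> card S = k} {S. S \<subseteq> I \<and> card S = k}"
  proof (intro bij_betw_imageI)
    show "inj_on (image h) {S. S \<subseteq> J \<and> card S = k}"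
      using inj_on_image_Pow[OF inj] by (auto simp: inj_on_def)
    show "image h ` {S. S \<subseteq> J \<and> card S = k} = {S. S \<subseteq> I \<and> card S = k}"
    proof (intro set_eqI iffI)
      fix T assume T: "T \<in> {S. S \<subseteq> I \<and> card S = k}"
      then have "T \<subseteq> h ` J" using im by simp
      then obtain S where S: "S \<subseteq> J" "T = h ` S" by (rule subset_imageE)
      then have "card S = k" using T card_image[OF inj_on_subset[OF inj S(1)]] by simp
      then show "T \<in> image h ` {S. S \<subseteq> J \<and> card S = k}" using S by auto
    next
      fix T assume "T \<in> image h ` {S. S \<subseteq> J \<and> card S = k}"
      then obtain S where S: "S \<subseteq> J" "card S = k" "T = h ` S" by blast
      then show "T \<in> {S. S \<subseteq> I \<and> card S = k}"
        using im card_image[OF inj_on_subset[OF inj S(1)]] by auto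
    qed
  qed
  then have "(\<Sum>S\<in>{S. S \<subseteq> J \<and> card S = k}. prod l (h ` S)) = esym I k l"
    unfolding esym_def by (rule sum.reindex_bij_betw)
  moreover have "prod l (h ` S) = (\<Prod>j\<in>S. l (h j))" if "S \<subseteq> J" for S
    using prod.reindex[of h S l] inj_on_subset[OF inj that] by (simp add: comp_def)
  ultimately show ?thesis unfolding esym_def
    by (metis (no_types, lifting) mem_Collect_eq sum.cong)
qed

lemma gcone_0 [simp]: "gcone I 0 = UNIV"
  by (simp add: gcone_def)

lemma gcone_Suc: "l \<in> gcone I (Suc k) \<longleftrightarrow> l \<in> gcone I k \<and> esym I (Suc k) l > 0"
  by (auto simp: gcone_def le_Suc_eq)

lemma gcone_esym_pos:
  assumes "finite I" "l \<in> gcone I k" "j \<le> k" shows "esym I j l > 0"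
  using assms by (cases j) (auto simp: gcone_def)

lemma gcone_mono: "j \<le> k \<Longrightarrow> gcone I k \<subseteq> gcone I j"
  by (auto simp: gcone_def)

lemma gcone_scale: "finite I \<Longrightarrow> l \<in> gcone I k \<Longrightarrow> c > 0 \<Longrightarrow> (\<lambda>i. c * l i) \<in> gcone I k"
  by (auto simp: gcone_def esym_scale)

lemma gcone_pos: "finite I \<Longrightarrow> (\<And>i. i \<in> I \<Longrightarrow> 0 < l i) \<Longrightarrow> k \<le> card I \<Longrightarrow> l \<in> gcone I k"
  by (auto simp: gcone_def intro!: esym_pos)

text \<open>The parallel sum, i.e. \<open>1 / (1 / x + 1 / y)\<close>. In this form it can also be used when one of the
  arguments is not positive, as long as \<open>x + y > 0\<close>.\<close>

definition psum :: "real \<Rightarrow> real \<Rightarrow> real" where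
  "psum x y = x * y / (x + y)"

lemma psum_mono:
  assumes "x \<le> x'" "y \<le> y'" "x + y > 0"
  shows "psum x y \<le> psum x' y'"
proof -
  have p: "x + y' > 0" "x' + y' > 0" using assms by auto
  have "psum x y' - psum x y = x^2 * (y' - y) / ((x + y) * (x + y'))"
    unfolding psum_def using assms p by (simp add: field_simps power2_eq_square)
  also have "\<dots> \<ge> 0" using assms p by (intro divide_nonneg_pos mult_nonneg_nonneg) auto
  finally have 1: "psum x y \<le> psum x y'" by simp
  have "psum x' y' - psum x y' = y'^2 * (x' - x) / ((x + y') * (x' + y'))"
    unfolding psum_def using assms p by (simp add: field_simps power2_eq_square)
  also have "\<dots> \<ge> 0" using assms p by (intro divide_nonneg_pos mult_nonneg_nonneg) auto
  finally show ?thesis using 1 by simp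
qed

text \<open>Since \<open>psum x y = x - x\<^sup>2 / (x + y)\<close>, this is the subadditivity of \<open>u\<^sup>2 / s\<close>.\<close>

lemma psum_superadd:
  assumes "x + y > 0" "x' + y' > 0"
  shows "psum x y + psum x' y' \<le> psum (x + x') (y + y')"
proof -
  have titu: "(u + u')^2 / (s + s') \<le> u^2 / s + u'^2 / s'" if "s > 0" "s' > 0" for u u' s s' :: real
  proof -
    have "u^2 / s + u'^2 / s' - (u + u')^2 / (s + s') = (u * s' - u' * s)^2 / (s * s' * (s + s'))"
      using that by (simp add: divide_simps) algebra
    also have "\<dots> \<ge> 0" using that by (intro divide_nonneg_pos mult_pos_pos) auto
    finally show ?thesis by simp
  qed
  have ps: "psum u w = u - u^2 / (u + w)" if "u + w > 0" for u w
    using that by (simp add: psum_def field_simps power2_eq_square)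
  have e: "x + x' + (y + y') = (x + y) + (x' + y')" by simp
  have "x + x' + (y + y') > 0" using assms by simp
  then show ?thesis using ps[of "x + x'" "y + y'"] ps[of x y] ps[of x' y'] titu[OF assms, of x x'] assms
    unfolding e by simp
qed

definition eratio :: "'i set \<Rightarrow> nat \<Rightarrow> ('i \<Rightarrow> real) \<Rightarrow> real" where
  "eratio I k l = esym I (Suc k) l / esym I k l"

text \<open>Splitting \<open>\<sigma>\<^sub>k\<^sub>+\<^sub>1\<close> over \<open>I\<close> according to an index \<open>i\<close> expresses the ratio over \<open>I\<close> by parallel sums with the
  next lower ratios over \<open>I - {i}\<close>. Monotonicity and superadditivity of \<open>psum\<close> can therefore be
  transferred to the ratios by induction.\<close>

lemma eratio_rec:
  assumes "finite I" "l \<in> gcone I (Suc k)" "\<And>i. i \<in> I \<Longrightarrow> l \<in> gcone (I - {i}) k"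
  shows "real (Suc (Suc k)) * eratio I (Suc k) l = (\<Sum>i\<in>I. psum (l i) (eratio (I - {i}) k l))"
    and "\<And>i. i \<in> I \<Longrightarrow> l i + eratio (I - {i}) k l > 0"
proof -
  have sp: "l i + eratio (I - {i}) k l > 0"
    and ps: "psum (l i) (eratio (I - {i}) k l) = l i * esym (I - {i}) (Suc k) l / esym I (Suc k) l"
    if i: "i \<in> I" for i
  proof -
    let ?p = "esym (I - {i}) k l"
    have p: "?p > 0" using gcone_esym_pos[of "I - {i}" l k k] assms i by auto
    have S: "esym I (Suc k) l > 0" using assms gcone_esym_pos by blast
    have e: "l i + eratio (I - {i}) k l = esym I (Suc k) l / ?p"
      using esym_remove[OF assms(1) i, of k l] p by (simp add: eratio_def field_simps)
    show "l i + eratio (I - {i}) k l > 0" unfolding e using p S by simp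
    show "psum (l i) (eratio (I - {i}) k l) = l i * esym (I - {i}) (Suc k) l / esym I (Suc k) l"
      unfolding psum_def e using p S by (simp add: eratio_def)
  qed
  show "real (Suc (Suc k)) * eratio I (Suc k) l = (\<Sum>i\<in>I. psum (l i) (eratio (I - {i}) k l))"
  proof -
    have "(\<Sum>i\<in>I. psum (l i) (eratio (I - {i}) k l)) = (\<Sum>i\<in>I. l i * esym (I - {i}) (Suc k) l) / esym I (Suc k) l"
      by (simp only: sum_divide_distrib) (rule sum.cong[OF refl ps])
    then show ?thesis using esym_double_sum[OF assms(1), of l "Suc k"] by (simp add: eratio_def)
  qed
  show "\<And>i. i \<in> I \<Longrightarrow> l i + eratio (I - {i}) k l > 0" by (rule sp)
qed

text \<open>Monotonicity and superadditivity of the ratio on the cone, and stability of the cones under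
  deletion of an index. They have to be proved by one simultaneous induction on \<open>k\<close>: the recursion needs
  the third clause, and the third clause for \<open>k + 1\<close> needs the first two.\<close>

definition ratio_good :: "'i set \<Rightarrow> nat \<Rightarrow> bool" where
  "ratio_good I k \<longleftrightarrow>
    (\<forall>l m. l \<in> gcone I k \<and> (\<forall>i\<in>I. l i \<le> m i) \<longrightarrow> m \<in> gcone I k \<and> eratio I k l \<le> eratio I k m) \<and>
    (\<forall>l m. l \<in> gcone I k \<and> m \<in> gcone I k \<longrightarrow>
        (\<lambda>i. l i + m i) \<in> gcone I k \<and> eratio I k l + eratio I k m \<le> eratio I k (\<lambda>i. l i + m i)) \<and>
    (\<forall>l. l \<in> gcone I (Suc k) \<longrightarrow> (\<forall>i\<in>I. l \<in> gcone (I - {i}) k))"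

lemma gcone_SucI:
  assumes "finite I" "l \<in> gcone I k" "eratio I k l > 0"
  shows "l \<in> gcone I (Suc k)"
proof -
  have "esym I k l > 0" using assms gcone_esym_pos by blast
  then have "esym I (Suc k) l > 0" using assms(3) by (simp add: eratio_def zero_less_divide_iff)
  then show ?thesis using assms by (simp add: gcone_Suc)
qed

lemma eratio_pos: "finite I \<Longrightarrow> l \<in> gcone I (Suc k) \<Longrightarrow> eratio I k l > 0"
  using gcone_esym_pos[of I l "Suc k"] by (simp add: eratio_def)

lemma esym_1: "finite I \<Longrightarrow> esym I (Suc 0) l = sum l I"
  using esym_double_sum[of I l 0] by simp

lemma esym_fun_upd:
  assumes "finite I" "i \<in> I"
  shows "esym I (Suc k) (l(i := l i + t)) = esym I (Suc k) l + t * esym (I - {i}) k l"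
proof -
  have "esym (I - {i}) j (l(i := l i + t)) = esym (I - {i}) j l" for j
    by (rule esym_cong) auto
  then show ?thesis using esym_remove[OF assms, of k] by (simp add: algebra_simps)
qed

lemma continuous_esym: "isCont (\<lambda>t::real. esym I k (\<lambda>i. l i + t * m i)) s"
  unfolding esym_def by (intro continuous_intros)

lemma gcone_open_line:
  assumes "finite I" "l \<in> gcone I k"
  shows "\<exists>d>0. (\<lambda>i. l i - d) \<in> gcone I k"
proof -
  have "\<forall>\<^sub>F t in at 0. esym I j (\<lambda>i. l i + t * (-1)) > 0" if "j \<in> {1..k}" for j
  proof -
    have "((\<lambda>t. esym I j (\<lambda>i. l i + t * (-1))) \<longlongrightarrow> esym I j (\<lambda>i. l i + 0 * (-1))) (at 0)"
      using continuous_esym[where I=I and k=j and l=l and m="\<lambda>_. -1" and s=0] by (simp add: isCont_def)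
    then show ?thesis using assms that by (intro order_tendstoD(1)) (auto simp: gcone_def)
  qed
  then have "\<forall>\<^sub>F t in at 0. \<forall>j\<in>{1..k}. esym I j (\<lambda>i. l i + t * (-1)) > 0"
    by (intro eventually_ball_finite) auto
  then obtain d where d: "d > 0" "\<And>t. t \<noteq> 0 \<Longrightarrow> dist t 0 < d \<Longrightarrow> \<forall>j\<in>{1..k}. esym I j (\<lambda>i. l i + t * (-1)) > 0"
    unfolding eventually_at by auto
  then have "(\<lambda>i. l i - d/2) \<in> gcone I k" using d(2)[of "d/2"] by (simp add: gcone_def)
  then show ?thesis using d(1) by (intro exI[of _ "d/2"]) auto
qed

text \<open>For the first two clauses the recursion \<open>eratio_rec\<close> is combined with \<open>psum_mono\<close> and \<open>psum_superadd\<close>.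
  For the third, \<open>\<sigma>\<^sub>k\<^sub>+\<^sub>1\<close> over \<open>I - {i}\<close> is the derivative of \<open>\<sigma>\<^sub>k\<^sub>+\<^sub>2\<close> over \<open>I\<close> in the \<open>i\<close>-th variable. If it were
  negative, then \<open>\<sigma>\<^sub>k\<^sub>+\<^sub>2\<close> would vanish after a suitable increase of that variable, although the ratio
  does not decrease and hence the cone is not left. This gives a weak inequality; applied to \<open>l - d\<close>,
  which is still in the open cone, it becomes strict by superadditivity.\<close>

lemma ratio_good: "finite I \<Longrightarrow> ratio_good I k"
proof (induction k arbitrary: I)
  case 0
  have "eratio I 0 l = sum l I" for l using 0 by (simp add: eratio_def esym_1)
  then show ?case by (auto simp: ratio_good_def sum_mono sum.distrib)
next
  case (Suc k)
  have M: "m \<in> gcone J k" "eratio J k l \<le> eratio J k m"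
    if "finite J" "l \<in> gcone J k" "\<forall>i\<in>J. l i \<le> m i" for J and l m :: "'a \<Rightarrow> real"
    using Suc.IH[OF that(1)] that(2,3) unfolding ratio_good_def by blast+
  have S: "(\<lambda>i. l i + m i) \<in> gcone J k" "eratio J k l + eratio J k m \<le> eratio J k (\<lambda>i. l i + m i)"
    if "finite J" "l \<in> gcone J k" "m \<in> gcone J k" for J and l m :: "'a \<Rightarrow> real"
    using Suc.IH[OF that(1)] that(2,3) unfolding ratio_good_def by blast+
  have D: "l \<in> gcone (J - {i}) k" if "finite J" "l \<in> gcone J (Suc k)" "i \<in> J" for J i and l :: "'a \<Rightarrow> real"
    using Suc.IH[OF that(1)] that(2,3) unfolding ratio_good_def by blast
  have E1: "real (Suc (Suc k)) * eratio I (Suc k) l = (\<Sum>i\<in>I. psum (l i) (eratio (I - {i}) k l))"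
    if "l \<in> gcone I (Suc k)" for l
    by (rule eratio_rec(1)[OF Suc.prems that]) (rule D[OF Suc.prems that])
  have E2: "l i + eratio (I - {i}) k l > 0" if "l \<in> gcone I (Suc k)" "i \<in> I" for l i
    by (rule eratio_rec(2)[OF Suc.prems that(1) _ that(2)]) (rule D[OF Suc.prems that(1)])
  have M': "m \<in> gcone I (Suc k) \<and> eratio I (Suc k) l \<le> eratio I (Suc k) m"
    if l: "l \<in> gcone I (Suc k)" and lm: "\<forall>i\<in>I. l i \<le> m i" for l m
  proof
    have lk: "l \<in> gcone I k" using l gcone_Suc by blast
    have m: "m \<in> gcone I k" "eratio I k l \<le> eratio I k m"
      using M[OF Suc.prems lk lm] by auto
    show m': "m \<in> gcone I (Suc k)"
      using gcone_SucI[OF Suc.prems m(1)] m(2) eratio_pos[OF Suc.prems l] by linarith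
    have "real (Suc (Suc k)) * eratio I (Suc k) l \<le> real (Suc (Suc k)) * eratio I (Suc k) m"
      unfolding E1[OF l]
        E1[OF m']
    proof (rule sum_mono)
      fix i assume i: "i \<in> I"
      show "psum (l i) (eratio (I - {i}) k l) \<le> psum (m i) (eratio (I - {i}) k m)"
        using lm i M(2)[of "I - {i}" l m] Suc.prems D[OF Suc.prems l i]
          E2[OF l i]
        by (intro psum_mono) auto
    qed
    then show "eratio I (Suc k) l \<le> eratio I (Suc k) m" by (simp only: mult_le_cancel_left_pos of_nat_0_less_iff zero_less_Suc)
  qed
  have S': "(\<lambda>i. l i + m i) \<in> gcone I (Suc k) \<and>
      eratio I (Suc k) l + eratio I (Suc k) m \<le> eratio I (Suc k) (\<lambda>i. l i + m i)"
    if l: "l \<in> gcone I (Suc k)" and m: "m \<in> gcone I (Suc k)" for l m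
  proof
    have lk: "l \<in> gcone I k" "m \<in> gcone I k" using l m gcone_Suc by blast+
    note s = S[OF Suc.prems lk]
    show s': "(\<lambda>i. l i + m i) \<in> gcone I (Suc k)"
      using gcone_SucI[OF Suc.prems s(1)] s(2) eratio_pos[OF Suc.prems l] eratio_pos[OF Suc.prems m]
      by linarith
    have "real (Suc (Suc k)) * eratio I (Suc k) l + real (Suc (Suc k)) * eratio I (Suc k) m
        \<le> real (Suc (Suc k)) * eratio I (Suc k) (\<lambda>i. l i + m i)"
      unfolding E1[OF l]
        E1[OF m]
        E1[OF s'] sum.distrib[symmetric]
    proof (rule sum_mono)
      fix i assume i: "i \<in> I"
      have pl: "l i + eratio (I - {i}) k l > 0" "m i + eratio (I - {i}) k m > 0"
        using E2[OF l i]
          E2[OF m i] by auto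
      have "psum (l i) (eratio (I - {i}) k l) + psum (m i) (eratio (I - {i}) k m)
          \<le> psum (l i + m i) (eratio (I - {i}) k l + eratio (I - {i}) k m)"
        by (rule psum_superadd[OF pl])
      also have "\<dots> \<le> psum (l i + m i) (eratio (I - {i}) k (\<lambda>i. l i + m i))"
        using S(2)[of "I - {i}" l m] Suc.prems D[OF Suc.prems l i] D[OF Suc.prems m i] pl
        by (intro psum_mono) auto
      finally show "psum (l i) (eratio (I - {i}) k l) + psum (m i) (eratio (I - {i}) k m)
          \<le> psum (l i + m i) (eratio (I - {i}) k (\<lambda>i. l i + m i))" .
    qed
    then show "eratio I (Suc k) l + eratio I (Suc k) m \<le> eratio I (Suc k) (\<lambda>i. l i + m i)"
      by (simp only: distrib_left[symmetric] mult_le_cancel_left_pos of_nat_0_less_iff zero_less_Suc)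
  qed
  have D': "l \<in> gcone (I - {i}) (Suc k)" if l: "l \<in> gcone I (Suc (Suc k))" and i: "i \<in> I" for l i
  proof -
    let ?J = "I - {i}"
    have fJ: "finite ?J" using Suc.prems by auto
    have nonneg: "esym ?J (Suc k) l \<ge> 0" if l: "l \<in> gcone I (Suc (Suc k))" for l
    proof (rule ccontr)
      assume neg: "\<not> esym ?J (Suc k) l \<ge> 0"
      let ?e = "esym ?J (Suc k) l"
      have lk: "l \<in> gcone I (Suc k)" and lp: "esym I (Suc (Suc k)) l > 0"
        using l gcone_Suc by blast+
      \<comment> \<open>The increase at which the affine function of the \<open>i\<close>-th variable reaches zero.\<close>
      define t where "t = esym I (Suc (Suc k)) l / (- ?e)"
      have t: "t > 0" unfolding t_def using neg lp by (intro divide_pos_pos) auto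
      let ?m = "l(i := l i + t)"
      have m: "?m \<in> gcone I (Suc k)" "eratio I (Suc k) l \<le> eratio I (Suc k) ?m"
        using M'[OF lk, of ?m] t by auto
      have "eratio I (Suc k) l > 0" using eratio_pos[OF Suc.prems l] .
      then have "?m \<in> gcone I (Suc (Suc k))" using gcone_SucI[OF Suc.prems m(1)] m(2) by linarith
      then have "esym I (Suc (Suc k)) ?m > 0" using gcone_Suc by blast
      moreover have "esym I (Suc (Suc k)) ?m = esym I (Suc (Suc k)) l + t * ?e"
        using esym_fun_upd[OF Suc.prems i] by blast
      moreover have "t * ?e = - esym I (Suc (Suc k)) l" using neg by (simp add: t_def)
      ultimately show False by simp
    qed
    have card: "Suc (Suc k) \<le> card I"
    proof (rule ccontr)
      assume "\<not> Suc (Suc k) \<le> card I"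
      then have "esym I (Suc (Suc k)) l = 0" using esym_card_gt[OF Suc.prems] by simp
      then show False using l gcone_Suc[of l I "Suc k"] by simp
    qed
    obtain d where d: "d > 0" "(\<lambda>i. l i - d) \<in> gcone I (Suc (Suc k))"
      using gcone_open_line[OF Suc.prems l] by auto
    let ?n = "\<lambda>i. l i - d"
    have nJ: "?n \<in> gcone ?J k" using D[OF Suc.prems _ i] d(2) gcone_Suc by blast
    have cJ: "Suc k \<le> card ?J" using card i Suc.prems by auto
    have dJ: "(\<lambda>_. d) \<in> gcone ?J (Suc k)" using d fJ cJ by (intro gcone_pos) auto
    then have dJk: "(\<lambda>_. d) \<in> gcone ?J k" using gcone_Suc by blast
    have e0: "eratio ?J k ?n \<ge> 0" using nonneg[OF d(2)] gcone_esym_pos[OF fJ nJ, of k] by (simp add: eratio_def)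
    have "l \<in> gcone ?J k" "eratio ?J k ?n + eratio ?J k (\<lambda>_. d) \<le> eratio ?J k l"
      using S[OF fJ nJ dJk] by auto
    then show ?thesis using gcone_SucI[OF fJ, of l k] eratio_pos[OF fJ dJ] e0 by linarith
  qed
  show ?case unfolding ratio_good_def using M' S' D' by blast
qed

section \<open>Quotients of elementary symmetric functions\<close>

text \<open>The exponent makes the quotient homogeneous of degree one.\<close>

definition FQ :: "'i set \<Rightarrow> nat \<Rightarrow> nat \<Rightarrow> ('i \<Rightarrow> real) \<Rightarrow> real" where
  "FQ I a b l = (esym I a l / esym I b l) powr (1 / real (a - b))"

lemma gcone_add: "finite I \<Longrightarrow> l \<in> gcone I k \<Longrightarrow> m \<in> gcone I k \<Longrightarrow> (\<lambda>i. l i + m i) \<in> gcone I k"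
  using ratio_good[of I k] unfolding ratio_good_def by blast

lemma gcone_up: "finite I \<Longrightarrow> l \<in> gcone I k \<Longrightarrow> (\<And>i. i \<in> I \<Longrightarrow> l i \<le> m i) \<Longrightarrow> m \<in> gcone I k"
  using ratio_good[of I k] unfolding ratio_good_def by blast

text \<open>The quotient is a geometric mean of successive ratios, each of which is increasing and
  superadditive.\<close>

lemma esym_quot_prod:
  assumes "finite I" "l \<in> gcone I a" "b \<le> a"
  shows "esym I a l / esym I b l = (\<Prod>j\<in>{b..<a}. eratio I j l)"
  using assms(3) assms(2)
proof (induction a rule: dec_induct)
  case base
  then show ?case using gcone_esym_pos[OF assms(1)] by fastforce
next
  case (step n)
  have "esym I n l > 0" using gcone_esym_pos[OF assms(1) step.prems, of n] by simp
  moreover have "esym I n l / esym I b l = (\<Prod>j\<in>{b..<n}. eratio I j l)"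
    using step gcone_Suc[of l I n] by blast
  moreover have "esym I (Suc n) l / esym I b l = esym I n l / esym I b l * eratio I n l"
    using calculation(1) by (simp add: eratio_def)
  ultimately show ?case using step by (simp add: prod.atLeastLessThan_Suc)
qed

lemma FQ_pos: "finite I \<Longrightarrow> l \<in> gcone I a \<Longrightarrow> b < a \<Longrightarrow> FQ I a b l > 0"
  unfolding FQ_def using gcone_esym_pos[of I l a] by (simp add: less_imp_neq[symmetric])

lemma FQ_cong: "(\<And>i. i \<in> I \<Longrightarrow> l i = m i) \<Longrightarrow> FQ I a b l = FQ I a b m"
  unfolding FQ_def using esym_cong[of I l m] by simp

lemma eratio_mono: "finite I \<Longrightarrow> l \<in> gcone I k \<Longrightarrow> (\<And>i. i \<in> I \<Longrightarrow> l i \<le> m i) \<Longrightarrow> eratio I k l \<le> eratio I k m"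
  using ratio_good[of I k] unfolding ratio_good_def by blast

lemma eratio_superadd: "finite I \<Longrightarrow> l \<in> gcone I k \<Longrightarrow> m \<in> gcone I k \<Longrightarrow>
   eratio I k l + eratio I k m \<le> eratio I k (\<lambda>i. l i + m i)"
  using ratio_good[of I k] unfolding ratio_good_def by blast

lemma FQ_mono:
  assumes "finite I" "l \<in> gcone I a" "b < a" "\<And>i. i \<in> I \<Longrightarrow> l i \<le> m i"
  shows "FQ I a b l \<le> FQ I a b m"
proof -
  have m: "m \<in> gcone I a" using gcone_up[OF assms(1,2,4)] .
  have "(\<Prod>j\<in>{b..<a}. eratio I j l) \<le> (\<Prod>j\<in>{b..<a}. eratio I j m)"
  proof (rule prod_mono)
    fix j assume j: "j \<in> {b..<a}"
    then have "l \<in> gcone I (Suc j)" using assms(2) gcone_mono[of "Suc j" a I] by auto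
    then show "0 \<le> eratio I j l \<and> eratio I j l \<le> eratio I j m"
      using eratio_pos[OF assms(1), of l j] eratio_mono[OF assms(1), of l j m] assms(4) gcone_Suc[of l I j]
      by (auto simp: less_imp_le)
  qed
  moreover have "(\<Prod>j\<in>{b..<a}. eratio I j l) \<ge> 0"
    using esym_quot_prod[OF assms(1,2), of b] gcone_esym_pos[OF assms(1,2)] assms(3)
    by (metis divide_nonneg_nonneg less_imp_le order_refl)
  ultimately show ?thesis unfolding FQ_def
    using esym_quot_prod[OF assms(1,2), of b] esym_quot_prod[OF assms(1) m, of b] assms(3)
    by (intro powr_mono2) auto
qed

lemma FQ_scale:
  assumes "finite I" "c > 0" "b < a" "l \<in> gcone I a"
  shows "FQ I a b (\<lambda>i. c * l i) = c * FQ I a b l"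
proof -
  have "c ^ a / c ^ b = c ^ (a - b)" using assms by (simp add: power_diff)
  then have "esym I a (\<lambda>i. c * l i) / esym I b (\<lambda>i. c * l i) = c ^ (a - b) * (esym I a l / esym I b l)"
    using assms by (simp add: esym_scale flip: \<open>c ^ a / c ^ b = c ^ (a - b)\<close>)
  moreover have "(c ^ (a - b)) powr (1 / real (a - b)) = c"
    using assms by (simp add: powr_realpow[symmetric] powr_powr)
  moreover have "esym I a l / esym I b l > 0" using gcone_esym_pos[OF assms(1,4)] assms(3) by simp
  ultimately show ?thesis unfolding FQ_def using assms(2) by (simp only: powr_mult)
qed

text \<open>Superadditivity of the geometric mean (Mahler). After division by the geometric mean of \<open>x + y\<close> both
  terms on the left are estimated by arithmetic means, which add up to \<open>1\<close>.\<close>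

lemma prod_powr_superadd:
  fixes x y :: "'j \<Rightarrow> real"
  assumes "finite J" "J \<noteq> {}" "\<And>j. j \<in> J \<Longrightarrow> x j > 0" "\<And>j. j \<in> J \<Longrightarrow> y j > 0"
  shows "(prod x J) powr (1 / real (card J)) + (prod y J) powr (1 / real (card J))
     \<le> (\<Prod>j\<in>J. x j + y j) powr (1 / real (card J))"
proof -
  let ?m = "1 / real (card J)"
  let ?s = "\<lambda>j. x j + y j"
  have P: "prod ?s J > 0" using assms by (intro prod_pos) (auto intro: add_pos_pos)
  have amgm: "(\<Prod>j\<in>J. w j / ?s j) powr ?m \<le> (\<Sum>j\<in>J. w j / ?s j) * ?m" if "\<And>j. j \<in> J \<Longrightarrow> w j > 0" for w
  proof -
    have nn: "\<And>j. j \<in> J \<Longrightarrow> w j / ?s j \<ge> 0" using that assms by (simp add: add_pos_pos less_imp_le)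
    show ?thesis using arith_geom_mean[OF assms(1,2), of "\<lambda>j. w j / ?s j"] nn
      by (simp add: sum_divide_distrib)
  qed
  have "(prod x J) powr ?m + (prod y J) powr ?m
     = (prod ?s J) powr ?m * ((\<Prod>j\<in>J. x j / ?s j) powr ?m + (\<Prod>j\<in>J. y j / ?s j) powr ?m)"
  proof -
    have "(prod w J) powr ?m = (prod ?s J) powr ?m * (\<Prod>j\<in>J. w j / ?s j) powr ?m" if "\<And>j. j \<in> J \<Longrightarrow> w j > 0" for w
    proof -
      have "prod w J \<ge> 0" using that by (intro prod_nonneg) (auto intro: less_imp_le)
      moreover have "prod w J = prod ?s J * (\<Prod>j\<in>J. w j / ?s j)" using P by (simp add: prod_dividef)
      ultimately show ?thesis using P that assms
        by (simp add: powr_mult[symmetric] del: powr_mult)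
    qed
    then show ?thesis using assms by (simp add: distrib_left)
  qed
  also have "\<dots> \<le> (prod ?s J) powr ?m * ((\<Sum>j\<in>J. x j / ?s j) * ?m + (\<Sum>j\<in>J. y j / ?s j) * ?m)"
    using amgm[of x] amgm[of y] assms by (intro mult_left_mono add_mono) auto
  also have "(\<Sum>j\<in>J. x j / ?s j) * ?m + (\<Sum>j\<in>J. y j / ?s j) * ?m = 1"
  proof -
    have "(\<Sum>j\<in>J. x j / ?s j) + (\<Sum>j\<in>J. y j / ?s j) = (\<Sum>j\<in>J. 1)"
      unfolding sum.distrib[symmetric]
    proof (rule sum.cong[OF refl])
      fix j assume "j \<in> J"
      then have "x j + y j > 0" using assms by (simp add: add_pos_pos)
      then show "x j / ?s j + y j / ?s j = 1" by (simp add: add_divide_distrib[symmetric])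
    qed
    then show ?thesis using assms by (simp add: add_divide_distrib[symmetric])
  qed
  finally show ?thesis by simp
qed

lemma FQ_superadd:
  assumes "finite I" "l \<in> gcone I a" "m \<in> gcone I a" "b < a"
  shows "FQ I a b l + FQ I a b m \<le> FQ I a b (\<lambda>i. l i + m i)"
proof -
  have s: "(\<lambda>i. l i + m i) \<in> gcone I a" using gcone_add assms by blast
  have J: "real (card {b..<a}) = real (a - b)" "{b..<a} \<noteq> {}" using assms by auto
  have pos: "eratio I j n > 0" if "j \<in> {b..<a}" "n \<in> gcone I a" for j n
    using that eratio_pos[OF assms(1), of n j] gcone_mono[of "Suc j" a I] by auto
  have h1: "FQ I a b l + FQ I a b m \<le> (\<Prod>j\<in>{b..<a}. eratio I j l + eratio I j m) powr (1 / real (a - b))"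
    unfolding FQ_def using prod_powr_superadd[of "{b..<a}" "\<lambda>j. eratio I j l" "\<lambda>j. eratio I j m"]
      esym_quot_prod[OF assms(1,2), of b] esym_quot_prod[OF assms(1,3), of b] assms J pos by simp
  have pos': "0 \<le> eratio I j l + eratio I j m" if "j \<in> {b..<a}" for j
    using pos[OF that] assms by (simp add: add_nonneg_nonneg less_imp_le)
  have "FQ I a b l + FQ I a b m \<le> (\<Prod>j\<in>{b..<a}. eratio I j l + eratio I j m) powr (1 / real (a - b))"
    by (rule h1)
  also have "\<dots> \<le> (\<Prod>j\<in>{b..<a}. eratio I j (\<lambda>i. l i + m i)) powr (1 / real (a - b))"
  proof (intro powr_mono2 prod_mono conjI prod_nonneg)
    fix j assume j: "j \<in> {b..<a}"
    show "0 \<le> eratio I j l + eratio I j m" by (rule pos'[OF j])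
    have "l \<in> gcone I j" "m \<in> gcone I j" using assms j gcone_mono[of j a I] by auto
    then show "eratio I j l + eratio I j m \<le> eratio I j (\<lambda>i. l i + m i)"
      using eratio_superadd[OF assms(1)] by auto
  qed (use pos' in auto)
  also have "\<dots> = FQ I a b (\<lambda>i. l i + m i)"
    unfolding FQ_def using esym_quot_prod[OF assms(1) s, of b] assms by simp
  finally show ?thesis .
qed

text \<open>A product of inverses over an index set is the product over its complement, divided by the product
  over all indices.\<close>

lemma esym_inverse:
  assumes "finite I" "\<And>i. i \<in> I \<Longrightarrow> l i > 0" "k \<le> card I"
  shows "esym I k (\<lambda>i. 1 / l i) = esym I (card I - k) l / prod l I"
proof -
  have "bij_betw (\<lambda>S. I - S) {S. S \<subseteq> I \<and> card S = k} {S. S \<subseteq> I \<and> card S = card I - k}"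
  proof (rule bij_betw_byWitness[where f' = "\<lambda>S. I - S"])
    show "(\<lambda>S. I - S) ` {S. S \<subseteq> I \<and> card S = k} \<subseteq> {S. S \<subseteq> I \<and> card S = card I - k}"
      using assms by (auto simp: card_Diff_subset finite_subset)
    show "(\<lambda>S. I - S) ` {S. S \<subseteq> I \<and> card S = card I - k} \<subseteq> {S. S \<subseteq> I \<and> card S = k}"
      using assms by (auto simp: card_Diff_subset finite_subset)
  qed auto
  then have "esym I (card I - k) l = (\<Sum>S\<in>{S. S \<subseteq> I \<and> card S = k}. prod l (I - S))"
    unfolding esym_def by (rule sum.reindex_bij_betw[symmetric])
  also have "\<dots> = (\<Sum>S\<in>{S. S \<subseteq> I \<and> card S = k}. prod l I * (\<Prod>i\<in>S. 1 / l i))"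
  proof (rule sum.cong[OF refl])
    fix S assume S: "S \<in> {S. S \<subseteq> I \<and> card S = k}"
    then have "prod l I = prod l (I - S) * prod l S" using assms by (intro prod.subset_diff) auto
    moreover have "prod l S > 0" using S assms by (intro prod_pos) auto
    ultimately show "prod l (I - S) = prod l I * (\<Prod>i\<in>S. 1 / l i)" by (simp add: prod_dividef)
  qed
  finally have "esym I (card I - k) l = prod l I * esym I k (\<lambda>i. 1 / l i)"
    by (simp add: esym_def sum_distrib_left)
  moreover have "prod l I > 0" using assms by (intro prod_pos) auto
  ultimately show ?thesis by simp
qed

lemma FQ_inverse:
  assumes "finite I" "\<And>i. i \<in> I \<Longrightarrow> l i > 0" "b < a" "a \<le> card I"
  shows "FQ I a b (\<lambda>i. 1 / l i) = 1 / FQ I (card I - b) (card I - a) l"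
proof -
  have "prod l I > 0" using assms by (intro prod_pos) auto
  moreover have "esym I (card I - b) l > 0" "esym I (card I - a) l > 0" using assms by (auto intro!: esym_pos)
  moreover have "card I - b - (card I - a) = a - b" using assms by auto
  ultimately show ?thesis unfolding FQ_def using assms
    by (simp add: esym_inverse powr_divide less_imp_neq[symmetric])
qed

section \<open>Symmetric bilinear forms\<close>

definition symform :: "('a::euclidean_space \<Rightarrow> 'a \<Rightarrow> real) \<Rightarrow> bool" where
  "symform A \<longleftrightarrow> bilinear A \<and> (\<forall>v w. A v w = A w v)"

text \<open>Orthonormal bases are indexed by the standard basis, so that the eigenvalues of a form can be
  inserted into \<open>esym Basis\<close> without choosing an enumeration.\<close>

definition onb :: "('a::euclidean_space \<Rightarrow> 'a) \<Rightarrow> bool" where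
  "onb e \<longleftrightarrow> (\<forall>b\<in>Basis. \<forall>c\<in>Basis. e b \<bullet> e c = (if b = c then 1 else 0))"

definition eigf :: "('a::euclidean_space \<Rightarrow> 'a \<Rightarrow> real) \<Rightarrow> ('a \<Rightarrow> 'a) \<Rightarrow> ('a \<Rightarrow> real) \<Rightarrow> bool" where
  "eigf A e l \<longleftrightarrow> onb e \<and> (\<forall>b\<in>Basis. \<forall>w. A (e b) w = l b * (e b \<bullet> w))"

lemma symform_bilinear: "symform A \<Longrightarrow> bilinear A" by (simp add: symform_def)
lemma symform_sym: "symform A \<Longrightarrow> A v w = A w v" by (simp add: symform_def)

lemma symform_bb: "symform A \<Longrightarrow> bounded_bilinear A"
  by (simp add: symform_def bilinear_conv_bounded_bilinear)

lemma symform_add_left: "symform A \<Longrightarrow> A (u + v) w = A u w + A v w"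
  by (simp add: symform_bilinear bilinear_ladd)
lemma symform_add_right: "symform A \<Longrightarrow> A w (u + v) = A w u + A w v"
  by (simp add: symform_bilinear bilinear_radd)
lemma symform_scale_left: "symform A \<Longrightarrow> A (c *\<^sub>R v) w = c * A v w"
  by (simp add: symform_bilinear bilinear_lmul)
lemma symform_scale_right: "symform A \<Longrightarrow> A v (c *\<^sub>R w) = c * A v w"
  by (simp add: symform_bilinear bilinear_rmul)
lemma symform_sum_left: "symform A \<Longrightarrow> A (sum g I) w = (\<Sum>i\<in>I. A (g i) w)"
  using linear_sum[of "\<lambda>x. A x w" g I] by (simp add: symform_def bilinear_def)
lemma symform_sum_right: "symform A \<Longrightarrow> A w (sum g I) = (\<Sum>i\<in>I. A w (g i))"
  using linear_sum[of "\<lambda>x. A w x" g I] by (simp add: symform_def bilinear_def)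

lemmas symform_simps = symform_add_left symform_add_right symform_scale_left symform_scale_right

lemma symformI:
  assumes "\<And>u v w. A (u + v) w = A u w + A v w" "\<And>c v w. A (c *\<^sub>R v) w = c * A v w"
    "\<And>v w. A v w = A w v"
  shows "symform A"
proof -
  have "A w (u + v) = A w u + A w v" "A w (c *\<^sub>R v) = c * A w v" for c u v w
    using assms(1)[of u v w] assms(2)[of c v w] assms(3)[of w "u+v"] assms(3)[of w u] assms(3)[of w v] assms(3)[of w "c *\<^sub>R v"] by auto
  then show ?thesis unfolding symform_def bilinear_def using assms by (auto intro!: linearI)
qed

lemma symform_inner: "symform (\<lambda>v w. v \<bullet> w)"
  by (rule symformI) (auto simp: inner_simps inner_commute)
lemma symform_sq: "symform (\<lambda>v w. (u \<bullet> v) * (u \<bullet> w))"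
  by (rule symformI) (auto simp: inner_simps algebra_simps)
lemma symform_add: "symform A \<Longrightarrow> symform B \<Longrightarrow> symform (\<lambda>v w. A v w + B v w)"
  by (rule symformI) (auto simp: symform_simps algebra_simps symform_sym)
lemma symform_cmult: "symform A \<Longrightarrow> symform (\<lambda>v w. c * A v w)"
  by (rule symformI) (auto simp: symform_simps algebra_simps symform_sym)
lemma symform_diff: "symform A \<Longrightarrow> symform B \<Longrightarrow> symform (\<lambda>v w. A v w - B v w)"
  by (rule symformI) (auto simp: symform_simps algebra_simps symform_sym)

lemma quad_lin_zero:
  fixes x C :: real assumes "\<And>t. t * x \<le> t^2 * C" shows "x = 0"
proof (rule ccontr)
  assume x: "x \<noteq> 0"
  define K where "K = \<bar>C\<bar> + 1"
  have K: "K > 0" "C < K" by (auto simp: K_def)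
  have "(x / K) * x \<le> (x / K)^2 * C" by (rule assms)
  then have "x^2 * K \<le> x^2 * C" using K by (simp add: field_simps power2_eq_square)
  then show False using x K by simp
qed

text \<open>The quadratic form is maximised on the unit sphere of the subspace. By the first variation the
  maximiser is an eigenvector, and the induction continues on its orthogonal complement in the subspace.\<close>

theorem spectral_subspace:
  fixes A :: "'a::euclidean_space \<Rightarrow> 'a \<Rightarrow> real"
  assumes "symform A" "subspace S"
  shows "\<exists>B. finite B \<and> B \<subseteq> S \<and> card B = dim S \<and> (\<forall>b\<in>B. \<forall>c\<in>B. b \<bullet> c = (if b = c then 1 else 0)) \<and>
     (\<forall>b\<in>B. \<forall>w\<in>S. A b w = A b b * (b \<bullet> w))"
  using assms(2)
proof (induction "dim S" arbitrary: S)
  case 0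
  show ?case by (rule exI[of _ "{}"]) (use 0 in auto)
next
  case (Suc n)
  let ?K = "S \<inter> sphere 0 1"
  have "\<not> S \<subseteq> {0}" using Suc(2) by (metis dim_eq_0 nat.distinct(1))
  then obtain x where x: "x \<in> S" "x \<noteq> 0" by auto
  then have "x /\<^sub>R norm x \<in> ?K" using Suc.prems by (simp add: subspace_scale)
  then have ne: "?K \<noteq> {}" by blast
  have comp: "compact ?K"
    using closed_subspace[OF Suc.prems] by (intro closed_Int_compact) auto
  have cont: "continuous_on ?K (\<lambda>w. A w w)"
    by (rule bounded_bilinear.continuous_on[OF symform_bb[OF assms(1)] continuous_on_id continuous_on_id])
  obtain v where v: "v \<in> ?K" "\<And>w. w \<in> ?K \<Longrightarrow> A w w \<le> A v v"
    using continuous_attains_sup[OF comp ne cont] by blast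
  have vS: "v \<in> S" and nv: "norm v = 1" using v by auto
  have vv: "v \<bullet> v = 1" using nv by (simp add: norm_eq_1)
  have max: "A w w \<le> A v v * (norm w)^2" if "w \<in> S" for w
  proof (cases "w = 0")
    case True then show ?thesis using assms(1) symform_scale_left[OF assms(1), of 0 0 0] by simp
  next
    case False
    have "A (w /\<^sub>R norm w) (w /\<^sub>R norm w) \<le> A v v"
      using False that Suc.prems by (intro v(2)) (simp add: subspace_scale)
    then show ?thesis using False by (simp add: symform_simps[OF assms(1)] field_simps power2_eq_square)
  qed
  have orth: "A v w = 0" if w: "w \<in> S" "v \<bullet> w = 0" for w
  proof (rule quad_lin_zero[of _ "A v v * (norm w)^2 / 2 - A w w / 2"])
    fix t :: real
    have "(norm (v + t *\<^sub>R w))^2 = 1 + t^2 * (norm w)^2"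
      using w vv unfolding power2_norm_eq_inner by (simp add: inner_simps inner_commute power2_eq_square)
    moreover have "v + t *\<^sub>R w \<in> S" using w vS Suc.prems by (simp add: subspace_add subspace_scale)
    moreover have "A (v + t *\<^sub>R w) (v + t *\<^sub>R w) = A v v + 2 * t * A v w + t^2 * A w w"
      using symform_sym[OF assms(1), of w v] by (simp add: symform_simps[OF assms(1)] algebra_simps power2_eq_square)
    ultimately have "A v v + 2 * t * A v w + t^2 * A w w \<le> A v v * (1 + t^2 * (norm w)^2)" using max by metis
    then show "t * A v w \<le> t^2 * (A v v * (norm w)^2 / 2 - A w w / 2)" by (simp add: algebra_simps)
  qed
  define S' where "S' = {y \<in> S. \<forall>x\<in>span {v}. orthogonal x y}"
  have S'iff: "y \<in> S' \<longleftrightarrow> y \<in> S \<and> v \<bullet> y = 0" for y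
    unfolding S'_def by (auto simp: orthogonal_def span_singleton inner_simps)
  have subS': "subspace S'"
    unfolding subspace_def using Suc.prems by (auto simp: S'iff inner_simps subspace_add subspace_scale subspace_0)
  have "span {v} \<subseteq> S" using vS Suc.prems by (simp add: span_minimal)
  then have "dim S' + dim (span {v}) = dim S"
    unfolding S'_def by (intro dim_subspace_orthogonal_to_vectors subspace_span Suc.prems)
  moreover have "dim (span {v}) = 1" using nv dim_singleton[of v] by auto
  ultimately have dS': "n = dim S'" using Suc(2) by simp
  obtain B where B: "finite B" "B \<subseteq> S'" "card B = dim S'"
    "\<forall>b\<in>B. \<forall>c\<in>B. b \<bullet> c = (if b = c then 1 else 0)" "\<forall>b\<in>B. \<forall>w\<in>S'. A b w = A b b * (b \<bullet> w)"
    using Suc(1)[OF dS' subS'] by blast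
  have vB: "v \<notin> B" using B(2) vv S'iff by auto
  have Bv: "b \<in> S" "v \<bullet> b = 0" "b \<bullet> v = 0" if "b \<in> B" for b using B(2) that S'iff by (auto simp: inner_commute)
  have decomp: "w - (v \<bullet> w) *\<^sub>R v \<in> S'" if "w \<in> S" for w
    using that vS Suc.prems vv by (simp add: S'iff inner_simps subspace_diff subspace_scale)
  have eqv: "A v w = A v v * (v \<bullet> w)" if "w \<in> S" for w
  proof -
    have "A v (w - (v \<bullet> w) *\<^sub>R v) = 0" using decomp[OF that] S'iff orth by blast
    moreover have "A v w = A v ((w - (v \<bullet> w) *\<^sub>R v) + (v \<bullet> w) *\<^sub>R v)" by simp
    ultimately show ?thesis unfolding symform_add_right[OF assms(1)] symform_scale_right[OF assms(1)] by simp
  qed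
  have eqb: "A b w = A b b * (b \<bullet> w)" if "b \<in> B" "w \<in> S" for b w
  proof -
    have "A b (w - (v \<bullet> w) *\<^sub>R v) = A b b * (b \<bullet> (w - (v \<bullet> w) *\<^sub>R v))" using decomp[OF that(2)] B(5) that by blast
    moreover have "A b v = 0" using orth[OF Bv(1,2)[OF that(1)]] symform_sym[OF assms(1)] by metis
    moreover have "A b w = A b ((w - (v \<bullet> w) *\<^sub>R v) + (v \<bullet> w) *\<^sub>R v)" by simp
    ultimately show ?thesis unfolding symform_add_right[OF assms(1)] symform_scale_right[OF assms(1)]
      using Bv(3)[OF that(1)] by (simp add: inner_simps)
  qed
  show ?case
  proof (intro exI[of _ "insert v B"] conjI)
    show "card (insert v B) = dim S" using vB B(1,3) dS' Suc(2) by simp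
    show "\<forall>b\<in>insert v B. \<forall>c\<in>insert v B. b \<bullet> c = (if b = c then 1 else 0)"
      using B(4) Bv vv vB by auto
    show "\<forall>b\<in>insert v B. \<forall>w\<in>S. A b w = A b b * (b \<bullet> w)" using eqv eqb by blast
  qed (use B(1) Bv vS in auto)
qed

lemma onb_expand:
  fixes w :: "'a::euclidean_space"
  assumes "onb e" shows "w = (\<Sum>b\<in>Basis. (w \<bullet> e b) *\<^sub>R e b)"
proof -
  have o: "e b \<bullet> e c = (if b = c then 1 else 0)" if "b \<in> Basis" "c \<in> Basis" for b c
    using assms that by (simp add: onb_def)
  have inj: "inj_on e Basis" using o by (intro inj_onI) (metis zero_neq_one)
  have "pairwise orthogonal (e ` Basis)" using o by (auto simp: pairwise_def orthogonal_def)
  moreover have "0 \<notin> e ` Basis" using o by (metis imageE inner_zero_left zero_neq_one)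
  ultimately have ind: "independent (e ` Basis)" by (rule pairwise_orthogonal_independent)
  have "UNIV \<subseteq> span (e ` Basis)"
    using inj by (intro card_ge_dim_independent[OF _ ind]) (auto simp: card_image)
  then have sp: "span (e ` Basis) = UNIV" by auto
  let ?r = "w - (\<Sum>b\<in>Basis. (w \<bullet> e b) *\<^sub>R e b)"
  have "orthogonal ?r x" if "x \<in> e ` Basis" for x
  proof -
    obtain c where c: "c \<in> Basis" "x = e c" using \<open>x \<in> e ` Basis\<close> by blast
    have "(\<Sum>b\<in>Basis. (w \<bullet> e b) * (e b \<bullet> e c)) = (\<Sum>b\<in>Basis. if b = c then w \<bullet> e c else 0)"
      using o c by (intro sum.cong) auto
    then show ?thesis using c by (simp add: orthogonal_def inner_simps inner_sum_left)
  qed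
  then have "orthogonal ?r ?r" using orthogonal_to_span[of ?r "e ` Basis" ?r] sp by auto
  then show ?thesis by (simp add: orthogonal_self)
qed

lemma onb_inner: "onb e \<Longrightarrow> v \<bullet> w = (\<Sum>b\<in>Basis. (v \<bullet> e b) * (w \<bullet> e b))" for v w :: "'a::euclidean_space"
  by (subst onb_expand[of e w]) (auto simp: inner_sum_right mult.commute)

lemma onb_norm: "onb e \<Longrightarrow> (norm w)^2 = (\<Sum>b\<in>Basis. (w \<bullet> e b)^2)" for w :: "'a::euclidean_space"
  unfolding power2_norm_eq_inner by (subst onb_inner[of e w w]) (simp_all add: power2_eq_square)

lemma eigf_exists:
  fixes A :: "'a::euclidean_space \<Rightarrow> 'a \<Rightarrow> real"
  assumes "symform A" shows "\<exists>e l. eigf A e l"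
proof -
  obtain B where B: "finite B" "card B = DIM('a)"
    "\<forall>b\<in>B. \<forall>c\<in>B. b \<bullet> c = (if b = c then 1 else 0)" "\<forall>b\<in>B. \<forall>w. A b w = A b b * (b \<bullet> w)"
    using spectral_subspace[OF assms subspace_UNIV] by auto
  obtain e where e: "bij_betw e (Basis :: 'a set) B"
    using finite_same_card_bij[of "Basis :: 'a set" B] B by auto
  then have eB: "e b \<in> B" if "b \<in> Basis" for b using that by (auto simp: bij_betw_def)
  have "onb e" unfolding onb_def using B(3) eB e by (metis bij_betw_def inj_onD)
  then have "eigf A e (\<lambda>b. A (e b) (e b))" unfolding eigf_def using B(4) eB by blast
  then show ?thesis by blast
qed

lemma eigf_form:
  assumes "symform A" "eigf A e l"
  shows "A v w = (\<Sum>b\<in>Basis. l b * (e b \<bullet> v) * (e b \<bullet> w))"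
proof -
  have "A v w = A (\<Sum>b\<in>Basis. (v \<bullet> e b) *\<^sub>R e b) w"
    using onb_expand[of e v] assms(2) by (simp add: eigf_def)
  also have "\<dots> = (\<Sum>b\<in>Basis. (v \<bullet> e b) * A (e b) w)"
    by (simp add: symform_sum_left[OF assms(1)] symform_scale_left[OF assms(1)])
  also have "\<dots> = (\<Sum>b\<in>Basis. l b * (e b \<bullet> v) * (e b \<bullet> w))"
    using assms(2) by (intro sum.cong refl) (auto simp: eigf_def inner_commute)
  finally show ?thesis .
qed

subsection \<open>Traces and elementary symmetric functions of a form\<close>

text \<open>The powers of the matrix of \<open>A\<close> in the standard basis, as bilinear forms.\<close>

fun mpow :: "('a::euclidean_space \<Rightarrow> 'a \<Rightarrow> real) \<Rightarrow> nat \<Rightarrow> 'a \<Rightarrow> 'a \<Rightarrow> real" where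
  "mpow A 0 v w = v \<bullet> w"
| "mpow A (Suc j) v w = (\<Sum>d\<in>Basis. A v d * mpow A j d w)"

definition ptr :: "('a::euclidean_space \<Rightarrow> 'a \<Rightarrow> real) \<Rightarrow> nat \<Rightarrow> real" where
  "ptr A j = (\<Sum>b\<in>Basis. mpow A j b b)"

text \<open>The elementary symmetric functions of the eigenvalues, defined from the power traces by Newton's
  identities. In this way they are visibly polynomials in the entries of the form, hence smooth functions
  of the form, without reference to eigenvectors.\<close>

fun msig :: "('a::euclidean_space \<Rightarrow> 'a \<Rightarrow> real) \<Rightarrow> nat \<Rightarrow> real" where
  "msig A 0 = 1"
| "msig A (Suc k) = (\<Sum>i\<le>k. (-1)^i * ptr A (Suc i) * msig A (k - i)) / real (Suc k)"

declare msig.simps(2) [simp del]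

lemma mpow_eigf:
  assumes "symform A" "eigf A e l"
  shows "mpow A j v w = (\<Sum>b\<in>Basis. l b ^ j * (e b \<bullet> v) * (e b \<bullet> w))"
proof (induction j arbitrary: v w)
  case 0
  have "onb e" using assms by (simp add: eigf_def)
  from onb_inner[OF this, of v w] show ?case by (simp add: inner_commute)
next
  case (Suc j)
  have o: "e b \<bullet> e c = (if b = c then 1 else 0)" if "b \<in> Basis" "c \<in> Basis" for b c
    using assms that by (simp add: onb_def eigf_def)
  have "mpow A (Suc j) v w = (\<Sum>d\<in>Basis. A v d * mpow A j d w)" by simp
  also have "\<dots>
    = (\<Sum>d\<in>Basis. (\<Sum>b\<in>Basis. l b * (e b \<bullet> v) * (e b \<bullet> d)) * (\<Sum>c\<in>Basis. l c ^ j * (e c \<bullet> d) * (e c \<bullet> w)))"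
    by (intro sum.cong refl arg_cong2[where f="(*)"] eigf_form[OF assms] Suc)
  also have "\<dots> = (\<Sum>d\<in>Basis. \<Sum>b\<in>Basis. \<Sum>c\<in>Basis. (l b * (e b \<bullet> v)) * (l c ^ j * (e c \<bullet> w)) * ((e b \<bullet> d) * (e c \<bullet> d)))"
    by (simp add: sum_product algebra_simps)
  also have "\<dots> = (\<Sum>b\<in>Basis. \<Sum>c\<in>Basis. \<Sum>d\<in>Basis. (l b * (e b \<bullet> v)) * (l c ^ j * (e c \<bullet> w)) * ((e b \<bullet> d) * (e c \<bullet> d)))"
    by (subst sum.swap) (intro sum.cong refl sum.swap)
  also have "\<dots> = (\<Sum>b\<in>Basis. \<Sum>c\<in>Basis. (l b * (e b \<bullet> v)) * (l c ^ j * (e c \<bullet> w)) * (e b \<bullet> e c))"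
    by (simp add: sum_distrib_left[symmetric] euclidean_inner[symmetric])
  also have "\<dots> = (\<Sum>b\<in>Basis. \<Sum>c\<in>Basis. if c = b then (l b * (e b \<bullet> v)) * (l b ^ j * (e b \<bullet> w)) else 0)"
    by (intro sum.cong refl) (simp add: o)
  also have "\<dots> = (\<Sum>b\<in>Basis. l b ^ Suc j * (e b \<bullet> v) * (e b \<bullet> w))"
    by (simp add: algebra_simps)
  finally show ?case .
qed

lemma ptr_eigf:
  assumes "symform A" "eigf A e l"
  shows "ptr A j = (\<Sum>b\<in>Basis. l b ^ j)"
proof -
  have o: "e b \<bullet> e b = 1" if "b \<in> Basis" for b
    using assms that by (simp add: onb_def eigf_def)
  have "ptr A j = (\<Sum>b\<in>Basis. \<Sum>d\<in>Basis. l b ^ j * ((e b \<bullet> d) * (e b \<bullet> d)))"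
    unfolding ptr_def mpow_eigf[OF assms] by (subst sum.swap) (simp add: mult.assoc)
  also have "\<dots> = (\<Sum>b\<in>Basis. l b ^ j * (e b \<bullet> e b))"
    by (simp add: sum_distrib_left[symmetric] euclidean_inner[symmetric])
  finally show ?thesis using o by simp
qed

text \<open>For each \<open>m\<close>, \<open>esym (I - {m}) k\<close> is expanded by repeated use of \<open>esym_remove\<close>; multiplying by \<open>l m\<close> and
  summing over \<open>m\<close> gives \<open>esym_double_sum\<close> on the left and power sums on the right.\<close>

lemma newton_identity:
  assumes "finite I"
  shows "real (Suc k) * esym I (Suc k) l = (\<Sum>i\<le>k. (-1)^i * (\<Sum>m\<in>I. l m ^ Suc i) * esym I (k - i) l)"
proof -
  have T: "(\<Sum>m\<in>I. l m ^ Suc j * esym (I - {m}) k l)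
      = (\<Sum>i\<le>k. (-1)^i * (\<Sum>m\<in>I. l m ^ Suc (j + i)) * esym I (k - i) l)" for j
  proof (induction k arbitrary: j)
    case 0 then show ?case using assms by simp
  next
    case (Suc k)
    have "(\<Sum>m\<in>I. l m ^ Suc j * esym (I - {m}) (Suc k) l)
      = (\<Sum>m\<in>I. l m ^ Suc j * (esym I (Suc k) l - l m * esym (I - {m}) k l))"
      using esym_remove[OF assms, of _ k l] by (intro sum.cong refl) (simp add: algebra_simps)
    also have "\<dots> = (\<Sum>m\<in>I. l m ^ Suc j) * esym I (Suc k) l - (\<Sum>m\<in>I. l m ^ Suc (Suc j) * esym (I - {m}) k l)"
      by (simp add: right_diff_distrib sum_subtractf sum_distrib_right mult.assoc mult.left_commute)
    also have "\<dots> = (\<Sum>i\<le>Suc k. (-1)^i * (\<Sum>m\<in>I. l m ^ Suc (j + i)) * esym I (Suc k - i) l)"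
      unfolding Suc.IH by (subst sum.atMost_Suc_shift) (simp add: sum_negf)
    finally show ?case .
  qed
  show ?thesis using T[of 0] esym_double_sum[OF assms, of l k] by simp
qed

lemma msig_eigf:
  assumes "symform A" "eigf A e l"
  shows "msig A k = esym Basis k l"
proof (induction k rule: less_induct)
  case (less k)
  show ?case
  proof (cases k)
    case (Suc j)
    have "(\<Sum>i\<le>j. (-1)^i * ptr A (Suc i) * msig A (j - i)) = (\<Sum>i\<le>j. (-1)^i * (\<Sum>m\<in>Basis. l m ^ Suc i) * esym Basis (j - i) l)"
      using less Suc ptr_eigf[OF assms] by (intro sum.cong refl) auto
    then show ?thesis using newton_identity[of "Basis :: 'a set" j l] Suc
      by (simp add: msig.simps field_simps)
  qed auto
qed

text \<open>The Garding cone of forms, and the quotient \<open>F\<close> on it.\<close>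

definition MG :: "nat \<Rightarrow> ('a::euclidean_space \<Rightarrow> 'a \<Rightarrow> real) set" where
  "MG a = {A. \<forall>j\<in>{1..a}. msig A j > 0}"

definition MF :: "nat \<Rightarrow> nat \<Rightarrow> ('a::euclidean_space \<Rightarrow> 'a \<Rightarrow> real) \<Rightarrow> real" where
  "MF a b A = (msig A a / msig A b) powr (1 / real (a - b))"

lemma MG_eigf: "symform A \<Longrightarrow> eigf A e l \<Longrightarrow> A \<in> MG a \<longleftrightarrow> l \<in> gcone Basis a"
  by (simp add: MG_def gcone_def msig_eigf)

lemma MF_eigf: "symform A \<Longrightarrow> eigf A e l \<Longrightarrow> MF a b A = FQ Basis a b l"
  by (simp add: MF_def FQ_def msig_eigf)

subsection \<open>Rado's theorem and diagonals of forms\<close>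

text \<open>A discrete integral of \<open>c\<close> with respect to \<open>l\<close>: the index with the largest values is removed, and the
  potential is continued from the largest of the remaining ones.\<close>

lemma similar_order_potential:
  fixes c l :: "'i \<Rightarrow> real"
  assumes "finite I" "\<And>i j. i \<in> I \<Longrightarrow> j \<in> I \<Longrightarrow> (c i - c j) * (l i - l j) \<ge> 0"
  shows "\<exists>w. \<forall>i\<in>I. \<forall>j\<in>I. w j - w i \<ge> c i * (l j - l i)"
  using assms
proof (induction "card I" arbitrary: I)
  case 0 then show ?case by auto
next
  case (Suc n)
  have top: "\<exists>m\<in>J. \<forall>i\<in>J. l i \<le> l m \<and> c i \<le> c m" if J: "J \<subseteq> I" "J \<noteq> {}" for J
  proof -
    have fJ: "finite J" using J Suc.prems(1) finite_subset by blast
    obtain m where m: "m \<in> J" "\<And>i. i \<in> J \<Longrightarrow> l i + c i \<le> l m + c m"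
    proof -
      have "Max ((\<lambda>i. l i + c i) ` J) \<in> (\<lambda>i. l i + c i) ` J" using fJ J(2) by (intro Max_in) auto
      then obtain m where "m \<in> J" "l m + c m = Max ((\<lambda>i. l i + c i) ` J)" by auto
      then show ?thesis using that[of m] fJ Max_ge[of "(\<lambda>i. l i + c i) ` J"] by auto
    qed
    have "l i \<le> l m \<and> c i \<le> c m" if i: "i \<in> J" for i
    proof -
      have "(c i - c m) * (l i - l m) \<ge> 0" using Suc.prems(2) i m(1) J by auto
      then show ?thesis using m(2)[OF i] by (auto simp: zero_le_mult_iff)
    qed
    then show ?thesis using m(1) by blast
  qed
  have Ine: "I \<noteq> {}" using Suc(2) by auto
  obtain m where m: "m \<in> I" "\<And>i. i \<in> I \<Longrightarrow> l i \<le> l m \<and> c i \<le> c m" using top[of I] Ine by auto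
  let ?J = "I - {m}"
  show ?case
  proof (cases "?J = {}")
    case True
    then have "I = {m}" using m by auto
    then show ?thesis by (intro exI[of _ "\<lambda>_. 0"]) auto
  next
    case False
    obtain t where t: "t \<in> ?J" "\<And>i. i \<in> ?J \<Longrightarrow> l i \<le> l t \<and> c i \<le> c t" using top[of ?J] False by auto
    have "n = card ?J" using Suc(2) m Suc.prems(1) by simp
    then obtain w where w: "\<And>i j. i \<in> ?J \<Longrightarrow> j \<in> ?J \<Longrightarrow> w j - w i \<ge> c i * (l j - l i)"
      using Suc(1)[of ?J] Suc.prems by (auto simp: Ball_def) blast
    define w' where "w' = w(m := w t + c t * (l m - l t))"
    have "w' j - w' i \<ge> c i * (l j - l i)" if ij: "i \<in> I" "j \<in> I" for i j
    proof -
      consider "i = m" "j = m" | "i = m" "j \<in> ?J" | "i \<in> ?J" "j = m" | "i \<in> ?J" "j \<in> ?J" using ij by auto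
      then show ?thesis
      proof cases
        case 2
        have "w j - w t \<ge> c t * (l j - l t)" using w t(1) 2 by auto
        moreover have "(c m - c t) * (l m - l j) \<ge> 0" using m t(1) ij by (intro mult_nonneg_nonneg) auto
        ultimately show ?thesis using 2 by (simp add: w'_def algebra_simps)
      next
        case 3
        have "w t - w i \<ge> c i * (l t - l i)" using w t(1) 3 by auto
        moreover have "(c t - c i) * (l m - l t) \<ge> 0" using m t 3 by (intro mult_nonneg_nonneg) auto
        ultimately show ?thesis using 3 by (simp add: w'_def algebra_simps)
      qed (use w in \<open>auto simp: w'_def\<close>)
    qed
    then show ?thesis by blast
  qed
qed

text \<open>A linear function on doubly stochastic matrices is maximal at a permutation. For a best permutation \<open>p\<close>
  no transposition improves the sum, so \<open>c\<close> and \<open>l \<circ> p\<close> are ordered alike and have a potential \<open>w\<close>. The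
  terms in \<open>w\<close> cancel because the row and column sums are equal.\<close>

lemma doubly_stochastic_le_perm:
  fixes c l :: "'i \<Rightarrow> real" and S :: "'i \<Rightarrow> 'i \<Rightarrow> real"
  assumes I: "finite I" and S: "\<And>i j. i \<in> I \<Longrightarrow> j \<in> I \<Longrightarrow> S i j \<ge> 0"
    and row: "\<And>i. i \<in> I \<Longrightarrow> (\<Sum>j\<in>I. S i j) = 1" and col: "\<And>j. j \<in> I \<Longrightarrow> (\<Sum>i\<in>I. S i j) = 1"
  shows "\<exists>p. p permutes I \<and> (\<Sum>i\<in>I. c i * (\<Sum>j\<in>I. S i j * l j)) \<le> (\<Sum>i\<in>I. c i * l (p i))"
proof -
  let ?v = "\<lambda>p. \<Sum>i\<in>I. c i * l (p i)"
  let ?P = "{p. p permutes I}"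
  have fP: "finite ?P" using finite_permutations[OF I] .
  have neP: "?P \<noteq> {}" using permutes_id by blast
  obtain p where p: "p permutes I" "\<And>q. q permutes I \<Longrightarrow> ?v q \<le> ?v p"
  proof -
    have "Max (?v ` ?P) \<in> ?v ` ?P" using fP neP by (intro Max_in) auto
    then obtain p where "p permutes I" "?v p = Max (?v ` ?P)" by auto
    then show ?thesis using that[of p] fP Max_ge[of "?v ` ?P"] by auto
  qed
  define l' where "l' = (\<lambda>i. l (p i))"
  have ord: "(c i - c j) * (l' i - l' j) \<ge> 0" if ij: "i \<in> I" "j \<in> I" for i j
  proof (cases "i = j")
    case False
    let ?t = "Transposition.transpose i j"
    have "p \<circ> ?t permutes I" using p(1) ij by (intro permutes_compose permutes_swap_id)
    then have "(\<Sum>k\<in>I. c k * l' (?t k)) \<le> (\<Sum>k\<in>I. c k * l' k)" using p(2) unfolding l'_def by fastforce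
    then have "0 \<le> (\<Sum>k\<in>I. c k * (l' k - l' (?t k)))" by (simp add: algebra_simps sum_subtractf)
    also have "\<dots> = (\<Sum>k\<in>{i,j}. c k * (l' k - l' (?t k)))"
      using I ij by (intro sum.mono_neutral_right) (auto simp: Transposition.transpose_def)
    also have "\<dots> = (c i - c j) * (l' i - l' j)" using False by (simp add: algebra_simps)
    finally show ?thesis .
  qed auto
  obtain w where w: "\<And>i j. i \<in> I \<Longrightarrow> j \<in> I \<Longrightarrow> w j - w i \<ge> c i * (l' j - l' i)"
    using similar_order_potential[of I c l', OF I ord] by blast
  have bij: "bij_betw p I I" using p(1) permutes_imp_bij by blast
  have re: "(\<Sum>j\<in>I. g (p j)) = (\<Sum>j\<in>I. g j)" for g :: "'i \<Rightarrow> real" using sum.reindex_bij_betw[OF bij] .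
  have pI: "p j \<in> I" if "j \<in> I" for j using that p(1) permutes_in_image by metis
  have "(\<Sum>i\<in>I. c i * (\<Sum>j\<in>I. S i j * l j)) = (\<Sum>i\<in>I. \<Sum>j\<in>I. S i (p j) * (c i * l' j))"
    unfolding l'_def re[of "\<lambda>j. S i j * l j" for i, symmetric] by (simp add: sum_distrib_left algebra_simps)
  also have "\<dots> \<le> (\<Sum>i\<in>I. \<Sum>j\<in>I. S i (p j) * (c i * l' i - w i + w j))"
  proof (intro sum_mono mult_left_mono)
    fix i j assume "i \<in> I" "j \<in> I"
    then show "c i * l' j \<le> c i * l' i - w i + w j" using w[of i j] by (simp add: algebra_simps)
  qed (use S pI in auto)
  also have "\<dots> = (\<Sum>i\<in>I. \<Sum>j\<in>I. S i (p j) * (c i * l' i - w i)) + (\<Sum>i\<in>I. \<Sum>j\<in>I. S i (p j) * w j)"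
    by (simp only: distrib_left sum.distrib)
  also have "(\<Sum>i\<in>I. \<Sum>j\<in>I. S i (p j) * (c i * l' i - w i)) = (\<Sum>i\<in>I. c i * l' i - w i)"
    using row by (simp add: sum_distrib_right[symmetric] re)
  also have "(\<Sum>i\<in>I. \<Sum>j\<in>I. S i (p j) * w j) = (\<Sum>j\<in>I. w j)"
    using col pI by (subst sum.swap) (simp add: sum_distrib_right[symmetric])
  finally have "(\<Sum>i\<in>I. c i * (\<Sum>j\<in>I. S i j * l j)) \<le> (\<Sum>i\<in>I. c i * l (p i))"
    by (simp add: sum_subtractf l'_def)
  then show ?thesis using p(1) by blast
qed

definition vec_of :: "('a::euclidean_space \<Rightarrow> real) \<Rightarrow> 'a" where
  "vec_of d = (\<Sum>b\<in>Basis. d b *\<^sub>R b)"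

lemma vec_of_inner [simp]: "b \<in> Basis \<Longrightarrow> vec_of d \<bullet> b = d b"
  by (simp add: vec_of_def inner_sum_left_Basis)

lemma inner_vec_of: "c \<bullet> vec_of d = (\<Sum>b\<in>Basis. (c \<bullet> b) * d b)"
  by (simp add: vec_of_def inner_sum_right mult.commute)

text \<open>A point outside the hull could be separated from it by a hyperplane, against
  \<open>doubly_stochastic_le_perm\<close>.\<close>

lemma rado:
  fixes l :: "'a::euclidean_space \<Rightarrow> real"
  assumes S: "\<And>i j. i \<in> Basis \<Longrightarrow> j \<in> Basis \<Longrightarrow> S i j \<ge> 0"
    and row: "\<And>i. i \<in> Basis \<Longrightarrow> (\<Sum>j\<in>Basis. S i j) = 1" and col: "\<And>j. j \<in> Basis \<Longrightarrow> (\<Sum>i\<in>Basis. S i j) = 1"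
  shows "vec_of (\<lambda>i. \<Sum>j\<in>Basis. S i j * l j) \<in> convex hull ((\<lambda>p. vec_of (\<lambda>i. l (p i))) ` {p. p permutes Basis})"
proof (rule ccontr)
  let ?H = "convex hull ((\<lambda>p. vec_of (\<lambda>i. l (p i))) ` {p. p permutes (Basis :: 'a set)})"
  let ?d = "vec_of (\<lambda>i. \<Sum>j\<in>Basis. S i j * l j)"
  assume "\<not> ?d \<in> ?H"
  moreover have "finite ((\<lambda>p. vec_of (\<lambda>i. l (p i))) ` {p. p permutes (Basis :: 'a set)})"
    by (intro finite_imageI finite_permutations) auto
  then have "closed ?H" by (intro compact_imp_closed finite_imp_compact_convex_hull)
  ultimately obtain a b where ab: "a \<bullet> ?d < b" "\<And>x. x \<in> ?H \<Longrightarrow> a \<bullet> x > b"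
    using separating_hyperplane_closed_point[of ?H ?d] convex_convex_hull by blast
  obtain p where p: "p permutes (Basis :: 'a set)"
    "(\<Sum>i\<in>Basis. - (a \<bullet> i) * (\<Sum>j\<in>Basis. S i j * l j)) \<le> (\<Sum>i\<in>Basis. - (a \<bullet> i) * l (p i))"
    using doubly_stochastic_le_perm[of "Basis :: 'a set" S "\<lambda>i. - (a \<bullet> i)" l] assms by auto
  have "vec_of (\<lambda>i. l (p i)) \<in> ?H" using p(1) by (intro hull_inc) auto
  then have "a \<bullet> vec_of (\<lambda>i. l (p i)) > b" using ab by blast
  then show False using p(2) ab(1) by (simp add: inner_vec_of sum_negf)
qed

lemma superlevel_convex:
  fixes c :: real assumes "b < a"
  shows "convex {x::'a::euclidean_space. (\<lambda>i. x \<bullet> i) \<in> gcone Basis a \<and> c \<le> FQ Basis a b (\<lambda>i. x \<bullet> i)}"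
proof (rule convexI)
  fix x y :: 'a and u v :: real
  assume x: "x \<in> {x. (\<lambda>i. x \<bullet> i) \<in> gcone Basis a \<and> c \<le> FQ Basis a b (\<lambda>i. x \<bullet> i)}"
    and y: "y \<in> {x. (\<lambda>i. x \<bullet> i) \<in> gcone Basis a \<and> c \<le> FQ Basis a b (\<lambda>i. x \<bullet> i)}"
    and uv: "0 \<le> u" "0 \<le> v" "u + v = 1"
  show "u *\<^sub>R x + v *\<^sub>R y \<in> {x. (\<lambda>i. x \<bullet> i) \<in> gcone Basis a \<and> c \<le> FQ Basis a b (\<lambda>i. x \<bullet> i)}"
  proof (cases "u = 0 \<or> v = 0")
    case True then show ?thesis using x y uv by auto
  next
    case False
    then have uv': "u > 0" "v > 0" using uv by auto
    have g: "(\<lambda>i. u * (x \<bullet> i)) \<in> gcone Basis a" "(\<lambda>i. v * (y \<bullet> i)) \<in> gcone Basis a"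
      using x y uv' by (auto intro: gcone_scale)
    have "u * c + v * c \<le> u * FQ Basis a b (\<lambda>i. x \<bullet> i) + v * FQ Basis a b (\<lambda>i. y \<bullet> i)"
      using x y uv by (intro add_mono mult_left_mono) auto
    also have "\<dots> = FQ Basis a b (\<lambda>i. u * (x \<bullet> i)) + FQ Basis a b (\<lambda>i. v * (y \<bullet> i))"
      using x y uv' assms by (simp add: FQ_scale)
    also have "\<dots> \<le> FQ Basis a b (\<lambda>i. u * (x \<bullet> i) + v * (y \<bullet> i))"
      using FQ_superadd[OF _ g assms] by simp
    finally have "c \<le> FQ Basis a b (\<lambda>i. u * (x \<bullet> i) + v * (y \<bullet> i))" using uv by (simp add: distrib_right[symmetric])
    moreover have "(\<bullet>) (u *\<^sub>R x + v *\<^sub>R y) = (\<lambda>i. u * (x \<bullet> i) + v * (y \<bullet> i))"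
      by (auto simp: inner_simps)
    ultimately show ?thesis using gcone_add[OF _ g] by simp
  qed
qed

lemma onb_double:
  assumes "onb e" "onb f"
  shows "b \<in> Basis \<Longrightarrow> (\<Sum>c\<in>Basis. (f b \<bullet> e c)^2) = 1" "c \<in> Basis \<Longrightarrow> (\<Sum>b\<in>Basis. (f b \<bullet> e c)^2) = 1"
proof -
  show "(\<Sum>c\<in>Basis. (f b \<bullet> e c)^2) = 1" if "b \<in> Basis"
    using onb_inner[OF assms(1), of "f b" "f b"] assms(2) that by (simp add: onb_def power2_eq_square)
  show "(\<Sum>b\<in>Basis. (f b \<bullet> e c)^2) = 1" if "c \<in> Basis"
    using onb_inner[OF assms(2), of "e c" "e c"] assms(1) that by (simp add: onb_def power2_eq_square inner_commute)
qed

text \<open>The diagonal of \<open>A\<close> in an orthonormal basis is the image of the eigenvalues under a doubly stochastic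
  matrix, hence lies in the hull of their permutations. The superlevel sets of \<open>FQ\<close> are convex and
  invariant under permutations. This reduces inequalities between forms to inequalities between vectors,
  by passing to an eigenbasis of the form on the larger side.\<close>

theorem schur_diag:
  fixes A :: "'a::euclidean_space \<Rightarrow> 'a \<Rightarrow> real"
  assumes A: "symform A" "A \<in> MG a" and f: "onb f" and ab: "b < a"
  shows "(\<lambda>c. A (f c) (f c)) \<in> gcone Basis a" "MF a b A \<le> FQ Basis a b (\<lambda>c. A (f c) (f c))"
proof -
  obtain e l where e: "eigf A e l" using eigf_exists[OF A(1)] by blast
  have l: "l \<in> gcone Basis a" using A e MG_eigf by blast
  have oe: "onb e" using e by (simp add: eigf_def)
  let ?d = "\<lambda>c. A (f c) (f c)"
  let ?X = "{x::'a. (\<lambda>i. x \<bullet> i) \<in> gcone Basis a \<and> MF a b A \<le> FQ Basis a b (\<lambda>i. x \<bullet> i)}"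
  have d: "?d = (\<lambda>i. \<Sum>j\<in>Basis. (f i \<bullet> e j)^2 * l j)"
    using eigf_form[OF A(1) e] by (auto simp: power2_eq_square inner_commute algebra_simps)
  have "vec_of ?d \<in> convex hull ((\<lambda>p. vec_of (\<lambda>i. l (p i))) ` {p. p permutes Basis})"
    unfolding d using onb_double[OF oe f] by (intro rado) auto
  also have "\<dots> \<subseteq> ?X"
  proof (rule hull_minimal)
    show "convex ?X" by (rule superlevel_convex[OF ab])
    show "(\<lambda>p. vec_of (\<lambda>i. l (p i))) ` {p. p permutes Basis} \<subseteq> ?X"
    proof clarify
      fix p :: "'a \<Rightarrow> 'a" assume p: "p permutes Basis"
      have bij: "bij_betw p Basis Basis" using p permutes_imp_bij by blast
      have es: "esym Basis k (\<lambda>i. vec_of (\<lambda>i. l (p i)) \<bullet> i) = esym Basis k l" for k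
      proof -
        have "esym Basis k (\<lambda>i. vec_of (\<lambda>i. l (p i)) \<bullet> i) = esym Basis k (\<lambda>i. l (p i))"
          by (rule esym_cong) simp
        then show ?thesis using esym_bij[OF bij] by metis
      qed
      show "(\<lambda>i. vec_of (\<lambda>i. l (p i)) \<bullet> i) \<in> gcone Basis a \<and> MF a b A \<le> FQ Basis a b (\<lambda>i. vec_of (\<lambda>i. l (p i)) \<bullet> i)"
        using l MF_eigf[OF A(1) e, of a b] by (simp add: gcone_def FQ_def es)
    qed
  qed
  finally have X: "vec_of ?d \<in> ?X" .
  have es: "esym Basis k (\<lambda>i. vec_of ?d \<bullet> i) = esym Basis k ?d" for k by (rule esym_cong) simp
  show "?d \<in> gcone Basis a" "MF a b A \<le> FQ Basis a b ?d"
    using X by (auto simp: gcone_def FQ_def es)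
qed

subsection \<open>Monotonicity and concavity on forms\<close>

lemma MF_pos:
  assumes "A \<in> MG a" "b < a" shows "MF a b A > 0"
proof -
  have "msig A a > 0" "msig A b > 0" using assms by (cases b; auto simp: MG_def)+
  then show ?thesis using assms(2) by (simp add: MF_def less_imp_neq[symmetric])
qed

lemma form_mono:
  fixes A B :: "'a::euclidean_space \<Rightarrow> 'a \<Rightarrow> real"
  assumes A: "symform A" "A \<in> MG a" and B: "symform B" and le: "\<And>w. A w w \<le> B w w" and ab: "b < a"
  shows "B \<in> MG a" "MF a b A \<le> MF a b B"
proof -
  obtain f l where f: "eigf B f l" using eigf_exists[OF B] by blast
  have of: "onb f" using f by (simp add: eigf_def)
  note d = schur_diag[OF A of ab]
  have l: "A (f c) (f c) \<le> l c" if "c \<in> Basis" for c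
  proof -
    have "B (f c) (f c) = l c" using f that by (simp add: eigf_def onb_def)
    then show ?thesis using le[of "f c"] by simp
  qed
  have "l \<in> gcone Basis a" using gcone_up[OF _ d(1), of l] l by simp
  then show "B \<in> MG a" using MG_eigf[OF B f] by blast
  have "FQ Basis a b (\<lambda>c. A (f c) (f c)) \<le> FQ Basis a b l" using FQ_mono[OF _ d(1) ab, of l] l by simp
  then show "MF a b A \<le> MF a b B" using d(2) MF_eigf[OF B f, of a b] by simp
qed

lemma form_superadd:
  fixes A B :: "'a::euclidean_space \<Rightarrow> 'a \<Rightarrow> real"
  assumes A: "symform A" "A \<in> MG a" and B: "symform B" "B \<in> MG a" and ab: "b < a"
  shows "(\<lambda>v w. A v w + B v w) \<in> MG a" "MF a b A + MF a b B \<le> MF a b (\<lambda>v w. A v w + B v w)"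
proof -
  let ?C = "\<lambda>v w. A v w + B v w"
  have C: "symform ?C" using A B by (intro symform_add)
  obtain f l where f: "eigf ?C f l" using eigf_exists[OF C] by blast
  have of: "onb f" using f by (simp add: eigf_def)
  note d = schur_diag[OF A of ab] and d' = schur_diag[OF B of ab]
  have l: "A (f c) (f c) + B (f c) (f c) = l c" if "c \<in> Basis" for c
    using f that by (simp add: eigf_def onb_def)
  have g: "(\<lambda>c. A (f c) (f c) + B (f c) (f c)) \<in> gcone Basis a" using gcone_add[OF _ d(1) d'(1)] by simp
  then have "l \<in> gcone Basis a" using gcone_up[OF _ g, of l] l by simp
  then show "?C \<in> MG a" using MG_eigf[OF C f] by blast
  have "MF a b A + MF a b B \<le> FQ Basis a b (\<lambda>c. A (f c) (f c) + B (f c) (f c))"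
    using FQ_superadd[OF _ d(1) d'(1) ab] d(2) d'(2) by simp
  also have "\<dots> = FQ Basis a b l" by (rule FQ_cong) (rule l)
  finally show "MF a b A + MF a b B \<le> MF a b ?C" using MF_eigf[OF C f] by simp
qed

lemma form_scale:
  fixes A :: "'a::euclidean_space \<Rightarrow> 'a \<Rightarrow> real"
  assumes A: "symform A" "A \<in> MG a" and c: "c > 0" and ab: "b < a"
  shows "(\<lambda>v w. c * A v w) \<in> MG a" "MF a b (\<lambda>v w. c * A v w) = c * MF a b A"
proof -
  obtain f l where f: "eigf A f l" using eigf_exists[OF A(1)] by blast
  have f': "eigf (\<lambda>v w. c * A v w) f (\<lambda>b. c * l b)" using f by (simp add: eigf_def)
  have l: "l \<in> gcone Basis a" using MG_eigf[OF A(1) f] A(2) by blast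
  show "(\<lambda>v w. c * A v w) \<in> MG a" "MF a b (\<lambda>v w. c * A v w) = c * MF a b A"
    using MG_eigf[OF symform_cmult[OF A(1)] f'] MF_eigf[OF symform_cmult[OF A(1)] f'] MF_eigf[OF A(1) f]
      gcone_scale[OF _ l c] FQ_scale[OF _ c ab l] by auto
qed

subsection \<open>The parallel sum inequality\<close>

text \<open>For positive definite \<open>A\<^sub>i\<close> with inverses \<open>B\<^sub>i\<close> the hypothesis says that \<open>C\<close> is bounded by the inverse of
  \<open>\<Sum> B\<^sub>i\<close>. In an eigenbasis \<open>f\<close> of \<open>\<Sum> B\<^sub>i\<close> the claim reduces, by \<open>FQ_inverse\<close>, to the superadditivity of the
  dual quotient on the diagonals \<open>r i\<close> of the \<open>B\<^sub>i\<close>.\<close>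

lemma parallel_sum_pd:
  fixes A :: "'i \<Rightarrow> 'a::euclidean_space \<Rightarrow> 'a \<Rightarrow> real" and C :: "'a \<Rightarrow> 'a \<Rightarrow> real"
  assumes I: "finite I" "I \<noteq> {}" and A: "\<And>i. i \<in> I \<Longrightarrow> symform (A i)"
    and pd: "\<And>i w. i \<in> I \<Longrightarrow> w \<noteq> 0 \<Longrightarrow> A i w w > 0"
    and C: "symform C" "C \<in> MG a" and ab: "b < a" "a \<le> DIM('a)"
    and le: "\<And>h. C (\<Sum>i\<in>I. h i) (\<Sum>i\<in>I. h i) \<le> (\<Sum>i\<in>I. A i (h i) (h i))"
  shows "(\<Sum>i\<in>I. 1 / MF a b (A i)) \<le> 1 / MF a b C"
proof -
  have "\<exists>e l. eigf (A i) e l" if "i \<in> I" for i using eigf_exists[OF A[OF that]] .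
  then obtain e l where e: "\<And>i. i \<in> I \<Longrightarrow> eigf (A i) (e i) (l i)" by metis
  have oe: "onb (e i)" if "i \<in> I" for i using e[OF that] by (simp add: eigf_def)
  have lpos: "l i m > 0" if "i \<in> I" "m \<in> Basis" for i m
  proof -
    have "e i m \<bullet> e i m = 1" using oe[OF that(1)] that(2) by (simp add: onb_def)
    then have "A i (e i m) (e i m) = l i m" "e i m \<noteq> 0" using e[OF that(1)] that(2) by (auto simp: eigf_def)
    then show ?thesis using pd[OF that(1)] by metis
  qed
  define Q where "Q i v = (\<Sum>m\<in>Basis. (1 / l i m * (e i m \<bullet> v)) *\<^sub>R e i m)" for i v
  define B where "B i v w = Q i v \<bullet> w" for i v w
  have B: "B i v w = (\<Sum>m\<in>Basis. 1 / l i m * (e i m \<bullet> v) * (e i m \<bullet> w))" for i v w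
    by (simp add: B_def Q_def inner_sum_left)
  have sB: "symform (B i)" for i
    unfolding B by (rule symformI)
      (simp_all add: inner_simps algebra_simps sum.distrib sum_distrib_left add_divide_distrib)
  have eB: "eigf (B i) (e i) (\<lambda>m. 1 / l i m)" if i: "i \<in> I" for i
    unfolding eigf_def
  proof (intro conjI ballI allI oe[OF i])
    fix c w assume c: "c \<in> (Basis :: 'a set)"
    have "B i (e i c) w = (\<Sum>m\<in>Basis. if m = c then 1 / l i c * (e i c \<bullet> w) else 0)"
      unfolding B using oe[OF i] c by (intro sum.cong refl) (auto simp: onb_def)
    then show "B i (e i c) w = 1 / l i c * (e i c \<bullet> w)" using c by simp
  qed
  have AQ: "A i (Q i v) w = v \<bullet> w" if i: "i \<in> I" for i v w
  proof -
    have "A i (Q i v) w = (\<Sum>m\<in>Basis. (1 / l i m * (e i m \<bullet> v)) * (l i m * (e i m \<bullet> w)))"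
      using e[OF i] unfolding Q_def by (simp add: symform_sum_left[OF A[OF i]] symform_scale_left[OF A[OF i]] eigf_def)
    also have "\<dots> = (\<Sum>m\<in>Basis. (v \<bullet> e i m) * (w \<bullet> e i m))"
      using lpos[OF i] by (intro sum.cong refl) (auto simp: inner_commute less_imp_neq[symmetric])
    finally show ?thesis using onb_inner[OF oe[OF i], of v w] by simp
  qed
  have "symform (\<lambda>v w. \<Sum>i\<in>I. B i v w)"
    using sB by (intro symformI) (auto simp: symform_simps sum.distrib sum_distrib_left symform_sym)
  then obtain f q where f: "eigf (\<lambda>v w. \<Sum>i\<in>I. B i v w) f q" using eigf_exists by blast
  have of: "onb f" using f by (simp add: eigf_def)
  have ff: "f j \<bullet> f j = 1" "f j \<noteq> 0" if "j \<in> Basis" for j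
  proof -
    show "f j \<bullet> f j = 1" using of that by (simp add: onb_def)
    then show "f j \<noteq> 0" by auto
  qed
  define r where "r i j = B i (f j) (f j)" for i j
  have rpos: "r i j > 0" if "i \<in> I" "j \<in> Basis" for i j
  proof -
    have AQQ: "r i j = A i (Q i (f j)) (Q i (f j))"
      using AQ[OF that(1), of "f j" "Q i (f j)"] by (simp add: r_def B_def inner_commute)
    have "Q i (f j) \<noteq> 0"
    proof
      assume "Q i (f j) = 0"
      then have "f j \<bullet> f j = 0" using AQ[OF that(1), of "f j" "f j"] symform_scale_left[OF A[OF that(1)], of 0 0] by simp
      then show False using ff that by simp
    qed
    then show ?thesis using pd[OF that(1)] AQQ by simp
  qed
  have qr: "q j = (\<Sum>i\<in>I. r i j)" if "j \<in> Basis" for j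
    using f that ff by (simp add: eigf_def r_def)
  have qpos: "q j > 0" if "j \<in> Basis" for j
    unfolding qr[OF that] using rpos that I by (intro sum_pos) auto
  have Cf: "C (f j) (f j) \<le> 1 / q j" if j: "j \<in> Basis" for j
  proof -
    \<comment> \<open>The decomposition of \<open>f j\<close> that minimises the right-hand side of \<open>le\<close>.\<close>
    define h where "h i = (1 / q j) *\<^sub>R Q i (f j)" for i
    have "(\<Sum>i\<in>I. Q i (f j)) \<bullet> w = (q j *\<^sub>R f j) \<bullet> w" for w
    proof -
      have "(\<Sum>i\<in>I. B i (f j) w) = q j * (f j \<bullet> w)" using f j by (simp add: eigf_def)
      then show ?thesis by (simp add: B_def inner_sum_left)
    qed
    then have "(\<Sum>i\<in>I. Q i (f j)) = q j *\<^sub>R f j" by (metis vector_eq_rdot)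
    then have "(\<Sum>i\<in>I. h i) = f j" unfolding h_def scaleR_right.sum[symmetric] using qpos[OF j] by simp
    then have "C (f j) (f j) \<le> (\<Sum>i\<in>I. A i (h i) (h i))" using le[of h] by simp
    also have "\<dots> = (\<Sum>i\<in>I. r i j / q j^2)"
    proof (rule sum.cong[OF refl])
      fix i assume i: "i \<in> I"
      have "A i (h i) (h i) = (f j \<bullet> Q i (f j)) / q j^2"
        unfolding h_def by (simp add: symform_simps[OF A[OF i]] AQ[OF i] power2_eq_square)
      then show "A i (h i) (h i) = r i j / q j^2" by (simp add: r_def B_def inner_commute)
    qed
    also have "\<dots> = 1 / q j" using qr[OF j] qpos[OF j] by (simp add: sum_divide_distrib[symmetric] power2_eq_square)
    finally show ?thesis .
  qed
  let ?a' = "DIM('a) - b" and ?b' = "DIM('a) - a"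
  have ab': "?b' < ?a'" "?a' \<le> DIM('a)" using ab by auto
  have rg: "r i \<in> gcone Basis ?a'" if "i \<in> I" for i using rpos[OF that] ab' by (intro gcone_pos) auto
  have sum_le: "(\<Sum>i\<in>J. FQ Basis ?a' ?b' (r i)) \<le> FQ Basis ?a' ?b' (\<lambda>j. \<Sum>i\<in>J. r i j)"
    "(\<lambda>j. \<Sum>i\<in>J. r i j) \<in> gcone Basis ?a'" if "J \<subseteq> I" "J \<noteq> {}" for J
  proof -
    have fJ: "finite J" using that I finite_subset by blast
    have "(\<Sum>i\<in>J. FQ Basis ?a' ?b' (r i)) \<le> FQ Basis ?a' ?b' (\<lambda>j. \<Sum>i\<in>J. r i j) \<and>
      (\<lambda>j. \<Sum>i\<in>J. r i j) \<in> gcone Basis ?a'"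
      using fJ that(2,1)
    proof (induction J rule: finite_ne_induct)
      case (singleton x) then show ?case using rg by simp
    next
      case (insert x F)
      then have IH: "(\<Sum>i\<in>F. FQ Basis ?a' ?b' (r i)) \<le> FQ Basis ?a' ?b' (\<lambda>j. \<Sum>i\<in>F. r i j)"
        "(\<lambda>j. \<Sum>i\<in>F. r i j) \<in> gcone Basis ?a'" and x: "r x \<in> gcone Basis ?a'" using rg by auto
      show ?case using insert IH FQ_superadd[OF _ x IH(2) ab'(1)] gcone_add[OF _ x IH(2)] by simp
    qed
    then show "(\<Sum>i\<in>J. FQ Basis ?a' ?b' (r i)) \<le> FQ Basis ?a' ?b' (\<lambda>j. \<Sum>i\<in>J. r i j)"
      "(\<lambda>j. \<Sum>i\<in>J. r i j) \<in> gcone Basis ?a'" by auto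
  qed
  have Ai: "1 / MF a b (A i) \<le> FQ Basis ?a' ?b' (r i)" if i: "i \<in> I" for i
  proof -
    have "(\<lambda>m. 1 / l i m) \<in> gcone Basis ?a'" using lpos[OF i] ab' by (intro gcone_pos) auto
    then have BG: "B i \<in> MG ?a'" using MG_eigf[OF sB eB[OF i]] by blast
    have "FQ Basis ?a' ?b' (\<lambda>m. 1 / l i m) = 1 / FQ Basis a b (l i)"
    proof -
      have "FQ Basis ?a' ?b' (\<lambda>m. 1 / l i m) = 1 / FQ Basis (DIM('a) - ?b') (DIM('a) - ?a') (l i)"
        using lpos[OF i] ab' by (intro FQ_inverse) auto
      then show ?thesis using ab by simp
    qed
    then have "1 / MF a b (A i) = MF ?a' ?b' (B i)"
      using MF_eigf[OF A[OF i] e[OF i], of a b] MF_eigf[OF sB eB[OF i], of ?a' ?b'] by simp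
    also have "\<dots> \<le> FQ Basis ?a' ?b' (\<lambda>c. B i (f c) (f c))" by (rule schur_diag(2)[OF sB BG of ab'(1)])
    also have "(\<lambda>c. B i (f c) (f c)) = r i" by (simp add: r_def fun_eq_iff)
    finally show ?thesis .
  qed
  have "(\<Sum>i\<in>I. 1 / MF a b (A i)) \<le> (\<Sum>i\<in>I. FQ Basis ?a' ?b' (r i))" by (intro sum_mono Ai)
  also have "\<dots> \<le> FQ Basis ?a' ?b' (\<lambda>j. \<Sum>i\<in>I. r i j)" using sum_le[of I] I by simp
  also have "\<dots> = FQ Basis ?a' ?b' q" by (rule FQ_cong) (simp add: qr)
  also have "\<dots> = 1 / FQ Basis a b (\<lambda>j. 1 / q j)" using FQ_inverse[of Basis q b a] qpos ab by simp
  also have "\<dots> \<le> 1 / MF a b C"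
  proof -
    note d = schur_diag[OF C of ab(1)]
    have "FQ Basis a b (\<lambda>c. C (f c) (f c)) \<le> FQ Basis a b (\<lambda>j. 1 / q j)"
      using FQ_mono[OF _ d(1) ab(1), of "\<lambda>j. 1 / q j"] Cf by simp
    then show ?thesis using d(2) MF_pos[OF C(2) ab(1)] by (intro divide_left_mono mult_pos_pos) auto
  qed
  finally show ?thesis .
qed

lemma isCont_mpow:
  fixes A :: "real \<Rightarrow> 'a::euclidean_space \<Rightarrow> 'a \<Rightarrow> real"
  assumes "\<And>v w. isCont (\<lambda>t. A t v w) s" shows "isCont (\<lambda>t. mpow (A t) j v w) s"
  by (induction j arbitrary: v w) (auto intro!: continuous_intros assms)

lemma isCont_msig:
  fixes A :: "real \<Rightarrow> 'a::euclidean_space \<Rightarrow> 'a \<Rightarrow> real"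
  assumes "\<And>v w. isCont (\<lambda>t. A t v w) s" shows "isCont (\<lambda>t. msig (A t) k) s"
proof (induction k rule: less_induct)
  case (less k)
  have p: "isCont (\<lambda>t. ptr (A t) j) s" for j unfolding ptr_def by (intro continuous_intros isCont_mpow assms)
  show ?case
  proof (cases k)
    case (Suc j)
    have "isCont (\<lambda>t. msig (A t) (j - i)) s" for i using less Suc by auto
    then show ?thesis unfolding Suc msig.simps by (intro continuous_intros p) auto
  qed auto
qed

text \<open>The forms \<open>A\<^sub>i\<close> are approximated by the positive definite forms \<open>A\<^sub>i + t * identity\<close> with \<open>t\<close> tending to \<open>0\<close>.\<close>

theorem parallel_sum_ineq:
  fixes A :: "'i \<Rightarrow> 'a::euclidean_space \<Rightarrow> 'a \<Rightarrow> real" and C :: "'a \<Rightarrow> 'a \<Rightarrow> real"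
  assumes I: "finite I" "I \<noteq> {}" and A: "\<And>i. i \<in> I \<Longrightarrow> symform (A i)" "\<And>i. i \<in> I \<Longrightarrow> A i \<in> MG a"
    and psd: "\<And>i w. i \<in> I \<Longrightarrow> A i w w \<ge> 0"
    and C: "symform C" "C \<in> MG a" and ab: "b < a" "a \<le> DIM('a)"
    and le: "\<And>h. C (\<Sum>i\<in>I. h i) (\<Sum>i\<in>I. h i) \<le> (\<Sum>i\<in>I. A i (h i) (h i))"
  shows "(\<Sum>i\<in>I. 1 / MF a b (A i)) \<le> 1 / MF a b C"
proof -
  define At where "At t i v w = A i v w + t * (v \<bullet> w)" for t :: real and i v w
  have c: "isCont (\<lambda>t. MF a b (At t i)) 0" "MF a b (At 0 i) > 0" if "i \<in> I" for i
  proof -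
    have At0: "At 0 i = A i" by (simp add: At_def fun_eq_iff)
    have m: "isCont (\<lambda>t. msig (At t i) k) 0" for k
      by (rule isCont_msig) (auto simp: At_def intro!: continuous_intros)
    have p: "msig (A i) a > 0" "msig (A i) b > 0" using A(2)[OF that] ab by (cases b; auto simp: MG_def)+
    show "isCont (\<lambda>t. MF a b (At t i)) 0" unfolding MF_def
      using p m by (intro continuous_intros) (auto simp: At0 isCont_def)
    show "MF a b (At 0 i) > 0" unfolding At0 using MF_pos[OF A(2)[OF that] ab(1)] .
  qed
  have "((\<lambda>t. \<Sum>i\<in>I. 1 / MF a b (At t i)) \<longlongrightarrow> (\<Sum>i\<in>I. 1 / MF a b (At 0 i))) (at_right 0)"
  proof (intro tendsto_sum tendsto_divide tendsto_const)
    fix i assume i: "i \<in> I"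
    show "((\<lambda>t. MF a b (At t i)) \<longlongrightarrow> MF a b (At 0 i)) (at_right 0)"
      using c(1)[OF i] unfolding isCont_def by (rule tendsto_mono[OF at_le, rotated]) auto
  qed (use c in force)
  moreover have "\<forall>\<^sub>F t in at_right 0. (\<Sum>i\<in>I. 1 / MF a b (At t i)) \<le> 1 / MF a b C"
    unfolding eventually_at_right_field
  proof (intro exI[of _ 1] conjI allI impI)
    fix t :: real assume t: "0 < t"
    show "(\<Sum>i\<in>I. 1 / MF a b (At t i)) \<le> 1 / MF a b C"
    proof (rule parallel_sum_pd[OF I _ _ C ab])
      show "symform (At t i)" if "i \<in> I" for i
        unfolding At_def using A(1)[OF that] by (intro symform_add symform_cmult symform_inner)
      show "At t i w w > 0" if "i \<in> I" "w \<noteq> 0" for i w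
        using psd[OF that(1), of w] t that(2) by (simp add: At_def add_nonneg_pos)
      show "C (\<Sum>i\<in>I. h i) (\<Sum>i\<in>I. h i) \<le> (\<Sum>i\<in>I. At t i (h i) (h i))" for h
      proof -
        have "(\<Sum>i\<in>I. A i (h i) (h i)) \<le> (\<Sum>i\<in>I. At t i (h i) (h i))"
          using t by (intro sum_mono) (simp add: At_def)
        then show ?thesis using le[of h] by simp
      qed
    qed
  qed simp
  ultimately have "(\<Sum>i\<in>I. 1 / MF a b (At 0 i)) \<le> 1 / MF a b C"
    by (intro tendsto_upperbound[OF _ _ trivial_limit_at_right_real]) auto
  moreover have "At 0 i = A i" for i by (simp add: At_def fun_eq_iff)
  ultimately show ?thesis by simp
qed

subsection \<open>Quantitative ellipticity\<close>

text \<open>Among the factors of \<open>esym_quot_prod\<close> the last one increases strictly: in its recursion the \<open>i\<close>-th term is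
  a parallel sum with a positive second argument.\<close>

lemma FQ_strict:
  assumes I: "finite I" and l: "l \<in> gcone I a" and ab: "b < a" and i: "i \<in> I" and t: "t > 0"
  shows "FQ I a b l < FQ I a b (l(i := l i + t))"
proof -
  let ?m = "l(i := l i + t)"
  have m: "?m \<in> gcone I a" using t by (intro gcone_up[OF I l]) auto
  obtain k where k: "a = Suc k" using ab by (cases a) auto
  have strict: "eratio I k l < eratio I k ?m"
  proof (cases k)
    case 0
    have "sum ?m I = sum l I + t" using I i by (simp add: sum.remove[of I i])
    then show ?thesis using 0 I t by (simp add: eratio_def esym_1)
  next
    case (Suc j)
    have lj: "l \<in> gcone I (Suc j)" "?m \<in> gcone I (Suc j)" using l m k Suc gcone_Suc by blast+
    have lS: "l \<in> gcone I (Suc (Suc j))" using l k Suc by simp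
    have D: "n \<in> gcone (I - {i}) j" if "n \<in> gcone I (Suc j)" "i \<in> I" for n i
      using ratio_good[OF I, of j] that unfolding ratio_good_def by blast
    have D1: "l \<in> gcone (I - {i}) (Suc j)"
      using ratio_good[OF I, of "Suc j"] lS i unfolding ratio_good_def by blast
    have y: "eratio (I - {i}) j l > 0" using eratio_pos[OF _ D1] I by simp
    have rl: "l c + eratio (I - {c}) j l > 0" if "c \<in> I" for c
      by (rule eratio_rec(2)[OF I lj(1) _ that]) (rule D[OF lj(1)])
    have rm': "eratio (I - {i}) j ?m = eratio (I - {i}) j l"
    proof -
      have "esym (I - {i}) k ?m = esym (I - {i}) k l" for k by (rule esym_cong) auto
      then show ?thesis by (simp add: eratio_def)
    qed
    have "(\<Sum>c\<in>I. psum (l c) (eratio (I - {c}) j l)) < (\<Sum>c\<in>I. psum (?m c) (eratio (I - {c}) j ?m))"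
    proof (rule sum_strict_mono_ex1[OF I])
      show "\<forall>c\<in>I. psum (l c) (eratio (I - {c}) j l) \<le> psum (?m c) (eratio (I - {c}) j ?m)"
      proof
        fix c assume c: "c \<in> I"
        show "psum (l c) (eratio (I - {c}) j l) \<le> psum (?m c) (eratio (I - {c}) j ?m)"
          using t I rl[OF c] eratio_mono[OF _ D[OF lj(1) c], of ?m]
          by (intro psum_mono) auto
      qed
      have p: "l i + eratio (I - {i}) j l > 0" using rl[OF i] .
      have "psum (l i + t) (eratio (I - {i}) j l) - psum (l i) (eratio (I - {i}) j l)
        = (eratio (I - {i}) j l)^2 * t / ((l i + eratio (I - {i}) j l) * (l i + t + eratio (I - {i}) j l))"
        unfolding psum_def using p t by (simp add: divide_simps) algebra
      also have "\<dots> > 0" using p t y by (intro divide_pos_pos mult_pos_pos) auto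
      finally show "\<exists>c\<in>I. psum (l c) (eratio (I - {c}) j l) < psum (?m c) (eratio (I - {c}) j ?m)"
        using i rm' by (intro bexI[of _ i]) auto
    qed
    moreover have "real (Suc (Suc j)) * eratio I (Suc j) l = (\<Sum>c\<in>I. psum (l c) (eratio (I - {c}) j l))"
      by (rule eratio_rec(1)[OF I lj(1)]) (rule D[OF lj(1)])
    moreover have "real (Suc (Suc j)) * eratio I (Suc j) ?m = (\<Sum>c\<in>I. psum (?m c) (eratio (I - {c}) j ?m))"
      by (rule eratio_rec(1)[OF I lj(2)]) (rule D[OF lj(2)])
    ultimately have "real (Suc (Suc j)) * eratio I (Suc j) l < real (Suc (Suc j)) * eratio I (Suc j) ?m" by linarith
    then show ?thesis using Suc by (simp only: mult_less_cancel_left_pos of_nat_0_less_iff zero_less_Suc)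
  qed
  have pos: "eratio I j l > 0" if "j \<in> {b..<a}" for j
    using that eratio_pos[OF I, of l j] gcone_mono[of "Suc j" a I] l by auto
  have lt: "(\<Prod>j\<in>{b..<a}. eratio I j l) < (\<Prod>j\<in>{b..<a}. eratio I j ?m)"
  proof -
    have s: "{b..<a} = insert k {b..<k}" "k \<notin> {b..<k}" using ab k by auto
    have "(\<Prod>j\<in>{b..<k}. eratio I j l) \<le> (\<Prod>j\<in>{b..<k}. eratio I j ?m)"
    proof (intro prod_mono conjI)
      fix j assume j: "j \<in> {b..<k}"
      then show "0 \<le> eratio I j l" using pos[of j] k by auto
      have "l \<in> gcone I j" using l j k gcone_mono[of j a I] by auto
      then show "eratio I j l \<le> eratio I j ?m" using t by (intro eratio_mono[OF I]) auto
    qed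
    moreover have "(\<Prod>j\<in>{b..<k}. eratio I j l) > 0" using pos k by (intro prod_pos) auto
    ultimately show ?thesis unfolding s(1) using strict pos[of k] ab k by (simp add: mult_strict_mono' mult_less_le_imp_less)
  qed
  have "(\<Prod>j\<in>{b..<a}. eratio I j l) > 0" using pos by (intro prod_pos) auto
  then show ?thesis unfolding FQ_def
    using lt esym_quot_prod[OF I l, of b] esym_quot_prod[OF I m, of b] ab
    by (intro powr_less_mono2) auto
qed

text \<open>Products of ratios again, now from \<open>\<sigma>\<^sub>0 = 1\<close> upwards.\<close>

lemma esym_ge_of_add:
  assumes I: "finite I" and l: "l \<in> gcone I k" and m: "m \<in> gcone I k" and j: "j \<le> k"
  shows "esym I j m \<le> esym I j (\<lambda>i. l i + m i)"
proof -
  have lj: "l \<in> gcone I j" "m \<in> gcone I j" using l m gcone_mono[OF j] by auto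
  have s: "(\<lambda>i. l i + m i) \<in> gcone I j" using gcone_add[OF I lj] .
  have "(\<Prod>i\<in>{0..<j}. eratio I i m) \<le> (\<Prod>i\<in>{0..<j}. eratio I i (\<lambda>i. l i + m i))"
  proof (intro prod_mono conjI)
    fix i assume i: "i \<in> {0..<j}"
    then have g: "l \<in> gcone I (Suc i)" "m \<in> gcone I (Suc i)" using lj gcone_mono[of "Suc i" j I] by auto
    then have "l \<in> gcone I i" "m \<in> gcone I i" using gcone_Suc by blast+
    then show "0 \<le> eratio I i m" "eratio I i m \<le> eratio I i (\<lambda>i. l i + m i)"
      using eratio_pos[OF I g(1)] eratio_pos[OF I g(2)] eratio_superadd[OF I, of l i m] by auto
  qed
  then show ?thesis using esym_quot_prod[OF I lj(2), of 0] esym_quot_prod[OF I s, of 0] I by simp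
qed

text \<open>By \<open>esym_ge_of_add\<close> a vector \<open>d\<close> with \<open>d - r\<close> in the cone satisfies \<open>\<sigma>\<^sub>j d \<ge> \<sigma>\<^sub>j (r, \<dots>, r) > 0\<close>. Bounded
  vectors of this kind form a compact subset of the cone, on which the strict inequality \<open>FQ_strict\<close> is
  uniform.\<close>

lemma FQ_gain_compact:
  fixes R r :: real
  assumes ab: "b < a" "a \<le> DIM('a::euclidean_space)" and r: "r > 0" and t: "t > 0"
  shows "\<exists>c>0. \<forall>d. (\<lambda>i. d i - r) \<in> gcone (Basis :: 'a set) a \<and> (\<forall>i\<in>Basis. \<bar>d i\<bar> \<le> R) \<longrightarrow>
     (\<forall>i\<in>Basis. (1 + c) * FQ Basis a b d \<le> FQ Basis a b (d(i := d i + t)))"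
proof -
  define K where "K = {x::'a. norm x \<le> DIM('a) * R \<and> (\<forall>j\<in>{1..a}. esym (Basis :: 'a set) j (\<lambda>_. r) \<le> esym Basis j (\<lambda>i. x \<bullet> i))}"
  have rG: "(\<lambda>_. r) \<in> gcone (Basis :: 'a set) a" using r ab by (intro gcone_pos) auto
  have KG: "(\<lambda>i. x \<bullet> i) \<in> gcone Basis a" if "x \<in> K" for x
  proof -
    have "esym Basis j (\<lambda>i. x \<bullet> i) > 0" if "j \<in> {1..a}" for j
    proof -
      have "esym (Basis :: 'a set) j (\<lambda>_. r) \<le> esym Basis j (\<lambda>i. x \<bullet> i)" using \<open>x \<in> K\<close> that unfolding K_def by blast
      moreover have "0 < esym (Basis :: 'a set) j (\<lambda>_. r)" using rG that by (simp add: gcone_def)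
      ultimately show ?thesis by simp
    qed
    then show ?thesis by (simp add: gcone_def)
  qed
  have ce: "continuous_on S (\<lambda>x::'a. esym Basis j (\<lambda>i. x \<bullet> i + (if i = k then s else 0)))" for S j k s
    unfolding esym_def by (intro continuous_intros)
  have ce0: "continuous_on S (\<lambda>x::'a. esym Basis j (\<lambda>i. x \<bullet> i))" for S j
    unfolding esym_def by (intro continuous_intros)
  have upd: "(\<lambda>i. x \<bullet> i)(k := x \<bullet> k + t) = (\<lambda>i. x \<bullet> i + (if i = k then t else 0))" for k and x :: 'a by auto
  have "K = cball 0 (DIM('a) * R) \<inter> (\<Inter>j\<in>{1..a}. {x. esym (Basis :: 'a set) j (\<lambda>_. r) \<le> esym Basis j (\<lambda>i. x \<bullet> i)})"
    by (auto simp: K_def)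
  then have cK: "compact K"
    by (auto intro!: compact_Int_closed closed_INT closed_Collect_le continuous_on_const ce0)
  have "\<exists>c>0. \<forall>x\<in>K. (1 + c) * FQ Basis a b (\<lambda>i. x \<bullet> i) \<le> FQ Basis a b ((\<lambda>i. x \<bullet> i)(k := x \<bullet> k + t))"
    if k: "k \<in> Basis" for k
  proof (cases "K = {}")
    case True then show ?thesis by (intro exI[of _ 1]) auto
  next
    case False
    let ?h = "\<lambda>x. FQ Basis a b (\<lambda>i. x \<bullet> i + (if i = k then t else 0)) / FQ Basis a b (\<lambda>i. x \<bullet> i)"
    have G2: "(\<lambda>i. x \<bullet> i + (if i = k then t else 0)) \<in> gcone Basis a" if "x \<in> K" for x
      using t by (intro gcone_up[OF _ KG[OF that]]) auto
    have pos: "esym Basis j (\<lambda>i. x \<bullet> i) > 0" "esym Basis j (\<lambda>i. x \<bullet> i + (if i = k then t else 0)) > 0"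
      if "x \<in> K" "j = a \<or> j = b" for x j
      using gcone_esym_pos[OF _ KG[OF that(1)], of j] gcone_esym_pos[OF _ G2[OF that(1)], of j] that(2) ab by auto
    have "continuous_on K (\<lambda>x. (esym Basis a (\<lambda>i. x \<bullet> i) / esym Basis b (\<lambda>i. x \<bullet> i)) powr (1 / real (a - b)))"
      using pos(1) by (intro continuous_intros ce0) (force simp: less_imp_neq[symmetric])+
    moreover have "continuous_on K (\<lambda>x. (esym Basis a (\<lambda>i. x \<bullet> i + (if i = k then t else 0)) / esym Basis b (\<lambda>i. x \<bullet> i + (if i = k then t else 0))) powr (1 / real (a - b)))"
      using pos(2) by (intro continuous_intros ce) (force simp: less_imp_neq[symmetric])+
    moreover have FP: "FQ Basis a b (\<lambda>i. x \<bullet> i) > 0" if "x \<in> K" for x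
      using FQ_pos[OF _ KG[OF that] ab(1)] by simp
    ultimately have "continuous_on K ?h"
      unfolding FQ_def by (intro continuous_on_divide) (force simp: FQ_def)+
    then obtain x0 where x0: "x0 \<in> K" "\<And>x. x \<in> K \<Longrightarrow> ?h x0 \<le> ?h x"
      using continuous_attains_inf[OF cK False] by blast
    have "?h x0 > 1"
      using FQ_strict[OF _ KG[OF x0(1)] ab(1) k t] FP[OF x0(1)] by (simp add: upd)
    moreover have "(1 + (?h x0 - 1)) * FQ Basis a b (\<lambda>i. x \<bullet> i) \<le> FQ Basis a b ((\<lambda>i. x \<bullet> i)(k := x \<bullet> k + t))"
      if "x \<in> K" for x
      using x0(2)[OF that] FP[OF that] unfolding upd by (simp add: pos_le_divide_eq)
    ultimately show ?thesis by (intro exI[of _ "?h x0 - 1"]) auto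
  qed
  then obtain c where c: "\<And>k. k \<in> Basis \<Longrightarrow> c k > 0"
    "\<And>k x. k \<in> Basis \<Longrightarrow> x \<in> K \<Longrightarrow> (1 + c k) * FQ Basis a b (\<lambda>i. x \<bullet> i) \<le> FQ Basis a b ((\<lambda>i. x \<bullet> i)(k := x \<bullet> k + t))"
    by metis
  define c0 where "c0 = Min (c ` Basis)"
  have c0: "c0 > 0" "\<And>k. k \<in> Basis \<Longrightarrow> c0 \<le> c k" using c(1) by (auto simp: c0_def)
  show ?thesis
  proof (intro exI[of _ c0] conjI allI impI ballI)
    fix d :: "'a \<Rightarrow> real" and k :: 'a
    assume d: "(\<lambda>i. d i - r) \<in> gcone Basis a \<and> (\<forall>i\<in>Basis. \<bar>d i\<bar> \<le> R)" and k: "k \<in> Basis"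
    have e: "esym Basis j (\<lambda>i. vec_of d \<bullet> i) = esym Basis j d" for j by (rule esym_cong) simp
    have "norm (vec_of d) \<le> (\<Sum>i\<in>Basis. norm (d i *\<^sub>R i))" unfolding vec_of_def by (rule norm_sum)
    also have "\<dots> \<le> (\<Sum>i\<in>(Basis::'a set). R)" using d by (intro sum_mono) auto
    finally have "norm (vec_of d) \<le> DIM('a) * R" by simp
    moreover have "esym (Basis :: 'a set) j (\<lambda>_. r) \<le> esym Basis j d" if "j \<in> {1..a}" for j
      using esym_ge_of_add[OF _ conjunct1[OF d] rG, of j] that by simp
    ultimately have vK: "vec_of d \<in> K" by (simp add: K_def e)
    have f1: "FQ Basis a b (\<lambda>i. vec_of d \<bullet> i) = FQ Basis a b d" by (rule FQ_cong) simp
    have f2: "FQ Basis a b ((\<lambda>i. vec_of d \<bullet> i)(k := vec_of d \<bullet> k + t)) = FQ Basis a b (d(k := d k + t))"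
      using k by (intro FQ_cong) auto
    have "FQ Basis a b d > 0" using FQ_pos[OF _ KG[OF vK] ab(1)] f1 by simp
    then have "(1 + c0) * FQ Basis a b d \<le> (1 + c k) * FQ Basis a b d" using c0(2)[OF k] by (simp add: mult_right_mono)
    also have "\<dots> \<le> FQ Basis a b (d(k := d k + t))" using c(2)[OF k vK] by (simp only: f1 f2)
    finally show "(1 + c0) * FQ Basis a b d \<le> FQ Basis a b (d(k := d k + t))" .
  qed (rule c0(1))
qed

text \<open>Uniform ellipticity: adding a positive form of rank one raises \<open>F\<close> by a definite factor, even if a small
  multiple \<open>\<eta>\<close> of the identity is subtracted at the same time. For \<open>\<tau> = 1\<close> the sum \<open>M\<close> is diagonalised; one
  of the basis vectors makes an angle with \<open>u\<close> that is bounded away from the right angle, and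
  \<open>FQ_gain_compact\<close> applies to that entry. The loss is controlled by writing
  \<open>d - \<eta> = (1 - \<eta> / r) * d + (\<eta> / r) * (d - r)\<close>. For smaller \<open>\<tau>\<close> the claim follows by concavity.\<close>

theorem form_gain:
  fixes R r :: real
  assumes ab: "b < a" "a \<le> DIM('a::euclidean_space)" and r: "r > 0"
  shows "\<exists>c>0. \<exists>\<eta>>0. \<forall>(A :: 'a \<Rightarrow> 'a \<Rightarrow> real) B u \<tau>.
     symform A \<and> (\<lambda>v w. A v w - r * (v \<bullet> w)) \<in> MG a \<and> (\<forall>w. \<bar>A w w\<bar> \<le> R * (norm w)^2) \<and> norm u = 1 \<and>
     0 \<le> \<tau> \<and> \<tau> \<le> 1 \<and> symform B \<and> (\<forall>w. A w w + \<tau> * ((u \<bullet> w)^2 - \<eta> * (norm w)^2) \<le> B w w)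
     \<longrightarrow> B \<in> MG a \<and> (1 + \<tau> * c) * MF a b A \<le> MF a b B"
proof -
  let ?N = "real DIM('a)"
  have N: "?N > 0" by simp
  obtain c1 where c1: "c1 > 0" and gain: "\<And>d i. (\<lambda>i. d i - r) \<in> gcone (Basis :: 'a set) a \<Longrightarrow> (\<forall>i\<in>Basis. \<bar>d i\<bar> \<le> R) \<Longrightarrow>
      i \<in> Basis \<Longrightarrow> (1 + c1) * FQ Basis a b d \<le> FQ Basis a b (d(i := d i + 1 / ?N))"
    using FQ_gain_compact[OF ab r, of "1 / ?N" R] by auto
  \<comment> \<open>Chosen such that one half of the gain \<open>c1\<close> survives.\<close>
  define \<eta> where "\<eta> = r * (c1 / 2 / (1 + c1))"
  have \<eta>: "\<eta> > 0" "\<eta> / r < 1" "(1 - \<eta> / r) * (1 + c1) = 1 + c1 / 2"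
  proof -
    have q: "\<eta> / r = c1 / 2 / (1 + c1)" using r by (simp add: \<eta>_def)
    show "\<eta> > 0" using c1 r by (simp add: \<eta>_def)
    show "\<eta> / r < 1" unfolding q using c1 by (simp add: field_simps)
    show "(1 - \<eta> / r) * (1 + c1) = 1 + c1 / 2" unfolding q using c1 by (simp add: field_simps)
  qed
  have AG: "A \<in> MG a" if "symform A" "(\<lambda>v w. A v w - r * (v \<bullet> w)) \<in> MG a" for A :: "'a \<Rightarrow> 'a \<Rightarrow> real"
    using r by (intro form_mono(1)[OF symform_diff[OF that(1) symform_cmult[OF symform_inner]] that(2) that(1) _ ab(1)]) auto
  have main: "M \<in> MG a \<and> (1 + c1 / 2) * MF a b A \<le> MF a b M"
    if A: "symform A" "(\<lambda>v w. A v w - r * (v \<bullet> w)) \<in> MG a" "\<forall>w. \<bar>A w w\<bar> \<le> R * (norm w)^2" and u: "norm u = 1"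
      and M: "M = (\<lambda>v w. A v w + ((u \<bullet> v) * (u \<bullet> w) - \<eta> * (v \<bullet> w)))" for A M and u :: 'a
  proof -
    have sM: "symform M" unfolding M by (intro symform_add symform_diff symform_cmult symform_inner symform_sq A)
    obtain f l where f: "eigf M f l" using eigf_exists[OF sM] by blast
    have of: "onb f" using f by (simp add: eigf_def)
    have ff: "f i \<bullet> f i = 1" if "i \<in> Basis" for i using of that by (simp add: onb_def)
    let ?d = "\<lambda>i. A (f i) (f i)"
    have l: "l i = ?d i + ((u \<bullet> f i)^2 - \<eta>)" if "i \<in> Basis" for i
    proof -
      have "M (f i) (f i) = l i" using f that ff[OF that] by (simp add: eigf_def)
      then show ?thesis using ff[OF that] by (simp add: M power2_eq_square)
    qed
    have sAr: "symform (\<lambda>v w. A v w - r * (v \<bullet> w))" by (intro symform_diff symform_cmult symform_inner A)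
    have "(\<lambda>i. A (f i) (f i) - r * (f i \<bullet> f i)) \<in> gcone Basis a" using schur_diag(1)[OF sAr A(2) of ab(1)] .
    then have dr: "(\<lambda>i. ?d i - r) \<in> gcone Basis a" by (rule gcone_up[rotated]) (auto simp: ff)
    have dR: "\<forall>i\<in>Basis. \<bar>?d i\<bar> \<le> R"
    proof
      fix i :: 'a assume "i \<in> Basis"
      then have "norm (f i) = 1" using ff by (simp add: norm_eq_1)
      then show "\<bar>?d i\<bar> \<le> R" using A(3)[rule_format, of "f i"] by simp
    qed
    have "\<exists>i\<in>Basis. 1 / ?N \<le> (u \<bullet> f i)^2"
    proof (rule ccontr)
      assume "\<not> ?thesis"
      then have "(\<Sum>i\<in>Basis. (u \<bullet> f i)^2) < (\<Sum>i\<in>(Basis :: 'a set). 1 / ?N)" by (intro sum_strict_mono) auto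
      then show False using onb_norm[OF of, of u] u by simp
    qed
    then obtain i where i: "i \<in> Basis" "1 / ?N \<le> (u \<bullet> f i)^2" by blast
    let ?p = "?d(i := ?d i + 1 / ?N)"
    have pr: "(\<lambda>j. ?p j - r) \<in> gcone Basis a" using N by (intro gcone_up[OF _ dr]) auto
    have pG: "?p \<in> gcone Basis a" using r by (intro gcone_up[OF _ pr]) auto
    have g: "(\<lambda>j. (1 - \<eta> / r) * ?p j) \<in> gcone Basis a" "(\<lambda>j. \<eta> / r * (?p j - r)) \<in> gcone Basis a"
      using gcone_scale[OF _ pG, of "1 - \<eta> / r"] gcone_scale[OF _ pr, of "\<eta> / r"] \<eta> r by auto
    have sp: "(\<lambda>j. (1 - \<eta> / r) * ?p j + \<eta> / r * (?p j - r)) = (\<lambda>j. ?p j - \<eta>)"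
      using r by (auto simp: field_simps)
    have pe: "(\<lambda>j. ?p j - \<eta>) \<in> gcone Basis a" using gcone_add[OF _ g] unfolding sp by simp
    have ple: "?p j - \<eta> \<le> l j" if "j \<in> Basis" for j using l[OF that] i by auto
    have lG: "l \<in> gcone Basis a" using gcone_up[OF _ pe, of l] ple by simp
    have "(1 + c1 / 2) * MF a b A \<le> (1 + c1 / 2) * FQ Basis a b ?d"
      using schur_diag(2)[OF A(1) AG[OF A(1,2)] of ab(1)] c1 by (intro mult_left_mono) auto
    also have "\<dots> = (1 - \<eta> / r) * ((1 + c1) * FQ Basis a b ?d)" using \<eta>(3) by (simp add: mult.assoc[symmetric])
    also have "\<dots> \<le> (1 - \<eta> / r) * FQ Basis a b ?p" using gain[OF dr dR i(1)] \<eta> by (intro mult_left_mono) auto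
    also have "\<dots> = FQ Basis a b (\<lambda>j. (1 - \<eta> / r) * ?p j)" using FQ_scale[OF _ _ ab(1) pG, of "1 - \<eta> / r"] \<eta> by simp
    also have "\<dots> \<le> FQ Basis a b (\<lambda>j. ?p j - \<eta>)"
      using FQ_superadd[OF _ g ab(1)] FQ_pos[OF _ g(2) ab(1)] unfolding sp by simp
    also have "\<dots> \<le> FQ Basis a b l" using FQ_mono[OF _ pe ab(1), of l] ple by simp
    finally show ?thesis using MF_eigf[OF sM f, of a b] MG_eigf[OF sM f, of a] lG by simp
  qed
  show ?thesis
  proof (rule exI[of _ "c1 / 2"], rule conjI, use c1 in simp, rule exI[of _ \<eta>], intro conjI allI impI)
    fix A B :: "'a \<Rightarrow> 'a \<Rightarrow> real" and u :: 'a and \<tau> :: real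
    assume H: "symform A \<and> (\<lambda>v w. A v w - r * (v \<bullet> w)) \<in> MG a \<and> (\<forall>w. \<bar>A w w\<bar> \<le> R * (norm w)^2) \<and> norm u = 1 \<and>
     0 \<le> \<tau> \<and> \<tau> \<le> 1 \<and> symform B \<and> (\<forall>w. A w w + \<tau> * ((u \<bullet> w)^2 - \<eta> * (norm w)^2) \<le> B w w)"
    define M where "M = (\<lambda>v w. A v w + ((u \<bullet> v) * (u \<bullet> w) - \<eta> * (v \<bullet> w)))"
    have sM: "symform M" unfolding M_def using H by (intro symform_add symform_diff symform_cmult symform_inner symform_sq) auto
    have A: "symform A" "A \<in> MG a" using H AG by auto
    have mm: "M \<in> MG a" "(1 + c1 / 2) * MF a b A \<le> MF a b M" using main[of A u M] H M_def by auto
    define L where "L = (\<lambda>v w. (1 - \<tau>) * A v w + \<tau> * M v w)"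
    have sL: "symform L" unfolding L_def by (intro symform_add symform_cmult A sM)
    have LL: "L \<in> MG a \<and> (1 + \<tau> * (c1 / 2)) * MF a b A \<le> MF a b L"
    proof -
      consider "\<tau> = 0" | "\<tau> = 1" | "0 < \<tau>" "\<tau> < 1" using H by linarith
      then show ?thesis
      proof cases
        case 3
        note f1 = form_scale[OF A _ ab(1), of "1 - \<tau>"] and f2 = form_scale[OF sM mm(1) 3(1) ab(1)]
        have "(1 + \<tau> * (c1 / 2)) * MF a b A = (1 - \<tau>) * MF a b A + \<tau> * ((1 + c1 / 2) * MF a b A)" by (simp add: algebra_simps)
        also have "\<dots> \<le> (1 - \<tau>) * MF a b A + \<tau> * MF a b M" using mm(2) 3 by (intro add_left_mono mult_left_mono) auto
        also have "\<dots> \<le> MF a b L"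
          using form_superadd(2)[OF symform_cmult[OF A(1)] f1(1) symform_cmult[OF sM] f2(1) ab(1)] f1(2) f2(2) 3 by (simp add: L_def)
        finally show ?thesis
          using form_superadd(1)[OF symform_cmult[OF A(1)] f1(1) symform_cmult[OF sM] f2(1) ab(1)] 3 by (simp add: L_def)
      qed (use A mm in \<open>auto simp: L_def\<close>)
    qed
    have "L w w \<le> B w w" for w
    proof -
      have "L w w = A w w + \<tau> * ((u \<bullet> w)^2 - \<eta> * (norm w)^2)"
        unfolding L_def M_def power2_norm_eq_inner by (simp add: algebra_simps power2_eq_square)
      then show ?thesis using H by auto
    qed
    then show "B \<in> MG a" "(1 + \<tau> * (c1 / 2)) * MF a b A \<le> MF a b B"
      using form_mono[OF sL _ _ _ ab(1), of B] LL H by force+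
  qed (use \<eta> in auto)
qed

section \<open>Smooth functions\<close>

definition Cinf :: "'a::euclidean_space set \<Rightarrow> ('a \<Rightarrow> real) \<Rightarrow> bool" where
  "Cinf S f \<longleftrightarrow> (\<forall>k. Ck_on k f S)"

lemma Ck_on_cong:
  assumes "open S" "\<And>x. x \<in> S \<Longrightarrow> f x = g x" "Ck_on k f S" shows "Ck_on k g S"
proof (cases k)
  case 0 then show ?thesis using assms continuous_on_cong[of S S f g] by simp
next
  case (Suc j)
  then obtain f' where "\<forall>x\<in>S. (f has_derivative f' x) (at x)" "\<forall>v. Ck_on j (\<lambda>x. f' x v) S"
    using assms(3) by auto
  then show ?thesis using Suc assms
    by (auto intro!: exI[of _ f'] has_derivative_transform_within_open[of f _ _ UNIV S g])
qed

lemma Ck_on_SucD: "Ck_on (Suc k) f S \<Longrightarrow> Ck_on k f S"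
proof (induction k arbitrary: f)
  case 0
  then obtain f' where "\<forall>x\<in>S. (f has_derivative f' x) (at x)" by auto
  then show ?case by (simp, meson continuous_at_imp_continuous_on has_derivative_continuous)
next
  case (Suc k)
  then obtain f' where "\<forall>x\<in>S. (f has_derivative f' x) (at x)" "\<forall>v. Ck_on (Suc k) (\<lambda>x. f' x v) S"
    by auto
  then show ?case using Suc.IH by auto
qed

lemma Ck_on_subset: "Ck_on k f S \<Longrightarrow> T \<subseteq> S \<Longrightarrow> Ck_on k f T"
proof (induction k arbitrary: f)
  case 0 then show ?case by (auto intro: continuous_on_subset)
next
  case (Suc k)
  then obtain f' where "\<forall>x\<in>S. (f has_derivative f' x) (at x)" "\<forall>v. Ck_on k (\<lambda>x. f' x v) S"
    by auto
  then show ?case using Suc by (auto intro!: exI[of _ f'])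
qed

lemma Ck_on_const: "Ck_on k (\<lambda>x. c) S"
  by (induction k arbitrary: c) (auto intro!: exI[of _ "\<lambda>_ _. 0"])

lemma Ck_on_linear: "bounded_linear L \<Longrightarrow> Ck_on k L S"
  by (cases k) (auto intro!: exI[of _ "\<lambda>_. L"] Ck_on_const linear_continuous_on bounded_linear_imp_has_derivative)

lemma Ck_on_add: "Ck_on k f S \<Longrightarrow> Ck_on k g S \<Longrightarrow> Ck_on k (\<lambda>x. f x + g x) S"
proof (induction k arbitrary: f g)
  case 0 then show ?case by (auto intro: continuous_intros)
next
  case (Suc k)
  obtain f' g' where "\<forall>x\<in>S. (f has_derivative f' x) (at x)" "\<forall>v. Ck_on k (\<lambda>x. f' x v) S"
    "\<forall>x\<in>S. (g has_derivative g' x) (at x)" "\<forall>v. Ck_on k (\<lambda>x. g' x v) S"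
    using Suc.prems by auto
  then show ?case using Suc.IH
    by (auto intro!: exI[of _ "\<lambda>x v. f' x v + g' x v"] has_derivative_add)
qed

lemma Ck_on_mult: "Ck_on k f S \<Longrightarrow> Ck_on k g S \<Longrightarrow> Ck_on k (\<lambda>x. f x * g x) S"
proof (induction k arbitrary: f g)
  case 0 then show ?case by (auto intro: continuous_intros)
next
  case (Suc k)
  obtain f' g' where fg: "\<forall>x\<in>S. (f has_derivative f' x) (at x)" "\<forall>v. Ck_on k (\<lambda>x. f' x v) S"
    "\<forall>x\<in>S. (g has_derivative g' x) (at x)" "\<forall>v. Ck_on k (\<lambda>x. g' x v) S"
    using Suc.prems by auto
  have "Ck_on k f S" "Ck_on k g S" using Suc.prems Ck_on_SucD by blast+
  then show ?case using fg Suc.IH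
    by (auto intro!: exI[of _ "\<lambda>x v. f x * g' x v + f' x v * g x"] has_derivative_mult Ck_on_add)
qed

lemma Ck_on_cmult: "Ck_on k f S \<Longrightarrow> Ck_on k (\<lambda>x. c * f x) S"
  by (intro Ck_on_mult Ck_on_const)

lemma Ck_on_sum: "(\<And>i. i \<in> I \<Longrightarrow> Ck_on k (f i) S) \<Longrightarrow> Ck_on k (\<lambda>x. \<Sum>i\<in>I. f i x) S"
  by (induction I rule: infinite_finite_induct) (auto intro: Ck_on_const Ck_on_add)

lemma Ck_on_inverse:
  "Ck_on k f S \<Longrightarrow> (\<And>x. x \<in> S \<Longrightarrow> f x \<noteq> 0) \<Longrightarrow> Ck_on k (\<lambda>x. inverse (f x)) S"
proof (induction k)
  case 0 then show ?case by (auto intro: continuous_intros)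
next
  case (Suc k)
  obtain f' where f': "\<forall>x\<in>S. (f has_derivative f' x) (at x)" "\<forall>v. Ck_on k (\<lambda>x. f' x v) S"
    using Suc.prems by auto
  have IH: "Ck_on k (\<lambda>x. inverse (f x)) S" using Suc Ck_on_SucD by blast
  have "((\<lambda>x. inverse (f x)) has_derivative (\<lambda>v. (-1) * (inverse (f x) * f' x v * inverse (f x)))) (at x)" if "x \<in> S" for x
    using Deriv.has_derivative_inverse[OF Suc.prems(2)[OF that] f'(1)[rule_format, OF that]] by simp
  moreover have "Ck_on k (\<lambda>x. (-1) * (inverse (f x) * f' x v * inverse (f x))) S" for v
    using IH f' by (intro Ck_on_cmult Ck_on_mult) auto
  ultimately show ?case
    unfolding Ck_on.simps by (intro exI[of _ "\<lambda>x v. (-1) * (inverse (f x) * f' x v * inverse (f x))"]) blast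
qed

lemma Ck_on_powr:
  "Ck_on k f S \<Longrightarrow> (\<And>x. x \<in> S \<Longrightarrow> f x > 0) \<Longrightarrow> Ck_on k (\<lambda>x. f x powr c) S"
proof (induction k arbitrary: c)
  case 0 then show ?case by (auto intro!: continuous_on_powr continuous_on_const simp: less_imp_neq[symmetric])
next
  case (Suc k)
  obtain f' where f': "\<forall>x\<in>S. (f has_derivative f' x) (at x)" "\<forall>v. Ck_on k (\<lambda>x. f' x v) S"
    using Suc.prems by auto
  have IH: "Ck_on k (\<lambda>x. f x powr d) S" for d using Suc Ck_on_SucD by blast
  have "((\<lambda>x. f x powr c) has_derivative (\<lambda>v. c * (f x powr (c - 1) * f' x v))) (at x)" if "x \<in> S" for x
  proof -
    have fx: "f x > 0" using Suc.prems that by blast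
    have "((\<lambda>y. y powr c) has_derivative (\<lambda>h. c * f x powr (c - 1) * h)) (at (f x))"
      using has_real_derivative_powr[OF fx, of c] by (simp add: has_field_derivative_def)
    from has_derivative_compose[OF f'(1)[rule_format, OF that] this] show ?thesis by (simp add: mult.assoc)
  qed
  moreover have "Ck_on k (\<lambda>x. c * (f x powr (c - 1) * f' x v)) S" for v
    using IH f' by (intro Ck_on_cmult Ck_on_mult) auto
  ultimately show ?case
    unfolding Ck_on.simps by (intro exI[of _ "\<lambda>x v. c * (f x powr (c - 1) * f' x v)"]) blast
qed

lemma Ck_on_exp: "Ck_on k f S \<Longrightarrow> Ck_on k (\<lambda>x. exp (f x)) S"
proof (induction k)
  case 0 then show ?case by (auto intro: continuous_intros)
next
  case (Suc k)
  obtain f' where f': "\<forall>x\<in>S. (f has_derivative f' x) (at x)" "\<forall>v. Ck_on k (\<lambda>x. f' x v) S"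
    using Suc.prems by auto
  have IH: "Ck_on k (\<lambda>x. exp (f x)) S" using Suc Ck_on_SucD by blast
  then show ?case using f'
    by (auto intro!: exI[of _ "\<lambda>x v. exp (f x) * f' x v"] Ck_on_mult derivative_eq_intros)
qed

lemma Ck_on_compose:
  fixes g :: "'b::euclidean_space \<Rightarrow> real" and h :: "'a::euclidean_space \<Rightarrow> 'b"
  shows "Ck_on k g U \<Longrightarrow> (\<And>b. b \<in> Basis \<Longrightarrow> Ck_on k (\<lambda>x. h x \<bullet> b) S) \<Longrightarrow> h ` S \<subseteq> U \<Longrightarrow> Ck_on k (\<lambda>x. g (h x)) S"
proof (induction k arbitrary: g)
  case 0
  then have "continuous_on S h" by (intro continuous_on_componentwise[THEN iffD2]) auto
  then show ?case using 0 continuous_on_compose2[of U g S h] by auto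
next
  case (Suc k)
  obtain g' where g': "\<forall>x\<in>U. (g has_derivative g' x) (at x)" "\<forall>v. Ck_on k (\<lambda>x. g' x v) U"
    using Suc.prems by auto
  have "\<exists>h'. (\<forall>x\<in>S. ((\<lambda>x. h x \<bullet> b) has_derivative h' x) (at x)) \<and> (\<forall>v. Ck_on k (\<lambda>x. h' x v) S)" if "b \<in> Basis" for b
    using Suc.prems(2)[OF that] by simp
  then obtain h' where h': "\<And>b x. b \<in> Basis \<Longrightarrow> x \<in> S \<Longrightarrow> ((\<lambda>x. h x \<bullet> b) has_derivative h' b x) (at x)"
    "\<And>b v. b \<in> Basis \<Longrightarrow> Ck_on k (\<lambda>x. h' b x v) S" by metis
  have hk: "\<And>b. b \<in> Basis \<Longrightarrow> Ck_on k (\<lambda>x. h x \<bullet> b) S" using Suc.prems Ck_on_SucD by blast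
  let ?H = "\<lambda>x v. \<Sum>b\<in>Basis. h' b x v *\<^sub>R b"
  have H: "(h has_derivative ?H x) (at x)" if x: "x \<in> S" for x
  proof -
    have "((\<lambda>x. h x \<bullet> b) has_derivative (\<lambda>v. ?H x v \<bullet> b)) (at x)" if "b \<in> Basis" for b
      using h'(1)[OF that x] that by (simp add: inner_sum_left_Basis)
    then show ?thesis using has_derivative_componentwise_within[of h "?H x" x UNIV] by simp
  qed
  have "((\<lambda>x. g (h x)) has_derivative (\<lambda>v. \<Sum>b\<in>Basis. h' b x v * g' (h x) b)) (at x)" if x: "x \<in> S" for x
  proof -
    have gd: "(g has_derivative g' (h x)) (at (h x))" using g' Suc.prems(3) x by blast
    have "((\<lambda>x. g (h x)) has_derivative (\<lambda>v. g' (h x) (?H x v))) (at x)"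
      using has_derivative_compose[OF H[OF x] gd] .
    moreover have "g' (h x) (?H x v) = (\<Sum>b\<in>Basis. h' b x v * g' (h x) b)" for v
      using has_derivative_linear[OF gd] by (simp add: linear_sum linear_cmul)
    ultimately show ?thesis by simp
  qed
  moreover have "Ck_on k (\<lambda>x. \<Sum>b\<in>Basis. h' b x v * g' (h x) b) S" for v
    using Suc.IH[OF _ hk Suc.prems(3)] g' h'(2) by (intro Ck_on_sum Ck_on_mult) auto
  ultimately show ?case
    unfolding Ck_on.simps by (intro exI[of _ "\<lambda>x v. \<Sum>b\<in>Basis. h' b x v * g' (h x) b"]) blast
qed

lemma Cinf_const [intro]: "Cinf S (\<lambda>x. c)" by (simp add: Cinf_def Ck_on_const)
lemma Cinf_linear: "bounded_linear L \<Longrightarrow> Cinf S L" by (simp add: Cinf_def Ck_on_linear)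
lemma Cinf_inner [intro]: "Cinf S (\<lambda>x. x \<bullet> c)" "Cinf S (\<lambda>x. c \<bullet> x)"
  by (auto intro!: Cinf_linear bounded_linear_inner_left bounded_linear_inner_right)
lemma Cinf_add [intro]: "Cinf S f \<Longrightarrow> Cinf S g \<Longrightarrow> Cinf S (\<lambda>x. f x + g x)" by (simp add: Cinf_def Ck_on_add)
lemma Cinf_mult [intro]: "Cinf S f \<Longrightarrow> Cinf S g \<Longrightarrow> Cinf S (\<lambda>x. f x * g x)" by (simp add: Cinf_def Ck_on_mult)
lemma Cinf_diff [intro]: "Cinf S f \<Longrightarrow> Cinf S g \<Longrightarrow> Cinf S (\<lambda>x. f x - g x)"
  using Cinf_add[of S f "\<lambda>x. (-1) * g x"] Cinf_mult[OF Cinf_const[of S "-1"], of g] by simp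
lemma Cinf_sum [intro]: "(\<And>i. i \<in> I \<Longrightarrow> Cinf S (f i)) \<Longrightarrow> Cinf S (\<lambda>x. \<Sum>i\<in>I. f i x)" by (simp add: Cinf_def Ck_on_sum)
lemma Cinf_inverse: "Cinf S f \<Longrightarrow> (\<And>x. x \<in> S \<Longrightarrow> f x \<noteq> 0) \<Longrightarrow> Cinf S (\<lambda>x. inverse (f x))" by (simp add: Cinf_def Ck_on_inverse)
lemma Cinf_divide: "Cinf S f \<Longrightarrow> Cinf S g \<Longrightarrow> (\<And>x. x \<in> S \<Longrightarrow> g x \<noteq> 0) \<Longrightarrow> Cinf S (\<lambda>x. f x / g x)"
  unfolding divide_inverse by (intro Cinf_mult Cinf_inverse)
lemma Cinf_powr: "Cinf S f \<Longrightarrow> (\<And>x. x \<in> S \<Longrightarrow> f x > 0) \<Longrightarrow> Cinf S (\<lambda>x. f x powr c)" by (simp add: Cinf_def Ck_on_powr)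
lemma Cinf_exp [intro]: "Cinf S f \<Longrightarrow> Cinf S (\<lambda>x. exp (f x))" by (simp add: Cinf_def Ck_on_exp)
lemma Cinf_compose: "Cinf U g \<Longrightarrow> (\<And>b. b \<in> Basis \<Longrightarrow> Cinf S (\<lambda>x. h x \<bullet> b)) \<Longrightarrow> h ` S \<subseteq> U \<Longrightarrow> Cinf S (\<lambda>x. g (h x))"
  for h :: "'a::euclidean_space \<Rightarrow> 'b::euclidean_space" unfolding Cinf_def using Ck_on_compose[of _ g U h S] by blast
lemma Cinf_cong: "open S \<Longrightarrow> (\<And>x. x \<in> S \<Longrightarrow> f x = g x) \<Longrightarrow> Cinf S f \<Longrightarrow> Cinf S g"
  unfolding Cinf_def using Ck_on_cong[of S f g] by blast
lemma Cinf_subset: "Cinf S f \<Longrightarrow> T \<subseteq> S \<Longrightarrow> Cinf T f" by (auto simp: Cinf_def intro: Ck_on_subset)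
lemma Cinf_continuous: "Cinf S f \<Longrightarrow> continuous_on S f" unfolding Cinf_def by (metis Ck_on.simps(1))

lemma Cinf_norm: "Cinf (- {0}) (\<lambda>x::'a::euclidean_space. norm x)"
proof (rule Cinf_cong)
  have "Cinf (- {0}) (\<lambda>x::'a. \<Sum>b\<in>Basis. (x \<bullet> b) * (x \<bullet> b))"
    by (intro Cinf_sum Cinf_mult Cinf_inner)
  then show "Cinf (- {0}) (\<lambda>x::'a. (x \<bullet> x) powr (1/2))"
    by (intro Cinf_powr) (auto simp: euclidean_inner[symmetric])
qed (auto simp: norm_eq_sqrt_inner powr_half_sqrt)

section \<open>First and second derivatives\<close>

definition D1 :: "('a::euclidean_space \<Rightarrow> real) \<Rightarrow> 'a \<Rightarrow> 'a \<Rightarrow> real" where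
  "D1 f x v = frechet_derivative f (at x) v"

definition D2 :: "('a::euclidean_space \<Rightarrow> real) \<Rightarrow> 'a \<Rightarrow> 'a \<Rightarrow> 'a \<Rightarrow> real" where
  "D2 f x v w = D1 (\<lambda>y. D1 f y w) x v"

lemma D1_eq: "(f has_derivative f') (at x) \<Longrightarrow> D1 f x = f'"
  unfolding D1_def using frechet_derivative_at by metis

lemma D1_has: "Cinf S f \<Longrightarrow> x \<in> S \<Longrightarrow> (f has_derivative D1 f x) (at x)"
proof -
  assume "Cinf S f" "x \<in> S"
  then have "Ck_on (Suc 0) f S" by (simp only: Cinf_def)
  then obtain f' where "(f has_derivative f') (at x)" using \<open>x \<in> S\<close> by auto
  then show ?thesis using D1_eq by metis
qed

lemma Cinf_D1: assumes "Cinf S f" "open S" shows "Cinf S (\<lambda>x. D1 f x v)"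
  unfolding Cinf_def
proof
  fix k
  obtain f' where f': "\<forall>x\<in>S. (f has_derivative f' x) (at x)" "\<forall>v. Ck_on k (\<lambda>x. f' x v) S"
    using assms(1)[unfolded Cinf_def, rule_format, of "Suc k"] by auto
  then have "f' x v = D1 f x v" if "x \<in> S" for x using that D1_eq by metis
  then show "Ck_on k (\<lambda>x. D1 f x v) S" by (rule Ck_on_cong[OF assms(2) _ f'(2)[rule_format, of v]])
qed

lemma Cinf_D2: assumes "Cinf S f" "open S" shows "Cinf S (\<lambda>x. D2 f x v w)"
  unfolding D2_def by (intro Cinf_D1 assms)

lemma D1_linear: "Cinf S f \<Longrightarrow> x \<in> S \<Longrightarrow> linear (D1 f x)"
  using D1_has has_derivative_linear by blast

lemma D1_add: "Cinf S f \<Longrightarrow> x \<in> S \<Longrightarrow> D1 f x (v + w) = D1 f x v + D1 f x w"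
  using linear_add[OF D1_linear] .
lemma D1_scale: "Cinf S f \<Longrightarrow> x \<in> S \<Longrightarrow> D1 f x (c *\<^sub>R v) = c * D1 f x v"
  using linear_cmul[OF D1_linear] by fastforce

lemma deriv_line:
  assumes "Cinf S f" "x + s *\<^sub>R w \<in> S"
  shows "((\<lambda>t. f (x + t *\<^sub>R w)) has_real_derivative D1 f (x + s *\<^sub>R w) w) (at s)"
proof -
  have "((\<lambda>t. x + t *\<^sub>R w) has_derivative (\<lambda>t. t *\<^sub>R w)) (at s)" by (auto intro!: derivative_eq_intros)
  from has_derivative_compose[OF this D1_has[OF assms]]
  have "((\<lambda>t. f (x + t *\<^sub>R w)) has_derivative (\<lambda>t. D1 f (x + s *\<^sub>R w) (t *\<^sub>R w))) (at s)" .
  moreover have "D1 f (x + s *\<^sub>R w) (t *\<^sub>R w) = D1 f (x + s *\<^sub>R w) w * t" for t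
    using D1_scale[OF assms] by simp
  ultimately show ?thesis by (simp add: has_field_derivative_def)
qed

text \<open>The value and the first two derivatives at \<open>0\<close> of a function of one real variable. All second
  variations below are computed by adding and multiplying such jets along lines.\<close>

definition jet2 :: "(real \<Rightarrow> real) \<Rightarrow> real \<Rightarrow> real \<Rightarrow> real \<Rightarrow> bool" where
  "jet2 h h0 h1 h2 \<longleftrightarrow> h 0 = h0 \<and> (\<exists>h'. (\<forall>\<^sub>F s in nhds 0. (h has_real_derivative h' s) (at s)) \<and> h' 0 = h1 \<and>
      (h' has_real_derivative h2) (at 0))"

lemma jet2_const: "jet2 (\<lambda>_. c) c 0 0"
  by (auto simp: jet2_def intro!: exI[of _ "\<lambda>_. 0"])

lemma jet2_add:
  assumes "jet2 f f0 f1 f2" "jet2 g g0 g1 g2"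
  shows "jet2 (\<lambda>s. f s + g s) (f0 + g0) (f1 + g1) (f2 + g2)"
proof -
  obtain f' g' where *: "\<forall>\<^sub>F s in nhds 0. (f has_real_derivative f' s) (at s)" "f' 0 = f1" "(f' has_real_derivative f2) (at 0)"
    "\<forall>\<^sub>F s in nhds 0. (g has_real_derivative g' s) (at s)" "g' 0 = g1" "(g' has_real_derivative g2) (at 0)"
    using assms by (auto simp: jet2_def)
  have "\<forall>\<^sub>F s in nhds 0. ((\<lambda>s. f s + g s) has_real_derivative f' s + g' s) (at s)"
    using *(1,4) by eventually_elim (rule DERIV_add)
  then show ?thesis using assms * by (auto simp: jet2_def intro!: exI[of _ "\<lambda>s. f' s + g' s"] DERIV_add)
qed

lemma jet2_mult:
  assumes "jet2 f f0 f1 f2" "jet2 g g0 g1 g2"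
  shows "jet2 (\<lambda>s. f s * g s) (f0 * g0) (f1 * g0 + f0 * g1) (f2 * g0 + 2 * f1 * g1 + f0 * g2)"
proof -
  obtain f' g' where *: "\<forall>\<^sub>F s in nhds 0. (f has_real_derivative f' s) (at s)" "f' 0 = f1" "(f' has_real_derivative f2) (at 0)"
    "\<forall>\<^sub>F s in nhds 0. (g has_real_derivative g' s) (at s)" "g' 0 = g1" "(g' has_real_derivative g2) (at 0)"
    using assms by (auto simp: jet2_def)
  have f0: "f 0 = f0" "g 0 = g0" using assms by (auto simp: jet2_def)
  have d: "(f has_real_derivative f1) (at 0)" "(g has_real_derivative g1) (at 0)"
    using *(1,4) *(2,5) eventually_nhds_x_imp_x by blast+
  have "\<forall>\<^sub>F s in nhds 0. ((\<lambda>s. f s * g s) has_real_derivative f' s * g s + g' s * f s) (at s)"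
    using *(1,4) by eventually_elim (rule DERIV_mult)
  moreover have "((\<lambda>s. f' s * g s + g' s * f s) has_real_derivative f2 * g0 + 2 * f1 * g1 + f0 * g2) (at 0)"
    by (rule derivative_eq_intros *(3,6) d refl)+ (simp add: f0 *(2,5))
  ultimately show ?thesis using * f0 by (auto simp: jet2_def intro!: exI[of _ "\<lambda>s. f' s * g s + g' s * f s"])
qed

lemma jet2_cmult: "jet2 f f0 f1 f2 \<Longrightarrow> jet2 (\<lambda>s. c * f s) (c * f0) (c * f1) (c * f2)"
  using jet2_mult[OF jet2_const, of f f0 f1 f2 c] by simp

lemma jet2_diff: "jet2 f f0 f1 f2 \<Longrightarrow> jet2 g g0 g1 g2 \<Longrightarrow> jet2 (\<lambda>s. f s - g s) (f0 - g0) (f1 - g1) (f2 - g2)"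
  using jet2_add[of f f0 f1 f2, OF _ jet2_cmult[of g g0 g1 g2 "-1"]] by simp

lemma jet2_sum: "finite I \<Longrightarrow> (\<And>i. i \<in> I \<Longrightarrow> jet2 (f i) (f0 i) (f1 i) (f2 i)) \<Longrightarrow>
   jet2 (\<lambda>s. \<Sum>i\<in>I. f i s) (\<Sum>i\<in>I. f0 i) (\<Sum>i\<in>I. f1 i) (\<Sum>i\<in>I. f2 i)"
  by (induction I rule: finite_induct) (auto intro: jet2_add jet2_const)

lemma jet2_exp:
  assumes "jet2 f f0 f1 f2"
  shows "jet2 (\<lambda>s. exp (f s)) (exp f0) (exp f0 * f1) (exp f0 * (f2 + f1^2))"
proof -
  obtain f' where *: "\<forall>\<^sub>F s in nhds 0. (f has_real_derivative f' s) (at s)" "f' 0 = f1" "(f' has_real_derivative f2) (at 0)"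
    using assms by (auto simp: jet2_def)
  have f0: "f 0 = f0" using assms by (auto simp: jet2_def)
  have d: "(f has_real_derivative f1) (at 0)"
    using * eventually_nhds_x_imp_x by blast
  have "\<forall>\<^sub>F s in nhds 0. ((\<lambda>s. exp (f s)) has_real_derivative exp (f s) * f' s) (at s)"
    using *(1) by eventually_elim (auto intro!: derivative_eq_intros)
  moreover have "((\<lambda>s. exp (f s) * f' s) has_real_derivative exp f0 * (f2 + f1^2)) (at 0)"
    by (rule derivative_eq_intros *(3) d refl)+ (simp add: f0 *(2) algebra_simps power2_eq_square)
  ultimately show ?thesis using * f0 by (auto simp: jet2_def intro!: exI[of _ "\<lambda>s. exp (f s) * f' s"])
qed

lemma jet2_unique:
  assumes "jet2 f f0 f1 f2" "jet2 f g0 g1 g2" shows "f1 = g1" "f2 = g2"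
proof -
  obtain f' g' where *: "\<forall>\<^sub>F s in nhds 0. (f has_real_derivative f' s) (at s)" "f' 0 = f1" "(f' has_real_derivative f2) (at 0)"
    "\<forall>\<^sub>F s in nhds 0. (f has_real_derivative g' s) (at s)" "g' 0 = g1" "(g' has_real_derivative g2) (at 0)"
    using assms by (auto simp: jet2_def)
  have e: "\<forall>\<^sub>F s in nhds 0. f' s = g' s" using *(1,4) by eventually_elim (rule DERIV_unique)
  then show "f1 = g1" using *(2,5) eventually_nhds_x_imp_x by force
  have "(f' has_real_derivative g2) (at 0)" using *(6) e by (subst DERIV_cong_ev[OF refl e refl])
  then show "f2 = g2" using *(3) DERIV_unique by blast
qed

lemma jet2_min:
  assumes "jet2 f f0 f1 f2" "\<forall>\<^sub>F s in nhds 0. f s \<ge> f 0"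
  shows "f1 = 0" "f2 \<ge> 0"
proof -
  obtain f' where *: "\<forall>\<^sub>F s in nhds 0. (f has_real_derivative f' s) (at s)" "f' 0 = f1" "(f' has_real_derivative f2) (at 0)"
    using assms by (auto simp: jet2_def)
  obtain d where d: "d > 0" "\<And>s. \<bar>s\<bar> < d \<Longrightarrow> (f has_real_derivative f' s) (at s) \<and> f s \<ge> f 0"
    using eventually_conj[OF *(1) assms(2)] unfolding eventually_nhds_metric by (auto simp: dist_real_def)
  show f1: "f1 = 0"
    using DERIV_local_min[of f f1 0 d] d *(2) by auto
  show "f2 \<ge> 0"
  proof (rule ccontr)
    assume "\<not> f2 \<ge> 0"
    then obtain e where e: "e > 0" "\<And>h. 0 < h \<Longrightarrow> h < e \<Longrightarrow> f' (0 + h) < f' 0"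
      using DERIV_neg_dec_right[OF *(3)] by force
    define h where "h = min d e / 2"
    have h: "0 < h" "h < d" "h < e" using d e by (auto simp: h_def min_def)
    obtain z where z: "0 < z" "z < h" "f h - f 0 = (h - 0) * f' z"
      using MVT2[of 0 h f f'] h d(2) by fastforce
    have "f' z < 0" using e(2)[of z] z h f1 *(2) by auto
    then have "(h - 0) * f' z < 0" using h by (simp add: mult_pos_neg)
    then have "f h < f 0" using z(3) by linarith
    then show False using d(2)[of h] h by auto
  qed
qed

lemma jet2_line:
  assumes "Cinf S f" "open S" "x \<in> S"
  shows "jet2 (\<lambda>s. f (x + s *\<^sub>R w)) (f x) (D1 f x w) (D2 f x w w)"
proof -
  have "((\<lambda>s::real. x + s *\<^sub>R w) \<longlongrightarrow> x + 0 *\<^sub>R w) (nhds 0)" by (intro tendsto_intros filterlim_ident)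
  then have "\<forall>\<^sub>F s in nhds 0. x + s *\<^sub>R w \<in> S" using assms topological_tendstoD by fastforce
  then have "\<forall>\<^sub>F s in nhds 0. ((\<lambda>t. f (x + t *\<^sub>R w)) has_real_derivative D1 f (x + s *\<^sub>R w) w) (at s)"
    by eventually_elim (rule deriv_line[OF assms(1)])
  moreover have "((\<lambda>s. D1 f (x + s *\<^sub>R w) w) has_real_derivative D2 f x w w) (at 0)"
    using deriv_line[OF Cinf_D1[OF assms(1,2)], of x 0 w w] assms(3) by (simp add: D2_def)
  ultimately show ?thesis by (auto simp: jet2_def intro!: exI[of _ "\<lambda>s. D1 f (x + s *\<^sub>R w) w"])
qed

lemma continuous_near:
  fixes g :: "'a::euclidean_space \<Rightarrow> real"
  assumes "continuous_on S g" "open S" "x \<in> S" "e > 0"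
  shows "\<forall>\<^sub>F y in nhds x. dist (g y) (g x) < e"
proof -
  have "isCont g x" using assms by (simp add: continuous_on_eq_continuous_at)
  then obtain d where "d > 0" "\<And>y. dist y x < d \<Longrightarrow> dist (g y) (g x) < e"
    using assms(4) unfolding continuous_at_eps_delta by (auto simp: dist_norm)
  then show ?thesis unfolding eventually_nhds_metric by blast
qed

text \<open>Two applications of the mean value theorem. Since the second difference is symmetric in \<open>v\<close> and \<open>w\<close>,
  continuity of the second derivatives gives their symmetry.\<close>

lemma second_difference:
  assumes f: "Cinf S f" and S: "open S" and t: "t > 0"
    and B: "\<And>p q. 0 \<le> p \<Longrightarrow> p \<le> t \<Longrightarrow> 0 \<le> q \<Longrightarrow> q \<le> t \<Longrightarrow> x + p *\<^sub>R v + q *\<^sub>R w \<in> S"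
  shows "\<exists>p q. 0 \<le> p \<and> p \<le> t \<and> 0 \<le> q \<and> q \<le> t \<and>
     f (x + t *\<^sub>R v + t *\<^sub>R w) - f (x + t *\<^sub>R v) - f (x + t *\<^sub>R w) + f x = t^2 * D2 f (x + p *\<^sub>R v + q *\<^sub>R w) w v"
proof -
  let ?g = "\<lambda>p. f (x + t *\<^sub>R w + p *\<^sub>R v) - f (x + p *\<^sub>R v)"
  have dg: "(?g has_real_derivative D1 f (x + t *\<^sub>R w + p *\<^sub>R v) v - D1 f (x + p *\<^sub>R v) v) (at p)" if "0 \<le> p" "p \<le> t" for p
    using B[OF that, of t] B[OF that, of 0] t by (intro DERIV_diff deriv_line[OF f]) (auto simp: add_ac)
  obtain p where p: "0 < p" "p < t" "?g t - ?g 0 = (t - 0) * (D1 f (x + t *\<^sub>R w + p *\<^sub>R v) v - D1 f (x + p *\<^sub>R v) v)"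
    using MVT2[where f = ?g and f' = "\<lambda>p. D1 f (x + t *\<^sub>R w + p *\<^sub>R v) v - D1 f (x + p *\<^sub>R v) v", OF t dg] by blast
  let ?h = "\<lambda>q. D1 f (x + p *\<^sub>R v + q *\<^sub>R w) v"
  have dh: "(?h has_real_derivative D2 f (x + p *\<^sub>R v + q *\<^sub>R w) w v) (at q)" if "0 \<le> q" "q \<le> t" for q
    unfolding D2_def using B[of p q] p that by (intro deriv_line[OF Cinf_D1[OF f S]]) auto
  obtain q where q: "0 < q" "q < t" "?h t - ?h 0 = (t - 0) * D2 f (x + p *\<^sub>R v + q *\<^sub>R w) w v"
    using MVT2[where f = ?h and f' = "\<lambda>q. D2 f (x + p *\<^sub>R v + q *\<^sub>R w) w v", OF t dh] by blast
  have "f (x + t *\<^sub>R v + t *\<^sub>R w) - f (x + t *\<^sub>R v) - f (x + t *\<^sub>R w) + f x = t^2 * D2 f (x + p *\<^sub>R v + q *\<^sub>R w) w v"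
    using p(3) q(3) by (simp add: add_ac power2_eq_square algebra_simps)
  then show ?thesis using p q by (intro exI[of _ p] exI[of _ q]) auto
qed

lemma D2_commute:
  assumes f: "Cinf S f" and S: "open S" and x: "x \<in> S"
  shows "D2 f x v w = D2 f x w v"
proof (rule ccontr)
  assume ne: "D2 f x v w \<noteq> D2 f x w v"
  define e where "e = \<bar>D2 f x v w - D2 f x w v\<bar> / 2"
  have e: "e > 0" using ne by (simp add: e_def)
  have "\<forall>\<^sub>F y in nhds x. dist (D2 f y a b) (D2 f x a b) < e" for a b
    by (rule continuous_near[OF Cinf_continuous[OF Cinf_D2[OF f S]] S x e])
  moreover have "\<forall>\<^sub>F y in nhds x. y \<in> S" using S x eventually_nhds by blast
  ultimately have "\<forall>\<^sub>F y in nhds x. y \<in> S \<and> dist (D2 f y v w) (D2 f x v w) < e \<and> dist (D2 f y w v) (D2 f x w v) < e"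
    by (intro eventually_conj)
  then obtain d where d: "d > 0" "\<And>y. dist y x < d \<Longrightarrow> y \<in> S \<and> dist (D2 f y v w) (D2 f x v w) < e \<and> dist (D2 f y w v) (D2 f x w v) < e"
    unfolding eventually_nhds_metric by blast
  define t where "t = d / (norm v + norm w + 1)"
  have np: "norm v + norm w + 1 > 0" by (smt (verit) norm_ge_zero)
  have t: "t > 0" "t * (norm v + norm w) < d"
    using d np by (auto simp: t_def field_simps)
  have near: "dist (x + p *\<^sub>R a + q *\<^sub>R b) x < d" if "0 \<le> p" "p \<le> t" "0 \<le> q" "q \<le> t" "(a = v \<and> b = w) \<or> (a = w \<and> b = v)" for p q a b
  proof -
    have "norm (p *\<^sub>R a + q *\<^sub>R b) \<le> p * norm a + q * norm b" using that norm_triangle_ineq[of "p *\<^sub>R a" "q *\<^sub>R b"] by simp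
    also have "\<dots> \<le> t * norm a + t * norm b" using that by (intro add_mono mult_right_mono) auto
    also have "\<dots> < d" using t(2) that(5) by (auto simp: algebra_simps)
    finally show ?thesis by (simp add: dist_norm add.assoc)
  qed
  obtain p q where 1: "0 \<le> p" "p \<le> t" "0 \<le> q" "q \<le> t"
     "f (x + t *\<^sub>R v + t *\<^sub>R w) - f (x + t *\<^sub>R v) - f (x + t *\<^sub>R w) + f x = t^2 * D2 f (x + p *\<^sub>R v + q *\<^sub>R w) w v"
    using second_difference[OF f S t(1), of x v w] near d(2) by blast
  obtain p' q' where 2: "0 \<le> p'" "p' \<le> t" "0 \<le> q'" "q' \<le> t"
     "f (x + t *\<^sub>R w + t *\<^sub>R v) - f (x + t *\<^sub>R w) - f (x + t *\<^sub>R v) + f x = t^2 * D2 f (x + p' *\<^sub>R w + q' *\<^sub>R v) v w"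
    using second_difference[OF f S t(1), of x w v] near d(2) by blast
  have "t^2 * D2 f (x + p *\<^sub>R v + q *\<^sub>R w) w v = t^2 * D2 f (x + p' *\<^sub>R w + q' *\<^sub>R v) v w"
  proof -
    have e: "x + t *\<^sub>R w + t *\<^sub>R v = x + t *\<^sub>R v + t *\<^sub>R w" by (simp add: add_ac)
    show ?thesis using 1(5) 2(5)[unfolded e] by linarith
  qed
  then have "D2 f (x + p *\<^sub>R v + q *\<^sub>R w) w v = D2 f (x + p' *\<^sub>R w + q' *\<^sub>R v) v w" using t by simp
  then have "\<bar>D2 f x v w - D2 f x w v\<bar> < 2 * e"
  proof -
    have "\<bar>D2 f (x + p *\<^sub>R v + q *\<^sub>R w) w v - D2 f x w v\<bar> < e"
      using d(2)[OF near[OF 1(1-4), of v w]] by (simp add: dist_real_def)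
    moreover have "\<bar>D2 f (x + p' *\<^sub>R w + q' *\<^sub>R v) v w - D2 f x v w\<bar> < e"
      using d(2)[OF near[OF 2(1-4), of w v]] by (simp add: dist_real_def)
    ultimately show ?thesis
      using \<open>D2 f (x + p *\<^sub>R v + q *\<^sub>R w) w v = D2 f (x + p' *\<^sub>R w + q' *\<^sub>R v) v w\<close> by linarith
  qed
  then show False by (simp add: e_def)
qed

lemma symform_D2:
  assumes "Cinf S f" "open S" "x \<in> S" shows "symform (D2 f x)"
  by (rule symformI)
    (auto simp: D2_commute[OF assms] D2_def D1_add[OF Cinf_D1[OF assms(1,2)] assms(3)] D1_scale[OF Cinf_D1[OF assms(1,2)] assms(3)]
      intro: D2_commute[OF assms, unfolded D2_def])

lemma symform_expand:
  assumes "symform (A :: 'a::euclidean_space \<Rightarrow> 'a \<Rightarrow> real)"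
  shows "A v w = (\<Sum>b\<in>Basis. \<Sum>c\<in>Basis. (v \<bullet> b) * (w \<bullet> c) * A b c)"
proof -
  have "A v w = A (\<Sum>b\<in>Basis. (v \<bullet> b) *\<^sub>R b) (\<Sum>c\<in>Basis. (w \<bullet> c) *\<^sub>R c)" by (simp add: euclidean_representation)
  then show ?thesis unfolding symform_sum_left[OF assms] symform_sum_right[OF assms] symform_simps[OF assms]
    by (subst sum.swap) (simp add: sum_distrib_left algebra_simps)
qed

lemma symform_entry_bound:
  assumes "symform (A :: 'a::euclidean_space \<Rightarrow> 'a \<Rightarrow> real)" "\<And>b c. b \<in> Basis \<Longrightarrow> c \<in> Basis \<Longrightarrow> \<bar>A b c\<bar> \<le> K"
  shows "\<bar>A w w\<bar> \<le> real DIM('a)^2 * K * (norm w)^2"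
proof -
  have "\<bar>A w w\<bar> \<le> (\<Sum>b\<in>(Basis::'a set). \<Sum>c\<in>(Basis::'a set). (norm w)^2 * K)"
    unfolding symform_expand[OF assms(1), of w w]
  proof (intro order_trans[OF sum_abs] sum_mono)
    fix b c :: 'a assume bc: "b \<in> Basis" "c \<in> Basis"
    have "\<bar>w \<bullet> b\<bar> * \<bar>w \<bullet> c\<bar> * \<bar>A b c\<bar> \<le> (norm w * norm w) * K"
      using assms(2)[OF bc] bc by (intro mult_mono) (auto simp: Basis_le_norm)
    then show "\<bar>(w \<bullet> b) * (w \<bullet> c) * A b c\<bar> \<le> (norm w)^2 * K" by (simp add: abs_mult power2_eq_square)
  qed
  then show ?thesis by (simp add: power2_eq_square algebra_simps)
qed

lemma D2_bound_compact:
  fixes f :: "'a::euclidean_space \<Rightarrow> real"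
  assumes "Cinf S f" "open S" "compact K" "K \<subseteq> S"
  shows "\<exists>C>0. \<forall>x\<in>K. \<forall>w. \<bar>D2 f x w w\<bar> \<le> C * (norm w)^2"
proof -
  have "\<exists>M. \<forall>x\<in>K. \<bar>D2 f x b c\<bar> \<le> M" for b c
  proof -
    have "continuous_on K (\<lambda>x. D2 f x b c)"
      using Cinf_continuous[OF Cinf_D2[OF assms(1,2)]] assms(4) continuous_on_subset by blast
    then have "bounded ((\<lambda>x. D2 f x b c) ` K)" using assms(3) compact_continuous_image compact_imp_bounded by blast
    then show ?thesis unfolding bounded_iff by auto
  qed
  then obtain M where M: "\<And>b c x. x \<in> K \<Longrightarrow> \<bar>D2 f x b c\<bar> \<le> M b c" by metis
  define L where "L = (\<Sum>b\<in>(Basis::'a set). \<Sum>c\<in>(Basis::'a set). \<bar>M b c\<bar>) + 1"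
  have MLe: "\<bar>M b c\<bar> \<le> L" if "b \<in> Basis" "c \<in> Basis" for b c :: 'a
  proof -
    have "\<bar>M b c\<bar> \<le> (\<Sum>c\<in>Basis. \<bar>M b c\<bar>)" using that by (intro member_le_sum) auto
    also have "\<dots> \<le> (\<Sum>b\<in>(Basis::'a set). \<Sum>c\<in>(Basis::'a set). \<bar>M b c\<bar>)"
      using that by (intro member_le_sum[of b Basis "\<lambda>b. \<Sum>c\<in>Basis. \<bar>M b c\<bar>"]) (auto intro: sum_nonneg)
    finally show ?thesis by (simp add: L_def)
  qed
  have L: "L > 0" unfolding L_def by (intro add_nonneg_pos sum_nonneg) auto
  have "\<bar>D2 f x w w\<bar> \<le> real DIM('a)^2 * L * (norm w)^2" if "x \<in> K" for x w
  proof (rule symform_entry_bound[where A = "D2 f x" and K = L])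
    show "symform (D2 f x)" using symform_D2[OF assms(1,2)] that assms(4) by blast
    fix b c :: 'a assume "b \<in> Basis" "c \<in> Basis"
    then show "\<bar>D2 f x b c\<bar> \<le> L" using M[OF that, of b c] MLe[of b c] by linarith
  qed
  then show ?thesis using L by (intro exI[of _ "real DIM('a)^2 * L"]) auto
qed

lemma D2_cont:
  fixes f :: "'a::euclidean_space \<Rightarrow> real"
  assumes "Cinf S f" "open S" "x \<in> S" "e > 0"
  shows "\<exists>r>0. \<forall>y\<in>ball x r. y \<in> S \<and> (\<forall>w. \<bar>D2 f y w w - D2 f x w w\<bar> \<le> e * (norm w)^2)"
proof -
  let ?e = "e / real DIM('a)^2"
  have e: "?e > 0" using assms by simp
  have "\<forall>\<^sub>F y in nhds x. dist (D2 f y a b) (D2 f x a b) < ?e" for a b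
    by (rule continuous_near[OF Cinf_continuous[OF Cinf_D2[OF assms(1,2)]] assms(2,3) e])
  then have "\<forall>\<^sub>F y in nhds x. \<forall>a\<in>Basis. \<forall>b\<in>Basis. dist (D2 f y a b) (D2 f x a b) < ?e"
    by (intro eventually_ball_finite ballI finite_Basis)
  moreover have "\<forall>\<^sub>F y in nhds x. y \<in> S" using assms eventually_nhds by blast
  ultimately have "\<forall>\<^sub>F y in nhds x. y \<in> S \<and> (\<forall>a\<in>Basis. \<forall>b\<in>Basis. dist (D2 f y a b) (D2 f x a b) < ?e)"
    by (rule eventually_conj[rotated])
  then obtain r where r: "r > 0" "\<And>y. dist y x < r \<Longrightarrow> y \<in> S \<and> (\<forall>a\<in>Basis. \<forall>b\<in>Basis. dist (D2 f y a b) (D2 f x a b) < ?e)"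
    unfolding eventually_nhds_metric by blast
  have "\<bar>D2 f y w w - D2 f x w w\<bar> \<le> e * (norm w)^2" if y: "dist y x < r" for y w
  proof -
    have "\<bar>(\<lambda>v w. D2 f y v w - D2 f x v w) w w\<bar> \<le> real DIM('a)^2 * ?e * (norm w)^2"
    proof (rule symform_entry_bound[where A = "\<lambda>v w. D2 f y v w - D2 f x v w"])
      show "symform (\<lambda>v w. D2 f y v w - D2 f x v w)"
        using r(2)[OF y] assms by (intro symform_diff symform_D2[OF assms(1,2)]) auto
      show "\<bar>D2 f y b c - D2 f x b c\<bar> \<le> ?e" if "b \<in> Basis" "c \<in> Basis" for b c
        using r(2)[OF y] that by (auto simp: dist_real_def less_imp_le)
    qed
    then show ?thesis by simp
  qed
  then show ?thesis using r by (intro exI[of _ r]) (auto simp: dist_commute)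
qed

section \<open>Positively homogeneous functions\<close>

definition hom1 :: "('a::euclidean_space \<Rightarrow> real) \<Rightarrow> bool" where
  "hom1 f \<longleftrightarrow> (\<forall>t>0. \<forall>x. f (t *\<^sub>R x) = t * f x)"

lemma hom1D: "hom1 f \<Longrightarrow> t > 0 \<Longrightarrow> f (t *\<^sub>R x) = t * f x" by (simp add: hom1_def)

lemma hom1_0: "hom1 f \<Longrightarrow> f 0 = 0"
  using hom1D[of f 2 0] by simp

lemma hom1_norm: "hom1 norm" by (simp add: hom1_def)

lemma open_punct: "open (- {0::'a::euclidean_space})" by auto

lemma jet2_cong_ev:
  assumes "jet2 f f0 f1 f2" "\<forall>\<^sub>F s in nhds 0. f s = g s" shows "jet2 g f0 f1 f2"
proof -
  obtain f' where *: "\<forall>\<^sub>F s in nhds 0. (f has_real_derivative f' s) (at s)" "f' 0 = f1" "(f' has_real_derivative f2) (at 0)"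
    using assms by (auto simp: jet2_def)
  have "\<forall>\<^sub>F s in nhds 0. \<forall>\<^sub>F t in nhds s. f t = g t" using assms(2) by (simp add: eventually_eventually)
  then have "\<forall>\<^sub>F s in nhds 0. (g has_real_derivative f' s) (at s)" using *(1)
    by eventually_elim (metis DERIV_cong_ev)
  moreover have "g 0 = f0" using assms eventually_nhds_x_imp_x[OF assms(2)] by (auto simp: jet2_def)
  ultimately show ?thesis using * by (auto simp: jet2_def)
qed

lemma jet2_id: "jet2 (\<lambda>s. s) 0 1 0"
  by (auto simp: jet2_def intro!: exI[of _ "\<lambda>_. 1"])

lemma jet2_affine: "jet2 (\<lambda>s. c + d * s) c d 0"
  using jet2_add[OF jet2_const[of c] jet2_cmult[OF jet2_id, of d]] by simp

lemma line_nonzero: "x \<noteq> 0 \<Longrightarrow> \<forall>\<^sub>F s in nhds 0. x + s *\<^sub>R w \<noteq> (0::'a::euclidean_space)"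
proof -
  assume x: "x \<noteq> 0"
  have "((\<lambda>s::real. x + s *\<^sub>R w) \<longlongrightarrow> x + 0 *\<^sub>R w) (nhds 0)" by (intro tendsto_intros filterlim_ident)
  then show ?thesis using x topological_tendstoD[of _ "x + 0 *\<^sub>R w" "nhds 0" "- {0}"] by auto
qed

lemma D_scaling:
  fixes f :: "'a::euclidean_space \<Rightarrow> real"
  assumes f: "Cinf (- {0}) f" and t: "t > 0" and h: "\<And>y. y \<noteq> 0 \<Longrightarrow> f (t *\<^sub>R y) = c * f y" and x: "x \<noteq> 0"
  shows "D1 f (t *\<^sub>R x) w = c / t * D1 f x w"
proof -
  have tx: "t *\<^sub>R x \<in> - {0}" and x': "x \<in> - {0}" using t x by auto
  have j: "jet2 (\<lambda>s. c * f (x + s *\<^sub>R w)) (c * f x) (c * D1 f x w) (c * D2 f x w w)"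
    by (intro jet2_cmult jet2_line[OF f open_punct x'])
  have "\<forall>\<^sub>F s in nhds 0. c * f (x + s *\<^sub>R w) = f (t *\<^sub>R x + s *\<^sub>R (t *\<^sub>R w))"
    using line_nonzero[OF x, of w]
  proof eventually_elim
    case (elim s)
    then have "f (t *\<^sub>R (x + s *\<^sub>R w)) = c * f (x + s *\<^sub>R w)" by (rule h)
    then show ?case by (simp add: algebra_simps)
  qed
  from jet2_cong_ev[OF j this] have "c * D1 f x w = D1 f (t *\<^sub>R x) (t *\<^sub>R w)"
    using jet2_unique(1)[OF _ jet2_line[OF f open_punct tx, of "t *\<^sub>R w"]] by blast
  also have "\<dots> = t * D1 f (t *\<^sub>R x) w" by (rule D1_scale[OF f tx])
  finally show ?thesis using t by (simp add: field_simps)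
qed

lemma hom1_D1: "Cinf (- {0}) f \<Longrightarrow> hom1 f \<Longrightarrow> t > 0 \<Longrightarrow> x \<noteq> 0 \<Longrightarrow> D1 f (t *\<^sub>R x) w = D1 f x w"
  using D_scaling[of f t t x w] by (simp add: hom1_def)

lemma hom1_D2:
  assumes "Cinf (- {0}) f" "hom1 f" "t > 0" "x \<noteq> 0" shows "D2 f (t *\<^sub>R x) v w = D2 f x v w / t"
  using D_scaling[OF Cinf_D1[OF assms(1) open_punct, of w] assms(3), of 1 x v] hom1_D1[OF assms(1,2,3)] assms(4)
  by (simp add: D2_def)

lemma hom1_euler:
  assumes f: "Cinf (- {0}) f" and h: "hom1 f" and x: "x \<noteq> (0::'a::euclidean_space)"
  shows "D1 f x x = f x" "D2 f x x w = 0" "D2 f x w x = 0"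
proof -
  have x': "x \<in> - {0}" using x by auto
  have ev: "\<forall>\<^sub>F s in nhds (0::real). s > -1"
    by (intro order_tendstoD(1)[of _ 0] filterlim_ident) auto
  have "jet2 (\<lambda>s. f x + f x * s) (f x) (f x) 0"
    by (rule jet2_affine)
  moreover have "\<forall>\<^sub>F s in nhds 0. f x + f x * s = f (x + s *\<^sub>R x)" using ev
  proof eventually_elim
    case (elim s)
    then have "f ((1 + s) *\<^sub>R x) = (1 + s) * f x" using hom1D[OF h, of "1 + s" x] by simp
    then show ?case by (simp add: algebra_simps)
  qed
  ultimately have "jet2 (\<lambda>s. f (x + s *\<^sub>R x)) (f x) (f x) 0" by (rule jet2_cong_ev)
  then show "D1 f x x = f x" using jet2_unique(1)[OF jet2_line[OF f open_punct x', of x]] by blast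
  have "jet2 (\<lambda>s. D1 f (x + s *\<^sub>R x) w) (D1 f x w) 0 0"
  proof (rule jet2_cong_ev[OF jet2_const])
    show "\<forall>\<^sub>F s in nhds 0. D1 f x w = D1 f (x + s *\<^sub>R x) w" using ev
    proof eventually_elim
      case (elim s)
      then have "D1 f ((1 + s) *\<^sub>R x) w = D1 f x w" using hom1_D1[OF f h _ x, of "1 + s"] by simp
      then show ?case by (simp add: algebra_simps)
    qed
  qed
  then show z: "D2 f x x w = 0"
    using jet2_unique(1)[OF jet2_line[OF Cinf_D1[OF f open_punct, of w] open_punct x', of x]] by (simp add: D2_def)
  then show "D2 f x w x = 0" using D2_commute[OF f open_punct x'] by simp
qed

definition tang :: "'a::euclidean_space \<Rightarrow> 'a \<Rightarrow> 'a" where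
  "tang x w = w - ((x \<bullet> w) / (x \<bullet> x)) *\<^sub>R x"

lemma tang_orth: "x \<noteq> 0 \<Longrightarrow> x \<bullet> tang x w = 0"
  by (simp add: tang_def inner_simps)

lemma tang_norm: "x \<noteq> 0 \<Longrightarrow> (norm (tang x w))^2 = (norm w)^2 - (x \<bullet> w)^2 / (norm x)^2"
  unfolding power2_norm_eq_inner tang_def by (simp add: inner_simps inner_commute power2_eq_square)

lemma hom1_D2_tang:
  assumes f: "Cinf (- {0}) f" and h: "hom1 f" and x: "x \<noteq> (0::'a::euclidean_space)"
  shows "D2 f x (tang x w) (tang x w) = D2 f x w w"
proof -
  have s: "symform (D2 f x)" using symform_D2[OF f open_punct, of x] x by auto
  show ?thesis
    using hom1_euler(2,3)[OF f h x] bilinear_lsub[OF symform_bilinear[OF s]] bilinear_rsub[OF symform_bilinear[OF s]]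
    by (simp add: tang_def symform_simps[OF s])
qed

text \<open>The second order expansion of the polynomial \<open>(norm x)\<^sup>2\<close> is compared with that of \<open>norm x * norm x\<close>.\<close>

lemma norm_derivs:
  assumes x: "x \<noteq> (0::'a::euclidean_space)"
  shows "D1 norm x w = (x \<bullet> w) / norm x"
    "D2 norm x w w = (norm (tang x w))^2 / norm x"
    "D2 norm x w w = ((norm w)^2 - (x \<bullet> w)^2 / (norm x)^2) / norm x"
proof -
  have x': "x \<in> - {0}" using x by auto
  have j: "jet2 (\<lambda>s. norm (x + s *\<^sub>R w)) (norm x) (D1 norm x w) (D2 norm x w w)"
    by (rule jet2_line[OF Cinf_norm open_punct x'])
  have sq: "jet2 (\<lambda>s. (norm x)^2 + (2 * (x \<bullet> w) * s + (norm w)^2 * (s * s))) ((norm x)^2) (2 * (x \<bullet> w)) ((norm w)^2 * 2)"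
    using jet2_add[OF jet2_const[of "(norm x)^2"] jet2_add[OF jet2_cmult[OF jet2_id, of "2 * (x \<bullet> w)"] jet2_cmult[OF jet2_mult[OF jet2_id jet2_id], of "(norm w)^2"]]]
    by simp
  have e: "(\<lambda>s. (norm x)^2 + (2 * (x \<bullet> w) * s + (norm w)^2 * (s * s))) = (\<lambda>s. norm (x + s *\<^sub>R w) * norm (x + s *\<^sub>R w))"
    unfolding power2_norm_eq_inner power2_eq_square[symmetric] by (rule ext) (simp add: inner_simps inner_commute power2_eq_square)
  note u = jet2_unique[OF sq[unfolded e] jet2_mult[OF j j]]
  show 1: "D1 norm x w = (x \<bullet> w) / norm x" using u(1) x by (simp add: field_simps)
  have "D2 norm x w w * norm x = (norm w)^2 - (D1 norm x w)^2" using u(2) by (simp add: power2_eq_square algebra_simps)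
  then show 3: "D2 norm x w w = ((norm w)^2 - (x \<bullet> w)^2 / (norm x)^2) / norm x"
    using x 1 by (simp add: field_simps power_divide)
  then show "D2 norm x w w = (norm (tang x w))^2 / norm x" using tang_norm[OF x] by simp
qed

text \<open>Convexity along the segment from \<open>x\<close> to \<open>y\<close>, if this does not meet the origin, where \<open>f\<close> need not be
  differentiable. Otherwise one of the points is a nonpositive multiple of the other of modulus at most
  one, and \<open>f \<ge> 0\<close> suffices.\<close>

lemma hom1_subadd:
  fixes f :: "'a::euclidean_space \<Rightarrow> real"
  assumes f: "Cinf (- {0}) f" and h: "hom1 f" and nn: "\<And>x. f x \<ge> 0"
    and psd: "\<And>x w. x \<noteq> 0 \<Longrightarrow> D2 f x w w \<ge> 0"
  shows "f (x + y) \<le> f x + f y"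
proof (cases "\<exists>s\<in>{0..1}. x + s *\<^sub>R (y - x) = 0")
  case True
  then obtain s where s: "0 \<le> s" "s \<le> 1" "x + s *\<^sub>R (y - x) = 0" by auto
  have anti: "f (u + w) \<le> f u + f w" if "w = - c *\<^sub>R u" "0 \<le> c" "c \<le> 1" for u w c
  proof -
    have "u + w = (1 - c) *\<^sub>R u" using that by (simp add: algebra_simps)
    then have "f (u + w) = (1 - c) * f u" using that hom1D[OF h, of "1 - c" u] hom1_0[OF h] by (cases "c = 1") auto
    also have "\<dots> \<le> f u" using that nn[of u] by (simp add: mult_left_le_one_le)
    finally show ?thesis using nn[of w] by simp
  qed
  have e: "(1 - s) *\<^sub>R x = - s *\<^sub>R y" using s(3) by (simp add: algebra_simps eq_neg_iff_add_eq_0)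
  show ?thesis
  proof (cases "s \<le> 1/2")
    case True
    have "x = (1 / (1 - s)) *\<^sub>R ((1 - s) *\<^sub>R x)" using True by simp
    also have "\<dots> = - (s / (1 - s)) *\<^sub>R y" unfolding e by simp
    finally have "f (y + x) \<le> f y + f x" using True s by (intro anti[of x "s / (1 - s)" y]) (auto simp: field_simps)
    then show ?thesis by (simp add: add.commute)
  next
    case False
    have "y = (- (1 / s)) *\<^sub>R (- s *\<^sub>R y)" using False by simp
    also have "\<dots> = - ((1 - s) / s) *\<^sub>R x" unfolding e[symmetric] by simp
    finally show ?thesis using False s by (intro anti[of y "(1 - s) / s" x]) (auto simp: field_simps)
  qed
next
  case False
  have P: "x + s *\<^sub>R (y - x) \<in> - {0}" if "s \<in> {0..1}" for s using False that by auto
  have "convex_on {0..1} (\<lambda>s. f (x + s *\<^sub>R (y - x)))"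
  proof (rule f''_ge0_imp_convex)
    fix s :: real assume s: "s \<in> {0..1}"
    show "((\<lambda>s. f (x + s *\<^sub>R (y - x))) has_real_derivative D1 f (x + s *\<^sub>R (y - x)) (y - x)) (at s)"
      by (rule deriv_line[OF f P[OF s]])
    show "((\<lambda>s. D1 f (x + s *\<^sub>R (y - x)) (y - x)) has_real_derivative D2 f (x + s *\<^sub>R (y - x)) (y - x) (y - x)) (at s)"
      unfolding D2_def by (rule deriv_line[OF Cinf_D1[OF f open_punct] P[OF s]])
    show "D2 f (x + s *\<^sub>R (y - x)) (y - x) (y - x) \<ge> 0" using psd P[OF s] by auto
  qed auto
  from convex_onD[OF this, of "1/2" 0 1]
  have "f (x + (1/2) *\<^sub>R (y - x)) \<le> f x / 2 + f y / 2" by simp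
  moreover have "x + (1/2) *\<^sub>R (y - x) = (1/2) *\<^sub>R (x + y)"
    by (rule scaleR_left_imp_eq[of 2]) (simp_all add: algebra_simps scaleR_2)
  ultimately show ?thesis using hom1D[OF h, of "1/2" "x + y"] by simp
qed

lemma subadd_sum:
  fixes f :: "'a::euclidean_space \<Rightarrow> real"
  assumes "\<And>x y. f (x + y) \<le> f x + f y" "finite I" "I \<noteq> {}"
  shows "f (\<Sum>i\<in>I. h i) \<le> (\<Sum>i\<in>I. f (h i))"
  using assms(2,3)
proof (induction I rule: finite_ne_induct)
  case (insert x F)
  have "f (\<Sum>i\<in>insert x F. h i) \<le> f (h x) + f (\<Sum>i\<in>F. h i)" using insert assms(1)[of "h x" "\<Sum>i\<in>F. h i"] by simp
  then show ?case using insert by simp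
qed auto

section \<open>A reverse Hoelder inequality\<close>

lemma powr_tangent:
  assumes "r > 0" "R > 0" "\<beta> \<ge> (1::real)"
  shows "R powr \<beta> + \<beta> * R powr (\<beta> - 1) * (r - R) \<le> r powr \<beta>"
proof -
  have "\<beta> * R powr (\<beta> - 1) * (r - R) \<le> r powr \<beta> - R powr \<beta>"
  proof (rule convex_on_imp_above_tangent[where A = "{0<..}"])
    show "convex_on {0<..} (\<lambda>x. x powr \<beta>)"
      using assms by (intro powr_convex)
    show "((\<lambda>x. x powr \<beta>) has_real_derivative \<beta> * R powr (\<beta> - 1)) (at R within {0<..})"
      using has_real_derivative_powr[OF assms(2), of \<beta>] has_field_derivative_at_within by blast
    show "R \<in> interior {0<..}" using assms by (simp add: interior_open)
  qed (use assms in auto)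
  then show ?thesis by simp
qed

text \<open>\<open>G powr (1 + \<alpha>) * V powr (- \<alpha>)\<close> equals \<open>V * (G / V) powr (1 + \<alpha>)\<close>. The convex power is replaced by its
  tangent at the quotient of the sums.\<close>

lemma hoelder_reverse:
  fixes G V :: "'i \<Rightarrow> real"
  assumes I: "finite I" "I \<noteq> {}" and pos: "\<And>i. i \<in> I \<Longrightarrow> G i > 0" "\<And>i. i \<in> I \<Longrightarrow> V i > 0" and \<alpha>: "\<alpha> \<ge> 0"
  shows "(sum G I) powr (1 + \<alpha>) * (sum V I) powr (- \<alpha>) \<le> (\<Sum>i\<in>I. G i powr (1 + \<alpha>) * V i powr (- \<alpha>))"
proof -
  define R where "R = sum G I / sum V I"
  have S: "sum G I > 0" "sum V I > 0" using I pos by (auto intro!: sum_pos)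
  have R: "R > 0" using S by (simp add: R_def)
  have e: "G powr (1 + \<alpha>) * V powr (- \<alpha>) = V * (G / V) powr (1 + \<alpha>)" if "G > 0" "V > 0" for G V :: real
    using that by (simp add: powr_divide powr_add powr_minus field_simps)
  have "(sum G I) powr (1 + \<alpha>) * (sum V I) powr (- \<alpha>) = sum V I * R powr (1 + \<alpha>)" unfolding R_def using e S by simp
  also have "\<dots> = sum V I * R powr (1 + \<alpha>) + (1 + \<alpha>) * R powr \<alpha> * (sum G I - R * sum V I)" using S by (simp add: R_def)
  also have "\<dots> = (\<Sum>i\<in>I. V i * (R powr (1 + \<alpha>) + (1 + \<alpha>) * R powr ((1 + \<alpha>) - 1) * (G i / V i - R)))"
  proof -
    have "(\<Sum>i\<in>I. V i * (R powr (1 + \<alpha>) + (1 + \<alpha>) * R powr ((1 + \<alpha>) - 1) * (G i / V i - R)))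
      = (\<Sum>i\<in>I. V i * R powr (1 + \<alpha>) + (1 + \<alpha>) * R powr \<alpha> * (G i - R * V i))"
    proof (rule sum.cong[OF refl])
      fix i assume "i \<in> I"
      then have "V i \<noteq> 0" using pos(2)[of i] by simp
      then show "V i * (R powr (1 + \<alpha>) + (1 + \<alpha>) * R powr ((1 + \<alpha>) - 1) * (G i / V i - R))
        = V i * R powr (1 + \<alpha>) + (1 + \<alpha>) * R powr \<alpha> * (G i - R * V i)" by (simp add: field_simps)
    qed
    then show ?thesis by (simp add: sum.distrib sum_distrib_left[symmetric] sum_distrib_right[symmetric] sum_subtractf)
  qed
  also have "\<dots> \<le> (\<Sum>i\<in>I. V i * (G i / V i) powr (1 + \<alpha>))"
    using pos R \<alpha> by (intro sum_mono mult_left_mono powr_tangent) (auto intro: less_imp_le)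
  also have "\<dots> = (\<Sum>i\<in>I. G i powr (1 + \<alpha>) * V i powr (- \<alpha>))"
    using pos by (intro sum.cong refl) (simp add: e)
  finally show ?thesis .
qed

section \<open>Smooth dependence of the symmetric functions\<close>

lemma Cinf_mpow:
  assumes "\<And>v w. Cinf S (\<lambda>x. A x v w)" shows "Cinf S (\<lambda>x. mpow (A x) j v w)"
  by (induction j arbitrary: v w) (auto intro!: Cinf_const Cinf_sum Cinf_mult assms)

lemma Cinf_msig:
  assumes "\<And>v w. Cinf S (\<lambda>x. A x v w)" shows "Cinf S (\<lambda>x. msig (A x) k)"
proof (induction k rule: less_induct)
  case (less k)
  have p: "Cinf S (\<lambda>x. ptr (A x) j)" for j unfolding ptr_def by (intro Cinf_sum Cinf_mpow assms)
  show ?case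
  proof (cases k)
    case (Suc j)
    have "Cinf S (\<lambda>x. msig (A x) (j - i))" for i using less Suc by auto
    then show ?thesis unfolding Suc msig.simps divide_inverse
      by (intro Cinf_mult Cinf_sum Cinf_const p)
  qed auto
qed

text \<open>Compactness: the Hessians keep a positive distance from the boundary of the cone.\<close>

lemma MG_radius:
  fixes f :: "'a::euclidean_space \<Rightarrow> real"
  assumes f: "Cinf S f" "open S" and K: "compact K" "K \<subseteq> S" and G: "\<And>x. x \<in> K \<Longrightarrow> D2 f x \<in> MG a"
  shows "\<exists>r>0. \<forall>x\<in>K. (\<lambda>v w. D2 f x v w - r * (v \<bullet> w)) \<in> MG a"
proof -
  have "\<exists>r>0. \<forall>t. 0 \<le> t \<and> t \<le> r \<longrightarrow> (\<forall>x\<in>K. msig (\<lambda>v w. D2 f x v w - t * (v \<bullet> w)) j > 0)" if j: "j \<in> {1..a}" for j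
  proof (cases "K = {}")
    case True then show ?thesis by (intro exI[of _ 1]) auto
  next
    case False
    let ?h = "\<lambda>z. msig (\<lambda>v w. D2 f (fst z) v w - snd z * (v \<bullet> w)) j"
    have c: "continuous_on (K \<times> {0..1}) ?h"
    proof -
      have 1: "Cinf (S \<times> UNIV) (\<lambda>z::'a \<times> real. D2 f (fst z) v w)" for v w
      proof (rule Cinf_compose[OF Cinf_D2[OF f]])
        show "Cinf (S \<times> UNIV) (\<lambda>z::'a \<times> real. fst z \<bullet> b)" for b :: 'a
          by (intro Cinf_linear bounded_linear_compose[OF bounded_linear_inner_left bounded_linear_fst])
      qed auto
      have 2: "Cinf (S \<times> UNIV) (\<lambda>z::'a \<times> real. snd z)" by (intro Cinf_linear bounded_linear_snd)
      have "Cinf (S \<times> UNIV) ?h" by (intro Cinf_msig Cinf_diff Cinf_mult 1 2 Cinf_const)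
      then have "continuous_on (S \<times> UNIV) ?h" by (rule Cinf_continuous)
      then show ?thesis by (rule continuous_on_subset) (use K(2) in auto)
    qed
    have comp: "compact (K \<times> {0..1::real})" using K by (intro compact_Times) auto
    have "continuous_on K (\<lambda>x. ?h (x, 0))"
      by (rule continuous_on_compose2[OF c]) (auto intro!: continuous_intros)
    then obtain x0 where x0: "x0 \<in> K" "\<And>x. x \<in> K \<Longrightarrow> ?h (x0, 0) \<le> ?h (x, 0)"
      using continuous_attains_inf[OF K(1) False] by blast
    have m: "?h (x0, 0) > 0" using G[OF x0(1)] j by (auto simp: MG_def)
    obtain d where d: "d > 0" "\<And>z z'. z \<in> K \<times> {0..1} \<Longrightarrow> z' \<in> K \<times> {0..1} \<Longrightarrow> dist z' z < d \<Longrightarrow> dist (?h z') (?h z) < ?h (x0, 0)"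
    proof -
      have "\<forall>e>0. \<exists>d>0. \<forall>z\<in>K \<times> {0..1}. \<forall>z'\<in>K \<times> {0..1}. dist z' z < d \<longrightarrow> dist (?h z') (?h z) < e"
        using compact_uniformly_continuous[OF c comp] unfolding uniformly_continuous_on_def .
      from this[rule_format, OF m] show ?thesis using that by blast
    qed
    show ?thesis
    proof (intro exI[of _ "min (d/2) 1"] conjI allI impI ballI)
      fix t x assume t: "0 \<le> t \<and> t \<le> min (d/2) 1" and x: "x \<in> K"
      have "dist (x, t) (x, 0::real) = t" using t by (simp add: dist_Pair_Pair)
      then have "dist (?h (x, t)) (?h (x, 0)) < ?h (x0, 0)" using t x d by (intro d(2)) auto
      then show "msig (\<lambda>v w. D2 f x v w - t * (v \<bullet> w)) j > 0" using x0(2)[OF x] by (simp add: dist_real_def)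
    qed (use d in auto)
  qed
  then have "\<forall>j\<in>{1..a}. \<exists>r. r > 0 \<and> (\<forall>t. 0 \<le> t \<and> t \<le> r \<longrightarrow> (\<forall>x\<in>K. msig (\<lambda>v w. D2 f x v w - t * (v \<bullet> w)) j > 0))"
    by blast
  from bchoice[OF this] obtain r where
    r: "\<forall>j\<in>{1..a}. r j > 0 \<and> (\<forall>t. 0 \<le> t \<and> t \<le> r j \<longrightarrow> (\<forall>x\<in>K. msig (\<lambda>v w. D2 f x v w - t * (v \<bullet> w)) j > 0))" ..
  define r0 where "r0 = Min (insert 1 (r ` {1..a}))"
  have r0: "r0 > 0" unfolding r0_def using r by (subst Min_gr_iff) auto
  have r0le: "r0 \<le> r j" if "j \<in> {1..a}" for j unfolding r0_def using that by (intro Min_le) blast+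
  have "(\<lambda>v w. D2 f x v w - r0 * (v \<bullet> w)) \<in> MG a" if "x \<in> K" for x
    unfolding MG_def using r less_imp_le[OF r0] r0le that by blast
  then show ?thesis using r0 by blast
qed

section \<open>A barrier without critical points away from a given point\<close>

text \<open>\<open>s\<close> is a function on the sphere, extended constantly along rays, whose gradient has length at
  least \<open>sqrt \<gamma>\<close> outside the ball of radius \<open>\<delta>\<close> about \<open>p\<close>.\<close>

definition barrier_for :: "'a::euclidean_space \<Rightarrow> real \<Rightarrow> ('a \<Rightarrow> real) \<Rightarrow> real \<Rightarrow> real \<Rightarrow> bool" where
  "barrier_for p \<delta> s \<gamma> C \<longleftrightarrow> \<gamma> > 0 \<and> C > 0 \<and> Cinf (- {0}) s \<and> (\<forall>t>0. \<forall>x. x \<noteq> 0 \<longrightarrow> s (t *\<^sub>R x) = s x) \<and>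
     (\<forall>z w. norm z = 1 \<longrightarrow> \<bar>D1 s z w\<bar> \<le> C * norm w \<and> \<bar>D2 s z w w\<bar> \<le> C * (norm w)^2) \<and>
     (\<forall>z. norm z = 1 \<and> \<delta> \<le> dist z p \<longrightarrow> (\<exists>u. norm u = 1 \<and> (\<forall>w. \<gamma> * (u \<bullet> w)^2 \<le> (D1 s z w)^2)))"

lemma barrier_forD:
  assumes "barrier_for p \<delta> s \<gamma> C"
  shows "\<gamma> > 0" "C > 0" "Cinf (- {0}) s" "\<And>t x. t > 0 \<Longrightarrow> x \<noteq> 0 \<Longrightarrow> s (t *\<^sub>R x) = s x"
     "\<And>z w. norm z = 1 \<Longrightarrow> \<bar>D1 s z w\<bar> \<le> C * norm w \<and> \<bar>D2 s z w w\<bar> \<le> C * (norm w)^2"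
     "\<And>z. norm z = 1 \<Longrightarrow> \<delta> \<le> dist z p \<Longrightarrow> \<exists>u. norm u = 1 \<and> (\<forall>w. \<gamma> * (u \<bullet> w)^2 \<le> (D1 s z w)^2)"
  using assms unfolding barrier_for_def by simp_all

text \<open>With \<open>q\<close> orthogonal to \<open>p\<close> and \<open>c < 1\<close>, take the quotient of \<open>x \<bullet> q\<close> and \<open>norm x - c * (x \<bullet> p)\<close>. At a
  critical point \<open>z\<close> of the quotient, \<open>q\<close> is a multiple of \<open>z - c *\<^sub>R p\<close>; since \<open>q\<close> is orthogonal to \<open>p\<close>, it
  follows that \<open>z \<bullet> p = c\<close>. For \<open>c\<close> close to \<open>1\<close> such points are close to \<open>p\<close>.\<close>

lemma barrier_exists:
  fixes p :: "'a::euclidean_space"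
  assumes dim: "DIM('a) \<ge> 2" and p: "norm p = 1" and \<delta>: "\<delta> > 0"
  shows "\<exists>s \<gamma> C. barrier_for p \<delta> s \<gamma> C"
proof -
  obtain q where q: "q \<noteq> 0" "p \<bullet> q = 0"
    using orthogonal_to_vector_exists[of p] dim by (auto simp: orthogonal_def)
  define c where "c = 1 - min (\<delta>^2 / 4) (1/2)"
  have "min (\<delta>^2 / 4) (1/2) > 0" "min (\<delta>^2 / 4) (1/2) \<le> 1/2" using \<delta> by auto
  then have c: "0 < c" "c < 1" by (auto simp: c_def)
  have c2: "2 - 2 * c < \<delta>^2"
  proof -
    define m where "m = min (\<delta>^2 / 4) (1/2)"
    have "m \<le> \<delta>^2 / 4" unfolding m_def by (rule min.cobounded1)
    moreover have "\<delta>^2 > 0" using \<delta> by simp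
    moreover have "c = 1 - m" by (simp add: c_def m_def)
    ultimately show ?thesis by linarith
  qed
  define den where "den x = norm x - c * (x \<bullet> p)" for x
  have den: "den x > 0" if "x \<noteq> 0" for x
  proof -
    have "c * (x \<bullet> p) \<le> c * norm x" using c p norm_cauchy_schwarz[of x p] by simp
    also have "\<dots> < norm x" using c that by simp
    finally show ?thesis by (simp add: den_def)
  qed
  define s where "s x = (x \<bullet> q) / den x" for x
  have Cden: "Cinf (- {0}) den" unfolding den_def by (intro Cinf_diff Cinf_norm Cinf_mult Cinf_const Cinf_inner)
  have Cs: "Cinf (- {0}) s" unfolding s_def by (intro Cinf_divide Cinf_inner Cden) (use den in force)
  have hom: "s (t *\<^sub>R x) = s x" if "t > 0" "x \<noteq> 0" for t x
  proof -
    have "den (t *\<^sub>R x) = t * den x" using that by (simp add: den_def algebra_simps)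
    then show ?thesis using that by (simp add: s_def)
  qed
  have crit: "z \<bullet> p = c" if z: "norm z = 1" and D: "\<And>w. D1 s z w = 0" for z
  proof -
    have z0: "z \<noteq> 0" "z \<in> - {0}" using z by auto
    have "s z * (z \<bullet> w - c * (p \<bullet> w)) = q \<bullet> w" for w
    proof -
      have lin: "jet2 (\<lambda>t. (z + t *\<^sub>R w) \<bullet> y) (z \<bullet> y) (w \<bullet> y) 0" for y
        using jet2_affine[of "z \<bullet> y" "w \<bullet> y"] by (simp add: inner_simps mult.commute)
      have jd: "jet2 (\<lambda>t. den (z + t *\<^sub>R w)) (den z) (D1 norm z w - c * (w \<bullet> p)) (D2 norm z w w - c * 0)"
        unfolding den_def by (intro jet2_diff jet2_cmult lin jet2_line[OF Cinf_norm open_punct z0(2)])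
      have jm: "jet2 (\<lambda>t. s (z + t *\<^sub>R w) * den (z + t *\<^sub>R w)) (s z * den z)
          (D1 s z w * den z + s z * (D1 norm z w - c * (w \<bullet> p)))
          (D2 s z w w * den z + 2 * D1 s z w * (D1 norm z w - c * (w \<bullet> p)) + s z * (D2 norm z w w - c * 0))"
        by (intro jet2_mult jd jet2_line[OF Cs open_punct z0(2)])
      have "\<forall>\<^sub>F t in nhds 0. s (z + t *\<^sub>R w) * den (z + t *\<^sub>R w) = (z + t *\<^sub>R w) \<bullet> q"
        using line_nonzero[OF z0(1), of w] by eventually_elim (use den in \<open>force simp: s_def\<close>)
      from jet2_unique(1)[OF jet2_cong_ev[OF jm this] lin[of q]]
      show ?thesis using D[of w] norm_derivs(1)[OF z0(1), of w] z by (simp add: inner_commute)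
    qed
    then have "(s z *\<^sub>R (z - c *\<^sub>R p)) \<bullet> w = q \<bullet> w" for w by (simp add: inner_simps)
    then have e: "s z *\<^sub>R (z - c *\<^sub>R p) = q" by (metis vector_eq_rdot)
    then have "s z \<noteq> 0" using q by auto
    moreover have "s z * (z \<bullet> p - c * (p \<bullet> p)) = q \<bullet> p" unfolding e[symmetric] by (simp add: inner_simps)
    ultimately show ?thesis using q(2) p by (simp add: inner_commute norm_eq_1)
  qed
  define G where "G z = (\<Sum>b\<in>Basis. D1 s z b *\<^sub>R b)" for z
  have DG: "D1 s z w = G z \<bullet> w" if "norm z = 1" for z w
  proof -
    have z0: "z \<in> - {0}" using that by auto
    have "D1 s z w = D1 s z (\<Sum>b\<in>Basis. (w \<bullet> b) *\<^sub>R b)" by (simp add: euclidean_representation)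
    also have "\<dots> = (\<Sum>b\<in>Basis. (w \<bullet> b) * D1 s z b)"
      using D1_linear[OF Cs z0] by (simp add: linear_sum linear_cmul)
    also have "\<dots> = G z \<bullet> w" unfolding G_def inner_sum_left
      by (intro sum.cong refl) (simp add: inner_commute[of w])
    finally show ?thesis .
  qed
  have contG: "continuous_on (- {0}) G" unfolding G_def
    by (intro continuous_on_sum continuous_on_scaleR continuous_on_const Cinf_continuous[OF Cinf_D1[OF Cs open_punct]])
  have sub: "sphere 0 1 \<subseteq> - {0::'a}" by auto
  have cG: "continuous_on (sphere 0 1) (\<lambda>z. norm (G z))" using contG sub by (intro continuous_on_norm) (rule continuous_on_subset)
  obtain C1 where C1: "\<And>z. norm z = 1 \<Longrightarrow> norm (G z) \<le> C1"
  proof -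
    have "bounded ((\<lambda>z. norm (G z)) ` sphere 0 1)" using cG by (intro compact_imp_bounded compact_continuous_image) auto
    then obtain c1 where "\<forall>z\<in>sphere 0 1. norm (G z) \<le> c1" unfolding bounded_iff by auto
    then show ?thesis by (intro that[of c1]) simp
  qed
  obtain C2 where C2: "C2 > 0" "\<And>z w. norm z = 1 \<Longrightarrow> \<bar>D2 s z w w\<bar> \<le> C2 * (norm w)^2"
    using D2_bound_compact[OF Cs open_punct compact_sphere[of 0 1] sub] by auto
  let ?L = "sphere 0 1 \<inter> {z. \<delta> \<le> dist z p}"
  obtain \<mu> where \<mu>: "\<mu> > 0" "\<And>z. z \<in> ?L \<Longrightarrow> \<mu> \<le> norm (G z)"
  proof (cases "?L = {}")
    case True then show ?thesis using that[of 1] by auto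
  next
    case False
    have cL: "compact ?L" by (intro compact_Int_closed compact_sphere closed_Collect_le continuous_intros)
    obtain z0 where z0: "z0 \<in> ?L" "\<And>z. z \<in> ?L \<Longrightarrow> norm (G z0) \<le> norm (G z)"
      using continuous_attains_inf[OF cL False, of "\<lambda>z. norm (G z)"] continuous_on_subset[OF cG, of ?L] by blast
    have "G z0 \<noteq> 0"
    proof
      assume "G z0 = 0"
      then have "z0 \<bullet> p = c" using crit[of z0] DG z0(1) by simp
      then have "(dist z0 p)^2 = 2 - 2 * c"
        using z0(1) p unfolding dist_norm power2_norm_eq_inner by (simp add: inner_simps inner_commute norm_eq_1)
      then have "(dist z0 p)^2 < \<delta>^2" using c2 by simp
      moreover have "\<delta>^2 \<le> (dist z0 p)^2" using z0(1) \<delta> by (intro power_mono) auto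
      ultimately show False by simp
    qed
    then show ?thesis using that[of "norm (G z0)"] z0(2) by auto
  qed
  show ?thesis unfolding barrier_for_def
  proof (rule exI[of _ s], rule exI[of _ "\<mu>^2"], rule exI[of _ "\<bar>C1\<bar> + C2"], intro conjI allI impI)
    show "\<mu>^2 > 0" "\<bar>C1\<bar> + C2 > 0" using \<mu> C2 by auto
    fix z w :: 'a assume z: "norm z = 1"
    have "\<bar>D1 s z w\<bar> \<le> norm (G z) * norm w" using DG[OF z] Cauchy_Schwarz_ineq2 by metis
    also have "\<dots> \<le> (\<bar>C1\<bar> + C2) * norm w" using C1[OF z] C2(1) by (intro mult_right_mono) auto
    finally show "\<bar>D1 s z w\<bar> \<le> (\<bar>C1\<bar> + C2) * norm w" .
    have "\<bar>D2 s z w w\<bar> \<le> C2 * (norm w)^2" by (rule C2(2)[OF z])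
    also have "\<dots> \<le> (\<bar>C1\<bar> + C2) * (norm w)^2" by (intro mult_right_mono) auto
    finally show "\<bar>D2 s z w w\<bar> \<le> (\<bar>C1\<bar> + C2) * (norm w)^2" .
  next
    fix z assume z: "norm z = 1 \<and> \<delta> \<le> dist z p"
    have g: "\<mu> \<le> norm (G z)" using \<mu>(2)[of z] z by auto
    then have gne: "G z \<noteq> 0" using \<mu>(1) by auto
    show "\<exists>u. norm u = 1 \<and> (\<forall>w. \<mu>^2 * (u \<bullet> w)^2 \<le> (D1 s z w)^2)"
    proof (intro exI[of _ "G z /\<^sub>R norm (G z)"] conjI allI)
      show "norm (G z /\<^sub>R norm (G z)) = 1" using gne by simp
      fix w
      have "D1 s z w = norm (G z) * ((G z /\<^sub>R norm (G z)) \<bullet> w)" using DG[of z w] z gne by simp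
      then have "(D1 s z w)^2 = (norm (G z))^2 * ((G z /\<^sub>R norm (G z)) \<bullet> w)^2" by (simp add: power_mult_distrib)
      then show "\<mu>^2 * ((G z /\<^sub>R norm (G z)) \<bullet> w)^2 \<le> (D1 s z w)^2"
        using g \<mu>(1) by (simp only:) (intro mult_right_mono power_mono, auto)
    qed
  qed (use Cs hom in auto)
qed

text \<open>For large \<open>K\<close> the second derivative is dominated by the square of the gradient of \<open>s\<close>.\<close>

lemma exp_barrier_derivs:
  assumes s: "Cinf (- {0}) s" and z: "z \<noteq> (0::'a::euclidean_space)"
  shows "Cinf (- {0}) (\<lambda>x. exp (K * s x))"
    "D1 (\<lambda>x. exp (K * s x)) z w = exp (K * s z) * (K * D1 s z w)"
    "D2 (\<lambda>x. exp (K * s x)) z w w = exp (K * s z) * (K * D2 s z w w + (K * D1 s z w)^2)"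
proof -
  have z': "z \<in> - {0}" using z by auto
  show C: "Cinf (- {0}) (\<lambda>x. exp (K * s x))" by (intro Cinf_exp Cinf_mult Cinf_const s)
  note j = jet2_exp[OF jet2_cmult[OF jet2_line[OF s open_punct z', of w], of K]]
  note j' = jet2_line[OF C open_punct z', of w]
  show "D1 (\<lambda>x. exp (K * s x)) z w = exp (K * s z) * (K * D1 s z w)"
    "D2 (\<lambda>x. exp (K * s x)) z w w = exp (K * s z) * (K * D2 s z w w + (K * D1 s z w)^2)"
    using jet2_unique[OF j' j] by auto
qed

section \<open>Convexity of solutions of the quotient equation\<close>

lemma hom1_bound:
  fixes f :: "'a::euclidean_space \<Rightarrow> real"
  assumes f: "Cinf (- {0}) f" and h: "hom1 f"
  shows "\<exists>M>0. \<forall>x. \<bar>f x\<bar> \<le> M * norm x"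
proof -
  have sub: "sphere 0 1 \<subseteq> - {0::'a}" by auto
  have "bounded (f ` sphere 0 1)"
    using continuous_on_subset[OF Cinf_continuous[OF f] sub] by (intro compact_imp_bounded compact_continuous_image) auto
  then obtain M where M: "\<forall>x\<in>sphere 0 1. \<bar>f x\<bar> \<le> M" unfolding bounded_iff by auto
  have "\<bar>f x\<bar> \<le> (\<bar>M\<bar> + 1) * norm x" for x
  proof (cases "x = 0")
    case True then show ?thesis using hom1_0[OF h] by simp
  next
    case False
    have "f x = norm x * f (x /\<^sub>R norm x)" using hom1D[OF h, of "norm x" "x /\<^sub>R norm x"] False by simp
    moreover have "\<bar>f (x /\<^sub>R norm x)\<bar> \<le> M" using M False by simp
    then have "\<bar>f (x /\<^sub>R norm x)\<bar> \<le> \<bar>M\<bar> + 1" by linarith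
    ultimately show ?thesis using mult_left_mono[of "\<bar>f (x /\<^sub>R norm x)\<bar>" "\<bar>M\<bar> + 1" "norm x"]
      by (simp add: abs_mult mult.commute)
  qed
  then show ?thesis by (intro exI[of _ "\<bar>M\<bar> + 1"]) auto
qed

lemma hom1_cont:
  fixes f :: "'a::euclidean_space \<Rightarrow> real"
  assumes f: "Cinf (- {0}) f" and h: "hom1 f"
  shows "continuous_on UNIV f"
proof -
  obtain M where M: "\<And>x. \<bar>f x\<bar> \<le> M * norm x" using hom1_bound[OF assms] by blast
  have "isCont f x" for x
  proof (cases "x = 0")
    case True
    have "(f \<longlongrightarrow> 0) (at 0)"
    proof (rule tendsto_0_le[where K = M and f = "\<lambda>x. norm x"])
      show "((\<lambda>x. norm x) \<longlongrightarrow> 0) (at (0::'a))" by (intro tendsto_norm_zero tendsto_ident_at)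
      show "\<forall>\<^sub>F x in at 0. norm (f x) \<le> norm (norm x) * M" using M by (auto simp: mult.commute intro!: always_eventually)
    qed
    then show ?thesis using True hom1_0[OF h] by (simp add: isCont_def)
  next
    case False
    then show ?thesis using Cinf_continuous[OF f] open_punct continuous_on_eq_continuous_at[of "- {0}" f] by auto
  qed
  then show ?thesis by (simp add: continuous_at_imp_continuous_on)
qed

lemma hom1_add: "hom1 f \<Longrightarrow> hom1 g \<Longrightarrow> hom1 (\<lambda>x. f x + g x)"
  by (simp add: hom1_def algebra_simps)
lemma hom1_cmult: "hom1 f \<Longrightarrow> hom1 (\<lambda>x. c * f x)"
  by (simp add: hom1_def algebra_simps)

text \<open>The equation for the homogeneous extensions \<open>v\<close> and \<open>g\<close>. Here \<open>gsub\<close> is the convexity hypothesis on \<open>f\<close>, and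
  \<open>vG\<close> is admissibility.\<close>

locale quotient_eq =
  fixes v g :: "'a::euclidean_space \<Rightarrow> real" and a b :: nat and \<alpha> c :: real
  assumes dim: "DIM('a) \<ge> 2" and ab: "b < a" "a \<le> DIM('a)" and \<alpha>: "\<alpha> \<ge> 1" and c: "c > 0"
    and vC: "Cinf (- {0}) v" and vh: "hom1 v" and vpos: "\<And>x. x \<noteq> 0 \<Longrightarrow> v x > 0"
    and gh: "hom1 g" and gpos: "\<And>x. x \<noteq> 0 \<Longrightarrow> g x > 0" and gsub: "\<And>x y. g (x + y) \<le> g x + g y"
    and vG: "\<And>x. x \<noteq> 0 \<Longrightarrow> D2 v x \<in> MG a"
    and eqn: "\<And>x. x \<noteq> 0 \<Longrightarrow> 1 / MF a b (D2 v x) = c * (g x powr (1 + \<alpha>) * v x powr (- \<alpha>))"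
begin

lemma v_sym: "x \<noteq> 0 \<Longrightarrow> symform (D2 v x)"
  using symform_D2[OF vC open_punct] by auto

lemma v_0: "v 0 = 0" by (rule hom1_0[OF vh])

lemma v_cont: "continuous_on UNIV v" by (rule hom1_cont[OF vC vh])

lemma v_nonneg: "v x \<ge> 0" using vpos[of x] v_0 by (cases "x = 0") auto

lemma v_MFpos: "x \<noteq> 0 \<Longrightarrow> MF a b (D2 v x) > 0" using MF_pos[OF vG ab(1)] .

lemma sphere_min: "\<exists>p. norm p = 1 \<and> v p > 0 \<and> (\<forall>x. v p * norm x \<le> v x)"
proof -
  obtain p where p: "p \<in> sphere 0 1" "\<And>x. x \<in> sphere 0 1 \<Longrightarrow> v p \<le> v x"
    using continuous_attains_inf[of "sphere 0 1" v] continuous_on_subset[OF v_cont] by auto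
  have "v p * norm x \<le> v x" for x
  proof (cases "x = 0")
    case False
    have "v x = norm x * v (x /\<^sub>R norm x)" using hom1D[OF vh, of "norm x" "x /\<^sub>R norm x"] False by simp
    moreover have "v p \<le> v (x /\<^sub>R norm x)" using False by (intro p(2)) simp
    ultimately show ?thesis using False by (simp add: mult.commute)
  qed (simp add: v_0)
  moreover have "p \<noteq> 0" using p(1) by auto
  ultimately show ?thesis using p vpos by auto
qed

text \<open>Subadditivity of \<open>g\<close> and the reverse Hoelder inequality act in the same direction, since the exponent of
  \<open>g\<close> is positive.\<close>

lemma rhs_superadd:
  assumes I: "finite I" "I \<noteq> {}" and x: "\<And>i. i \<in> I \<Longrightarrow> x i \<noteq> 0" and z: "(\<Sum>i\<in>I. x i) \<noteq> 0"
  shows "c * (g (\<Sum>i\<in>I. x i) powr (1 + \<alpha>) * (\<Sum>i\<in>I. v (x i)) powr (- \<alpha>)) \<le> (\<Sum>i\<in>I. 1 / MF a b (D2 v (x i)))"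
proof -
  have S: "(\<Sum>i\<in>I. v (x i)) > 0" using I x vpos by (intro sum_pos) auto
  have "g (\<Sum>i\<in>I. x i) powr (1 + \<alpha>) * (\<Sum>i\<in>I. v (x i)) powr (- \<alpha>)
    \<le> (\<Sum>i\<in>I. g (x i)) powr (1 + \<alpha>) * (\<Sum>i\<in>I. v (x i)) powr (- \<alpha>)"
    using gpos[OF z] \<alpha> subadd_sum[OF gsub I, of x] by (intro mult_right_mono powr_mono2) auto
  also have "\<dots> \<le> (\<Sum>i\<in>I. g (x i) powr (1 + \<alpha>) * v (x i) powr (- \<alpha>))"
    using I x gpos vpos \<alpha> by (intro hoelder_reverse) auto
  finally have "c * (g (\<Sum>i\<in>I. x i) powr (1 + \<alpha>) * (\<Sum>i\<in>I. v (x i)) powr (- \<alpha>))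
     \<le> c * (\<Sum>i\<in>I. g (x i) powr (1 + \<alpha>) * v (x i) powr (- \<alpha>))" using c by simp
  also have "\<dots> = (\<Sum>i\<in>I. 1 / MF a b (D2 v (x i)))"
    unfolding sum_distrib_left using x by (intro sum.cong refl) (simp add: eqn)
  finally show ?thesis .
qed

text \<open>\<open>Y\<close> is the level set of \<open>v\<close> at height \<open>1\<close>. The gauge of its convex hull is the convex envelope of \<open>v\<close>.\<close>

definition Y :: "'a set" where "Y = (\<lambda>x. x /\<^sub>R v x) ` sphere 0 1"
definition Chull :: "'a set" where "Chull = convex hull Y"

lemma Y_props: "y \<in> Y \<Longrightarrow> y \<noteq> 0" "y \<in> Y \<Longrightarrow> v y = 1" "x \<noteq> 0 \<Longrightarrow> x /\<^sub>R v x \<in> Y"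
proof -
  show "y \<noteq> 0" if "y \<in> Y"
  proof -
    obtain x where x: "y = x /\<^sub>R v x" "norm x = 1" using \<open>y \<in> Y\<close> by (auto simp: Y_def)
    then have "x \<noteq> 0" by auto
    then show ?thesis using x vpos[of x] by auto
  qed
  show "v y = 1" if "y \<in> Y"
  proof -
    obtain x where x: "y = x /\<^sub>R v x" "norm x = 1" using \<open>y \<in> Y\<close> by (auto simp: Y_def)
    then have "x \<noteq> 0" by auto
    then have "v x > 0" by (rule vpos)
    then show ?thesis unfolding x(1) using hom1D[OF vh, of "inverse (v x)" x] by simp
  qed
  show "x /\<^sub>R v x \<in> Y" if x: "x \<noteq> 0"
  proof -
    have "v (x /\<^sub>R norm x) = inverse (norm x) * v x" using hom1D[OF vh, of "inverse (norm x)" x] x by simp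
    then have "x /\<^sub>R v x = (x /\<^sub>R norm x) /\<^sub>R v (x /\<^sub>R norm x)" using x by (simp add: field_simps)
    then show ?thesis unfolding Y_def using x by (intro image_eqI[of _ _ "x /\<^sub>R norm x"]) auto
  qed
qed

lemma compact_Chull: "compact Chull"
  unfolding Chull_def
proof (rule compact_convex_hull)
  have "continuous_on (sphere 0 1) (\<lambda>x. x /\<^sub>R v x)"
  proof (intro continuous_intros continuous_on_subset[OF v_cont] ballI)
    fix x :: 'a assume "x \<in> sphere 0 1"
    then have "x \<noteq> 0" by auto
    then show "v x \<noteq> 0" using vpos[of x] by simp
  qed auto
  then show "compact Y" unfolding Y_def by (intro compact_continuous_image) auto
qed

lemma Chull_mem:
  assumes I: "finite I" "I \<noteq> {}" and x: "\<And>i. i \<in> I \<Longrightarrow> x i \<noteq> 0"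
  shows "(\<Sum>i\<in>I. x i) /\<^sub>R (\<Sum>i\<in>I. v (x i)) \<in> Chull"
proof -
  let ?J = "\<Sum>i\<in>I. v (x i)"
  have J: "?J > 0" using I x vpos by (intro sum_pos) auto
  have "(\<Sum>i\<in>I. (v (x i) / ?J) *\<^sub>R (x i /\<^sub>R v (x i))) \<in> convex hull Y"
  proof (rule convex_sum[OF I(1) convex_convex_hull])
    show "(\<Sum>i\<in>I. v (x i) / ?J) = 1" using J by (simp add: sum_divide_distrib[symmetric])
    show "v (x i) / ?J \<ge> 0" "x i /\<^sub>R v (x i) \<in> convex hull Y" if "i \<in> I" for i
      using J v_nonneg[of "x i"] Y_props(3)[OF x[OF that]] by (auto intro: hull_inc)
  qed
  also have "(\<Sum>i\<in>I. (v (x i) / ?J) *\<^sub>R (x i /\<^sub>R v (x i))) = (\<Sum>i\<in>I. x i /\<^sub>R ?J)"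
    using x vpos by (intro sum.cong refl) (force simp: field_simps)
  finally show ?thesis by (simp add: Chull_def scaleR_right.sum[symmetric])
qed

text \<open>A point \<open>z\<close> of the hull is a sum of vectors \<open>x\<^sub>i\<close> with \<open>\<Sum> v x\<^sub>i = 1\<close>. By homogeneity maximality of \<open>W z = \<rho>\<close>
  means that \<open>W (\<Sum> x'\<^sub>i) \<le> \<rho> * \<Sum> v x'\<^sub>i\<close> for all vectors \<open>x'\<^sub>i\<close>, with equality at the \<open>x\<^sub>i\<close>. The second variation is
  the hypothesis of \<open>parallel_sum_ineq\<close> for the form \<open>D2 W z / \<rho>\<close>.\<close>

lemma contact:
  assumes W: "Cinf (- {0}) W" "hom1 W" and \<rho>: "\<rho> > 0" and z: "z \<in> Chull" "W z = \<rho>"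
    and max: "\<And>y. y \<in> Chull \<Longrightarrow> W y \<le> \<rho>" and WG: "D2 W z \<in> MG a"
  shows "c * g z powr (1 + \<alpha>) \<le> \<rho> / MF a b (D2 W z)"
proof -
  have z0: "z \<noteq> 0" using z(2) \<rho> hom1_0[OF W(2)] by auto
  obtain S u where S: "finite S" "S \<subseteq> Y" "\<forall>y\<in>S. 0 \<le> u y" "sum u S = 1" "(\<Sum>y\<in>S. u y *\<^sub>R y) = z"
    using z(1) unfolding Chull_def convex_hull_explicit by auto
  define I where "I = {y\<in>S. u y > 0}"
  define x where "x y = u y *\<^sub>R y" for y
  have I: "finite I" "I \<subseteq> S" using S by (auto simp: I_def)
  have off: "u y = 0" if "y \<in> S - I" for y using that S(3) by (force simp: I_def)
  have sumu: "sum u I = 1" using sum.mono_neutral_left[OF S(1) I(2), of u] off S(4) by auto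
  have Ine: "I \<noteq> {}" using sumu by auto
  have sumx: "(\<Sum>y\<in>I. x y) = z"
    using sum.mono_neutral_left[OF S(1) I(2), of x] off S(5) by (auto simp: x_def)
  have Y: "y \<in> Y" "u y > 0" if "y \<in> I" for y using that S(2) by (auto simp: I_def)
  have x0: "x y \<noteq> 0" if "y \<in> I" for y using Y[OF that] Y_props(1)[of y] by (auto simp: x_def)
  have vx: "v (x y) = u y" if "y \<in> I" for y
    using hom1D[OF vh Y(2)[OF that], of y] Y_props(2)[OF Y(1)[OF that]] by (simp add: x_def)
  have sumv: "(\<Sum>y\<in>I. v (x y)) = 1" using vx sumu by simp
  have key: "W (\<Sum>i\<in>J. x' i) \<le> \<rho> * (\<Sum>i\<in>J. v (x' i))"
    if "finite J" "J \<noteq> {}" "\<And>i. i \<in> J \<Longrightarrow> x' i \<noteq> 0" for J :: "'i set" and x' :: "'i \<Rightarrow> 'a"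
  proof -
    let ?J = "\<Sum>i\<in>J. v (x' i)"
    have J: "?J > 0" using that vpos by (intro sum_pos) auto
    have "W ((\<Sum>i\<in>J. x' i) /\<^sub>R ?J) \<le> \<rho>" by (intro max Chull_mem that)
    moreover have "W ((\<Sum>i\<in>J. x' i) /\<^sub>R ?J) = W (\<Sum>i\<in>J. x' i) / ?J"
      using hom1D[OF W(2), of "inverse ?J" "\<Sum>i\<in>J. x' i"] J by (simp add: divide_inverse mult.commute)
    ultimately show ?thesis using J by (simp add: pos_divide_le_eq)
  qed
  have xP: "x y \<in> - {0}" if "y \<in> I" for y using x0[OF that] by simp
  have zP: "z \<in> - {0}" using z0 by simp
  have le: "D2 W z (\<Sum>y\<in>I. h y) (\<Sum>y\<in>I. h y) \<le> \<rho> * (\<Sum>y\<in>I. D2 v (x y) (h y) (h y))" for h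
  proof -
    have j: "jet2 (\<lambda>s. \<rho> * (\<Sum>y\<in>I. v (x y + s *\<^sub>R h y)) - W (z + s *\<^sub>R (\<Sum>y\<in>I. h y)))
       (\<rho> * (\<Sum>y\<in>I. v (x y)) - W z) (\<rho> * (\<Sum>y\<in>I. D1 v (x y) (h y)) - D1 W z (\<Sum>y\<in>I. h y))
       (\<rho> * (\<Sum>y\<in>I. D2 v (x y) (h y) (h y)) - D2 W z (\<Sum>y\<in>I. h y) (\<Sum>y\<in>I. h y))"
      by (intro jet2_diff jet2_cmult jet2_sum I jet2_line[OF vC open_punct xP] jet2_line[OF W(1) open_punct zP])
    have "\<forall>\<^sub>F s in nhds (0::real). \<forall>y\<in>I. x y + s *\<^sub>R h y \<noteq> 0"
      using line_nonzero x0 I(1) by (intro eventually_ball_finite) auto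
    then have "\<forall>\<^sub>F s in nhds 0. \<rho> * (\<Sum>y\<in>I. v (x y + s *\<^sub>R h y)) - W (z + s *\<^sub>R (\<Sum>y\<in>I. h y)) \<ge>
       \<rho> * (\<Sum>y\<in>I. v (x y + 0 *\<^sub>R h y)) - W (z + 0 *\<^sub>R (\<Sum>y\<in>I. h y))"
    proof eventually_elim
      case (elim s)
      have "(\<Sum>y\<in>I. x y + s *\<^sub>R h y) = z + s *\<^sub>R (\<Sum>y\<in>I. h y)"
        by (simp add: sum.distrib sumx scaleR_right.sum)
      then show ?case using key[OF I(1) Ine, of "\<lambda>y. x y + s *\<^sub>R h y"] elim z(2) sumv by simp
    qed
    from jet2_min(2)[OF j this] show ?thesis by simp
  qed
  \<comment> \<open>Splitting \<open>x\<^sub>y\<close> into \<open>x\<^sub>y / 2 + s w\<close> and \<open>x\<^sub>y / 2 - s w\<close> gives a competitor, so \<open>v\<close> is convex to second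
    order at the contact points.\<close>
  have psd: "D2 v (x y) w w \<ge> 0" if y: "y \<in> I" for y w
  proof -
    let ?h = "(1/2) *\<^sub>R x y"
    have hP: "?h \<in> - {0}" using x0[OF y] by simp
    have j: "jet2 (\<lambda>s. v (?h + s *\<^sub>R w) + v (?h + s *\<^sub>R (- w))) (v ?h + v ?h) (D1 v ?h w + D1 v ?h (- w)) (D2 v ?h w w + D2 v ?h (- w) (- w))"
      by (intro jet2_add jet2_line[OF vC open_punct hP])
    have "\<forall>\<^sub>F s in nhds (0::real). ?h + s *\<^sub>R w \<noteq> 0" "\<forall>\<^sub>F s in nhds (0::real). ?h + s *\<^sub>R (- w) \<noteq> 0"
      by (rule line_nonzero, use hP in simp)+
    then have "\<forall>\<^sub>F s in nhds 0. v (?h + s *\<^sub>R w) + v (?h + s *\<^sub>R (- w)) \<ge> v (?h + 0 *\<^sub>R w) + v (?h + 0 *\<^sub>R (- w))"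
    proof eventually_elim
      case (elim s)
      define x' where "x' k = (case k of None \<Rightarrow> ?h + s *\<^sub>R w | Some i \<Rightarrow> if i = y then ?h + s *\<^sub>R (- w) else x i)" for k
      let ?J = "insert None (Some ` I)"
      have sJ: "(\<Sum>k\<in>?J. f k) = f None + (f (Some y) + (\<Sum>i\<in>I - {y}. f (Some i)))" for f :: "'a option \<Rightarrow> 'b::comm_monoid_add"
        using I(1) y by (subst sum.insert) (auto simp: sum.reindex sum.remove[of I y])
      have 1: "(\<Sum>k\<in>?J. x' k) = z"
      proof -
        have "(\<Sum>i\<in>I - {y}. x' (Some i)) = (\<Sum>i\<in>I - {y}. x i)" by (intro sum.cong) (auto simp: x'_def)
        moreover have "z = x y + (\<Sum>i\<in>I - {y}. x i)" using sumx sum.remove[OF I(1) y, of x] by simp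
        moreover have "x' None + x' (Some y) = x y" by (simp add: x'_def flip: scaleR_add_left)
        ultimately show ?thesis unfolding sJ by (simp add: add.assoc[symmetric])
      qed
      have 2: "(\<Sum>k\<in>?J. v (x' k)) = v (?h + s *\<^sub>R w) + v (?h + s *\<^sub>R (- w)) + (1 - v (x y))"
      proof -
        have "(\<Sum>i\<in>I - {y}. v (x' (Some i))) = (\<Sum>i\<in>I - {y}. v (x i))" by (intro sum.cong) (auto simp: x'_def)
        moreover have "1 = v (x y) + (\<Sum>i\<in>I - {y}. v (x i))" using sumv sum.remove[OF I(1) y, of "\<lambda>i. v (x i)"] by simp
        ultimately show ?thesis unfolding sJ by (simp add: x'_def)
      qed
      have "W (\<Sum>k\<in>?J. x' k) \<le> \<rho> * (\<Sum>k\<in>?J. v (x' k))"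
        using elim x0 I(1) by (intro key) (auto simp: x'_def split: if_splits)
      then have "1 \<le> v (?h + s *\<^sub>R w) + v (?h + s *\<^sub>R (- w)) + (1 - v (x y))"
        unfolding 1 2 z(2) using \<rho> by simp
      moreover have "v ?h = v (x y) / 2" using hom1D[OF vh, of "1/2" "x y"] by simp
      ultimately show ?case by simp
    qed
    from jet2_min(2)[OF j this] have "D2 v ?h w w + D2 v ?h (- w) (- w) \<ge> 0" .
    moreover have "D2 v ?h (- w) (- w) = D2 v ?h w w"
      using symform_scale_left[OF v_sym[of ?h], of "-1"] symform_scale_right[OF v_sym[of ?h], of _ "-1"] hP by simp
    moreover have "D2 v ?h w w = 2 * D2 v (x y) w w" using hom1_D2[OF vC vh, of "1/2" "x y"] x0[OF y] by simp
    ultimately show ?thesis by simp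
  qed
  let ?C = "\<lambda>p q. (1/\<rho>) * D2 W z p q"
  have sW: "symform (D2 W z)" using symform_D2[OF W(1) open_punct zP] .
  note fs = form_scale[OF sW WG _ ab(1), of "1/\<rho>"]
  have "(\<Sum>y\<in>I. 1 / MF a b (D2 v (x y))) \<le> 1 / MF a b ?C"
  proof (rule parallel_sum_ineq[OF I(1) Ine _ _ _ symform_cmult[OF sW] _ ab])
    show "symform (D2 v (x i))" "D2 v (x i) \<in> MG a" "D2 v (x i) w w \<ge> 0" if "i \<in> I" for i w
      using v_sym vG x0 psd that by auto
    show "?C \<in> MG a" using fs \<rho> by simp
    show "?C (\<Sum>i\<in>I. h i) (\<Sum>i\<in>I. h i) \<le> (\<Sum>i\<in>I. D2 v (x i) (h i) (h i))" for h
      using le[of h] \<rho> by (simp add: field_simps)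
  qed
  also have "1 / MF a b ?C = \<rho> / MF a b (D2 W z)" using fs \<rho> by simp
  finally show ?thesis
    using rhs_superadd[OF I(1) Ine, of x] x0 sumx sumv z0 by simp
qed

lemma Chull_ball:
  assumes m: "m > 0" "\<And>x. m * norm x \<le> v x" and z: "z \<in> Chull"
  shows "m * norm z \<le> 1"
proof -
  have "Chull \<subseteq> cball 0 (1/m)" unfolding Chull_def
  proof (rule hull_minimal)
    show "Y \<subseteq> cball 0 (1/m)" proof
      fix y assume "y \<in> Y"
      then show "y \<in> cball 0 (1/m)" using m(1) m(2)[of y] Y_props(2)[of y] by (simp add: field_simps)
    qed
  qed simp
  then show ?thesis using z m(1) by (auto simp: field_simps)
qed

text \<open>The conclusion of \<open>form_gain\<close> for the Hessian of \<open>v\<close> at all unit vectors simultaneously. The parameter \<open>\<kappa>\<close>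
  is \<open>0\<close> in the proof of convexity and positive in the proof of strict convexity.\<close>

definition gain_ok :: "real \<Rightarrow> real \<Rightarrow> bool" where
  "gain_ok cg \<eta> \<longleftrightarrow> cg > 0 \<and> \<eta> > 0 \<and> (\<forall>z u \<tau> \<kappa> B. norm z = 1 \<and> norm u = 1 \<and> 0 \<le> \<tau> \<and> \<tau> \<le> 1 \<and> 0 \<le> \<kappa> \<and> \<kappa> \<le> 1 \<and> symform B \<and>
     (\<forall>w. D2 v z w w + \<kappa> * (norm w)^2 + \<tau> * ((u \<bullet> w)^2 - \<eta> * (norm w)^2) \<le> B w w) \<longrightarrow>
     B \<in> MG a \<and> (1 + \<tau> * cg) * MF a b (\<lambda>p q. D2 v z p q + \<kappa> * (p \<bullet> q)) \<le> MF a b B)"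

lemma gain_okD:
  assumes "gain_ok cg \<eta>"
  shows "cg > 0" "\<eta> > 0" "norm z = 1 \<Longrightarrow> norm u = 1 \<Longrightarrow> 0 \<le> \<tau> \<Longrightarrow> \<tau> \<le> 1 \<Longrightarrow> 0 \<le> \<kappa> \<Longrightarrow> \<kappa> \<le> 1 \<Longrightarrow> symform B \<Longrightarrow>
     (\<And>w. D2 v z w w + \<kappa> * (norm w)^2 + \<tau> * ((u \<bullet> w)^2 - \<eta> * (norm w)^2) \<le> B w w) \<Longrightarrow>
     B \<in> MG a \<and> (1 + \<tau> * cg) * MF a b (\<lambda>p q. D2 v z p q + \<kappa> * (p \<bullet> q)) \<le> MF a b B"
  using assms unfolding gain_ok_def by blast+

lemma gain_const: "\<exists>cg \<eta>. gain_ok cg \<eta>"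
proof -
  have sub: "sphere 0 1 \<subseteq> - {0::'a}" by auto
  obtain r where r: "r > 0" "\<And>x. x \<in> sphere 0 1 \<Longrightarrow> (\<lambda>p q. D2 v x p q - r * (p \<bullet> q)) \<in> MG a"
    using MG_radius[OF vC open_punct compact_sphere sub, of a] vG sub by blast
  obtain R where R: "R > 0" "\<And>x w. x \<in> sphere 0 1 \<Longrightarrow> \<bar>D2 v x w w\<bar> \<le> R * (norm w)^2"
    using D2_bound_compact[OF vC open_punct compact_sphere sub] by blast
  obtain cg \<eta> where cg: "cg > 0" "\<eta> > 0" and gain: "\<forall>(A :: 'a \<Rightarrow> 'a \<Rightarrow> real) B u \<tau>.
     symform A \<and> (\<lambda>v w. A v w - r * (v \<bullet> w)) \<in> MG a \<and> (\<forall>w. \<bar>A w w\<bar> \<le> (R + 1) * (norm w)^2) \<and> norm u = 1 \<and>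
     0 \<le> \<tau> \<and> \<tau> \<le> 1 \<and> symform B \<and> (\<forall>w. A w w + \<tau> * ((u \<bullet> w)^2 - \<eta> * (norm w)^2) \<le> B w w)
     \<longrightarrow> B \<in> MG a \<and> (1 + \<tau> * cg) * MF a b A \<le> MF a b B"
    using form_gain[OF ab r(1), of "R + 1"] by blast
  have main: "B \<in> MG a \<and> (1 + \<tau> * cg) * MF a b (\<lambda>p q. D2 v z p q + \<kappa> * (p \<bullet> q)) \<le> MF a b B"
    if 1: "norm z = 1 \<and> norm u = 1 \<and> 0 \<le> \<tau> \<and> \<tau> \<le> 1 \<and> 0 \<le> \<kappa> \<and> \<kappa> \<le> 1 \<and> symform B \<and>
     (\<forall>w. D2 v z w w + \<kappa> * (norm w)^2 + \<tau> * ((u \<bullet> w)^2 - \<eta> * (norm w)^2) \<le> B w w)" for z u \<tau> \<kappa> B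
  proof -
    let ?A = "\<lambda>p q. D2 v z p q + \<kappa> * (p \<bullet> q)"
    have z: "z \<in> sphere 0 1" "z \<noteq> 0" using 1 by auto
    have sA: "symform ?A" using z by (intro symform_add symform_cmult symform_inner v_sym)
    have s1: "symform (\<lambda>p q. D2 v z p q - r * (p \<bullet> q))" "symform (\<lambda>p q. ?A p q - r * (p \<bullet> q))"
      using z sA by (auto intro!: symform_diff symform_cmult symform_inner v_sym)
    have "(\<lambda>p q. ?A p q - r * (p \<bullet> q)) \<in> MG a"
      using 1 by (intro form_mono(1)[OF s1(1) r(2)[OF z(1)] s1(2) _ ab(1)]) auto
    moreover have "\<bar>?A w w\<bar> \<le> (R + 1) * (norm w)^2" for w
    proof -
      have "\<bar>\<kappa> * (w \<bullet> w)\<bar> \<le> 1 * (norm w)^2" using 1 unfolding power2_norm_eq_inner by (simp add: abs_mult mult_left_le_one_le)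
      then show ?thesis using R(2)[OF z(1), of w] abs_triangle_ineq[of "D2 v z w w" "\<kappa> * (w \<bullet> w)"]
        by (simp add: algebra_simps)
    qed
    ultimately show ?thesis using gain[rule_format, of ?A u \<tau> B] sA 1 by (simp add: power2_norm_eq_inner)
  qed
  have "gain_ok cg \<eta>" unfolding gain_ok_def using cg main by blast
  then show ?thesis by blast
qed

text \<open>Suppose the maximum \<open>Q\<close> of \<open>v\<close> on the hull exceeds \<open>1\<close>, and maximise \<open>W = v + \<epsilon> * h\<close> instead, where
  \<open>h x = exp (K * s x) * norm x\<close>. If \<open>\<epsilon>\<close> is small, the maximum point \<open>z\<close> still satisfies \<open>v z > (1 + Q) / 2\<close>,
  so its direction \<open>e\<close> is not near \<open>p\<close>. By \<open>gain_ok\<close> the quotient \<open>F\<close> at \<open>D2 W z\<close> is larger than at \<open>D2 v z\<close> by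
  the factor \<open>1 + \<tau> * cg\<close>, where \<open>\<tau>\<close> is of the order of \<open>\<epsilon> * K\<^sup>2\<close>. The inequality of \<open>contact\<close>, the
  equation at \<open>z\<close> and \<open>\<alpha> \<ge> 1\<close> then give \<open>(1 + \<tau> * cg) * v z \<le> v z + \<epsilon> * h z\<close>. Here the right-hand side
  exceeds \<open>v z\<close> by a term of order \<open>\<epsilon>\<close> only, which is impossible for large \<open>K\<close>.\<close>

theorem v_subadd: "v (x + y) \<le> v x + v y"
proof (rule ccontr)
  assume neg: "\<not> v (x + y) \<le> v x + v y"
  have xy: "x \<noteq> 0" "y \<noteq> 0" using neg v_0 by auto
  obtain p where p: "norm p = 1" "v p > 0" "\<And>x. v p * norm x \<le> v x" using sphere_min by blast
  define m where "m = v p"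
  have m: "m > 0" "\<And>x. m * norm x \<le> v x" using p by (auto simp: m_def)
  have p0: "p \<noteq> 0" using p(1) by auto
  have vxy: "v x + v y > 0" using vpos[OF xy(1)] vpos[OF xy(2)] by simp
  have q0: "(x + y) /\<^sub>R (v x + v y) \<in> Chull"
    using Chull_mem[of "{True, False}" "\<lambda>k. if k then x else y"] xy by simp
  obtain q where q: "q \<in> Chull" "\<And>z. z \<in> Chull \<Longrightarrow> v z \<le> v q"
    using continuous_attains_sup[OF compact_Chull _ continuous_on_subset[OF v_cont]] q0 by blast
  define Q where "Q = v q"
  have "v ((x + y) /\<^sub>R (v x + v y)) > 1"
  proof -
    have "v ((x + y) /\<^sub>R (v x + v y)) = v (x + y) / (v x + v y)"
      using vxy hom1D[OF vh, of "inverse (v x + v y)" "x + y"] by (simp add: divide_inverse mult.commute)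
    then show ?thesis using neg vxy by (simp add: pos_less_divide_eq)
  qed
  then have Q: "Q > 1" using q(2)[OF q0] by (simp add: Q_def)
  have q0: "q \<noteq> 0" using Q v_0 by (auto simp: Q_def)
  have "\<forall>\<^sub>F z in nhds p. dist (v z) (v p) < m * (Q - 1) / 2"
    using m Q by (intro continuous_near[OF v_cont]) auto
  then obtain \<delta> where \<delta>: "\<delta> > 0" "\<And>z. dist z p < \<delta> \<Longrightarrow> dist (v z) (v p) < m * (Q - 1) / 2"
    unfolding eventually_nhds_metric by blast
  obtain s \<gamma> C where bs: "barrier_for p \<delta> s \<gamma> C"
    using barrier_exists[OF dim p(1) \<delta>(1)] by (elim exE)
  note s = barrier_forD[OF bs]
  obtain cg \<eta> where "gain_ok cg \<eta>" using gain_const by (elim exE)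
  note cg = gain_okD(1,2)[OF this] and gain = gain_okD(3)[OF this]
  \<comment> \<open>The first bound makes the negative part of the Hessian of \<open>h\<close> small enough for \<open>gain_ok\<close>; the last one
    produces the contradiction.\<close>
  define K where "K = max (3 * C / (\<gamma> * \<eta>)) (max 1 (2 / (m * \<gamma> * cg)))"
  have K: "K \<ge> 1" "3 * C / (\<gamma> * \<eta>) \<le> K" "2 / (m * \<gamma> * cg) \<le> K" by (auto simp: K_def)
  have K1: "3 * C \<le> K * \<gamma> * \<eta>" using K(2) s(1) cg by (simp add: field_simps)
  have K2: "1 / m < K^2 * \<gamma> * cg"
  proof -
    have "2 / m \<le> K * (\<gamma> * cg)" using K(3) s(1) cg m by (simp add: field_simps)
    also have "\<dots> \<le> K^2 * (\<gamma> * cg)" using K(1) s(1) cg by (intro mult_right_mono) (auto simp: power2_eq_square)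
    finally have "2 / m \<le> K^2 * (\<gamma> * cg)" .
    moreover have "1 / m < 2 / m" using m by (simp add: field_simps)
    ultimately show ?thesis by (simp add: mult.assoc)
  qed
  define \<psi> where "\<psi> x = exp (K * s x)" for x
  define h where "h x = \<psi> x * norm x" for x
  have \<psi>C: "Cinf (- {0}) \<psi>" unfolding \<psi>_def by (intro Cinf_exp Cinf_mult Cinf_const s(3))
  have hC: "Cinf (- {0}) h" unfolding h_def by (intro Cinf_mult \<psi>C Cinf_norm)
  have hh: "hom1 h" unfolding hom1_def
  proof (intro allI impI)
    fix t :: real and x :: 'a assume t: "t > 0"
    show "h (t *\<^sub>R x) = t * h x" using t s(4)[OF t, of x] by (cases "x = 0") (auto simp: h_def \<psi>_def)
  qed
  obtain \<Psi> where \<Psi>: "\<Psi> > 0" "\<And>x. \<bar>h x\<bar> \<le> \<Psi> * norm x" using hom1_bound[OF hC hh] by blast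
  \<comment> \<open>The first bound keeps the maximum point away from \<open>p\<close>, the second ensures \<open>\<tau> \<le> 1\<close>.\<close>
  define \<epsilon> where "\<epsilon> = min (m * (Q - 1) / (4 * \<Psi>)) (1 / (\<Psi> * K^2 * \<gamma>))"
  have K0: "K > 0" using K by simp
  have \<epsilon>: "\<epsilon> > 0" "\<epsilon> * \<Psi> \<le> m * (Q - 1) / 4" "\<epsilon> * \<Psi> * (K^2 * \<gamma>) \<le> 1"
  proof -
    have P: "\<Psi> * K^2 * \<gamma> > 0" using \<Psi> K0 s(1) by simp
    show "\<epsilon> > 0" unfolding \<epsilon>_def using P m Q \<Psi> by auto
    have "\<epsilon> \<le> m * (Q - 1) / (4 * \<Psi>)" "\<epsilon> \<le> 1 / (\<Psi> * K^2 * \<gamma>)" by (auto simp: \<epsilon>_def)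
    then show "\<epsilon> * \<Psi> \<le> m * (Q - 1) / 4" "\<epsilon> * \<Psi> * (K^2 * \<gamma>) \<le> 1"
      using \<Psi> P K0 s(1) by (auto simp: pos_le_divide_eq mult.assoc mult.left_commute mult.commute)
  qed
  define W where "W x = v x + \<epsilon> * h x" for x
  have WC: "Cinf (- {0}) W" unfolding W_def by (intro Cinf_add vC Cinf_mult Cinf_const hC)
  have Wh: "hom1 W" unfolding W_def by (intro hom1_add hom1_cmult vh hh)
  obtain z where z: "z \<in> Chull" "\<And>y. y \<in> Chull \<Longrightarrow> W y \<le> W z"
    using continuous_attains_sup[OF compact_Chull _ continuous_on_subset[OF hom1_cont[OF WC Wh]]] q(1) by blast
  define \<rho> where "\<rho> = W z"
  have hn: "h x \<ge> 0" for x by (simp add: h_def \<psi>_def)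
  have \<rho>Q: "\<rho> \<ge> Q" using z(2)[OF q(1)] hn[of q] \<epsilon>(1) by (simp add: \<rho>_def W_def Q_def) (smt (verit) mult_nonneg_nonneg)
  then have \<rho>: "\<rho> > 0" using Q by simp
  have z0: "z \<noteq> 0" using \<rho> hom1_0[OF Wh] by (auto simp: \<rho>_def)
  have zn: "m * norm z \<le> 1" using Chull_ball[OF m z(1)] .
  have eh: "\<epsilon> * h z \<le> (Q - 1) / 4"
  proof -
    have "\<epsilon> * h z \<le> \<epsilon> * (\<Psi> * norm z)" using \<Psi>(2)[of z] \<epsilon>(1) by (intro mult_left_mono) auto
    also have "\<dots> \<le> m * (Q - 1) / 4 * norm z" using mult_right_mono[OF \<epsilon>(2), of "norm z"] by (simp add: mult.assoc)
    also have "\<dots> = (Q - 1) / 4 * (m * norm z)" by simp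
    also have "\<dots> \<le> (Q - 1) / 4 * 1" using zn Q by (intro mult_left_mono) auto
    finally show ?thesis by simp
  qed
  have vz: "v z > (1 + Q) / 2" using \<rho>Q eh Q by (simp add: \<rho>_def W_def field_simps)
  define r where "r = norm z"
  define e where "e = z /\<^sub>R r"
  have r: "r > 0" using z0 by (simp add: r_def)
  have e: "norm e = 1" "z = r *\<^sub>R e" "e \<noteq> 0" using z0 r by (auto simp: e_def r_def)
  have far: "\<delta> \<le> dist e p"
  proof (rule ccontr)
    assume "\<not> \<delta> \<le> dist e p"
    then have "dist (v e) (v p) < m * (Q - 1) / 2" using \<delta>(2)[of e] by simp
    then have "\<bar>v e - m\<bar> < m * (Q - 1) / 2" by (simp only: dist_real_def m_def)
    then have "v e < m + m * (Q - 1) / 2" by linarith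
    then have "v e < m * ((1 + Q) / 2)" by (simp add: field_simps)
    then have "r * v e < r * (m * ((1 + Q) / 2))" using r by simp
    also have "\<dots> = (m * norm z) * ((1 + Q) / 2)" by (simp add: r_def)
    also have "\<dots> \<le> 1 * ((1 + Q) / 2)" using zn Q by (intro mult_right_mono) auto
    finally have "v z < (1 + Q) / 2" using hom1D[OF vh r, of e] e(2) by simp
    then show False using vz by simp
  qed
  obtain u where u: "norm u = 1" "\<And>w. \<gamma> * (u \<bullet> w)^2 \<le> (D1 s e w)^2" using s(6)[OF e(1) far] by blast
  have eP: "e \<in> - {0}" using e by simp
  have D2h: "\<psi> e * (K^2 * \<gamma>) * ((u \<bullet> w)^2 - \<eta> * (norm w)^2) \<le> D2 h e w w" for w
  proof -
    note jh = jet2_mult[OF jet2_line[OF \<psi>C open_punct eP, of w] jet2_line[OF Cinf_norm open_punct eP, of w]]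
    have "D2 h e w w = D2 \<psi> e w w * norm e + 2 * D1 \<psi> e w * D1 norm e w + \<psi> e * D2 norm e w w"
      using jet2_unique(2)[OF jet2_line[OF hC open_punct eP, of w, unfolded h_def] jh] by (simp add: h_def[abs_def])
    also have "\<dots> = \<psi> e * (K * D2 s e w w + (K * D1 s e w)^2 + 2 * K * D1 s e w * (e \<bullet> w) + (norm (tang e w))^2)"
      using exp_barrier_derivs(2,3)[OF s(3) e(3), of K w] norm_derivs(1,2)[OF e(3), of w] e(1)
      by (simp add: \<psi>_def[abs_def] algebra_simps)
    finally have eq: "D2 h e w w = \<psi> e * (K * D2 s e w w + (K * D1 s e w)^2 + 2 * K * D1 s e w * (e \<bullet> w) + (norm (tang e w))^2)" .
    have b1: "- (C * (K * (norm w)^2)) \<le> K * D2 s e w w"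
    proof -
      have "- (C * (norm w)^2) \<le> D2 s e w w" using s(5)[OF e(1), of w] by linarith
      from mult_left_mono[OF this, of K] K0 show ?thesis by (simp add: mult.left_commute)
    qed
    have b2: "- (2 * (C * (K * (norm w)^2))) \<le> 2 * K * D1 s e w * (e \<bullet> w)"
    proof -
      have "\<bar>D1 s e w * (e \<bullet> w)\<bar> \<le> (C * norm w) * norm w"
        unfolding abs_mult using s(5)[OF e(1), of w] Cauchy_Schwarz_ineq2[of e w] e(1) s(2) by (intro mult_mono) auto
      then have "- (C * norm w * norm w) \<le> D1 s e w * (e \<bullet> w)" by linarith
      from mult_left_mono[OF this, of "2 * K"] K0 show ?thesis
        by (simp add: power2_eq_square mult.assoc mult.left_commute)
    qed
    have b3: "K^2 * (\<gamma> * (u \<bullet> w)^2) \<le> (K * D1 s e w)^2" using u(2)[of w] by (simp add: power_mult_distrib mult_left_mono)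
    have b4: "3 * (C * (K * (norm w)^2)) \<le> K * \<gamma> * \<eta> * (K * (norm w)^2)"
      using mult_right_mono[OF K1, of "K * (norm w)^2"] K0 by (simp add: mult.assoc)
    have "K^2 * \<gamma> * ((u \<bullet> w)^2 - \<eta> * (norm w)^2) = K^2 * (\<gamma> * (u \<bullet> w)^2) - K * \<gamma> * \<eta> * (K * (norm w)^2)"
      by (simp add: algebra_simps power2_eq_square)
    also have "\<dots> \<le> K * D2 s e w w + (K * D1 s e w)^2 + 2 * K * D1 s e w * (e \<bullet> w) + (norm (tang e w))^2"
      using b1 b2 b3 b4 zero_le_power2[of "norm (tang e w)"] by linarith
    finally have "\<psi> e * (K^2 * \<gamma> * ((u \<bullet> w)^2 - \<eta> * (norm w)^2)) \<le> D2 h e w w"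
      unfolding eq by (intro mult_left_mono) (auto simp: \<psi>_def)
    then show ?thesis by (simp add: mult.assoc)
  qed
  define \<tau> where "\<tau> = \<epsilon> * \<psi> e * (K^2 * \<gamma>)"
  have \<psi>e: "\<psi> e = h e" "\<psi> e > 0" using e(1) by (auto simp: h_def \<psi>_def)
  have \<tau>: "\<tau> \<ge> 0" "\<tau> \<le> 1"
  proof -
    show "\<tau> \<ge> 0" unfolding \<tau>_def using \<epsilon>(1) \<psi>e(2) s(1) by simp
    have "\<psi> e \<le> \<Psi>" using \<Psi>(2)[of e] e(1) \<psi>e by simp
    then have "\<tau> \<le> \<epsilon> * \<Psi> * (K^2 * \<gamma>)" unfolding \<tau>_def using \<epsilon>(1) s(1) by (intro mult_right_mono mult_left_mono) auto
    then show "\<tau> \<le> 1" using \<epsilon>(3) by simp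
  qed
  have D2W: "D2 W e w w = D2 v e w w + \<epsilon> * D2 h e w w" for w
    using jet2_unique(2)[OF jet2_line[OF WC open_punct eP, of w, unfolded W_def]
      jet2_add[OF jet2_line[OF vC open_punct eP, of w] jet2_cmult[OF jet2_line[OF hC open_punct eP, of w], of \<epsilon>]]]
    by (simp add: W_def[abs_def])
  have sW: "symform (D2 W e)" using symform_D2[OF WC open_punct eP] .
  have "D2 W e \<in> MG a \<and> (1 + \<tau> * cg) * MF a b (\<lambda>p q. D2 v e p q + 0 * (p \<bullet> q)) \<le> MF a b (D2 W e)"
  proof (rule gain[OF e(1) u(1) \<tau>(1,2) _ _ sW])
    fix w
    have "\<tau> * ((u \<bullet> w)^2 - \<eta> * (norm w)^2) = \<epsilon> * (\<psi> e * (K^2 * \<gamma>) * ((u \<bullet> w)^2 - \<eta> * (norm w)^2))" by (simp add: \<tau>_def mult.assoc)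
    also have "\<dots> \<le> \<epsilon> * D2 h e w w" using D2h[of w] \<epsilon>(1) by (intro mult_left_mono) auto
    finally show "D2 v e w w + 0 * (norm w)^2 + \<tau> * ((u \<bullet> w)^2 - \<eta> * (norm w)^2) \<le> D2 W e w w" by (simp add: D2W)
  qed auto
  then have WG: "D2 W e \<in> MG a" and Wge: "(1 + \<tau> * cg) * MF a b (D2 v e) \<le> MF a b (D2 W e)" by simp_all
  have Dz: "D2 W z = (\<lambda>p q. (1/r) * D2 W e p q)" "D2 v z = (\<lambda>p q. (1/r) * D2 v e p q)"
    unfolding e(2) using hom1_D2[OF WC Wh r e(3)] hom1_D2[OF vC vh r e(3)] by (auto simp: fun_eq_iff)
  have WGz: "D2 W z \<in> MG a" "MF a b (D2 W z) = MF a b (D2 W e) / r"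
    unfolding Dz(1) using form_scale[OF sW WG _ ab(1), of "1/r"] r by auto
  have MFz: "MF a b (D2 v z) = MF a b (D2 v e) / r"
    unfolding Dz(2) using form_scale[OF v_sym[OF e(3)] vG[OF e(3)] _ ab(1), of "1/r"] r by simp
  have ct: "c * g z powr (1 + \<alpha>) \<le> \<rho> / MF a b (D2 W z)"
    by (rule contact[OF WC Wh \<rho> z(1) _ _ WGz(1)]) (use z(2) in \<open>auto simp: \<rho>_def\<close>)
  have f0: "MF a b (D2 v z) > 0" by (rule v_MFpos[OF z0])
  have t1: "1 + \<tau> * cg > 0" using \<tau>(1) cg(1) by (simp add: add_pos_nonneg)
  have ge: "(1 + \<tau> * cg) * MF a b (D2 v z) \<le> MF a b (D2 W z)"
    using Wge r by (simp add: WGz(2) MFz divide_right_mono)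
  have "c * g z powr (1 + \<alpha>) \<le> \<rho> / ((1 + \<tau> * cg) * MF a b (D2 v z))"
    using ct ge f0 t1 \<rho> by (smt (verit, best) divide_left_mono mult_pos_pos)
  also have "\<dots> = \<rho> / (1 + \<tau> * cg) * (1 / MF a b (D2 v z))" by simp
  also have "\<dots> = \<rho> / (1 + \<tau> * cg) * (c * (g z powr (1 + \<alpha>) * v z powr (- \<alpha>)))"
    by (simp only: eqn[OF z0])
  finally have "c * g z powr (1 + \<alpha>) * 1 \<le> c * g z powr (1 + \<alpha>) * (\<rho> / (1 + \<tau> * cg) * v z powr (- \<alpha>))"
    by (simp add: mult_ac)
  then have "1 \<le> \<rho> / (1 + \<tau> * cg) * v z powr (- \<alpha>)"
    using c gpos[OF z0] by (subst (asm) mult_le_cancel_left_pos) auto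
  then have "1 \<le> \<rho> / ((1 + \<tau> * cg) * v z powr \<alpha>)"
    by (simp add: powr_minus divide_inverse mult.assoc)
  then have A: "(1 + \<tau> * cg) * v z powr \<alpha> \<le> \<rho>"
    using t1 vpos[OF z0] by (subst (asm) pos_le_divide_eq) auto
  have "v z powr 1 \<le> v z powr \<alpha>" using vz Q \<alpha> by (intro powr_mono) auto
  then have B: "(1 + \<tau> * cg) * v z \<le> \<rho>" using A t1 vpos[OF z0] by (smt (verit) mult_left_mono powr_one)
  have "\<epsilon> * h z = r * (\<epsilon> * \<psi> e)" using hom1D[OF hh r, of e] e(2) \<psi>e by simp
  also have "\<dots> \<le> (v z / m) * (\<epsilon> * \<psi> e)"
    using m(2)[of z] m(1) \<epsilon>(1) \<psi>e(2) by (intro mult_right_mono) (auto simp: field_simps r_def)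
  finally have "\<rho> \<le> v z + (v z / m) * (\<epsilon> * \<psi> e)" by (simp add: \<rho>_def W_def)
  then have "v z * (\<tau> * cg) \<le> v z * (\<epsilon> * \<psi> e * (1 / m))" using B by (simp add: algebra_simps)
  then have "\<tau> * cg \<le> \<epsilon> * \<psi> e * (1 / m)" using vpos[OF z0] by (simp only: mult_le_cancel_left_pos)
  then have "\<epsilon> * \<psi> e * (K^2 * \<gamma> * cg) \<le> \<epsilon> * \<psi> e * (1 / m)" by (simp add: \<tau>_def mult.assoc)
  then have "K^2 * \<gamma> * cg \<le> 1 / m" using \<epsilon>(1) \<psi>e(2) by (subst (asm) mult_le_cancel_left_pos) auto
  then show False using K2 by simp
qed

end

section \<open>The triangle defect of the norm\<close>

lemma amgm2: "2 * x * y \<le> x^2 + y^2" for x y :: real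
  using sum_squares_bound[of x y] by simp

text \<open>The first and second variation of the defect \<open>d = norm x + norm y - norm (x + y)\<close> in direction \<open>(h, k)\<close>,
  bounded in terms of \<open>d\<close> itself, of \<open>e = h + k\<close>, and of \<open>\<sigma>\<close>, which measures how far the relative velocities
  \<open>h / norm x\<close> and \<open>k / norm y\<close> differ. With \<open>l = norm x + norm y\<close> and the difference \<open>\<Delta>\<close> of the relative
  velocities, \<open>h\<close> and \<open>k\<close> are the proportional parts of \<open>e\<close> plus and minus \<open>\<rho> *\<^sub>R \<Delta>\<close>, and
  \<open>\<sigma> = \<rho> * (norm \<Delta>)\<^sup>2\<close>. The distance \<open>\<theta>\<close> between the directions of \<open>x\<close> and \<open>y\<close> satisfies
  \<open>\<rho> * \<theta>\<^sup>2 \<le> 2 * d\<close>, so all mixed terms are bounded by \<open>d\<close> and \<open>\<sigma>\<close>. The first estimate is what allows a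
  multiple of the identity divided by the norm to absorb \<open>\<sigma>\<close>.\<close>

lemma norm_defect_estimates:
  fixes x y h k :: "'a::euclidean_space"
  assumes x: "x \<noteq> 0" and y: "y \<noteq> 0" and z: "norm (x + y) = 1"
  defines "e \<equiv> h + k" and "d \<equiv> norm x + norm y - 1"
  shows "\<exists>\<sigma>\<ge>0. (1 - d) * (norm e)^2 + \<sigma> \<le> (norm h)^2 / norm x + (norm k)^2 / norm y \<and>
    2 * norm e * \<bar>D1 norm x h + D1 norm y k - D1 norm (x + y) e\<bar> \<le> 4 * d * (norm e)^2 + \<sigma> \<and>
    - (7 * d * (norm e)^2 + 2 * \<sigma>) \<le> D2 norm x h h + D2 norm y k k - D2 norm (x + y) e e"
proof -
  define A where "A = norm x"
  define B where "B = norm y"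
  define l where "l = A + B"
  define X where "X = x /\<^sub>R A"
  define Y where "Y = y /\<^sub>R B"
  define \<rho> where "\<rho> = A * B / l"
  define \<Delta> where "\<Delta> = h /\<^sub>R A - k /\<^sub>R B"
  have AB: "A > 0" "B > 0" "l > 0" using x y by (auto simp: A_def B_def l_def intro!: add_pos_pos)
  have l1: "l \<ge> 1" using norm_triangle_ineq[of x y] z by (simp add: l_def A_def B_def)
  have d: "d = l - 1" "d \<ge> 0" using l1 by (auto simp: d_def l_def A_def B_def)
  have \<rho>: "\<rho> > 0" "\<rho> / A = B / l" "\<rho> / B = A / l" using AB by (auto simp: \<rho>_def)
  have nX: "norm X = 1" "norm Y = 1" using AB by (auto simp: X_def Y_def A_def B_def)
  have xX: "x = A *\<^sub>R X" "y = B *\<^sub>R Y" using AB by (auto simp: X_def Y_def)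
  have h: "h = (A / l) *\<^sub>R e + \<rho> *\<^sub>R \<Delta>"
  proof -
    have "(A / l) *\<^sub>R e + \<rho> *\<^sub>R \<Delta> = (A / l + \<rho> / A) *\<^sub>R h + (A / l - \<rho> / B) *\<^sub>R k"
      by (simp add: e_def \<Delta>_def algebra_simps divide_inverse)
    also have "A / l + \<rho> / A = 1" unfolding \<rho>(2) using AB by (simp add: l_def add_divide_distrib[symmetric])
    finally show ?thesis by (simp add: \<rho>(3))
  qed
  have k: "k = (B / l) *\<^sub>R e - \<rho> *\<^sub>R \<Delta>"
  proof -
    have "(B / l) *\<^sub>R e - \<rho> *\<^sub>R \<Delta> = (B / l - \<rho> / A) *\<^sub>R h + (B / l + \<rho> / B) *\<^sub>R k"
      by (simp add: e_def \<Delta>_def algebra_simps divide_inverse)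
    also have "B / l + \<rho> / B = 1" unfolding \<rho>(3) using AB by (simp add: l_def add_divide_distrib[symmetric])
    finally show ?thesis by (simp add: \<rho>(2))
  qed
  define E where "E = (norm e)^2"
  define D where "D = (norm \<Delta>)^2"
  define a1 where "a1 = X \<bullet> e" define a2 where "a2 = Y \<bullet> e"
  define b1 where "b1 = X \<bullet> \<Delta>" define b2 where "b2 = Y \<bullet> \<Delta>"
  define ze where "ze = (x + y) \<bullet> e"
  define \<theta> where "\<theta> = norm (X - Y)"
  have th: "A * B * \<theta>^2 = l^2 - 1"
  proof -
    have "1 = (norm (A *\<^sub>R X + B *\<^sub>R Y))^2" using z xX by simp
    also have "\<dots> = A^2 + B^2 + 2 * A * B * (X \<bullet> Y)"
      using nX unfolding power2_norm_eq_inner by (simp add: inner_simps inner_commute norm_eq_1 power2_eq_square)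
    finally have 1: "1 = A^2 + B^2 + 2 * A * B * (X \<bullet> Y)" .
    have "\<theta>^2 = 2 - 2 * (X \<bullet> Y)"
      using nX unfolding \<theta>_def power2_norm_eq_inner by (simp add: inner_simps inner_commute norm_eq_1)
    then have "A * B * \<theta>^2 = 2 * A * B - 2 * A * B * (X \<bullet> Y)" by (simp only:) (simp add: algebra_simps)
    moreover have "l^2 = A^2 + B^2 + 2 * A * B" by (simp add: l_def algebra_simps power2_eq_square)
    ultimately show ?thesis using 1 by linarith
  qed
  have rth: "\<rho> * \<theta>^2 \<le> 2 * d" "\<rho> * \<theta>^2 / l^2 \<le> 2 * d"
  proof -
    have e1: "\<rho> * \<theta>^2 = (l + 1) / l * d" using th AB by (simp add: \<rho>_def d field_simps power2_eq_square)
    have "(l + 1) / l \<le> 2" using l1 by (simp add: field_simps)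
    then show 1: "\<rho> * \<theta>^2 \<le> 2 * d" unfolding e1 using d by (intro mult_right_mono) auto
    have "\<rho> * \<theta>^2 / l^2 \<le> \<rho> * \<theta>^2 / 1" using l1 \<rho> by (intro divide_left_mono) auto
    then show "\<rho> * \<theta>^2 / l^2 \<le> 2 * d" using 1 by simp
  qed
  have En: "E \<ge> 0" "D \<ge> 0" by (auto simp: E_def D_def)
  have cs: "\<bar>a1 - a2\<bar> \<le> \<theta> * norm e" "\<bar>b1 - b2\<bar> \<le> \<theta> * norm \<Delta>" "\<bar>b1\<bar> \<le> norm \<Delta>" "\<bar>b2\<bar> \<le> norm \<Delta>" "\<bar>a2\<bar> \<le> norm e" "\<bar>ze\<bar> \<le> norm e"
    using Cauchy_Schwarz_ineq2[of "X - Y" e] Cauchy_Schwarz_ineq2[of "X - Y" \<Delta>] Cauchy_Schwarz_ineq2[of X \<Delta>]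
      Cauchy_Schwarz_ineq2[of Y \<Delta>] Cauchy_Schwarz_ineq2[of Y e] Cauchy_Schwarz_ineq2[of "x + y" e] nX z
    by (auto simp: a1_def a2_def b1_def b2_def ze_def \<theta>_def inner_simps)
  have zea: "ze = A * a1 + B * a2" unfolding ze_def a1_def a2_def using xX by (simp add: inner_simps)
  have cross: "2 * \<rho> * (\<theta> * norm e * norm \<Delta>) \<le> 2 * d * E + \<rho> * D"
  proof -
    have "2 * (\<theta> * norm e) * norm \<Delta> \<le> (\<theta> * norm e)^2 + (norm \<Delta>)^2" by (rule amgm2)
    from mult_left_mono[OF this, of \<rho>] \<rho>
    have "2 * \<rho> * (\<theta> * norm e * norm \<Delta>) \<le> \<rho> * \<theta>^2 * E + \<rho> * D"
      by (simp add: E_def D_def power_mult_distrib algebra_simps)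
    also have "\<rho> * \<theta>^2 * E \<le> 2 * d * E" using rth(1) En by (intro mult_right_mono) auto
    finally show ?thesis by simp
  qed
  have hk2: "(norm h)^2 / A + (norm k)^2 / B = E / l + \<rho> * D"
  proof -
    have n1: "(norm h)^2 = (A / l)^2 * E + 2 * (A / l) * \<rho> * (e \<bullet> \<Delta>) + \<rho>^2 * D"
      unfolding E_def D_def power2_norm_eq_inner by (subst (1 2) h) (simp add: inner_simps inner_commute power2_eq_square algebra_simps)
    have n2: "(norm k)^2 = (B / l)^2 * E - 2 * (B / l) * \<rho> * (e \<bullet> \<Delta>) + \<rho>^2 * D"
      unfolding E_def D_def power2_norm_eq_inner by (subst (1 2) k) (simp add: inner_simps inner_commute power2_eq_square algebra_simps)
    have "(norm h)^2 / A + (norm k)^2 / B = ((A / l)^2 / A + (B / l)^2 / B) * E + (\<rho>^2 / A + \<rho>^2 / B) * D"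
      unfolding n1 n2 using AB by (simp add: field_simps power2_eq_square)
    also have "(A / l)^2 / A + (B / l)^2 / B = 1 / l"
    proof -
      have "(A / l)^2 / A = A / l^2" "(B / l)^2 / B = B / l^2" using AB by (simp_all add: power_divide power2_eq_square)
      then have "(A / l)^2 / A + (B / l)^2 / B = l / l^2" by (simp add: l_def add_divide_distrib)
      then show ?thesis using AB by (simp add: power2_eq_square)
    qed
    also have "\<rho>^2 / A + \<rho>^2 / B = \<rho>"
    proof -
      have "\<rho>^2 / A + \<rho>^2 / B = \<rho> * (\<rho> / A + \<rho> / B)" by (simp add: power2_eq_square algebra_simps)
      also have "\<rho> / A + \<rho> / B = 1" unfolding \<rho>(2,3) using AB by (simp add: l_def add_divide_distrib[symmetric])
      finally show ?thesis by simp
    qed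
    finally show ?thesis by simp
  qed
  have dl: "1 - d \<le> 1 / l"
  proof -
    have "(1 - d) * l = 1 - d^2" unfolding d(1) by (simp add: power2_eq_square algebra_simps)
    then have "(1 - d) * l \<le> 1" by simp
    then show ?thesis using AB by (simp add: pos_le_divide_eq)
  qed
  have e1: "(1 - d) * E + \<rho> * D \<le> (norm h)^2 / norm x + (norm k)^2 / norm y"
  proof -
    have "(1 - d) * E \<le> 1 / l * E" using En dl by (intro mult_right_mono) auto
    then show ?thesis using hk2 by (simp add: A_def B_def)
  qed
  have z0: "x + y \<noteq> 0" using z by auto
  have e2: "2 * norm e * \<bar>D1 norm x h + D1 norm y k - D1 norm (x + y) e\<bar> \<le> 4 * d * E + \<rho> * D"
  proof -
    have "D1 norm x h + D1 norm y k - D1 norm (x + y) e = X \<bullet> h + Y \<bullet> k - ze"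
      using norm_derivs(1)[OF x] norm_derivs(1)[OF y] norm_derivs(1)[OF z0] z
      by (simp add: X_def Y_def A_def B_def ze_def divide_inverse mult.commute)
    also have "\<dots> = ((A / l) * a1 + \<rho> * b1) + ((B / l) * a2 - \<rho> * b2) - ze"
      by (subst h, subst k) (simp add: inner_simps a1_def a2_def b1_def b2_def)
    also have "\<dots> = \<rho> * (b1 - b2) - (1 - 1 / l) * ze" unfolding zea using AB by (simp add: field_simps)
    finally have eq: "D1 norm x h + D1 norm y k - D1 norm (x + y) e = \<rho> * (b1 - b2) - (1 - 1 / l) * ze" .
    have ll: "0 \<le> 1 - 1 / l" "1 - 1 / l \<le> d"
      using l1 dl by auto
    have "\<bar>\<rho> * (b1 - b2) - (1 - 1 / l) * ze\<bar> \<le> \<bar>\<rho> * (b1 - b2)\<bar> + \<bar>(1 - 1 / l) * ze\<bar>" by (rule abs_triangle_ineq4)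
    also have "\<bar>\<rho> * (b1 - b2)\<bar> \<le> \<rho> * (\<theta> * norm \<Delta>)" unfolding abs_mult using cs(2) \<rho> by (intro mult_mono) auto
    also have "\<bar>(1 - 1 / l) * ze\<bar> \<le> d * norm e" unfolding abs_mult using cs(6) ll d by (intro mult_mono) auto
    finally have "\<bar>D1 norm x h + D1 norm y k - D1 norm (x + y) e\<bar> \<le> \<rho> * (\<theta> * norm \<Delta>) + d * norm e" unfolding eq by simp
    from mult_left_mono[OF this, of "2 * norm e"]
    have "2 * norm e * \<bar>D1 norm x h + D1 norm y k - D1 norm (x + y) e\<bar> \<le> 2 * \<rho> * (\<theta> * norm e * norm \<Delta>) + 2 * d * E"
      by (simp add: E_def power2_eq_square algebra_simps)
    then show ?thesis using cross by simp
  qed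
  have e3: "- (7 * d * E + 2 * (\<rho> * D)) \<le> D2 norm x h h + D2 norm y k k - D2 norm (x + y) e e"
  proof -
    have dx: "D2 norm x h h = ((norm h)^2 - (X \<bullet> h)^2) / A"
      using norm_derivs(3)[OF x, of h] AB by (simp add: X_def A_def divide_inverse power_mult_distrib power_inverse)
    have dy: "D2 norm y k k = ((norm k)^2 - (Y \<bullet> k)^2) / B"
      using norm_derivs(3)[OF y, of k] AB by (simp add: Y_def B_def divide_inverse power_mult_distrib power_inverse)
    have dz: "D2 norm (x + y) e e = E - ze^2"
      using norm_derivs(3)[OF z0, of e] z by (simp add: E_def ze_def)
    have Xh: "X \<bullet> h = (A / l) * a1 + \<rho> * b1" by (subst h) (simp add: inner_simps a1_def b1_def)
    have Yk: "Y \<bullet> k = (B / l) * a2 - \<rho> * b2" by (subst k) (simp add: inner_simps a2_def b2_def)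
    have br: "(X \<bullet> h)^2 / A + (Y \<bullet> k)^2 / B
       = (A * a1^2 + B * a2^2) / l^2 + (2 * \<rho> / l) * (a1 * b1 - a2 * b2) + (\<rho> / l) * (B * b1^2 + A * b2^2)"
      unfolding Xh Yk \<rho>_def using AB by (simp add: field_simps power2_eq_square)
    have t1: "(A * a1^2 + B * a2^2) / l^2 \<le> ze^2 + 2 * d * E"
    proof -
      have "(A * a1^2 + B * a2^2) / l^2 = (ze^2 + A * B * (a1 - a2)^2) / l^3"
      proof -
        have "ze^2 + A * B * (a1 - a2)^2 = l * (A * a1^2 + B * a2^2)"
          unfolding zea l_def by (simp add: algebra_simps power2_eq_square)
        then show ?thesis using AB by (simp add: power2_eq_square power3_eq_cube)
      qed
      also have "\<dots> = ze^2 / l^3 + \<rho> * (a1 - a2)^2 / l^2" using AB by (simp add: \<rho>_def field_simps power2_eq_square power3_eq_cube)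
      also have "ze^2 / l^3 \<le> ze^2 / 1" using l1 by (intro divide_left_mono) auto
      also have "\<rho> * (a1 - a2)^2 / l^2 \<le> \<rho> * (\<theta>^2 * E) / l^2"
      proof -
        have "(a1 - a2)^2 \<le> (\<theta> * norm e)^2" using cs(1) by (simp add: abs_le_square_iff[symmetric] \<theta>_def)
        then show ?thesis using \<rho> AB by (intro divide_right_mono mult_left_mono) (auto simp: E_def power_mult_distrib)
      qed
      also have "\<rho> * (\<theta>^2 * E) / l^2 = (\<rho> * \<theta>^2 / l^2) * E" by simp
      also have "\<dots> \<le> 2 * d * E" using rth(2) En by (intro mult_right_mono) auto
      finally show ?thesis by simp
    qed
    have t2: "(2 * \<rho> / l) * (a1 * b1 - a2 * b2) \<le> 4 * d * E + 2 * (\<rho> * D)"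
    proof -
      have "a1 * b1 - a2 * b2 = (a1 - a2) * b1 + a2 * (b1 - b2)" by (simp add: algebra_simps)
      also have "\<dots> \<le> \<bar>(a1 - a2) * b1\<bar> + \<bar>a2 * (b1 - b2)\<bar>" by linarith
      also have "\<bar>(a1 - a2) * b1\<bar> \<le> (\<theta> * norm e) * norm \<Delta>" unfolding abs_mult using cs by (intro mult_mono) (auto simp: \<theta>_def)
      also have "\<bar>a2 * (b1 - b2)\<bar> \<le> norm e * (\<theta> * norm \<Delta>)" unfolding abs_mult using cs by (intro mult_mono) auto
      finally have q: "a1 * b1 - a2 * b2 \<le> 2 * (\<theta> * norm e * norm \<Delta>)" by (simp add: algebra_simps)
      have "(2 * \<rho> / l) * (a1 * b1 - a2 * b2) \<le> (2 * \<rho> / l) * (2 * (\<theta> * norm e * norm \<Delta>))"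
        using q \<rho> AB by (intro mult_left_mono) auto
      also have "\<dots> \<le> (2 * \<rho>) * (2 * (\<theta> * norm e * norm \<Delta>))"
      proof (rule mult_right_mono)
        have "2 * \<rho> / l \<le> 2 * \<rho> / 1" using l1 \<rho> by (intro divide_left_mono) auto
        then show "2 * \<rho> / l \<le> 2 * \<rho>" by simp
      qed (simp add: \<theta>_def)
      also have "\<dots> = 2 * (2 * \<rho> * (\<theta> * norm e * norm \<Delta>))" by simp
      also have "\<dots> \<le> 2 * (2 * d * E + \<rho> * D)" using cross by simp
      finally show ?thesis by simp
    qed
    have t3: "(\<rho> / l) * (B * b1^2 + A * b2^2) \<le> \<rho> * D"
    proof -
      have "b1^2 \<le> D" "b2^2 \<le> D" using cs(3,4) by (simp_all add: D_def abs_le_square_iff[symmetric])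
      then have "B * b1^2 + A * b2^2 \<le> B * D + A * D" using AB by (intro add_mono mult_left_mono) auto
      also have "\<dots> = l * D" by (simp add: l_def algebra_simps)
      finally have "(\<rho> / l) * (B * b1^2 + A * b2^2) \<le> (\<rho> / l) * (l * D)" using \<rho> AB by (intro mult_left_mono) auto
      then show ?thesis using AB by simp
    qed
    have t4: "(1 - d) * E + \<rho> * D \<le> (norm h)^2 / A + (norm k)^2 / B" using e1 by (simp add: A_def B_def)
    have "D2 norm x h h + D2 norm y k k - D2 norm (x + y) e e
       = ((norm h)^2 / A + (norm k)^2 / B) - ((X \<bullet> h)^2 / A + (Y \<bullet> k)^2 / B) - E + ze^2"
      unfolding dx dy dz by (simp add: diff_divide_distrib)
    moreover have "(1 - d) * E = E - d * E" by (simp add: algebra_simps)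
    ultimately show ?thesis using t1 t2 t3 t4 br by linarith
  qed
  show ?thesis using e1 e2 e3 \<rho> En unfolding E_def by (intro exI[of _ "\<rho> * D"]) auto
qed

section \<open>Strict convexity near the minimum on the sphere\<close>

lemma convex_taylor_lower:
  fixes \<phi> :: "real \<Rightarrow> real"
  assumes s: "s \<ge> 0" and d1: "\<And>t. 0 \<le> t \<Longrightarrow> t \<le> s \<Longrightarrow> (\<phi> has_real_derivative \<phi>' t) (at t)"
    and d2: "\<And>t. 0 \<le> t \<Longrightarrow> t \<le> s \<Longrightarrow> (\<phi>' has_real_derivative \<phi>'' t) (at t)"
    and L: "\<And>t. 0 \<le> t \<Longrightarrow> t \<le> s \<Longrightarrow> L \<le> \<phi>'' t"
  shows "\<phi> 0 + s * \<phi>' 0 + L * s^2 / 2 \<le> \<phi> s"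
proof -
  have 1: "\<phi>' 0 + L * t \<le> \<phi>' t" if t: "0 \<le> t" "t \<le> s" for t
  proof -
    have "\<phi>' 0 - L * 0 \<le> \<phi>' t - L * t"
    proof (rule DERIV_nonneg_imp_nondecreasing[OF t(1)])
      fix u assume u: "0 \<le> u" "u \<le> t"
      have "((\<lambda>u. \<phi>' u - L * u) has_real_derivative \<phi>'' u - L) (at u)"
        using d2[of u] u t by (auto intro!: derivative_eq_intros)
      then show "\<exists>y. ((\<lambda>u. \<phi>' u - L * u) has_real_derivative y) (at u) \<and> 0 \<le> y" using L[of u] u t by auto
    qed
    then show ?thesis by simp
  qed
  have "\<phi> 0 - \<phi>' 0 * 0 - L * 0^2 / 2 \<le> \<phi> s - \<phi>' 0 * s - L * s^2 / 2"
  proof (rule DERIV_nonneg_imp_nondecreasing[OF s])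
    fix u assume u: "0 \<le> u" "u \<le> s"
    have "((\<lambda>u. \<phi> u - \<phi>' 0 * u - L * u^2 / 2) has_real_derivative \<phi>' u - \<phi>' 0 - L * u) (at u)"
      using d1[of u] u by (auto intro!: derivative_eq_intros)
    then show "\<exists>y. ((\<lambda>u. \<phi> u - \<phi>' 0 * u - L * u^2 / 2) has_real_derivative y) (at u) \<and> 0 \<le> y" using 1[of u] u by auto
  qed
  then show ?thesis by (simp add: mult.commute)
qed

context quotient_eq
begin

text \<open>Second variation of \<open>v x \<le> v (x / 2 + s w) + v (x / 2 - s w)\<close> at \<open>s = 0\<close>.\<close>

lemma v_psd: assumes x: "x \<noteq> 0" shows "D2 v x w w \<ge> 0"
proof -
  let ?h = "(1/2) *\<^sub>R x"
  have hP: "?h \<in> - {0}" using x by simp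
  have j: "jet2 (\<lambda>s. v (?h + s *\<^sub>R w) + v (?h + s *\<^sub>R (- w))) (v ?h + v ?h) (D1 v ?h w + D1 v ?h (- w)) (D2 v ?h w w + D2 v ?h (- w) (- w))"
    by (intro jet2_add jet2_line[OF vC open_punct hP])
  have "v (?h + s *\<^sub>R w) + v (?h + s *\<^sub>R (- w)) \<ge> v (?h + 0 *\<^sub>R w) + v (?h + 0 *\<^sub>R (- w))" for s
  proof -
    have "x = (?h + s *\<^sub>R w) + (?h + s *\<^sub>R (- w))" by (simp flip: scaleR_add_left)
    then have "v x \<le> v (?h + s *\<^sub>R w) + v (?h + s *\<^sub>R (- w))" by (metis v_subadd)
    then show ?thesis using hom1D[OF vh, of "1/2" x] by simp
  qed
  then have "D2 v ?h w w + D2 v ?h (- w) (- w) \<ge> 0" using jet2_min(2)[OF j] by (simp add: always_eventually)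
  moreover have "D2 v ?h (- w) (- w) = D2 v ?h w w"
    using symform_scale_left[OF v_sym[of ?h], of "-1"] symform_scale_right[OF v_sym[of ?h], of _ "-1"] hP by simp
  moreover have "D2 v ?h w w = 2 * D2 v x w w" using hom1_D2[OF vC vh, of "1/2" x] x by simp
  ultimately show ?thesis by simp
qed

text \<open>The function \<open>v - v p * norm\<close> has a minimum at \<open>p\<close>, so \<open>D2 v p\<close> is bounded below by \<open>v p\<close> times the Hessian of
  the norm. By continuity half of this bound persists near \<open>p\<close>.\<close>

lemma near_min_pd:
  assumes p: "norm p = 1" "v p > 0" "\<And>x. v p * norm x \<le> v x"
  shows "\<exists>r>0. r \<le> 1 \<and> (\<forall>y w. dist y p < r \<longrightarrow> y \<noteq> 0 \<and> v p / 2 * (norm (tang y w))^2 \<le> D2 v y w w)"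
proof -
  define m where "m = v p"
  have m: "m > 0" using p by (simp add: m_def)
  have p0: "p \<noteq> 0" "p \<in> - {0}" using p by auto
  have at_p: "m * (norm w)^2 \<le> D2 v p w w + m * (p \<bullet> w)^2" for w
  proof -
    have j: "jet2 (\<lambda>s. v (p + s *\<^sub>R w) - m * norm (p + s *\<^sub>R w)) (v p - m * norm p) (D1 v p w - m * D1 norm p w) (D2 v p w w - m * D2 norm p w w)"
      by (intro jet2_diff jet2_cmult jet2_line[OF vC open_punct p0(2)] jet2_line[OF Cinf_norm open_punct p0(2)])
    have "D2 v p w w - m * D2 norm p w w \<ge> 0"
      using jet2_min(2)[OF j] p(1,3) by (simp add: m_def always_eventually)
    then show ?thesis using norm_derivs(3)[OF p0(1), of w] p(1) by (simp add: algebra_simps)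
  qed
  obtain r1 where r1: "r1 > 0" "\<And>y w. y \<in> ball p r1 \<Longrightarrow> y \<in> - {0} \<and> \<bar>D2 v y w w - D2 v p w w\<bar> \<le> m / 4 * (norm w)^2"
    using D2_cont[OF vC open_punct p0(2), of "m / 4"] m by auto
  define r where "r = min r1 (1 / 12)"
  have "y \<noteq> 0 \<and> m / 2 * (norm (tang y w))^2 \<le> D2 v y w w" if y: "dist y p < r" for y w
  proof
    have yb: "y \<in> ball p r1" using y by (simp add: r_def dist_commute)
    show y0: "y \<noteq> 0" using r1(2)[OF yb] by simp
    let ?w = "tang y w"
    have "y \<bullet> ?w = 0" by (rule tang_orth[OF y0])
    then have "p \<bullet> ?w = (p - y) \<bullet> ?w" by (simp add: inner_simps)
    then have "\<bar>p \<bullet> ?w\<bar> \<le> norm (p - y) * norm ?w" using Cauchy_Schwarz_ineq2 by metis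
    also have "\<dots> \<le> 1 / 2 * norm ?w" using y by (intro mult_right_mono) (auto simp: r_def dist_norm norm_minus_commute)
    finally have "(p \<bullet> ?w)^2 \<le> (1 / 2 * norm ?w)^2" by (simp add: abs_le_square_iff[symmetric])
    then have "m * (p \<bullet> ?w)^2 \<le> m * (1 / 4 * (norm ?w)^2)" using m by (intro mult_left_mono) (auto simp: power_mult_distrib power2_eq_square)
    moreover have "\<bar>D2 v y ?w ?w - D2 v p ?w ?w\<bar> \<le> m / 4 * (norm ?w)^2" using r1(2)[OF yb] by blast
    ultimately have "m / 2 * (norm ?w)^2 \<le> D2 v y ?w ?w" using at_p[of ?w] by linarith
    then show "m / 2 * (norm ?w)^2 \<le> D2 v y w w" using hom1_D2_tang[OF vC vh y0, of w] by simp
  qed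
  then show ?thesis using r1(1) unfolding m_def by (intro exI[of _ r]) (auto simp: r_def)
qed

text \<open>Near the minimum the triangle defect of \<open>v\<close> dominates that of the norm, although \<open>x\<close> and \<open>y\<close> may be far from
  \<open>p\<close>. It suffices to bound \<open>m0 x = v x - D1 v z x\<close> at \<open>z = x + y\<close> from below by a multiple of
  \<open>norm x - x \<bullet> z\<close>, and likewise for \<open>y\<close>. The function \<open>m0\<close> is subadditive and homogeneous and vanishes on the ray
  of \<open>z\<close>. For unit vectors \<open>x\<close> close to \<open>- z\<close> it is bounded below by positivity of \<open>v\<close>. Otherwise
  \<open>m0 (z + s0 *\<^sub>R x) \<le> s0 * m0 x\<close>, and the left-hand side is estimated by Taylor expansion along a segment
  so short that \<open>near_min_pd\<close> applies.\<close>

lemma gap_near_min: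
  assumes p: "norm p = 1" "v p > 0" "\<And>x. v p * norm x \<le> v x"
  shows "\<exists>r>0. \<exists>c1>0. \<forall>x y. norm (x + y) = 1 \<and> dist (x + y) p < r \<longrightarrow>
     c1 * (norm x + norm y - 1) \<le> v x + v y - v (x + y)"
proof -
  define m where "m = v p"
  have m: "m > 0" "\<And>x. m * norm x \<le> v x" using p by (auto simp: m_def)
  obtain r where r: "r > 0" "r \<le> 1" "\<And>y. dist y p < r \<Longrightarrow> y \<noteq> 0"
    "\<And>y w. dist y p < r \<Longrightarrow> m / 2 * (norm (tang y w))^2 \<le> D2 v y w w"
    using near_min_pd[OF p] unfolding m_def by blast
  obtain M where M: "M > 0" "\<And>x. \<bar>v x\<bar> \<le> M * norm x" using hom1_bound[OF vC vh] by blast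
  define s0 where "s0 = r / 2"
  have s0: "s0 > 0" "s0 \<le> 1 / 2" using r by (auto simp: s0_def)
  define c1 where "c1 = min (m / 2) (m * s0 / 9 * (m^2 / (2 * M)^2 / 2))"
  have c1: "c1 > 0" using m(1) s0 M(1) by (simp add: c1_def)
  have main: "c1 * (1 - x \<bullet> z) \<le> v x - D1 v z x"
    if z: "norm z = 1" "dist z p < r / 2" and x: "norm x = 1" for x z
  proof -
    have z0: "z \<noteq> 0" "z \<in> - {0}" using z by auto
    define m0 where "m0 w = v w - D1 v z w" for w
    have lin: "D1 v z (w + w') = D1 v z w + D1 v z w'" "D1 v z (t *\<^sub>R w) = t * D1 v z w" for w w' t
      using D1_add[OF vC z0(2)] D1_scale[OF vC z0(2)] by auto
    \<comment> \<open>By subadditivity the derivative is a subgradient; a violation would show up at small \<open>t\<close>.\<close>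
    have Dle: "D1 v z w \<le> v w" for w
    proof (rule ccontr)
      assume "\<not> D1 v z w \<le> v w"
      then have neg: "v w - D1 v z w < 0" by simp
      have dl: "((\<lambda>t. v (z + t *\<^sub>R w)) has_real_derivative D1 v z w) (at 0)"
        using deriv_line[OF vC, of z 0 w] z0 by simp
      then have "((\<lambda>t. t * v w - v (z + t *\<^sub>R w)) has_real_derivative (v w - D1 v z w)) (at 0)"
        by (auto intro!: derivative_eq_intros)
      from DERIV_neg_dec_right[OF this neg] obtain d where d: "d > 0"
        "\<And>t. 0 < t \<Longrightarrow> t < d \<Longrightarrow> t * v w - v (z + t *\<^sub>R w) < - v z" by auto
      have "(d/2) * v w - v (z + (d/2) *\<^sub>R w) < - v z" using d(2)[of "d/2"] d(1) by simp
      moreover have "v (z + (d/2) *\<^sub>R w) \<le> v z + (d/2) * v w"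
        using v_subadd[of z "(d/2) *\<^sub>R w"] hom1D[OF vh, of "d/2" w] d(1) by simp
      ultimately show False by simp
    qed
    have m0h: "m0 (t *\<^sub>R w) = t * m0 w" if "t > 0" for t w
      using hom1D[OF vh that, of w] by (simp add: m0_def lin algebra_simps)
    have m0s: "m0 (w + w') \<le> m0 w + m0 w'" for w w' using v_subadd[of w w'] by (simp add: m0_def lin)
    have m0z: "m0 z = 0" using hom1_euler(1)[OF vC vh z0(1)] by (simp add: m0_def)
    have m0b: "m0 w \<le> 2 * M * norm w" for w
    proof -
      have "D1 v z (- w) \<le> v (- w)" by (rule Dle)
      then have "- D1 v z w \<le> v (- w)" using lin(2)[of "-1" w] by simp
      then show ?thesis using M(2)[of w] M(2)[of "- w"] by (simp add: m0_def)
    qed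
    define \<xi> where "\<xi> = x \<bullet> z"
    have \<xi>: "\<xi> \<le> 1" using norm_cauchy_schwarz[of x z] x z by (simp add: \<xi>_def)
    have xz: "(norm (x + z))^2 = 2 + 2 * \<xi>"
      using x z unfolding power2_norm_eq_inner \<xi>_def by (simp add: inner_simps inner_commute norm_eq_1)
    show ?thesis
    proof (cases "2 * M * norm (x + z) \<le> m")
      case True
      have "m0 (- z) \<le> m0 x + m0 (- (x + z))" using m0s[of x "- (x + z)"] by simp
      also have "m0 (- (x + z)) \<le> 2 * M * norm (x + z)" using m0b[of "- (x + z)"] by (simp only: norm_minus_cancel)
      finally have "m0 (- z) \<le> m0 x + m" using True by simp
      moreover have "m0 (- z) \<ge> 2 * m"
      proof -
        have "m0 (- z) = v (- z) + v z" using lin(2)[of "-1" z] hom1_euler(1)[OF vC vh z0(1)] by (simp add: m0_def)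
        then show ?thesis using m(2)[of z] m(2)[of "- z"] z(1) by simp
      qed
      ultimately have "m \<le> m0 x" by simp
      moreover have "c1 * (1 - \<xi>) \<le> m / 2 * 2"
      proof (rule mult_mono)
        show "c1 \<le> m / 2" by (simp add: c1_def)
        show "1 - \<xi> \<le> 2" using xz zero_le_power2[of "norm (x + z)"] by linarith
      qed (use m \<xi> in auto)
      ultimately show ?thesis by (simp add: m0_def \<xi>_def)
    next
      case False
      have near: "dist (z + t *\<^sub>R x) p < r" if "0 \<le> t" "t \<le> s0" for t
      proof -
        have "dist (z + t *\<^sub>R x) z \<le> r / 2" using that x by (simp add: dist_norm s0_def)
        then show ?thesis using z(2) dist_triangle[of "z + t *\<^sub>R x" p z] by linarith
      qed
      let ?L = "2 * m / 9 * (1 - \<xi>^2)"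
      have "v (z + 0 *\<^sub>R x) + s0 * D1 v (z + 0 *\<^sub>R x) x + ?L * s0^2 / 2 \<le> v (z + s0 *\<^sub>R x)"
      proof (rule convex_taylor_lower[where \<phi> = "\<lambda>t. v (z + t *\<^sub>R x)" and \<phi>' = "\<lambda>t. D1 v (z + t *\<^sub>R x) x" and \<phi>'' = "\<lambda>t. D2 v (z + t *\<^sub>R x) x x"])
        fix t assume t: "0 \<le> t" "t \<le> s0"
        have y0: "z + t *\<^sub>R x \<noteq> 0" using r(3)[OF near[OF t]] .
        then have yP: "z + t *\<^sub>R x \<in> - {0}" by simp
        show "((\<lambda>t. v (z + t *\<^sub>R x)) has_real_derivative D1 v (z + t *\<^sub>R x) x) (at t)" by (rule deriv_line[OF vC yP])
        show "((\<lambda>t. D1 v (z + t *\<^sub>R x) x) has_real_derivative D2 v (z + t *\<^sub>R x) x x) (at t)"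
          unfolding D2_def by (rule deriv_line[OF Cinf_D1[OF vC open_punct] yP])
        have ny: "norm (z + t *\<^sub>R x) \<le> 3 / 2" using norm_triangle_ineq[of z "t *\<^sub>R x"] t z x s0 by simp
        have tn: "(norm (tang (z + t *\<^sub>R x) x))^2 = (1 - \<xi>^2) / (norm (z + t *\<^sub>R x))^2"
        proof -
          have y2: "(norm (z + t *\<^sub>R x))^2 = 1 + 2 * t * \<xi> + t^2"
            using x z unfolding power2_norm_eq_inner \<xi>_def by (simp add: inner_simps inner_commute norm_eq_1 power2_eq_square)
          have yx: "(z + t *\<^sub>R x) \<bullet> x = \<xi> + t" using x by (simp add: \<xi>_def inner_simps inner_commute norm_eq_1)
          have yn: "(norm (z + t *\<^sub>R x))^2 \<noteq> 0" using y0 by simp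
          have "(norm (tang (z + t *\<^sub>R x) x))^2 = 1 - (\<xi> + t)^2 / (norm (z + t *\<^sub>R x))^2"
            using tang_norm[OF y0, of x] yx x by simp
          also have "\<dots> = ((norm (z + t *\<^sub>R x))^2 - (\<xi> + t)^2) / (norm (z + t *\<^sub>R x))^2" using yn by (simp add: diff_divide_distrib)
          also have "(norm (z + t *\<^sub>R x))^2 - (\<xi> + t)^2 = 1 - \<xi>^2" unfolding y2 by (simp add: power2_eq_square algebra_simps)
          finally show ?thesis .
        qed
        have x1: "0 \<le> 1 - \<xi>^2"
        proof -
          have "\<bar>\<xi>\<bar> \<le> 1" using Cauchy_Schwarz_ineq2[of x z] x z by (simp add: \<xi>_def)
          then show ?thesis by (simp add: abs_square_le_1)
        qed
        have "4 / 9 * (1 - \<xi>^2) \<le> (1 - \<xi>^2) / (norm (z + t *\<^sub>R x))^2"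
        proof -
          have "(norm (z + t *\<^sub>R x))^2 \<le> (3 / 2)^2" using ny by (intro power_mono) auto
          then have "(1 - \<xi>^2) / (3 / 2)^2 \<le> (1 - \<xi>^2) / (norm (z + t *\<^sub>R x))^2" using x1 y0 by (intro divide_left_mono) auto
          then show ?thesis by (simp add: power2_eq_square)
        qed
        then have "m / 2 * (4 / 9 * (1 - \<xi>^2)) \<le> m / 2 * (norm (tang (z + t *\<^sub>R x) x))^2" unfolding tn using m by (intro mult_left_mono) auto
        also have "m / 2 * (norm (tang (z + t *\<^sub>R x) x))^2 \<le> D2 v (z + t *\<^sub>R x) x x" by (rule r(4)[OF near[OF t]])
        finally have "m / 2 * (4 / 9 * (1 - \<xi>^2)) \<le> D2 v (z + t *\<^sub>R x) x x" .
        moreover have "?L = m / 2 * (4 / 9 * (1 - \<xi>^2))" by simp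
        ultimately show "?L \<le> D2 v (z + t *\<^sub>R x) x x" by (simp only:)
      qed (use s0 in auto)
      then have "?L * s0^2 / 2 \<le> m0 (z + s0 *\<^sub>R x)"
        using hom1_euler(1)[OF vC vh z0(1)] by (simp add: m0_def lin)
      also have "\<dots> \<le> s0 * m0 x" using m0s[of z "s0 *\<^sub>R x"] m0z m0h[OF s0(1), of x] by simp
      finally have "s0 * (m / 9 * s0 * (1 - \<xi>^2)) \<le> s0 * m0 x" by (simp add: power2_eq_square algebra_simps)
      then have "m / 9 * s0 * (1 - \<xi>^2) \<le> m0 x" using s0(1) by (simp only: mult_le_cancel_left_pos)
      then have lo: "m * s0 / 9 * ((1 + \<xi>) * (1 - \<xi>)) \<le> m0 x" by (simp add: power2_eq_square algebra_simps)
      have "m / (2 * M) < norm (x + z)" using False M(1) by (simp add: field_simps)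
      then have "(m / (2 * M))^2 \<le> (norm (x + z))^2" using m(1) M(1) by (intro power_mono) auto
      then have "m^2 / (2 * M)^2 / 2 \<le> 1 + \<xi>" unfolding xz by (simp add: power_divide)
      then have "m * s0 / 9 * (m^2 / (2 * M)^2 / 2) \<le> m * s0 / 9 * (1 + \<xi>)" using m(1) s0 by (intro mult_left_mono) auto
      then have "c1 \<le> m * s0 / 9 * (1 + \<xi>)" by (simp add: c1_def)
      then have "c1 * (1 - \<xi>) \<le> m * s0 / 9 * (1 + \<xi>) * (1 - \<xi>)" using \<xi> by (intro mult_right_mono) auto
      also have "\<dots> = m * s0 / 9 * ((1 + \<xi>) * (1 - \<xi>))" by (rule mult.assoc)
      also note lo
      finally show ?thesis by (simp only: m0_def \<xi>_def)
    qed
  qed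
  have gen: "c1 * (norm x - x \<bullet> z) \<le> v x - D1 v z x" if z: "norm z = 1" "dist z p < r / 2" for x z
  proof (cases "x = 0")
    case True
    have "z \<in> - {0}" using z by auto
    then show ?thesis using True v_0 D1_scale[OF vC, of z 0 0] by simp
  next
    case False
    let ?u = "x /\<^sub>R norm x"
    have zP: "z \<in> - {0}" using z by auto
    have "c1 * (1 - ?u \<bullet> z) \<le> v ?u - D1 v z ?u" using False by (intro main z) simp
    from mult_left_mono[OF this, of "norm x"]
    have "norm x * (c1 * (1 - ?u \<bullet> z)) \<le> norm x * v ?u - norm x * D1 v z ?u" by (simp add: right_diff_distrib)
    also have "norm x * v ?u = v x" using hom1D[OF vh, of "norm x" ?u] False by simp
    also have "norm x * D1 v z ?u = D1 v z x" using D1_scale[OF vC zP, of "norm x" ?u] False by simp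
    also have "norm x * (c1 * (1 - ?u \<bullet> z)) = c1 * (norm x - x \<bullet> z)" using False by (simp add: field_simps)
    finally show ?thesis .
  qed
  show ?thesis
  proof (rule exI[of _ "r / 2"], rule conjI, use r in simp, rule exI[of _ c1], intro conjI c1 allI impI)
    fix x y assume xy: "norm (x + y) = 1 \<and> dist (x + y) p < r / 2"
    have z0: "x + y \<noteq> 0" "x + y \<in> - {0}" using xy by auto
    have "c1 * (norm x - x \<bullet> (x + y)) + c1 * (norm y - y \<bullet> (x + y)) \<le> (v x - D1 v (x + y) x) + (v y - D1 v (x + y) y)"
      using xy by (intro add_mono gen) auto
    also have "\<dots> = v x + v y - D1 v (x + y) (x + y)" using D1_add[OF vC z0(2), of x y] by simp
    also have "D1 v (x + y) (x + y) = v (x + y)" by (rule hom1_euler(1)[OF vC vh z0(1)])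
    also have "c1 * (norm x - x \<bullet> (x + y)) + c1 * (norm y - y \<bullet> (x + y)) = c1 * (norm x + norm y - (x + y) \<bullet> (x + y))"
      by (simp add: inner_simps algebra_simps)
    also have "(x + y) \<bullet> (x + y) = 1" using xy by (simp only: norm_eq_1)
    finally show "c1 * (norm x + norm y - 1) \<le> v x + v y - v (x + y)" .
  qed
qed

end

section \<open>Regularising the Hessian\<close>

text \<open>Functions of a point and a real parameter: estimates that are uniform in the parameter follow from
  smoothness in both variables.\<close>

lemma slice_smooth:
  fixes F :: "'a::euclidean_space \<times> real \<Rightarrow> real"
  assumes F: "Cinf S F" and S: "open S"
  shows "Cinf {y. (y, \<kappa>) \<in> S} (\<lambda>y. F (y, \<kappa>))"
    and "(x, \<kappa>) \<in> S \<Longrightarrow> D2 (\<lambda>y. F (y, \<kappa>)) x w w = D2 F (x, \<kappa>) (w, 0) (w, 0)"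
proof -
  show C: "Cinf {y. (y, \<kappa>) \<in> S} (\<lambda>y. F (y, \<kappa>))"
  proof (rule Cinf_compose[OF F])
    fix b :: "'a \<times> real"
    have "Cinf {y. (y, \<kappa>) \<in> S} (\<lambda>y. y \<bullet> fst b + \<kappa> * snd b)" by (intro Cinf_add Cinf_inner Cinf_const)
    then show "Cinf {y. (y, \<kappa>) \<in> S} (\<lambda>y. (y, \<kappa>) \<bullet> b)" by (simp add: inner_prod_def)
  qed auto
  have o: "open {y. (y, \<kappa>) \<in> S}"
  proof -
    have "{y. (y, \<kappa>) \<in> S} = (\<lambda>y. (y, \<kappa>)) -` S" by auto
    then show ?thesis using S by (auto intro!: open_vimage continuous_intros)
  qed
  show "D2 (\<lambda>y. F (y, \<kappa>)) x w w = D2 F (x, \<kappa>) (w, 0) (w, 0)" if x: "(x, \<kappa>) \<in> S"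
    using jet2_unique(2)[OF jet2_line[OF C o, of x w] jet2_line[OF F S x, of "(w, 0)", simplified]] x by simp
qed

lemma param_lipschitz:
  fixes H :: "'a::euclidean_space \<times> real \<Rightarrow> real"
  assumes H: "Cinf S H" and S: "open S" and K: "compact K" "K \<times> {0..1} \<subseteq> S"
  shows "\<exists>C>0. \<forall>x\<in>K. \<forall>\<kappa>. 0 \<le> \<kappa> \<and> \<kappa> \<le> 1 \<longrightarrow> \<bar>H (x, \<kappa>) - H (x, 0)\<bar> \<le> C * \<kappa>"
proof -
  have "continuous_on (K \<times> {0..1}) (\<lambda>z. D1 H z (0, 1))"
    using Cinf_continuous[OF Cinf_D1[OF H S]] K(2) continuous_on_subset by blast
  then have "bounded ((\<lambda>z. D1 H z (0, 1)) ` (K \<times> {0..1}))"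
    using K(1) by (intro compact_imp_bounded compact_continuous_image compact_Times) auto
  then obtain C where C: "\<forall>z\<in>K \<times> {0..1}. \<bar>D1 H z (0, 1)\<bar> \<le> C" unfolding bounded_iff by auto
  have "\<bar>H (x, \<kappa>) - H (x, 0)\<bar> \<le> (\<bar>C\<bar> + 1) * \<kappa>" if x: "x \<in> K" and k: "0 \<le> \<kappa>" "\<kappa> \<le> 1" for x \<kappa>
  proof (cases "\<kappa> = 0")
    case False
    have d: "((\<lambda>t. H (x, t)) has_real_derivative D1 H (x, t) (0, 1)) (at t)" if "0 \<le> t" "t \<le> \<kappa>" for t
    proof -
      have "(x, t) \<in> K \<times> {0..1}" using x that k by auto
      then have "(x, t) \<in> S" using K(2) by blast
      then show ?thesis using deriv_line[OF H, of "(x, 0)" t "(0, 1)"] by simp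
    qed
    obtain t where t: "0 < t" "t < \<kappa>" "H (x, \<kappa>) - H (x, 0) = (\<kappa> - 0) * D1 H (x, t) (0, 1)"
      using MVT2[of 0 \<kappa> "\<lambda>t. H (x, t)" "\<lambda>t. D1 H (x, t) (0, 1)"] d False k by auto
    have "\<bar>D1 H (x, t) (0, 1)\<bar> \<le> C" using C x t k by auto
    then have "\<bar>D1 H (x, t) (0, 1)\<bar> \<le> \<bar>C\<bar> + 1" by linarith
    then have "\<kappa> * \<bar>D1 H (x, t) (0, 1)\<bar> \<le> \<kappa> * (\<bar>C\<bar> + 1)" using k by (intro mult_left_mono) auto
    then show ?thesis using t(3) k by (simp add: abs_mult mult.commute)
  qed auto
  then show ?thesis by (intro exI[of _ "\<bar>C\<bar> + 1"]) auto
qed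

lemma slice_bound:
  fixes F :: "'a::euclidean_space \<times> real \<Rightarrow> real"
  assumes F: "Cinf S F" and S: "open S" and K: "compact K" "K \<times> {0..1} \<subseteq> S"
  shows "\<exists>C>0. \<forall>x\<in>K. \<forall>\<kappa>. 0 \<le> \<kappa> \<and> \<kappa> \<le> 1 \<longrightarrow>
     (\<forall>w. \<bar>D2 (\<lambda>y. F (y, \<kappa>)) x w w - D2 (\<lambda>y. F (y, 0)) x w w\<bar> \<le> C * \<kappa> * (norm w)^2)"
proof -
  have "\<exists>C>0. \<forall>x\<in>K. \<forall>\<kappa>. 0 \<le> \<kappa> \<and> \<kappa> \<le> 1 \<longrightarrow> \<bar>D2 F (x, \<kappa>) (b, 0) (c, 0) - D2 F (x, 0) (b, 0) (c, 0)\<bar> \<le> C * \<kappa>" for b c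
    by (rule param_lipschitz[OF Cinf_D2[OF F S] S K])
  then obtain M where M: "\<And>b c. M b c > 0" "\<And>b c x \<kappa>. x \<in> K \<Longrightarrow> 0 \<le> \<kappa> \<Longrightarrow> \<kappa> \<le> 1 \<Longrightarrow>
     \<bar>D2 F (x, \<kappa>) (b, 0) (c, 0) - D2 F (x, 0) (b, 0) (c, 0)\<bar> \<le> M b c * \<kappa>" by metis
  define L where "L = (\<Sum>b\<in>(Basis::'a set). \<Sum>c\<in>(Basis::'a set). M b c) + 1"
  have Mle: "M b c \<le> L" if "b \<in> Basis" "c \<in> Basis" for b c :: 'a
  proof -
    have "M b c \<le> (\<Sum>c\<in>Basis. M b c)" using that M(1) by (intro member_le_sum) (auto intro: less_imp_le)
    also have "\<dots> \<le> (\<Sum>b\<in>(Basis::'a set). \<Sum>c\<in>(Basis::'a set). M b c)"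
      using that M(1) by (intro member_le_sum[of b Basis "\<lambda>b. \<Sum>c\<in>Basis. M b c"]) (auto intro!: sum_nonneg less_imp_le[OF M(1)])
    finally show ?thesis by (simp add: L_def)
  qed
  have L: "L > 0" unfolding L_def using M(1) by (intro add_nonneg_pos sum_nonneg) (auto intro: less_imp_le)
  have "\<bar>D2 (\<lambda>y. F (y, \<kappa>)) x w w - D2 (\<lambda>y. F (y, 0)) x w w\<bar> \<le> real DIM('a)^2 * L * \<kappa> * (norm w)^2"
    if x: "x \<in> K" and k: "0 \<le> \<kappa>" "\<kappa> \<le> 1" for x \<kappa> w
  proof -
    have xS: "(x, \<kappa>) \<in> S" "(x, 0) \<in> S" using K(2) x k by auto
    let ?A = "\<lambda>p q. D2 F (x, \<kappa>) (p, 0) (q, 0) - D2 F (x, 0) (p, 0) (q, 0)"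
    have sl: "symform (\<lambda>p q. D2 F z (p, 0) (q, 0))" if "z \<in> S" for z
    proof -
      have s: "symform (D2 F z)" by (rule symform_D2[OF F S that])
      show ?thesis
      proof (rule symformI)
        fix u v w :: 'a and c :: real
        show "D2 F z (u + v, 0) (w, 0) = D2 F z (u, 0) (w, 0) + D2 F z (v, 0) (w, 0)"
          using symform_add_left[OF s, of "(u, 0)" "(v, 0)" "(w, 0)"] by simp
        show "D2 F z (c *\<^sub>R v, 0) (w, 0) = c * D2 F z (v, 0) (w, 0)"
          using symform_scale_left[OF s, of c "(v, 0)" "(w, 0)"] by simp
        show "D2 F z (v, 0) (w, 0) = D2 F z (w, 0) (v, 0)" by (rule symform_sym[OF s])
      qed
    qed
    have "\<bar>?A w w\<bar> \<le> real DIM('a)^2 * (L * \<kappa>) * (norm w)^2"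
    proof (rule symform_entry_bound[where A = ?A])
      show "symform ?A" by (intro symform_diff sl xS)
      fix b c :: 'a assume bc: "b \<in> Basis" "c \<in> Basis"
      have "M b c * \<kappa> \<le> L * \<kappa>" using Mle[OF bc] k by (intro mult_right_mono) auto
      then show "\<bar>?A b c\<bar> \<le> L * \<kappa>" using M(2)[OF x k, of b c] by linarith
    qed
    then show ?thesis using slice_smooth(2)[OF F S xS(1), of w] slice_smooth(2)[OF F S xS(2), of w] by (simp add: mult.assoc)
  qed
  then show ?thesis using L by (intro exI[of _ "real DIM('a)^2 * L"]) auto
qed

context quotient_eq
begin

text \<open>The Hessian regularised by a multiple of the identity of the same homogeneity, and the reciprocal of \<open>F\<close>
  at this form. \<open>Phi\<close> is smooth on the open set \<open>PhiS\<close>, which contains all nonnegative parameters.\<close>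

definition Af :: "'a \<times> real \<Rightarrow> 'a \<Rightarrow> 'a \<Rightarrow> real" where
  "Af z p q = D2 v (fst z) p q + snd z * inverse (norm (fst z)) * (p \<bullet> q)"

definition Phi :: "'a \<times> real \<Rightarrow> real" where
  "Phi z = (msig (Af z) b / msig (Af z) a) powr (1 / real (a - b))"

definition PhiS :: "('a \<times> real) set" where
  "PhiS = {z. fst z \<noteq> 0 \<and> (\<forall>j\<in>{1..a}. msig (Af z) j > 0)}"

lemma Af_sym: "x \<noteq> 0 \<Longrightarrow> symform (Af (x, \<kappa>))"
  unfolding Af_def[abs_def] fst_conv snd_conv by (intro symform_add symform_cmult symform_inner v_sym)

lemma Af_MG: assumes "x \<noteq> 0" "\<kappa> \<ge> 0" shows "Af (x, \<kappa>) \<in> MG a"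
  by (rule form_mono(1)[OF v_sym[OF assms(1)] vG[OF assms(1)] Af_sym[OF assms(1)] _ ab(1)])
    (use assms in \<open>simp add: Af_def\<close>)

lemma Phi_eq: assumes "x \<noteq> 0" "\<kappa> \<ge> 0" shows "Phi (x, \<kappa>) = 1 / MF a b (Af (x, \<kappa>))"
proof -
  have "msig (Af (x, \<kappa>)) a > 0" "msig (Af (x, \<kappa>)) b > 0"
    using Af_MG[OF assms] ab by (cases b; auto simp: MG_def)+
  then show ?thesis by (simp add: Phi_def MF_def powr_divide)
qed

lemma Phi_pos: "x \<noteq> 0 \<Longrightarrow> \<kappa> \<ge> 0 \<Longrightarrow> Phi (x, \<kappa>) > 0"
  using Phi_eq MF_pos[OF Af_MG ab(1)] by simp

lemma Af_smooth: "Cinf ((- {0}) \<times> UNIV) (\<lambda>z. Af z p q)"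
proof -
  have 1: "Cinf ((- {0}) \<times> UNIV) (\<lambda>z::'a \<times> real. f (fst z))" if "Cinf (- {0}) f" for f
  proof (rule Cinf_compose[OF that])
    show "Cinf ((- {0}) \<times> UNIV) (\<lambda>z::'a \<times> real. fst z \<bullet> b)" for b :: 'a
      by (intro Cinf_linear bounded_linear_compose[OF bounded_linear_inner_left bounded_linear_fst])
  qed auto
  have 2: "Cinf ((- {0}) \<times> UNIV) (\<lambda>z::'a \<times> real. snd z)" by (intro Cinf_linear bounded_linear_snd)
  show ?thesis unfolding Af_def
    by (intro Cinf_add Cinf_mult Cinf_const 2 1[OF Cinf_D2[OF vC open_punct]] 1[of "\<lambda>x. inverse (norm x)"] Cinf_inverse[OF Cinf_norm]) auto
qed

lemma PhiS_open: "open PhiS"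
proof -
  have o: "open ((- {0::'a}) \<times> (UNIV :: real set))" by (intro open_Times) auto
  have "open (((- {0}) \<times> UNIV) \<inter> (\<lambda>z. msig (Af z) j) -` {0<..})" for j
    by (intro continuous_open_preimage[OF Cinf_continuous[OF Cinf_msig[OF Af_smooth]] o]) auto
  then have "open (((- {0}) \<times> UNIV) \<inter> (\<Inter>j\<in>{1..a}. ((- {0}) \<times> UNIV) \<inter> (\<lambda>z. msig (Af z) j) -` {0<..}))"
    using o by (intro open_Int open_INT) auto
  moreover have "((- {0}) \<times> UNIV) \<inter> (\<Inter>j\<in>{1..a}. ((- {0}) \<times> UNIV) \<inter> (\<lambda>z. msig (Af z) j) -` {0<..}) = PhiS"
    by (auto simp: PhiS_def)
  ultimately show ?thesis by simp
qed

lemma PhiS_mem: "x \<noteq> 0 \<Longrightarrow> \<kappa> \<ge> 0 \<Longrightarrow> (x, \<kappa>) \<in> PhiS"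
  using Af_MG[of x \<kappa>] by (simp add: PhiS_def MG_def)

lemma PhiS_sphere: "sphere 0 1 \<times> {0..1} \<subseteq> PhiS"
proof
  fix z :: "'a \<times> real" assume z: "z \<in> sphere 0 1 \<times> {0..1}"
  then have "fst z \<noteq> 0" "snd z \<ge> 0" by auto
  then show "z \<in> PhiS" using PhiS_mem[of "fst z" "snd z"] by simp
qed

lemma Phi_smooth: "Cinf PhiS Phi"
proof -
  have sub: "PhiS \<subseteq> (- {0}) \<times> UNIV" by (auto simp: PhiS_def)
  have m: "Cinf PhiS (\<lambda>z. msig (Af z) k)" for k by (rule Cinf_subset[OF Cinf_msig[OF Af_smooth] sub])
  have p: "msig (Af z) a > 0" "msig (Af z) b > 0" if "z \<in> PhiS" for z
    using that ab by (cases b; auto simp: PhiS_def)+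
  show ?thesis unfolding Phi_def[abs_def]
    using p by (intro Cinf_powr Cinf_divide m) (auto simp: less_imp_neq[symmetric])
qed

lemma Phi_hom: assumes "t > 0" "x \<noteq> 0" "\<kappa> \<ge> 0" shows "Phi (t *\<^sub>R x, \<kappa>) = t * Phi (x, \<kappa>)"
proof -
  have "Af (t *\<^sub>R x, \<kappa>) = (\<lambda>p q. (1/t) * Af (x, \<kappa>) p q)"
    using assms hom1_D2[OF vC vh assms(1,2)] by (auto simp: Af_def fun_eq_iff field_simps)
  then have "MF a b (Af (t *\<^sub>R x, \<kappa>)) = (1/t) * MF a b (Af (x, \<kappa>))"
    using form_scale(2)[OF Af_sym[OF assms(2)] Af_MG[OF assms(2,3)] _ ab(1), of "1/t"] assms(1) by simp
  then show ?thesis using Phi_eq assms by simp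
qed

text \<open>On the sphere \<open>Phi (x, \<kappa>) - Phi (x, 0)\<close> and its second derivatives are bounded by a multiple of \<open>\<kappa>\<close>.
  Hence this difference becomes convex after addition of \<open>C * \<kappa> * norm x\<close>, and convexity is subadditivity.\<close>

lemma Phi_defect:
  "\<exists>C>0. \<forall>\<kappa> x y. 0 \<le> \<kappa> \<and> \<kappa> \<le> 1 \<and> x \<noteq> 0 \<and> y \<noteq> 0 \<and> x + y \<noteq> 0 \<longrightarrow>
    Phi (x, 0) + Phi (y, 0) - Phi (x + y, 0) - C * \<kappa> * (norm x + norm y - norm (x + y))
      \<le> Phi (x, \<kappa>) + Phi (y, \<kappa>) - Phi (x + y, \<kappa>)"
proof -
  note sub = PhiS_sphere
  obtain C1 where C1: "C1 > 0" "\<And>x \<kappa> w. x \<in> sphere 0 1 \<Longrightarrow> 0 \<le> \<kappa> \<Longrightarrow> \<kappa> \<le> 1 \<Longrightarrow>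
     \<bar>D2 (\<lambda>y. Phi (y, \<kappa>)) x w w - D2 (\<lambda>y. Phi (y, 0)) x w w\<bar> \<le> C1 * \<kappa> * (norm w)^2"
    using slice_bound[OF Phi_smooth PhiS_open compact_sphere sub] by blast
  obtain C2 where C2: "C2 > 0" "\<And>x \<kappa>. x \<in> sphere 0 1 \<Longrightarrow> 0 \<le> \<kappa> \<Longrightarrow> \<kappa> \<le> 1 \<Longrightarrow> \<bar>Phi (x, \<kappa>) - Phi (x, 0)\<bar> \<le> C2 * \<kappa>"
    using param_lipschitz[OF Phi_smooth PhiS_open compact_sphere sub] by blast
  define C where "C = C1 + C2"
  have C: "C > 0" using C1 C2 by (simp add: C_def)
  have "Phi (x, 0) + Phi (y, 0) - Phi (x + y, 0) - C * \<kappa> * (norm x + norm y - norm (x + y))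
      \<le> Phi (x, \<kappa>) + Phi (y, \<kappa>) - Phi (x + y, \<kappa>)"
    if k: "0 \<le> \<kappa>" "\<kappa> \<le> 1" and xy: "x \<noteq> 0" "y \<noteq> 0" "x + y \<noteq> 0" for \<kappa> x y
  proof -
    define W where "W x = (if x = 0 then 0 else Phi (x, \<kappa>) - Phi (x, 0) + C * \<kappa> * norm x)" for x
    have slC: "Cinf (- {0}) (\<lambda>y. Phi (y, t))" if "t \<ge> 0" for t
      by (rule Cinf_subset[OF slice_smooth(1)[OF Phi_smooth PhiS_open]]) (use PhiS_mem that in auto)
    have W0C: "Cinf (- {0}) (\<lambda>x. Phi (x, \<kappa>) - Phi (x, 0) + C * \<kappa> * norm x)"
      by (intro Cinf_add Cinf_diff Cinf_mult Cinf_const Cinf_norm slC) (use k in auto)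
    have WC: "Cinf (- {0}) W" by (rule Cinf_cong[OF open_punct _ W0C]) (simp add: W_def)
    have Wh: "hom1 W" unfolding hom1_def W_def using Phi_hom k by (auto simp: algebra_simps)
    have unit: "W x \<ge> 0 \<and> D2 W x w w \<ge> 0" if x: "norm x = 1" for x w
    proof
      have x0: "x \<noteq> 0" "x \<in> - {0}" "x \<in> sphere 0 1" using x by auto
      have "C2 * \<kappa> \<le> C * \<kappa>" using C1 k by (intro mult_right_mono) (auto simp: C_def)
      then show "W x \<ge> 0" using C2(2)[OF x0(3) k] x x0 by (simp add: W_def)
      let ?w = "tang x w"
      have j: "jet2 (\<lambda>s. Phi (x + s *\<^sub>R ?w, \<kappa>) - Phi (x + s *\<^sub>R ?w, 0) + C * \<kappa> * norm (x + s *\<^sub>R ?w))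
         (Phi (x, \<kappa>) - Phi (x, 0) + C * \<kappa> * norm x)
         (D1 (\<lambda>y. Phi (y, \<kappa>)) x ?w - D1 (\<lambda>y. Phi (y, 0)) x ?w + C * \<kappa> * D1 norm x ?w)
         (D2 (\<lambda>y. Phi (y, \<kappa>)) x ?w ?w - D2 (\<lambda>y. Phi (y, 0)) x ?w ?w + C * \<kappa> * D2 norm x ?w ?w)"
        by (intro jet2_add jet2_diff jet2_cmult jet2_line[OF Cinf_norm open_punct x0(2)] jet2_line[OF slC open_punct x0(2)]) (use k in auto)
      have "\<forall>\<^sub>F s in nhds 0. Phi (x + s *\<^sub>R ?w, \<kappa>) - Phi (x + s *\<^sub>R ?w, 0) + C * \<kappa> * norm (x + s *\<^sub>R ?w) = W (x + s *\<^sub>R ?w)"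
        using line_nonzero[OF x0(1), of ?w] by eventually_elim (simp add: W_def)
      from jet2_unique(2)[OF jet2_line[OF WC open_punct x0(2), of ?w] jet2_cong_ev[OF j this]]
      have e: "D2 W x ?w ?w = D2 (\<lambda>y. Phi (y, \<kappa>)) x ?w ?w - D2 (\<lambda>y. Phi (y, 0)) x ?w ?w + C * \<kappa> * D2 norm x ?w ?w" .
      have "D2 norm x ?w ?w = (norm ?w)^2"
        using norm_derivs(3)[OF x0(1), of ?w] tang_orth[OF x0(1), of w] x by simp
      moreover have "C1 * \<kappa> * (norm ?w)^2 \<le> C * \<kappa> * (norm ?w)^2" using C2 k by (intro mult_right_mono) (auto simp: C_def)
      ultimately have "D2 W x ?w ?w \<ge> 0" using C1(2)[OF x0(3) k, of ?w] unfolding e by simp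
      then show "D2 W x w w \<ge> 0" using hom1_D2_tang[OF WC Wh x0(1), of w] by simp
    qed
    have "W (x + y) \<le> W x + W y"
    proof (rule hom1_subadd[OF WC Wh])
      fix x w :: 'a
      show "D2 W x w w \<ge> 0" if x: "x \<noteq> 0"
      proof -
        have "D2 W x w w = D2 W (x /\<^sub>R norm x) w w / norm x"
          using hom1_D2[OF WC Wh, of "norm x" "x /\<^sub>R norm x" w w] x by simp
        then show ?thesis using unit[of "x /\<^sub>R norm x" w] x by simp
      qed
      show "W x \<ge> 0"
      proof (cases "x = 0")
        case False
        have "W x = norm x * W (x /\<^sub>R norm x)" using hom1D[OF Wh, of "norm x" "x /\<^sub>R norm x"] False by simp
        then show ?thesis using unit[of "x /\<^sub>R norm x"] False by simp
      qed (simp add: W_def)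
    qed
    then show ?thesis using xy by (simp add: W_def algebra_simps)
  qed
  then show ?thesis using C by (intro exI[of _ C]) blast
qed

lemma Phi_bounds: "\<exists>c5>0. \<exists>C6>0. \<forall>z \<kappa>. norm z = 1 \<and> 0 \<le> \<kappa> \<and> \<kappa> \<le> 1 \<longrightarrow> c5 \<le> Phi (z, \<kappa>) \<and> Phi (z, \<kappa>) \<le> C6"
proof -
  note sub = PhiS_sphere
  have co: "compact (sphere (0::'a) 1 \<times> {0..1::real})" by (intro compact_Times) auto
  have c: "continuous_on (sphere 0 1 \<times> {0..1}) Phi" using Cinf_continuous[OF Phi_smooth] sub continuous_on_subset by blast
  obtain p :: 'a where "norm p = 1" using sphere_min by blast
  then have "(p, 0) \<in> sphere (0::'a) 1 \<times> {0..1::real}" by auto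
  then have ne: "sphere (0::'a) 1 \<times> {0..1::real} \<noteq> {}" by blast
  obtain z1 where z1: "z1 \<in> sphere 0 1 \<times> {0..1}" "\<And>z. z \<in> sphere 0 1 \<times> {0..1} \<Longrightarrow> Phi z1 \<le> Phi z"
    using continuous_attains_inf[OF co ne c] by blast
  obtain z2 where z2: "z2 \<in> sphere 0 1 \<times> {0..1}" "\<And>z. z \<in> sphere 0 1 \<times> {0..1} \<Longrightarrow> Phi z \<le> Phi z2"
    using continuous_attains_sup[OF co ne c] by blast
  have pos: "Phi z > 0" if "z \<in> sphere 0 1 \<times> {0..1}" for z
  proof -
    have "fst z \<noteq> 0" "snd z \<ge> 0" using that by auto
    then show ?thesis using Phi_pos[of "fst z" "snd z"] by simp
  qed
  show ?thesis
    by (rule exI[of _ "Phi z1"], rule conjI, rule pos[OF z1(1)], rule exI[of _ "Phi z2"], rule conjI, rule pos[OF z2(1)])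
      (use z1(2) z2(2) in auto)
qed

end

section \<open>Strict convexity of solutions\<close>

lemma bernoulli_neg: "t \<ge> 0 \<Longrightarrow> \<alpha> \<ge> 0 \<Longrightarrow> 1 - \<alpha> * t \<le> (1 + t) powr (- \<alpha>)" for t \<alpha> :: real
proof -
  assume t: "t \<ge> 0" "\<alpha> \<ge> 0"
  have "1 - \<alpha> * t \<le> exp (- (\<alpha> * t))" using exp_ge_add_one_self[of "- (\<alpha> * t)"] by simp
  also have "\<dots> \<le> exp (- \<alpha> * ln (1 + t))" using t ln_add_one_self_le_self[of t] by (simp add: mult_left_mono)
  also have "\<dots> = (1 + t) powr (- \<alpha>)" using t by (simp add: powr_def)
  finally show ?thesis .
qed

context quotient_eq
begin

text \<open>The factor is \<open>\<epsilon> * \<psi>\<close> with \<open>\<psi> x = exp (K * s x)\<close>. It suffices that \<open>G x y \<ge> 0\<close> for \<open>norm (x + y) = 1\<close>; the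
  claim is then the second variation at \<open>x = y\<close>. For large \<open>norm x + norm y\<close> this is clear, so a negative
  value of \<open>G\<close> implies a negative minimum \<open>- \<mu>\<close>, attained at some \<open>(x0, y0)\<close> with sum \<open>z0\<close>. The direction
  \<open>z0\<close> is not near \<open>p\<close>, by \<open>gap_near_min\<close>.

  The second variation at the minimum, together with \<open>norm_defect_estimates\<close>, gives the hypothesis of
  \<open>parallel_sum_ineq\<close> for the two regularised Hessians at \<open>x0\<close> and \<open>y0\<close> and the form \<open>Ch\<close>, which is the
  regularised Hessian at \<open>z0\<close> plus \<open>\<tau>\<close> times the barrier term (\<open>second\<close>). So
  \<open>Phi (x0, \<kappa>) + Phi (y0, \<kappa>)\<close> is at most \<open>Phi (z0, \<kappa>) / (1 + \<tau> * cg)\<close>. On the other hand \<open>rhs_superadd\<close> at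
  \<open>\<kappa> = 0\<close>, the smallness of \<open>Z = v x0 + v y0 - v z0\<close> and \<open>Phi_defect\<close> bound the same sum from below by
  \<open>Phi (z0, \<kappa>)\<close> minus a term of order \<open>\<epsilon> * \<psi> z0 * d0 * K\<close>, where \<open>d0\<close> is the triangle defect. As \<open>\<tau>\<close> is of
  the order of \<open>\<epsilon> * \<psi> z0 * d0 * K\<^sup>2\<close>, this is impossible for large \<open>K\<close>.\<close>

theorem v_strict: "\<exists>f0. (\<forall>z. norm z = 1 \<longrightarrow> f0 z > 0) \<and> (\<forall>z w. norm z = 1 \<longrightarrow> f0 z * (norm (tang z w))^2 \<le> D2 v z w w)"
proof -
  obtain p where p: "norm p = 1" "v p > 0" "\<And>x. v p * norm x \<le> v x" using sphere_min by blast
  define m where "m = v p"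
  have m: "m > 0" "\<And>x. m * norm x \<le> v x" using p by (auto simp: m_def)
  obtain M where M: "M > 0" "\<And>x. \<bar>v x\<bar> \<le> M * norm x" using hom1_bound[OF vC vh] by blast
  obtain \<delta> c1 where \<delta>: "\<delta> > 0" and c1: "c1 > 0"
    and gap: "\<And>x y. norm (x + y) = 1 \<and> dist (x + y) p < \<delta> \<longrightarrow> c1 * (norm x + norm y - 1) \<le> v x + v y - v (x + y)"
    using gap_near_min[OF p] by blast
  obtain s \<gamma> Cs where bs: "barrier_for p \<delta> s \<gamma> Cs"
    using barrier_exists[OF dim p(1) \<delta>] by (elim exE)
  note s = barrier_forD[OF bs]
  obtain cg \<eta> where "gain_ok cg \<eta>" using gain_const by (elim exE)
  note cg = gain_okD(1,2)[OF this] and gain = gain_okD(3)[OF this]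
  obtain C3 where C3: "C3 > 0" and defect: "\<And>\<kappa> x y. 0 \<le> \<kappa> \<and> \<kappa> \<le> 1 \<and> x \<noteq> 0 \<and> y \<noteq> 0 \<and> x + y \<noteq> 0 \<longrightarrow>
    Phi (x, 0) + Phi (y, 0) - Phi (x + y, 0) - C3 * \<kappa> * (norm x + norm y - norm (x + y))
      \<le> Phi (x, \<kappa>) + Phi (y, \<kappa>) - Phi (x + y, \<kappa>)"
    using Phi_defect by blast
  obtain c5 C6 where c5: "c5 > 0" "C6 > 0" and Phib: "\<And>z \<kappa>. norm z = 1 \<and> 0 \<le> \<kappa> \<and> \<kappa> \<le> 1 \<longrightarrow> c5 \<le> Phi (z, \<kappa>) \<and> Phi (z, \<kappa>) \<le> C6"
    using Phi_bounds by blast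
  define C7 where "C7 = \<alpha> * C6 / m + C3 * (2 + Cs)"
  have C7: "C7 > 0" unfolding C7_def using \<alpha> c5 m(1) C3 s(2) by (intro add_pos_pos mult_pos_pos divide_pos_pos) auto
  \<comment> \<open>The second bound makes the unfavourable terms of the second variation smaller than \<open>\<eta>\<close> times the
    favourable one; the third produces the contradiction.\<close>
  define K where "K = max 1 (max ((6 * Cs + 10) / (\<gamma> * \<eta>)) (2 * C7 * (1 + cg) / (c5 * \<gamma> * cg)))"
  have K: "K \<ge> 1" "(6 * Cs + 10) / (\<gamma> * \<eta>) \<le> K" "2 * C7 * (1 + cg) / (c5 * \<gamma> * cg) \<le> K" by (auto simp: K_def)
  have K0: "K > 0" using K by simp
  have K1: "6 * K * Cs + 10 \<le> K^2 * \<gamma> * \<eta>"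
  proof -
    have "6 * Cs + 10 \<le> K * (\<gamma> * \<eta>)" using K(2) s(1) cg by (simp add: pos_divide_le_eq)
    from mult_left_mono[OF this, of K] K0 have "K * (6 * Cs + 10) \<le> K^2 * \<gamma> * \<eta>" by (simp add: power2_eq_square mult.assoc)
    moreover have "6 * K * Cs + 10 \<le> K * (6 * Cs + 10)" using K(1) by (simp add: algebra_simps)
    ultimately show ?thesis by linarith
  qed
  have K2: "C7 * K * (1 + cg) < c5 * (K^2 * \<gamma>) * cg"
  proof -
    have "2 * C7 * (1 + cg) \<le> K * (c5 * \<gamma> * cg)" using K(3) s(1) cg c5 by (simp add: pos_divide_le_eq)
    from mult_left_mono[OF this, of K] K0 have "2 * (C7 * K * (1 + cg)) \<le> c5 * (K^2 * \<gamma>) * cg"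
      by (simp add: power2_eq_square mult_ac)
    moreover have "C7 * K * (1 + cg) > 0" using C7 K0 cg by (intro mult_pos_pos) auto
    ultimately show ?thesis by linarith
  qed
  define \<psi> where "\<psi> x = exp (K * s x)" for x
  have \<psi>C: "Cinf (- {0}) \<psi>" unfolding \<psi>_def by (intro Cinf_exp Cinf_mult Cinf_const s(3))
  have \<psi>p: "\<psi> x > 0" for x by (simp add: \<psi>_def)
  have \<psi>h: "\<psi> (t *\<^sub>R x) = \<psi> x" if "t > 0" "x \<noteq> 0" for t x using s(4)[OF that] by (simp add: \<psi>_def)
  obtain \<Psi> where \<Psi>: "\<Psi> > 0" "\<And>z. norm z = 1 \<Longrightarrow> \<psi> z \<le> \<Psi>"
  proof -
    have "continuous_on (sphere 0 1) \<psi>" using Cinf_continuous[OF \<psi>C] by (rule continuous_on_subset) auto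
    then have "bounded (\<psi> ` sphere 0 1)" by (intro compact_imp_bounded compact_continuous_image) auto
    then obtain B where "\<forall>z\<in>sphere 0 1. \<bar>\<psi> z\<bar> \<le> B" unfolding bounded_iff by auto
    then have B: "\<psi> z \<le> B" if "norm z = 1" for z using that by force
    then have "B > 0" using \<psi>p[of p] p(1) by force
    then show ?thesis using B that by blast
  qed
  \<comment> \<open>Beyond \<open>norm x + norm y = L\<close> the value \<open>v (x + y) \<le> M\<close> is too small for \<open>G\<close> to be negative.\<close>
  define L where "L = 2 * M / m"
  have L: "L > 0" using M m by (simp add: L_def)
  \<comment> \<open>A bound for \<open>\<epsilon> * \<psi>\<close>. The four terms serve, in this order, the case of large \<open>norm x + norm y\<close>, the case
    of \<open>z0\<close> near \<open>p\<close>, the bound \<open>\<kappa> \<le> 1\<close> and the bound \<open>\<tau> \<le> 1\<close>.\<close>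
  define \<omega> where "\<omega> = min (min (m / 2) c1) (min (1 / (2 + K * Cs)) (1 / (L * (K^2 * \<gamma>))))"
  have q1: "2 + K * Cs > 0" using K0 s(2) by (intro add_pos_pos mult_pos_pos) auto
  have q2: "L * (K^2 * \<gamma>) > 0" using L K0 s(1) by simp
  have \<omega>: "\<omega> > 0" "\<omega> \<le> m / 2" "\<omega> \<le> c1" "\<omega> * (2 + K * Cs) \<le> 1" "\<omega> * (L * (K^2 * \<gamma>)) \<le> 1"
  proof -
    show "\<omega> > 0" unfolding \<omega>_def using m(1) c1 q1 q2 by simp
    show "\<omega> \<le> m / 2" "\<omega> \<le> c1" by (auto simp: \<omega>_def)
    have "\<omega> \<le> 1 / (2 + K * Cs)" "\<omega> \<le> 1 / (L * (K^2 * \<gamma>))" by (auto simp: \<omega>_def)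
    then show "\<omega> * (2 + K * Cs) \<le> 1" "\<omega> * (L * (K^2 * \<gamma>)) \<le> 1" using q1 q2 by (simp_all only: pos_le_divide_eq)
  qed
  define \<epsilon> where "\<epsilon> = \<omega> / \<Psi>"
  have \<epsilon>: "\<epsilon> > 0" using \<omega> \<Psi> by (simp add: \<epsilon>_def)
  have \<epsilon>\<psi>: "\<epsilon> * \<psi> z \<le> \<omega>" "0 < \<epsilon> * \<psi> z" if "norm z = 1" for z
  proof -
    have "\<epsilon> * \<psi> z \<le> \<epsilon> * \<Psi>" using \<epsilon> \<Psi>(2)[OF that] by (intro mult_left_mono) auto
    then show "\<epsilon> * \<psi> z \<le> \<omega>" using \<Psi>(1) by (simp add: \<epsilon>_def)
    show "0 < \<epsilon> * \<psi> z" using \<epsilon> \<psi>p[of z] by simp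
  qed
  define d where "d x y = norm x + norm y - norm (x + y)" for x y :: 'a
  have dn: "d x y \<ge> 0" for x y using norm_triangle_ineq[of x y] by (simp add: d_def)
  define G where "G x y = v x + v y - v (x + y) - \<epsilon> * (\<psi> (x + y) * d x y)" for x y
  have large: "G x y \<ge> 0" if xy: "norm (x + y) = 1" "L \<le> norm x + norm y" for x y
  proof -
    have "\<epsilon> * \<psi> (x + y) * d x y \<le> m / 2 * (norm x + norm y)"
      using \<epsilon>\<psi>[OF xy(1)] \<omega>(2) dn[of x y] xy(1) by (intro mult_mono) (auto simp: d_def)
    moreover have "M \<le> m / 2 * (norm x + norm y)" using xy(2) m(1) by (simp add: L_def field_simps)
    moreover have "v (x + y) \<le> M" using M(2)[of "x + y"] xy(1) by simp
    moreover have "m * norm x + m * norm y \<le> v x + v y" by (intro add_mono m(2))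
    moreover have "m * norm x + m * norm y = m / 2 * (norm x + norm y) + m / 2 * (norm x + norm y)" by (simp add: algebra_simps)
    ultimately show ?thesis by (simp add: G_def mult.assoc)
  qed
  have main: "G x y \<ge> 0" if n1: "norm (x + y) = 1" for x y
  proof (rule ccontr)
    assume neg: "\<not> G x y \<ge> 0"
    define T where "T = {z :: 'a \<times> 'a. norm (fst z + snd z) = 1} \<inter> {z. norm (fst z) + norm (snd z) \<le> L}"
    have "T \<subseteq> cball 0 L \<times> cball 0 L"
    proof
      fix z assume "z \<in> T"
      then have "norm (fst z) + norm (snd z) \<le> L" by (simp add: T_def)
      then have "norm (fst z) \<le> L" "norm (snd z) \<le> L" using norm_ge_zero[of "fst z"] norm_ge_zero[of "snd z"] by linarith+
      then show "z \<in> cball 0 L \<times> cball 0 L" by (cases z) auto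
    qed
    then have "bounded T" using bounded_Times[OF bounded_cball bounded_cball] bounded_subset by blast
    moreover have "closed T" unfolding T_def
      by (intro closed_Int closed_Collect_eq closed_Collect_le continuous_intros)
    ultimately have cT: "compact T" by (simp add: compact_eq_bounded_closed)
    have xyT: "(x, y) \<in> T" using n1 neg large[of x y] by (auto simp: T_def)
    have vc: "continuous_on T (\<lambda>z. v (fst z + snd z))" "continuous_on T (\<lambda>z. v (fst z))" "continuous_on T (\<lambda>z. v (snd z))"
      by (rule continuous_on_compose2[OF v_cont]; auto intro!: continuous_intros)+
    have \<psi>c: "continuous_on T (\<lambda>z. \<psi> (fst z + snd z))"
    proof (rule continuous_on_compose2[OF Cinf_continuous[OF \<psi>C]])
      show "(\<lambda>z. fst z + snd z) ` T \<subseteq> - {0}" by (auto simp: T_def)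
    qed (intro continuous_intros)
    have cG: "continuous_on T (\<lambda>z. G (fst z) (snd z))" unfolding G_def d_def
      by (intro continuous_on_diff continuous_on_add continuous_on_mult continuous_on_const vc \<psi>c continuous_on_norm continuous_on_fst continuous_on_snd continuous_on_id)
    obtain q where q: "q \<in> T" "\<And>z. z \<in> T \<Longrightarrow> G (fst q) (snd q) \<le> G (fst z) (snd z)"
      using continuous_attains_inf[OF cT _ cG] xyT by blast
    define x0 where "x0 = fst q" define y0 where "y0 = snd q"
    define z0 where "z0 = x0 + y0"
    define \<mu> where "\<mu> = - G x0 y0"
    have nz: "norm z0 = 1" using q(1) by (simp add: T_def z0_def x0_def y0_def)
    have lL: "norm x0 + norm y0 \<le> L" using q(1) by (simp add: T_def x0_def y0_def)
    have \<mu>: "\<mu> > 0" using q(2)[OF xyT] neg by (simp add: \<mu>_def x0_def y0_def)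
    have min1: "G x y \<ge> - \<mu>" if "norm (x + y) = 1" for x y
    proof (cases "norm x + norm y \<le> L")
      case True
      then have "(x, y) \<in> T" using that by (simp add: T_def)
      from q(2)[OF this] show ?thesis by (simp add: \<mu>_def x0_def y0_def)
    next
      case False then show ?thesis using large[OF that] \<mu> by simp
    qed
    \<comment> \<open>By homogeneity the constraint \<open>norm (x + y) = 1\<close> is replaced by the multiplier \<open>\<mu>\<close>.\<close>
    have minh: "G x y + \<mu> * norm (x + y) \<ge> 0" if xy: "x + y \<noteq> 0" for x y
    proof -
      define t where "t = norm (x + y)"
      have t: "t > 0" using xy by (simp add: t_def)
      have n1: "norm (x /\<^sub>R t + y /\<^sub>R t) = 1" using t unfolding scaleR_add_right[symmetric] by (simp add: t_def)
      have vt: "v (w /\<^sub>R t) = v w / t" for w using hom1D[OF vh, of "inverse t" w] t by (simp add: divide_inverse mult.commute)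
      have "G (x /\<^sub>R t) (y /\<^sub>R t) = G x y / t"
        using t \<psi>h[of "inverse t" "x + y"] xy
        by (simp add: G_def d_def vt scaleR_add_right[symmetric] diff_divide_distrib add_divide_distrib divide_inverse algebra_simps del: scaleR_add_right)
      then have "- \<mu> \<le> G x y / t" using min1[OF n1] by simp
      then have "- \<mu> * t \<le> G x y" using t by (simp only: pos_le_divide_eq)
      then show ?thesis by (simp add: t_def)
    qed
    have z00: "z0 \<noteq> 0" "z0 \<in> - {0}" using nz by auto
    have \<mu>eq: "- \<mu> = v x0 + v y0 - v z0 - \<epsilon> * \<psi> z0 * d x0 y0" by (simp add: \<mu>_def G_def z0_def mult.assoc)
    have x00: "x0 \<noteq> 0"
    proof
      assume "x0 = 0"
      then show False using \<mu>eq \<mu> v_0 by (simp add: z0_def d_def)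
    qed
    have y00: "y0 \<noteq> 0"
    proof
      assume "y0 = 0"
      then show False using \<mu>eq \<mu> v_0 by (simp add: z0_def d_def)
    qed
    have xP: "x0 \<in> - {0}" "y0 \<in> - {0}" using x00 y00 by auto
    define d0 where "d0 = d x0 y0"
    have d0: "d0 = norm x0 + norm y0 - 1" using nz by (simp add: d0_def d_def z0_def)
    define Z where "Z = v x0 + v y0 - v z0"
    have Z0: "Z \<ge> 0" using v_subadd[of x0 y0] by (simp add: Z_def z0_def)
    have Zlt: "Z < \<epsilon> * \<psi> z0 * d0" using \<mu>eq \<mu> by (simp add: Z_def d0_def)
    define e\<psi> where "e\<psi> = \<epsilon> * \<psi> z0"
    have e\<psi>: "e\<psi> > 0" "e\<psi> \<le> \<omega>" using \<epsilon>\<psi>[OF nz] by (auto simp: e\<psi>_def)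
    have d0p: "d0 > 0"
    proof -
      have "0 < e\<psi> * d0" using Z0 Zlt by (simp add: e\<psi>_def)
      then show ?thesis using e\<psi>(1) by (simp add: zero_less_mult_iff)
    qed
    have d0L: "d0 \<le> L" using lL by (simp add: d0)
    have \<mu>le: "\<mu> \<le> e\<psi> * d0" using \<mu>eq Z0 by (simp add: Z_def d0_def e\<psi>_def)
    have far: "\<delta> \<le> dist z0 p"
    proof (rule ccontr)
      assume "\<not> \<delta> \<le> dist z0 p"
      then have "c1 * d0 \<le> Z" using gap[of x0 y0] nz by (simp add: d0 Z_def z0_def)
      moreover have "e\<psi> * d0 \<le> c1 * d0" using e\<psi>(2) \<omega>(3) d0p by (intro mult_right_mono) auto
      ultimately show False using Zlt by (simp add: e\<psi>_def)
    qed
    obtain u where u: "norm u = 1" "\<And>w. \<gamma> * (u \<bullet> w)^2 \<le> (D1 s z0 w)^2" using s(6)[OF nz far] by blast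
    \<comment> \<open>In the lower bound for the second variation \<open>\<sigma>\<close> has the coefficient \<open>- e\<psi> * (2 + K * Cs)\<close>, which this \<open>\<kappa>\<close> cancels.\<close>
    define \<kappa> where "\<kappa> = e\<psi> * (2 + K * Cs)"
    define \<tau> where "\<tau> = e\<psi> * d0 * (K^2 * \<gamma>)"
    have \<kappa>: "0 \<le> \<kappa>" "\<kappa> \<le> 1"
    proof -
      show "0 \<le> \<kappa>" using e\<psi>(1) q1 by (simp add: \<kappa>_def)
      have "\<kappa> \<le> \<omega> * (2 + K * Cs)" unfolding \<kappa>_def using e\<psi>(2) q1 by (intro mult_right_mono) auto
      then show "\<kappa> \<le> 1" using \<omega>(4) by simp
    qed
    have \<tau>: "0 \<le> \<tau>" "\<tau> \<le> 1"
    proof -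
      show "0 \<le> \<tau>" using e\<psi>(1) d0p s(1) by (simp add: \<tau>_def)
      have "e\<psi> * d0 \<le> \<omega> * L" using e\<psi> d0p d0L \<omega>(1) by (intro mult_mono) auto
      then have "\<tau> \<le> \<omega> * L * (K^2 * \<gamma>)" unfolding \<tau>_def using s(1) by (intro mult_right_mono) auto
      then show "\<tau> \<le> 1" using \<omega>(5) by (simp add: mult.assoc)
    qed
    have second: "D2 v z0 (h + k) (h + k) + \<kappa> * (norm (h + k))^2 + \<tau> * ((u \<bullet> (h + k))^2 - \<eta> * (norm (h + k))^2)
       \<le> Af (x0, \<kappa>) h h + Af (y0, \<kappa>) k k" for h k
    proof -
      define e where "e = h + k"
      define E where "E = (norm e)^2"
      have E0: "E \<ge> 0" by (simp add: E_def)
      define d1 where "d1 = D1 norm x0 h + D1 norm y0 k - D1 norm z0 e"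
      define d2 where "d2 = D2 norm x0 h h + D2 norm y0 k k - D2 norm z0 e e"
      have jv: "jet2 (\<lambda>s. v (x0 + s *\<^sub>R h) + v (y0 + s *\<^sub>R k) - v (z0 + s *\<^sub>R e))
         (v x0 + v y0 - v z0) (D1 v x0 h + D1 v y0 k - D1 v z0 e) (D2 v x0 h h + D2 v y0 k k - D2 v z0 e e)"
        by (intro jet2_diff jet2_add jet2_line[OF vC open_punct] xP z00(2))
      have jd: "jet2 (\<lambda>s. norm (x0 + s *\<^sub>R h) + norm (y0 + s *\<^sub>R k) - norm (z0 + s *\<^sub>R e))
         (norm x0 + norm y0 - norm z0) d1 d2"
        unfolding d1_def d2_def by (intro jet2_diff jet2_add jet2_line[OF Cinf_norm open_punct] xP z00(2))
      note j\<psi> = jet2_line[OF \<psi>C open_punct z00(2), of e]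
      note jn = jet2_line[OF Cinf_norm open_punct z00(2), of e]
      note j = jet2_add[OF jet2_diff[OF jv jet2_cmult[OF jet2_mult[OF j\<psi> jd], of \<epsilon>]] jet2_cmult[OF jn, of \<mu>]]
      have ev: "\<forall>\<^sub>F s in nhds 0. (v (x0 + s *\<^sub>R h) + v (y0 + s *\<^sub>R k) - v (z0 + s *\<^sub>R e) -
          \<epsilon> * (\<psi> (z0 + s *\<^sub>R e) * (norm (x0 + s *\<^sub>R h) + norm (y0 + s *\<^sub>R k) - norm (z0 + s *\<^sub>R e)))) + \<mu> * norm (z0 + s *\<^sub>R e)
          \<ge> (v (x0 + 0 *\<^sub>R h) + v (y0 + 0 *\<^sub>R k) - v (z0 + 0 *\<^sub>R e) -
          \<epsilon> * (\<psi> (z0 + 0 *\<^sub>R e) * (norm (x0 + 0 *\<^sub>R h) + norm (y0 + 0 *\<^sub>R k) - norm (z0 + 0 *\<^sub>R e)))) + \<mu> * norm (z0 + 0 *\<^sub>R e)"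
        using line_nonzero[OF z00(1), of e]
      proof eventually_elim
        case (elim s)
        have sm: "(x0 + s *\<^sub>R h) + (y0 + s *\<^sub>R k) = z0 + s *\<^sub>R e" by (simp add: z0_def e_def algebra_simps)
        have "G (x0 + s *\<^sub>R h) (y0 + s *\<^sub>R k) + \<mu> * norm ((x0 + s *\<^sub>R h) + (y0 + s *\<^sub>R k)) \<ge> 0"
          using minh sm elim by metis
        moreover have "G x0 y0 + \<mu> * norm (x0 + y0) = 0" using nz by (simp add: \<mu>_def z0_def)
        ultimately show ?case by (simp add: G_def d_def sm z0_def[symmetric])
      qed
      have "0 \<le> (D2 v x0 h h + D2 v y0 k k - D2 v z0 e e) -
          \<epsilon> * (D2 \<psi> z0 e e * (norm x0 + norm y0 - norm z0) + 2 * D1 \<psi> z0 e * d1 + \<psi> z0 * d2) + \<mu> * D2 norm z0 e e"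
        using jet2_min(2)[OF j ev] .
      moreover have "norm x0 + norm y0 - norm z0 = d0" using nz by (simp add: d0)
      moreover have "D2 \<psi> z0 e e = \<psi> z0 * (K * D2 s z0 e e + (K * D1 s z0 e)^2)" "D1 \<psi> z0 e = \<psi> z0 * (K * D1 s z0 e)"
        using exp_barrier_derivs(2,3)[OF s(3) z00(1), of K e] by (simp_all add: \<psi>_def[abs_def])
      ultimately have var: "0 \<le> (D2 v x0 h h + D2 v y0 k k - D2 v z0 e e) -
          e\<psi> * ((K * D2 s z0 e e + (K * D1 s z0 e)^2) * d0 + 2 * (K * D1 s z0 e) * d1 + d2) + \<mu> * D2 norm z0 e e"
        by (simp add: e\<psi>_def algebra_simps)
      obtain \<sigma> where \<sigma>: "\<sigma> \<ge> 0" "(1 - d0) * E + \<sigma> \<le> (norm h)^2 / norm x0 + (norm k)^2 / norm y0"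
        "2 * norm e * \<bar>d1\<bar> \<le> 4 * d0 * E + \<sigma>" "- (7 * d0 * E + 2 * \<sigma>) \<le> d2"
        using norm_defect_estimates[OF x00 y00 nz[unfolded z0_def], of h k]
        unfolding d1_def d2_def E_def e_def d0 z0_def by blast
      have b1: "K^2 * \<gamma> * (u \<bullet> e)^2 * d0 - K * Cs * E * d0 \<le> (K * D2 s z0 e e + (K * D1 s z0 e)^2) * d0"
      proof -
        have "- (Cs * E) \<le> D2 s z0 e e" using s(5)[OF nz, of e] unfolding E_def by linarith
        from mult_left_mono[OF this, of K] K0 have 1: "- (K * Cs * E) \<le> K * D2 s z0 e e" by (simp add: mult.assoc)
        have 2: "K^2 * (\<gamma> * (u \<bullet> e)^2) \<le> (K * D1 s z0 e)^2" using u(2)[of e] by (simp add: power_mult_distrib mult_left_mono)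
        have "K^2 * (\<gamma> * (u \<bullet> e)^2) - K * Cs * E \<le> K * D2 s z0 e e + (K * D1 s z0 e)^2" using 1 2 by linarith
        from mult_right_mono[OF this, of d0] d0p show ?thesis by (simp add: left_diff_distrib mult.assoc)
      qed
      have b2: "- (K * Cs * (4 * d0 * E + \<sigma>)) \<le> 2 * (K * D1 s z0 e) * d1"
      proof -
        have "\<bar>2 * (K * D1 s z0 e) * d1\<bar> = K * \<bar>D1 s z0 e\<bar> * (2 * \<bar>d1\<bar>)" using K0 by (simp add: abs_mult)
        also have "\<dots> \<le> K * (Cs * norm e) * (2 * \<bar>d1\<bar>)" using s(5)[OF nz, of e] K0 by (intro mult_right_mono mult_left_mono) auto
        also have "\<dots> = K * Cs * (2 * norm e * \<bar>d1\<bar>)" by simp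
        also have "\<dots> \<le> K * Cs * (4 * d0 * E + \<sigma>)" using \<sigma>(3) K0 s(2) by (intro mult_left_mono) auto
        finally show ?thesis by linarith
      qed
      have b3: "\<mu> * D2 norm z0 e e \<le> e\<psi> * (d0 * E)"
      proof -
        have "D2 norm z0 e e \<le> E" using norm_derivs(3)[OF z00(1), of e] nz by (simp add: E_def)
        moreover have "0 \<le> D2 norm z0 e e" using norm_derivs(2)[OF z00(1), of e] by simp
        ultimately have "\<mu> * D2 norm z0 e e \<le> (e\<psi> * d0) * E" using \<mu>le \<mu> e\<psi>(1) d0p by (intro mult_mono) auto
        then show ?thesis by (simp add: mult.assoc)
      qed
      define R where "R = K^2 * \<gamma> * (u \<bullet> e)^2 * d0 - K * Cs * E * d0 - K * Cs * (4 * d0 * E + \<sigma>) - (7 * d0 * E + 2 * \<sigma>)"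
      have "R \<le> (K * D2 s z0 e e + (K * D1 s z0 e)^2) * d0 + 2 * (K * D1 s z0 e) * d1 + d2"
        using b1 b2 \<sigma>(4) by (simp add: R_def)
      then have "e\<psi> * R \<le> e\<psi> * ((K * D2 s z0 e e + (K * D1 s z0 e)^2) * d0 + 2 * (K * D1 s z0 e) * d1 + d2)"
        using e\<psi>(1) by (intro mult_left_mono) auto
      then have lo: "D2 v z0 e e + e\<psi> * R - e\<psi> * (d0 * E) \<le> D2 v x0 h h + D2 v y0 k k" using var b3 by linarith
      have kap: "\<kappa> * ((1 - d0) * E + \<sigma>) \<le> \<kappa> * ((norm h)^2 / norm x0 + (norm k)^2 / norm y0)"
        using \<sigma>(2) \<kappa>(1) by (intro mult_left_mono)
      have Afe: "Af (x0, \<kappa>) h h + Af (y0, \<kappa>) k k = D2 v x0 h h + D2 v y0 k k + \<kappa> * ((norm h)^2 / norm x0 + (norm k)^2 / norm y0)"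
        by (simp add: Af_def power2_norm_eq_inner divide_inverse algebra_simps)
      have alg: "\<kappa> * ((1 - d0) * E + \<sigma>) + e\<psi> * R - e\<psi> * (d0 * E)
         = \<kappa> * E + e\<psi> * d0 * (K^2 * \<gamma> * (u \<bullet> e)^2 - (6 * K * Cs + 10) * E)"
        unfolding \<kappa>_def R_def by (simp add: algebra_simps)
      have "\<tau> * ((u \<bullet> e)^2 - \<eta> * E) \<le> e\<psi> * d0 * (K^2 * \<gamma> * (u \<bullet> e)^2 - (6 * K * Cs + 10) * E)"
      proof -
        have "(6 * K * Cs + 10) * E \<le> K^2 * \<gamma> * \<eta> * E" using K1 E0 by (rule mult_right_mono)
        then have "K^2 * \<gamma> * ((u \<bullet> e)^2 - \<eta> * E) \<le> K^2 * \<gamma> * (u \<bullet> e)^2 - (6 * K * Cs + 10) * E" by (simp add: algebra_simps)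
        from mult_left_mono[OF this, of "e\<psi> * d0"] e\<psi>(1) d0p show ?thesis by (simp add: \<tau>_def mult.assoc)
      qed
      then show ?thesis using lo kap Afe alg unfolding e_def[symmetric] E_def[symmetric] by linarith
    qed
    define Ch where "Ch = (\<lambda>p q. D2 v z0 p q + \<kappa> * (p \<bullet> q) + \<tau> * ((u \<bullet> p) * (u \<bullet> q) - \<eta> * (p \<bullet> q)))"
    have sCh: "symform Ch" unfolding Ch_def using z00
      by (intro symform_add symform_diff symform_cmult symform_inner symform_sq v_sym)
    have Chw: "Ch w w = D2 v z0 w w + \<kappa> * (norm w)^2 + \<tau> * ((u \<bullet> w)^2 - \<eta> * (norm w)^2)" for w
      unfolding Ch_def power2_norm_eq_inner by (simp add: power2_eq_square)
    have Afz: "Af (z0, \<kappa>) = (\<lambda>p q. D2 v z0 p q + \<kappa> * (p \<bullet> q))" using nz by (simp add: Af_def fun_eq_iff)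
    have g: "Ch \<in> MG a \<and> (1 + \<tau> * cg) * MF a b (\<lambda>p q. D2 v z0 p q + \<kappa> * (p \<bullet> q)) \<le> MF a b Ch"
      by (rule gain[OF nz u(1) \<tau> \<kappa> sCh]) (simp add: Chw)
    define F where "F k = (if k then x0 else y0)" for k :: bool
    have F0: "F k \<noteq> 0" for k using x00 y00 by (simp add: F_def)
    have "(\<Sum>k\<in>{True, False}. 1 / MF a b (Af (F k, \<kappa>))) \<le> 1 / MF a b Ch"
    proof (rule parallel_sum_ineq[OF _ _ _ _ _ sCh _ ab])
      show "symform (Af (F k, \<kappa>))" "Af (F k, \<kappa>) \<in> MG a" for k using Af_sym[OF F0] Af_MG[OF F0 \<kappa>(1)] by auto
      show "0 \<le> Af (F k, \<kappa>) w w" for k w using v_psd[OF F0, of k w] \<kappa>(1) by (simp add: Af_def)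
      show "Ch (\<Sum>k\<in>{True, False}. h k) (\<Sum>k\<in>{True, False}. h k) \<le> (\<Sum>k\<in>{True, False}. Af (F k, \<kappa>) (h k) (h k))" for h
        using second[of "h True" "h False"] by (simp add: Chw F_def)
    qed (use g in auto)
    then have up: "Phi (x0, \<kappa>) + Phi (y0, \<kappa>) \<le> 1 / MF a b Ch"
      using Phi_eq[OF x00 \<kappa>(1)] Phi_eq[OF y00 \<kappa>(1)] by (simp add: F_def)
    have t1: "1 + \<tau> * cg > 0" using \<tau>(1) cg(1) by (simp add: add_pos_nonneg)
    have f0: "MF a b (Af (z0, \<kappa>)) > 0" by (rule MF_pos[OF Af_MG[OF z00(1) \<kappa>(1)] ab(1)])
    have "1 / MF a b Ch \<le> 1 / ((1 + \<tau> * cg) * MF a b (Af (z0, \<kappa>)))"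
      using g t1 f0 unfolding Afz by (intro divide_left_mono mult_pos_pos) (auto intro: MF_pos[OF _ ab(1)])
    also have "\<dots> = Phi (z0, \<kappa>) / (1 + \<tau> * cg)" using Phi_eq[OF z00(1) \<kappa>(1)] by simp
    finally have "1 / MF a b Ch \<le> Phi (z0, \<kappa>) / (1 + \<tau> * cg)" .
    from order_trans[OF up this] have up2: "(Phi (x0, \<kappa>) + Phi (y0, \<kappa>)) * (1 + \<tau> * cg) \<le> Phi (z0, \<kappa>)"
      using t1 by (simp only: pos_le_divide_eq)
    have E0: "Phi (w, 0) = 1 / MF a b (D2 v w)" if "w \<noteq> 0" for w
    proof -
      have "Af (w, 0) = D2 v w" by (simp add: Af_def fun_eq_iff)
      then show ?thesis using Phi_eq[OF that, of 0] by simp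
    qed
    have vz: "v z0 > 0" "m \<le> v z0" using vpos[OF z00(1)] m(2)[of z0] nz by auto
    \<comment> \<open>The lower bound for \<open>Phi (x0, \<kappa>) + Phi (y0, \<kappa>)\<close>, first without regularisation.\<close>
    have "Phi (z0, 0) * (1 - \<alpha> * (Z / v z0)) \<le> Phi (x0, 0) + Phi (y0, 0)"
    proof -
      have "Phi (z0, 0) * (1 - \<alpha> * (Z / v z0)) \<le> Phi (z0, 0) * (1 + Z / v z0) powr (- \<alpha>)"
        using Z0 vz \<alpha> Phi_pos[OF z00(1), of 0] by (intro mult_left_mono bernoulli_neg) auto
      also have "\<dots> = c * (g z0 powr (1 + \<alpha>) * (v z0 powr (- \<alpha>) * (1 + Z / v z0) powr (- \<alpha>)))"
        using E0[OF z00(1)] eqn[OF z00(1)] by (simp add: mult.assoc)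
      also have "v z0 powr (- \<alpha>) * (1 + Z / v z0) powr (- \<alpha>) = (v x0 + v y0) powr (- \<alpha>)"
      proof -
        have "v z0 * (1 + Z / v z0) = v x0 + v y0" using vz by (simp add: Z_def field_simps)
        then show ?thesis using powr_mult[of "v z0" "1 + Z / v z0" "- \<alpha>"] vz Z0 by simp
      qed
      also have "c * (g z0 powr (1 + \<alpha>) * (v x0 + v y0) powr (- \<alpha>)) \<le> Phi (x0, 0) + Phi (y0, 0)"
        using rhs_superadd[of "{True, False}" F] F0 z00 E0[OF x00] E0[OF y00] by (simp add: F_def z0_def)
      finally show ?thesis .
    qed
    moreover have "Phi (z0, 0) * (\<alpha> * (Z / v z0)) \<le> (\<alpha> * C6 / m) * (e\<psi> * d0)"
    proof -
      have "Z / v z0 \<le> (e\<psi> * d0) / m" using Zlt Z0 vz m(1) by (intro frac_le) (auto simp: e\<psi>_def)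
      then have a1: "\<alpha> * (Z / v z0) \<le> \<alpha> * ((e\<psi> * d0) / m)" using \<alpha> by (intro mult_left_mono) auto
      have a2: "Phi (z0, 0) \<le> C6" using Phib[of z0 0] nz by simp
      have "Phi (z0, 0) * (\<alpha> * (Z / v z0)) \<le> C6 * (\<alpha> * ((e\<psi> * d0) / m))"
        by (rule mult_mono[OF a2 a1]) (use c5 \<alpha> Z0 vz in auto)
      then show ?thesis by (simp add: mult_ac)
    qed
    moreover have "Phi (x0, 0) + Phi (y0, 0) - Phi (z0, 0) - C3 * \<kappa> * d0 \<le> Phi (x0, \<kappa>) + Phi (y0, \<kappa>) - Phi (z0, \<kappa>)"
      using defect[of \<kappa> x0 y0] \<kappa> x00 y00 z00 by (simp add: z0_def[symmetric] d0_def d_def)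
    ultimately have lo: "Phi (z0, \<kappa>) - (\<alpha> * C6 / m) * (e\<psi> * d0) - C3 * \<kappa> * d0 \<le> Phi (x0, \<kappa>) + Phi (y0, \<kappa>)"
      by (simp add: right_diff_distrib)
    have "(\<alpha> * C6 / m) * (e\<psi> * d0) + C3 * \<kappa> * d0 \<le> e\<psi> * d0 * (C7 * K)"
    proof -
      have "\<alpha> * C6 / m + C3 * (2 + K * Cs) \<le> K * (\<alpha> * C6 / m) + C3 * (2 * K + K * Cs)"
      proof (intro add_mono mult_left_mono)
        have "1 * (\<alpha> * C6 / m) \<le> K * (\<alpha> * C6 / m)" using K(1) \<alpha> c5 m(1) by (intro mult_right_mono) auto
        then show "\<alpha> * C6 / m \<le> K * (\<alpha> * C6 / m)" by simp
      qed (use K(1) C3 in auto)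
      also have "\<dots> = C7 * K" by (simp add: C7_def algebra_simps)
      finally have "e\<psi> * d0 * (\<alpha> * C6 / m + C3 * (2 + K * Cs)) \<le> e\<psi> * d0 * (C7 * K)"
        using e\<psi>(1) d0p by (intro mult_left_mono) auto
      then show ?thesis by (simp add: \<kappa>_def algebra_simps)
    qed
    then have lo2: "Phi (z0, \<kappa>) - e\<psi> * d0 * (C7 * K) \<le> Phi (x0, \<kappa>) + Phi (y0, \<kappa>)" using lo by linarith
    from mult_right_mono[OF this, of "1 + \<tau> * cg"] t1 up2
    have "(Phi (z0, \<kappa>) - e\<psi> * d0 * (C7 * K)) * (1 + \<tau> * cg) \<le> Phi (z0, \<kappa>)" by linarith
    then have "Phi (z0, \<kappa>) * (\<tau> * cg) \<le> e\<psi> * d0 * (C7 * K) * (1 + \<tau> * cg)" by (simp add: algebra_simps)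
    also have "\<dots> \<le> e\<psi> * d0 * (C7 * K) * (1 + cg)"
      using \<tau> cg e\<psi>(1) d0p C7 K0 by (intro mult_left_mono) (auto simp: mult_left_le_one_le)
    finally have "Phi (z0, \<kappa>) * (\<tau> * cg) \<le> e\<psi> * d0 * (C7 * K * (1 + cg))" by (simp add: mult.assoc)
    moreover have "c5 * (\<tau> * cg) \<le> Phi (z0, \<kappa>) * (\<tau> * cg)" using Phib[of z0 \<kappa>] nz \<kappa> \<tau> cg by (intro mult_right_mono) auto
    moreover have "c5 * (\<tau> * cg) = e\<psi> * d0 * (c5 * (K^2 * \<gamma>) * cg)" by (simp add: \<tau>_def)
    ultimately have "e\<psi> * d0 * (c5 * (K^2 * \<gamma>) * cg) \<le> e\<psi> * d0 * (C7 * K * (1 + cg))" by linarith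
    then have "c5 * (K^2 * \<gamma>) * cg \<le> C7 * K * (1 + cg)" using e\<psi>(1) d0p by (subst (asm) mult_le_cancel_left_pos) auto
    then show False using K2 by simp
  qed
  \<comment> \<open>The case \<open>x = z / 2 + t w\<close>, \<open>y = z / 2 - t w\<close> of \<open>G x y \<ge> 0\<close>, to second order in \<open>t\<close>.\<close>
  have "\<epsilon> * \<psi> z * (norm (tang z w))^2 \<le> D2 v z w w" if z: "norm z = 1" for z w
  proof -
    have z0: "z \<noteq> 0" using z by auto
    let ?h = "(1/2) *\<^sub>R z"
    have hP: "?h \<in> - {0}" using z0 by simp
    note jn = jet2_line[OF Cinf_norm open_punct hP] and jv = jet2_line[OF vC open_punct hP]
    note j = jet2_diff[OF jet2_add[OF jv[of w] jv[of "- w"]] jet2_cmult[OF jet2_add[OF jn[of w] jn[of "- w"]], of "\<epsilon> * \<psi> z"]]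
    have sm: "(?h + t *\<^sub>R w) + (?h + t *\<^sub>R (- w)) = z" for t by (simp flip: scaleR_add_left)
    have ge: "v z - \<epsilon> * \<psi> z \<le> v (?h + t *\<^sub>R w) + v (?h + t *\<^sub>R (- w)) - \<epsilon> * \<psi> z * (norm (?h + t *\<^sub>R w) + norm (?h + t *\<^sub>R (- w)))" for t
      using main[of "?h + t *\<^sub>R w" "?h + t *\<^sub>R (- w)"] z unfolding sm G_def d_def by (simp add: algebra_simps)
    have "v ?h = v z / 2" "norm ?h = 1 / 2" using hom1D[OF vh, of "1/2" z] z by auto
    then have base: "v (?h + 0 *\<^sub>R w) + v (?h + 0 *\<^sub>R (- w)) - \<epsilon> * \<psi> z * (norm (?h + 0 *\<^sub>R w) + norm (?h + 0 *\<^sub>R (- w))) = v z - \<epsilon> * \<psi> z"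
      by simp
    have "\<forall>\<^sub>F t in nhds 0. v (?h + t *\<^sub>R w) + v (?h + t *\<^sub>R (- w)) - \<epsilon> * \<psi> z * (norm (?h + t *\<^sub>R w) + norm (?h + t *\<^sub>R (- w)))
      \<ge> v (?h + 0 *\<^sub>R w) + v (?h + 0 *\<^sub>R (- w)) - \<epsilon> * \<psi> z * (norm (?h + 0 *\<^sub>R w) + norm (?h + 0 *\<^sub>R (- w)))"
      unfolding base by (intro always_eventually allI ge)
    from jet2_min(2)[OF j this]
    have nn: "0 \<le> D2 v ?h w w + D2 v ?h (- w) (- w) - \<epsilon> * \<psi> z * (D2 norm ?h w w + D2 norm ?h (- w) (- w))" .
    have neg: "D2 f ?h (- w) (- w) = D2 f ?h w w" if "Cinf (- {0}) f" for f
    proof -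
      have s: "symform (D2 f ?h)" by (rule symform_D2[OF that open_punct hP])
      show ?thesis using symform_scale_left[OF s, of "-1"] symform_scale_right[OF s, of _ "-1"] by simp
    qed
    have "D2 v ?h w w = 2 * D2 v z w w" "D2 norm ?h w w = 2 * D2 norm z w w"
      using hom1_D2[OF vC vh, of "1/2" z] hom1_D2[OF Cinf_norm hom1_norm, of "1/2" z] z0 by auto
    then have "0 \<le> 4 * (D2 v z w w - \<epsilon> * \<psi> z * D2 norm z w w)" using nn neg[OF vC] neg[OF Cinf_norm] by (simp add: algebra_simps)
    then have "\<epsilon> * \<psi> z * D2 norm z w w \<le> D2 v z w w" by simp
    moreover have "D2 norm z w w = (norm (tang z w))^2" using norm_derivs(2)[OF z0, of w] z by simp
    ultimately show ?thesis by simp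
  qed
  then show ?thesis using \<epsilon> \<psi>p by (intro exI[of _ "\<lambda>z. \<epsilon> * \<psi> z"]) auto
qed

end

section \<open>Homogeneous extension of functions on the sphere\<close>

definition hext :: "('a::euclidean_space \<Rightarrow> real) \<Rightarrow> 'a \<Rightarrow> real" where
  "hext u x = norm x * u (x /\<^sub>R norm x)"

lemma hext_unit: "norm x = 1 \<Longrightarrow> hext u x = u x"
  by (simp add: hext_def)

lemma hext_hom1: "hom1 (hext u)"
  unfolding hom1_def hext_def
proof (intro allI impI)
  fix t :: real and x :: 'a assume "t > 0"
  then show "norm (t *\<^sub>R x) * u ((t *\<^sub>R x) /\<^sub>R norm (t *\<^sub>R x)) = t * (norm x * u (x /\<^sub>R norm x))"
    by (cases "x = 0") (simp_all add: field_simps)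
qed

lemma radial_smooth:
  fixes u :: "'a::euclidean_space \<Rightarrow> real"
  assumes "C_on_sphere \<infinity> u" shows "Cinf (- {0}) (\<lambda>x. u (x /\<^sub>R norm x))"
proof -
  obtain U g where U0: "open U \<and> sphere 0 1 \<subseteq> U \<and> (\<forall>j. enat j \<le> \<infinity> \<longrightarrow> Ck_on j g U) \<and> (\<forall>x\<in>sphere 0 1. g x = u x)"
    using assms unfolding C_on_sphere_def by blast
  have U: "open U" "sphere 0 1 \<subseteq> U" "\<And>j. Ck_on j g U" "\<And>x. x \<in> sphere 0 1 \<Longrightarrow> g x = u x"
    using U0 enat_ord_code(3) by blast+
  have "Cinf (- {0}) (\<lambda>x::'a. g (x /\<^sub>R norm x))"
  proof (rule Cinf_compose[of U g])
    show "Cinf U g" using U(3) by (simp add: Cinf_def)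
    fix b :: 'a
    have "Cinf (- {0}) (\<lambda>x::'a. inverse (norm x) * (x \<bullet> b))"
      by (intro Cinf_mult Cinf_inverse Cinf_norm Cinf_inner) auto
    then show "Cinf (- {0}) (\<lambda>x::'a. (x /\<^sub>R norm x) \<bullet> b)" by simp
  next
    show "(\<lambda>x::'a. x /\<^sub>R norm x) ` (- {0}) \<subseteq> U"
    proof (rule image_subsetI)
      fix x :: 'a assume "x \<in> - {0}"
      then have "x /\<^sub>R norm x \<in> sphere 0 1" by simp
      then show "x /\<^sub>R norm x \<in> U" using U(2) by blast
    qed
  qed
  then show ?thesis by (rule Cinf_cong[OF open_punct, rotated]) (simp add: U(4))
qed

lemma hext_smooth: "C_on_sphere \<infinity> u \<Longrightarrow> Cinf (- {0}) (hext u)"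
  unfolding hext_def[abs_def] by (intro Cinf_mult Cinf_norm radial_smooth)

text \<open>Let \<open>r\<close> be the extension of \<open>u\<close> that is constant along rays. In the sphere Hessian the gradient is differentiated as
  the field \<open>norm y *\<^sub>R \<nabla>r y\<close>, and the derivative of the factor \<open>norm y\<close> vanishes in tangential directions,
  leaving \<open>D2 r\<close>. In the product \<open>norm * r\<close> the mixed terms vanish for tangential vectors too, and
  the Hessian of the norm contributes \<open>u x\<close> times the inner product.\<close>

lemma A_tensor_hext:
  fixes u :: "'a::euclidean_space \<Rightarrow> real"
  assumes u: "C_on_sphere \<infinity> u" and x: "norm x = 1"
    and v: "v \<in> tangent_sphere x" and w: "w \<in> tangent_sphere x"
  shows "A_tensor u x v w = D2 (hext u) x v w"
proof -
  define r where "r y = u (y /\<^sub>R norm y)" for y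
  have rC: "Cinf (- {0}) r" unfolding r_def by (rule radial_smooth[OF u])
  have x0: "x \<noteq> 0" "x \<in> - {0}" using x by auto
  have tan: "x \<bullet> v = 0" "x \<bullet> w = 0" using v w by (auto simp: tangent_sphere_def inner_commute)
  have rh: "r (t *\<^sub>R y) = 1 * r y" if "t > 0" "y \<noteq> 0" for t y
  proof -
    have "(t *\<^sub>R y) /\<^sub>R norm (t *\<^sub>R y) = y /\<^sub>R norm y" using that by (simp add: divide_inverse)
    then show ?thesis unfolding r_def mult_1 by (rule arg_cong)
  qed
  have grad: "sphere_grad u y = (\<Sum>b\<in>Basis. D1 r y b *\<^sub>R b)" for y
    by (simp add: sphere_grad_def sphere_deriv_def D1_def r_def[abs_def])
  have near: "sphere_grad u (y /\<^sub>R norm y) = (\<Sum>b\<in>Basis. (norm y * D1 r y b) *\<^sub>R b)" if y: "y \<noteq> 0" for y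
  proof -
    have "D1 r (inverse (norm y) *\<^sub>R y) b = norm y * D1 r y b" for b
      using D_scaling[OF rC, of "inverse (norm y)" 1 y b] rh y by (simp add: field_simps)
    then show ?thesis by (simp add: grad)
  qed
  have "((\<lambda>y. \<Sum>b\<in>Basis. (norm y * D1 r y b) *\<^sub>R b) has_derivative
     (\<lambda>h. \<Sum>b\<in>Basis. (norm x * D2 r x h b + D1 norm x h * D1 r x b) *\<^sub>R b)) (at x)"
  proof (rule has_derivative_sum)
    fix b :: 'a
    have "((\<lambda>y. norm y * D1 r y b) has_derivative (\<lambda>h. norm x * D2 r x h b + D1 norm x h * D1 r x b)) (at x)"
      using has_derivative_mult[OF D1_has[OF Cinf_norm x0(2)] D1_has[OF Cinf_D1[OF rC open_punct, of b] x0(2)]]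
      by (simp add: D2_def[abs_def])
    then show "((\<lambda>y. (norm y * D1 r y b) *\<^sub>R b) has_derivative (\<lambda>h. (norm x * D2 r x h b + D1 norm x h * D1 r x b) *\<^sub>R b)) (at x)"
      by (intro has_derivative_scaleR_left)
  qed
  then have "((\<lambda>y. sphere_grad u (y /\<^sub>R norm y)) has_derivative
     (\<lambda>h. \<Sum>b\<in>Basis. (norm x * D2 r x h b + D1 norm x h * D1 r x b) *\<^sub>R b)) (at x)"
    by (rule has_derivative_transform_within_open[OF _ open_punct x0(2)]) (simp add: near)
  from fun_cong[OF frechet_derivative_at[OF this], of v, symmetric]
  have fd: "frechet_derivative (\<lambda>y. sphere_grad u (y /\<^sub>R norm y)) (at x) v
     = (\<Sum>b\<in>Basis. (norm x * D2 r x v b + D1 norm x v * D1 r x b) *\<^sub>R b)" .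
  have "sphere_hessian u x v w = (\<Sum>b\<in>Basis. (norm x * D2 r x v b + D1 norm x v * D1 r x b) *\<^sub>R b) \<bullet> w"
    using tan by (simp add: sphere_hessian_def sphere_nabla_def tangent_proj_def sphere_deriv_def fd inner_diff_left)
  also have "\<dots> = (\<Sum>b\<in>Basis. D2 r x v b *\<^sub>R b) \<bullet> w"
    using norm_derivs(1)[OF x0(1), of v] tan x by simp
  also have "\<dots> = D2 r x v w"
  proof -
    have s: "symform (D2 r x)" by (rule symform_D2[OF rC open_punct x0(2)])
    have "D2 r x v w = D2 r x v (\<Sum>b\<in>Basis. (w \<bullet> b) *\<^sub>R b)" by (simp add: euclidean_representation)
    also have "\<dots> = (\<Sum>b\<in>Basis. (w \<bullet> b) * D2 r x v b)" by (simp add: symform_sum_right[OF s] symform_scale_right[OF s])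
    also have "\<dots> = (\<Sum>b\<in>Basis. D2 r x v b *\<^sub>R b) \<bullet> w" unfolding inner_sum_left
      by (intro sum.cong refl) (simp add: inner_commute[of w])
    finally show ?thesis by simp
  qed
  finally have hess: "sphere_hessian u x v w = D2 r x v w" .
  let ?B = "\<lambda>p q. D2 r x p q + u x * (p \<bullet> q)"
  have sB: "symform ?B" by (intro symform_add symform_cmult symform_inner symform_D2[OF rC open_punct x0(2)])
  have hC: "Cinf (- {0}) (hext u)" by (rule hext_smooth[OF u])
  have sH: "symform (D2 (hext u) x)" by (rule symform_D2[OF hC open_punct x0(2)])
  have quad: "D2 (hext u) x p p = ?B p p" if "x \<bullet> p = 0" for p
  proof -
    have he: "hext u = (\<lambda>y. norm y * r y)" by (simp add: hext_def r_def fun_eq_iff)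
    note jm = jet2_mult[OF jet2_line[OF Cinf_norm open_punct x0(2), of p] jet2_line[OF rC open_punct x0(2), of p]]
    have "D2 (hext u) x p p = D2 norm x p p * r x + 2 * D1 norm x p * D1 r x p + norm x * D2 r x p p"
      using jet2_unique(2)[OF jet2_line[OF hC open_punct x0(2), of p, unfolded he] jm] by (simp add: he)
    moreover have "r x = u x" using x by (simp add: r_def)
    ultimately show ?thesis
      using norm_derivs(1,3)[OF x0(1), of p] that x by (simp add: power2_norm_eq_inner)
  qed
  have pol: "2 * C v w = C (v + w) (v + w) - C v v - C w w" if "symform C" for C :: "'a \<Rightarrow> 'a \<Rightarrow> real"
    using that symform_sym[OF that, of w v] by (simp add: symform_simps[OF that])
  have "2 * D2 (hext u) x v w = 2 * ?B v w"
    using pol[OF sH] pol[OF sB] quad[of "v + w"] quad[of v] quad[of w] tan by (simp add: inner_add_right)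
  then show ?thesis by (simp add: A_tensor_def hess)
qed

section \<open>Symmetric functions of the eigenvalues on the tangent space\<close>

lemma subspace_tangent: "subspace (tangent_sphere x)"
  by (auto simp: subspace_def tangent_sphere_def inner_simps)

lemma is_eigenvalues_exists:
  fixes x :: "'a::euclidean_space"
  assumes dim: "DIM('a) = n + 1" and x: "norm x = 1" and A: "symform A"
    and B: "\<And>v w. v \<in> tangent_sphere x \<Longrightarrow> w \<in> tangent_sphere x \<Longrightarrow> B v w = A v w"
  shows "\<exists>lam. is_eigenvalues n x B lam"
proof -
  have x0: "x \<noteq> 0" using x by auto
  have "tangent_sphere x = {v. x \<bullet> v = 0}" by (auto simp: tangent_sphere_def inner_commute)
  then have dT: "dim (tangent_sphere x) = n" using dim_hyperplane[OF x0] dim by simp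
  obtain S where S: "finite S" "S \<subseteq> tangent_sphere x" "card S = n"
    "\<forall>b\<in>S. \<forall>c\<in>S. b \<bullet> c = (if b = c then 1 else 0)" "\<forall>b\<in>S. \<forall>w\<in>tangent_sphere x. A b w = A b b * (b \<bullet> w)"
    using spectral_subspace[OF A subspace_tangent[of x]] dT by auto
  obtain e where e: "bij_betw e {1..n} S" using finite_same_card_bij[of "{1..n}" S] S by auto
  have eS: "e i \<in> S" if "i \<in> {1..n}" for i using that e by (auto simp: bij_betw_def)
  have inj: "e i = e j \<longleftrightarrow> i = j" if "i \<in> {1..n}" "j \<in> {1..n}" for i j
    using e that by (auto simp: bij_betw_def inj_on_eq_iff)
  have "is_eigenvalues n x B (\<lambda>i. A (e i) (e i))"
    unfolding is_eigenvalues_def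
  proof (intro exI[of _ e] conjI ballI)
    fix i assume i: "i \<in> {1..n}"
    show "e i \<in> tangent_sphere x" using eS[OF i] S(2) by blast
    fix j assume j: "j \<in> {1..n}"
    show "e i \<bullet> e j = (if i = j then 1 else 0)" using S(4) eS[OF i] eS[OF j] inj[OF i j] by auto
  next
    fix i w assume i: "i \<in> {1..n}" and w: "w \<in> tangent_sphere x"
    have "B (e i) w = A (e i) w" using B[of "e i" w] w eS[OF i] S(2) by auto
    then show "B (e i) w = A (e i) (e i) * (e i \<bullet> w)" using S(5) eS[OF i] w by auto
  qed
  then show ?thesis by blast
qed

text \<open>An orthonormal eigenbasis on the tangent space is completed by \<open>x\<close>, which has eigenvalue zero and so
  does not change the elementary symmetric functions.\<close>

lemma sigma_sym_eq_msig:
  fixes x :: "'a::euclidean_space"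
  assumes dim: "DIM('a) = n + 1" and x: "norm x = 1" and A: "symform A" and ker: "\<And>w. A x w = 0"
    and B: "\<And>v w. v \<in> tangent_sphere x \<Longrightarrow> w \<in> tangent_sphere x \<Longrightarrow> B v w = A v w"
  shows "sigma_sym n k (eigenvalues n x B) = msig A k"
proof -
  define lam where "lam = eigenvalues n x B"
  have "is_eigenvalues n x B lam"
    unfolding lam_def eigenvalues_def using is_eigenvalues_exists[OF dim x A B] by (rule someI_ex)
  then obtain e where e: "\<And>i. i \<in> {1..n} \<Longrightarrow> e i \<in> tangent_sphere x"
    "\<And>i j. i \<in> {1..n} \<Longrightarrow> j \<in> {1..n} \<Longrightarrow> e i \<bullet> e j = (if i = j then 1 else 0)"
    "\<And>i w. i \<in> {1..n} \<Longrightarrow> w \<in> tangent_sphere x \<Longrightarrow> B (e i) w = lam i * (e i \<bullet> w)"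
    unfolding is_eigenvalues_def by blast
  define e' where "e' i = (if i = 0 then x else e i)" for i
  define l' where "l' i = (if i = 0 then 0 else lam i)" for i
  obtain h where h: "bij_betw h (Basis :: 'a set) {0..n}"
    using finite_same_card_bij[of "Basis :: 'a set" "{0..n}"] dim by auto
  have hI: "h b \<in> {0..n}" if "b \<in> Basis" for b using h that by (auto simp: bij_betw_def)
  have hinj: "h b = h c \<longleftrightarrow> b = c" if "b \<in> Basis" "c \<in> Basis" for b c
    using h that by (auto simp: bij_betw_def inj_on_eq_iff)
  have ex: "e i \<bullet> x = 0" "x \<bullet> e i = 0" if "i \<in> {1..n}" for i
    using e(1)[OF that] by (auto simp: tangent_sphere_def inner_commute)
  have xx: "x \<bullet> x = 1" using x by (simp add: norm_eq_1)
  have oe: "e' i \<bullet> e' j = (if i = j then 1 else 0)" if "i \<in> {0..n}" "j \<in> {0..n}" for i j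
    using that e(2)[of i j] ex[of i] ex[of j] xx by (auto simp: e'_def)
  have ev: "A (e' i) w = l' i * (e' i \<bullet> w)" if i: "i \<in> {0..n}" for i w
  proof (cases "i = 0")
    case True then show ?thesis by (simp add: e'_def l'_def ker)
  next
    case False
    then have i1: "i \<in> {1..n}" using i by auto
    define w' where "w' = w - (w \<bullet> x) *\<^sub>R x"
    have w': "w' \<in> tangent_sphere x" by (simp add: w'_def tangent_sphere_def inner_simps xx)
    have "A (e i) w = A (e i) (w' + (w \<bullet> x) *\<^sub>R x)" by (simp add: w'_def)
    also have "\<dots> = A (e i) w'" using ker[of "e i"] symform_sym[OF A, of "e i" x] by (simp add: symform_simps[OF A])
    also have "\<dots> = lam i * (e i \<bullet> w')" using B[OF e(1)[OF i1] w'] e(3)[OF i1 w'] by simp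
    also have "e i \<bullet> w' = e i \<bullet> w" by (simp add: w'_def inner_simps ex[OF i1])
    finally show ?thesis using False by (simp add: e'_def l'_def)
  qed
  have "eigf A (\<lambda>b. e' (h b)) (\<lambda>b. l' (h b))"
    unfolding eigf_def onb_def using oe ev hI hinj by auto
  then have "msig A k = esym Basis k (\<lambda>b. l' (h b))" by (rule msig_eigf[OF A])
  also have "\<dots> = esym {0..n} k l'" by (rule esym_bij[OF h])
  also have "{0..n} = insert 0 {1..n}" by auto
  also have "esym (insert 0 {1..n}) k l' = esym {1..n} k l'"
    by (cases k) (simp_all add: esym_insert l'_def[of 0])
  also have "\<dots> = esym {1..n} k lam" by (rule esym_cong) (simp add: l'_def)
  finally show ?thesis by (simp add: lam_def sigma_sym_def esym_def)
qed

section \<open>Strict spherical convexity\<close>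

text \<open>Both parts of the theorem at once, with a constant \<open>T\<close> that is \<open>\<tau>\<close> in the first and \<open>1\<close> in the second.\<close>

lemma convex_of_equation:
  fixes n k l :: nat and p T :: real and f u :: "'a::euclidean_space \<Rightarrow> real"
  assumes dim: "DIM('a) = n + 1"
    and lk: "l < k" and kn: "k < n"
    and p: "p \<ge> real k - real l + 1"
    and f_smooth: "C_on_sphere \<infinity> f"
    and f_pos: "\<forall>x\<in>sphere 0 1. f x > 0"
    and f_convex: "\<forall>x\<in>sphere 0 1. \<forall>v\<in>tangent_sphere x.
        A_tensor (\<lambda>y. f y powr (1 / (p + real k - real l - 1))) x v v \<ge> 0"
    and u: "C_on_sphere \<infinity> u" "\<forall>x\<in>sphere 0 1. u x > 0" and adm: "admissible n (n - l) u" and T: "T > 0"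
    and eq: "\<forall>x\<in>sphere 0 1. H_A n (n - l) u x / H_A n (n - k) u x = T * u x powr (p - 1) * inverse (f x)"
  shows "strictly_spherically_convex u"
proof -
  define a where "a = n - l"
  define b where "b = n - k"
  define P where "P = p + real k - real l - 1"
  define \<alpha> where "\<alpha> = (p - 1) / real (k - l)"
  have ab: "b < a" "a \<le> n" "a - b = k - l" using lk kn by (auto simp: a_def b_def)
  have kl: "real (k - l) = real k - real l" "real (k - l) > 0" using lk by auto
  have P: "P > 0" using p lk by (simp add: P_def)
  have \<alpha>: "\<alpha> \<ge> 1" using p kl by (simp add: \<alpha>_def)
  \<comment> \<open>The exponent in the hypothesis on \<open>f\<close> is the one for which \<open>g powr (1 + \<alpha>)\<close> is the \<open>(k - l)\<close>-th root of \<open>f\<close>.\<close>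
  have \<alpha>P: "1 / P * (1 + \<alpha>) = 1 / real (k - l)"
  proof -
    have "1 + \<alpha> = P / real (k - l)" using kl by (simp add: \<alpha>_def P_def field_simps)
    then show ?thesis using P by simp
  qed
  define fP where "fP y = f y powr (1 / P)" for y
  have fPC: "C_on_sphere \<infinity> fP"
  proof -
    obtain U g where U0: "open U \<and> sphere 0 1 \<subseteq> U \<and> (\<forall>j. enat j \<le> \<infinity> \<longrightarrow> Ck_on j g U) \<and> (\<forall>x\<in>sphere 0 1. g x = f x)"
      using f_smooth unfolding C_on_sphere_def by blast
    have U: "open U" "sphere 0 1 \<subseteq> U" "\<And>j. Ck_on j g U" "\<And>x. x \<in> sphere 0 1 \<Longrightarrow> g x = f x"
      using U0 enat_ord_code(3) by blast+
    have gC: "Cinf U g" using U(3) by (simp add: Cinf_def)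
    define V where "V = U \<inter> g -` {0<..}"
    have V: "open V" unfolding V_def by (intro continuous_open_preimage Cinf_continuous[OF gC] U(1)) auto
    have "Cinf V (\<lambda>y. g y powr (1 / P))" by (intro Cinf_powr Cinf_subset[OF gC]) (auto simp: V_def)
    moreover have "sphere 0 1 \<subseteq> V" using U(2,4) f_pos by (auto simp: V_def)
    ultimately show ?thesis unfolding C_on_sphere_def Cinf_def using V U(4)
      by (intro exI[of _ V] exI[of _ "\<lambda>y. g y powr (1 / P)"]) (auto simp: fP_def)
  qed
  define v where "v = hext u"
  define g where "g = hext fP"
  have vC: "Cinf (- {0}) v" and gC: "Cinf (- {0}) g" unfolding v_def g_def by (rule hext_smooth u fPC)+
  have vh: "hom1 v" and gh: "hom1 g" unfolding v_def g_def by (rule hext_hom1)+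
  have unit: "norm (x /\<^sub>R norm x) = 1" if "x \<noteq> 0" for x :: 'a using that by simp
  have vpos: "v x > 0" if "x \<noteq> 0" for x unfolding v_def hext_def using that u(2) unit[OF that] by (intro mult_pos_pos) auto
  have gpos: "g x > 0" if "x \<noteq> 0" for x
  proof -
    have "f (x /\<^sub>R norm x) > 0" using f_pos unit[OF that] by simp
    then show ?thesis unfolding g_def hext_def fP_def using that by (intro mult_pos_pos) auto
  qed
  have gD2: "D2 g x w w \<ge> 0" if x: "norm x = 1" for x w
  proof -
    have x0: "x \<noteq> 0" using x by auto
    have t: "tang x w \<in> tangent_sphere x" using tang_orth[OF x0, of w] by (simp add: tangent_sphere_def inner_commute)
    have "A_tensor fP x (tang x w) (tang x w) \<ge> 0" using f_convex x t by (simp add: fP_def[abs_def] P_def)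
    then show ?thesis using A_tensor_hext[OF fPC x t t] hom1_D2_tang[OF gC gh x0, of w] by (simp add: g_def)
  qed
  have gsub: "g (x + y) \<le> g x + g y" for x y
  proof (rule hom1_subadd[OF gC gh])
    show "g x \<ge> 0" for x using gpos[of x] hom1_0[OF gh] by (cases "x = 0") auto
    show "D2 g x w w \<ge> 0" if x: "x \<noteq> 0" for x w
    proof -
      have "D2 g x w w = D2 g (x /\<^sub>R norm x) w w / norm x"
        using hom1_D2[OF gC gh, of "norm x" "x /\<^sub>R norm x" w w] x by simp
      then show ?thesis using gD2[OF unit[OF x], of w] by simp
    qed
  qed
  have vs: "symform (D2 v x)" if "x \<noteq> 0" for x using symform_D2[OF vC open_punct] that by auto
  have sig: "sigma_sym n j (eigenvalues n x (A_tensor u x)) = msig (D2 v x) j" if x: "norm x = 1" for x j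
  proof -
    have x0: "x \<noteq> 0" using x by auto
    show ?thesis
      by (rule sigma_sym_eq_msig[OF dim x vs[OF x0] hom1_euler(2)[OF vC vh x0]])
        (simp add: A_tensor_hext[OF u(1) x] v_def)
  qed
  have uG: "D2 v x \<in> MG a" if x: "norm x = 1" for x
  proof -
    have "\<forall>i\<in>{1..a}. sigma_sym n i (eigenvalues n x (A_tensor u x)) > 0"
      using adm x by (simp add: admissible_def Garding_cone_def a_def)
    then show ?thesis using sig[OF x] by (simp add: MG_def)
  qed
  have vsc: "D2 v x = (\<lambda>q r. (1 / norm x) * D2 v (x /\<^sub>R norm x) q r)" if x: "x \<noteq> 0" for x
    using hom1_D2[OF vC vh, of "norm x" "x /\<^sub>R norm x"] x by (simp add: fun_eq_iff)
  have vG: "D2 v x \<in> MG a" "MF a b (D2 v x) = MF a b (D2 v (x /\<^sub>R norm x)) / norm x" if x: "x \<noteq> 0" for x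
  proof -
    have "x /\<^sub>R norm x \<noteq> 0" using x by simp
    from form_scale[OF vs[OF this] uG[OF unit[OF x]] _ ab(1), of "1 / norm x"] x
    show "D2 v x \<in> MG a" "MF a b (D2 v x) = MF a b (D2 v (x /\<^sub>R norm x)) / norm x"
      unfolding vsc[OF x] by auto
  qed
  define Na where "Na = real (n choose a)"
  define Nb where "Nb = real (n choose b)"
  have N: "Na > 0" "Nb > 0" using ab by (auto simp: Na_def Nb_def)
  define c where "c = (Nb / (Na * T)) powr (1 / real (k - l))"
  have c: "c > 0" using N T by (simp add: c_def)
  have eqn1: "1 / MF a b (D2 v x) = c * (g x powr (1 + \<alpha>) * v x powr (- \<alpha>))" if x: "norm x = 1" for x
  proof -
    have xs: "x \<in> sphere 0 1" using x by simp
    let ?a = "msig (D2 v x) a" and ?b = "msig (D2 v x) b"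
    have pos: "?a > 0" "?b > 0" using uG[OF x] ab(1) by (cases b; auto simp: MG_def)+
    have ux: "u x > 0" "f x > 0" using u(2) f_pos xs by auto
    have e0: "(?a / Na) / (?b / Nb) = T * u x powr (p - 1) * inverse (f x)"
      using bspec[OF eq xs] by (simp add: H_A_def H_sym_def sig[OF x] a_def b_def Na_def Nb_def)
    then have "?b / ?a = (Nb / (Na * T)) * (f x * u x powr (- (p - 1)))"
    proof -
      define Y where "Y = u x powr (p - 1)"
      have Y: "Y > 0" "u x powr (- (p - 1)) = inverse Y" using ux by (simp_all add: Y_def powr_minus[symmetric])
      have "?a * Nb * f x = T * Y * (?b * Na)"
        using e0 pos N ux unfolding Y_def[symmetric] by (simp add: field_simps)
      then show ?thesis unfolding Y(2) using pos N T Y(1) by (simp add: field_simps)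
    qed
    moreover have "1 / MF a b (D2 v x) = (?b / ?a) powr (1 / real (k - l))"
      using pos unfolding MF_def ab(3) by (simp add: powr_divide)
    ultimately have "1 / MF a b (D2 v x) = c * (f x powr (1 / real (k - l)) * (u x powr (- (p - 1))) powr (1 / real (k - l)))"
      by (simp only: c_def powr_mult[symmetric])
    also have "f x powr (1 / real (k - l)) = g x powr (1 + \<alpha>)"
      using \<alpha>P by (simp add: g_def hext_unit[OF x] fP_def powr_powr)
    also have "(u x powr (- (p - 1))) powr (1 / real (k - l)) = v x powr (- \<alpha>)"
      by (simp only: v_def hext_unit[OF x] powr_powr \<alpha>_def)
        (metis (no_types, opaque_lifting) minus_divide_left minus_diff_eq minus_mult_minus mult_1_right times_divide_eq_right)
    finally show ?thesis .
  qed
  have eqn: "1 / MF a b (D2 v x) = c * (g x powr (1 + \<alpha>) * v x powr (- \<alpha>))" if x: "x \<noteq> 0" for x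
  proof -
    let ?e = "x /\<^sub>R norm x"
    have e0: "?e \<noteq> 0" using x by simp
    have "g x = norm x * g ?e" "v x = norm x * v ?e"
      using hom1D[OF gh, of "norm x" ?e] hom1D[OF vh, of "norm x" ?e] x by auto
    then have "g x powr (1 + \<alpha>) * v x powr (- \<alpha>) = (norm x * g ?e) powr (1 + \<alpha>) * (norm x * v ?e) powr (- \<alpha>)"
      by (rule arg_cong2)
    also have "\<dots> = (norm x powr (1 + \<alpha>) * norm x powr (- \<alpha>)) * (g ?e powr (1 + \<alpha>) * v ?e powr (- \<alpha>))"
      by (simp only: powr_mult mult_ac)
    also have "norm x powr (1 + \<alpha>) * norm x powr (- \<alpha>) = norm x" using x by (simp add: powr_add[symmetric])
    finally have h: "g x powr (1 + \<alpha>) * v x powr (- \<alpha>) = norm x * (g ?e powr (1 + \<alpha>) * v ?e powr (- \<alpha>))" .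
    have "1 / MF a b (D2 v x) = norm x * (1 / MF a b (D2 v ?e))" unfolding vG(2)[OF x] by simp
    also have "\<dots> = norm x * (c * (g ?e powr (1 + \<alpha>) * v ?e powr (- \<alpha>)))" by (simp only: eqn1[OF unit[OF x]])
    also have "\<dots> = c * (g x powr (1 + \<alpha>) * v x powr (- \<alpha>))" unfolding h by (simp only: mult_ac)
    finally show ?thesis .
  qed
  interpret quotient_eq v g a b \<alpha> c
  proof
    show "DIM('a) \<ge> 2" "a \<le> DIM('a)" using dim kn ab by linarith+
  qed (fact ab(1) \<alpha> c vC vh vpos gh gpos gsub vG(1) eqn)+
  obtain f0 where f0: "\<forall>z. norm z = 1 \<longrightarrow> f0 z > 0" "\<forall>z w. norm z = 1 \<longrightarrow> f0 z * (norm (tang z w))^2 \<le> D2 v z w w"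
    using v_strict by blast
  show ?thesis unfolding strictly_spherically_convex_def
  proof (intro conjI ballI impI)
    show "C_on_sphere 2 u" using u(1) unfolding C_on_sphere_def by auto
    fix x w :: 'a assume xw: "x \<in> sphere 0 1" "w \<in> tangent_sphere x" "w \<noteq> 0"
    have x: "norm x = 1" using xw by simp
    have "tang x w = w" using xw(2) by (simp add: tang_def tangent_sphere_def inner_commute)
    then have "f0 x * (norm w)^2 \<le> A_tensor u x w w"
      using f0(2) x A_tensor_hext[OF u(1) x xw(2) xw(2)] by (metis v_def)
    moreover have "f0 x * (norm w)^2 > 0" using f0(1) x xw(3) by simp
    ultimately show "A_tensor u x w w > 0" by linarith
  qed
qed

theorem theorem1p3:
  fixes n k l :: nat and p :: real and f :: "'a::euclidean_space \<Rightarrow> real"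
  assumes dim: "DIM('a) = n + 1"
    and lk: "l < k" and kn: "k < n"
    and p: "p \<ge> real k - real l + 1"
    and f_smooth: "C_on_sphere \<infinity> f"
    and f_pos: "\<forall>x\<in>sphere 0 1. f x > 0"
    and f_convex: "\<forall>x\<in>sphere 0 1. \<forall>v\<in>tangent_sphere x.
        A_tensor (\<lambda>y. f y powr (1 / (p + real k - real l - 1))) x v v \<ge> 0"
  shows "(p = real k - real l + 1 \<longrightarrow>
            (\<forall>(u :: 'a \<Rightarrow> real) (\<tau> :: real).
               C_on_sphere \<infinity> u \<and> (\<forall>x\<in>sphere 0 1. u x > 0) \<and> admissible n (n - l) u \<and> \<tau> > 0 \<and>
               (\<forall>x\<in>sphere 0 1. H_A n (n - l) u x / H_A n (n - k) u x
                                  = \<tau> * u x ^ (k - l) * inverse (f x))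
               \<longrightarrow> strictly_spherically_convex u))
       \<and> (p > real k - real l + 1 \<longrightarrow>
            (\<forall>u :: 'a \<Rightarrow> real.
               C_on_sphere \<infinity> u \<and> (\<forall>x\<in>sphere 0 1. u x > 0) \<and> admissible n (n - l) u \<and>
               (\<forall>x\<in>sphere 0 1. H_A n (n - l) u x / H_A n (n - k) u x
                                  = inverse (f x) * u x powr (p - 1))
               \<longrightarrow> strictly_spherically_convex u))"
proof (intro conjI allI impI; elim conjE)
  fix u :: "'a \<Rightarrow> real" and \<tau> :: real
  assume pe: "p = real k - real l + 1" and u: "C_on_sphere \<infinity> u" "\<forall>x\<in>sphere 0 1. u x > 0" "admissible n (n - l) u"
    and \<tau>: "\<tau> > 0" and eq: "\<forall>x\<in>sphere 0 1. H_A n (n - l) u x / H_A n (n - k) u x = \<tau> * u x ^ (k - l) * inverse (f x)"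
  show "strictly_spherically_convex u"
  proof (rule convex_of_equation[OF dim lk kn p f_smooth f_pos f_convex u \<tau>], rule ballI)
    fix x :: 'a assume x: "x \<in> sphere 0 1"
    have "p - 1 = real (k - l)" using pe lk by simp
    then have "u x powr (p - 1) = u x ^ (k - l)" using u(2) x by (simp add: powr_realpow)
    then show "H_A n (n - l) u x / H_A n (n - k) u x = \<tau> * u x powr (p - 1) * inverse (f x)" using bspec[OF eq x] by simp
  qed
next
  fix u :: "'a \<Rightarrow> real"
  assume u: "C_on_sphere \<infinity> u" "\<forall>x\<in>sphere 0 1. u x > 0" "admissible n (n - l) u"
    and eq: "\<forall>x\<in>sphere 0 1. H_A n (n - l) u x / H_A n (n - k) u x = inverse (f x) * u x powr (p - 1)"
  show "strictly_spherically_convex u"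
    by (rule convex_of_equation[OF dim lk kn p f_smooth f_pos f_convex u zero_less_one])
      (use eq in \<open>simp add: mult.commute\<close>)
qed

end
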